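(* Let $\Gamma\subset SO(4)$ be a finite subgroup acting freely on $S^3$, let $g_{S^3/\Gamma}$ be the metric of constant curvature $1$ on $S^3/\Gamma$, and let $M=\mathbb{R}\times S^3/\Gamma$ with the product metric $g=dt^2+g_{S^3/\Gamma}$. Let $\mathcal{I}^*$ denote the set of indicial roots of $F^*$. If $\beta\in\mathcal{I}^*$ satisfies $|\mathrm{Re}(\beta)|<2$, then $\beta=0$ or $\beta=\pm1$. In these cases, the corresponding solutions are of the form $(0,\omega)$, where $\omega$ is dual to a conformal Killing field (that is, $\mathcal{K}_g\omega=0$). Consequently: Case (0): $0\in\mathcal{I}^*$, and the corresponding solutions are given by (linear combinations of) $(0,dt)$ and $(0,\omega_0)$ for $\omega_0$ dual to a Killing field on $S^3/\Gamma$. Case (1): $\pm1\in\mathcal{I}^*$ if and only if $\Gamma$ is trivial. In this case, the corresponding solutions are given by $(0,\omega)$ with $\omega=e^{\pm t}(\phi\,dt\mp d\phi)$, where $\phi$ is a lowest nontrivial eigenfunction of the Laplacian on $S^3$, with eigenvalue $3$ (i.e. $-\Delta_{S^3}\phi=3\phi$).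
   Context: For an oriented Riemannian 4-manifold $(M,g)$, $\Lambda^2_-$ is the bundle of anti-self-dual 2-forms, $S^2_0(\cdot)$ denotes traceless symmetric 2-tensors, and $\mathcal{W}^-=\pi_-\mathcal{W}\pi_-$ (with $\mathcal W$ the Weyl curvature operator on 2-forms and $\pi_-$ the projection to $\Lambda^2_-$) is the anti-self-dual Weyl tensor, a section of $S^2_0(\Lambda^2_-)$; $g$ is self-dual if $\mathcal{W}^-=0$. For self-dual $g$, $\mathcal{D}=(\mathcal{W}^-)'_g:\Gamma(S^2_0(T^*M))\to\Gamma(S^2_0(\Lambda^2_-))$ is the linearization of $\mathcal{W}^-$ at $g$ and $\mathcal{D}^*$ its formal $L^2$-adjoint. Set $(\delta h)_j=\nabla^ih_{ij}$ for symmetric 2-tensors, $\delta\omega=\nabla^i\omega_i$ for 1-forms, and $(\mathcal{K}_g\omega)_{ij}=\nabla_i\omega_j+\nabla_j\omega_i-\frac12(\delta\omega)g_{ij}$ (conformal Killing operator). Let $F(h)=(\mathcal{D}h,2\delta h)$, from $\Gamma(S^2_0(T^*M))$ to $\Gamma(S^2_0(\Lambda^2_-))\oplus\Gamma(T^*M)$, with formal adjoint $F^*(Z,\omega)=\mathcal{D}^*Z-\mathcal{K}_g\omega$. On a cylinder $(\mathbb{R}\times Y^3,dt^2+g_Y)$ (oriented so that $dt\wedge dV_{Y}$ is positive), the indicial roots of $F^*$ are those $\lambda\in\mathbb{C}$ for which there is a (nonzero) solution $(Z,\omega)$ of $F^*(Z,\omega)=0$ whose components have the form $e^{\lambda t}p(y,t)$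 with $p$ a polynomial in $t$ with coefficients in $C^\infty(Y)$; these are the solutions corresponding to $\lambda$. "Dual" means dual via the metric. *)

theory Defs
  imports "HOL-Analysis.Analysis" "HOL-Algebra.Group"
begin

section \<open>Riemannian geometry in a global chart\<close>

text \<open>
  Everything takes place on an open set \<open>U\<close> of \<open>\<real>\<^sup>4\<close>, oriented by \<open>dx\<^sub>1 \<and> dx\<^sub>2 \<and> dx\<^sub>3 \<and> dx\<^sub>4\<close> (the index
  \<open>4 :: 4\<close> is the same element as \<open>0\<close>). Tensor fields are arrays of their components in the
  coordinate frame, with all indices lowered. Sections may have real or complex components; a real
  differential operator acts on complex sections by its complex-linear extension, which is why
  several definitions are polymorphic in the type of the components.
\<close>

type_synonym 'a tens1 = "'a ^ 4"
type_synonym 'a tens2 = "'a ^ 4 ^ 4"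
type_synonym 'a tens4 = "'a ^ 4 ^ 4 ^ 4 ^ 4"
type_synonym 'a fld = "real ^ 4 \<Rightarrow> 'a"

definition pd :: "4 \<Rightarrow> ('a::real_normed_vector) fld \<Rightarrow> 'a fld" where
  "pd i f x = frechet_derivative f (at x) (axis i 1)"

primrec ck_on :: "nat \<Rightarrow> (real ^ 4) set \<Rightarrow> ('a::real_normed_vector) fld \<Rightarrow> bool" where
  "ck_on 0 U f \<longleftrightarrow> continuous_on U f"
| "ck_on (Suc k) U f \<longleftrightarrow> f differentiable_on U \<and> (\<forall>i. ck_on k U (pd i f))"

definition smooth_on :: "(real ^ 4) set \<Rightarrow> ('a::real_normed_vector) fld \<Rightarrow> bool" where
  "smooth_on U f \<longleftrightarrow> (\<forall>k. ck_on k U f)"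

abbreviation ginv :: "real tens2 fld \<Rightarrow> real tens2 fld" where
  "ginv g x \<equiv> matrix_inv (g x)"

definition vol_density :: "real tens2 fld \<Rightarrow> real fld" where
  "vol_density g x = sqrt (det (g x))"

text \<open>\<open>christoffel g x k i j\<close> is \<open>\<Gamma>\<^sup>k\<^sub>i\<^sub>j\<close>.\<close>

definition christoffel :: "real tens2 fld \<Rightarrow> real ^ 4 \<Rightarrow> 4 \<Rightarrow> 4 \<Rightarrow> 4 \<Rightarrow> real" where
  "christoffel g x k i j =
     (1/2) * (\<Sum>l\<in>UNIV. ginv g x $ k $ l *
        (pd i (\<lambda>y. g y $ j $ l) x + pd j (\<lambda>y. g y $ i $ l) x - pd l (\<lambda>y. g y $ i $ j) x))"

text \<open>
  \<open>R(\<partial>\<^sub>i, \<partial>\<^sub>j)\<partial>\<^sub>k = \<Sum>\<^sub>l riem_up g x l k i j \<partial>\<^sub>l\<close> and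
  \<open>riem g x i j k l = \<langle>R(\<partial>\<^sub>k, \<partial>\<^sub>l)\<partial>\<^sub>j, \<partial>\<^sub>i\<rangle>\<close>, so that \<open>R\<^sub>i\<^sub>j\<^sub>k\<^sub>l = g\<^sub>i\<^sub>k g\<^sub>j\<^sub>l - g\<^sub>i\<^sub>l g\<^sub>j\<^sub>k\<close> on the unit sphere.
\<close>

definition riem_up :: "real tens2 fld \<Rightarrow> real ^ 4 \<Rightarrow> 4 \<Rightarrow> 4 \<Rightarrow> 4 \<Rightarrow> 4 \<Rightarrow> real" where
  "riem_up g x l k i j =
     pd i (\<lambda>y. christoffel g y l j k) x - pd j (\<lambda>y. christoffel g y l i k) x
     + (\<Sum>m\<in>UNIV. christoffel g x l i m * christoffel g x m j k
                - christoffel g x l j m * christoffel g x m i k)"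

definition riem :: "real tens2 fld \<Rightarrow> real ^ 4 \<Rightarrow> 4 \<Rightarrow> 4 \<Rightarrow> 4 \<Rightarrow> 4 \<Rightarrow> real" where
  "riem g x i j k l = (\<Sum>m\<in>UNIV. g x $ i $ m * riem_up g x m j k l)"

definition ricci :: "real tens2 fld \<Rightarrow> real ^ 4 \<Rightarrow> 4 \<Rightarrow> 4 \<Rightarrow> real" where
  "ricci g x j l = (\<Sum>i\<in>UNIV. \<Sum>k\<in>UNIV. ginv g x $ i $ k * riem g x i j k l)"

definition scal :: "real tens2 fld \<Rightarrow> real fld" where
  "scal g x = (\<Sum>j\<in>UNIV. \<Sum>l\<in>UNIV. ginv g x $ j $ l * ricci g x j l)"

definition weyl :: "real tens2 fld \<Rightarrow> real ^ 4 \<Rightarrow> 4 \<Rightarrow> 4 \<Rightarrow> 4 \<Rightarrow> 4 \<Rightarrow> real" where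
  "weyl g x i j k l =
     riem g x i j k l
     - (1/2) * (ricci g x i k * g x $ j $ l - ricci g x i l * g x $ j $ k
                + g x $ i $ k * ricci g x j l - g x $ i $ l * ricci g x j k)
     + scal g x / 6 * (g x $ i $ k * g x $ j $ l - g x $ i $ l * g x $ j $ k)"

text \<open>
  A 2-form is an antisymmetric array \<open>\<eta>\<^sub>i\<^sub>j\<close>, i.e. \<open>\<eta> = 1/2 \<eta>\<^sub>i\<^sub>j dx\<^sub>i \<and> dx\<^sub>j\<close>.
\<close>

definition weyl_op :: "real tens2 fld \<Rightarrow> real ^ 4 \<Rightarrow> real tens2 \<Rightarrow> real tens2" where
  "weyl_op g x \<eta> = (\<chi> i j. (1/2) * (\<Sum>k\<in>UNIV. \<Sum>l\<in>UNIV. \<Sum>a\<in>UNIV. \<Sum>b\<in>UNIV.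
      weyl g x i j k l * ginv g x $ k $ a * ginv g x $ l $ b * \<eta> $ a $ b))"

definition levi_civita :: "4 \<Rightarrow> 4 \<Rightarrow> 4 \<Rightarrow> 4 \<Rightarrow> real" where
  "levi_civita i j k l = det (vector [axis i 1, axis j 1, axis k 1, axis l 1] :: real ^ 4 ^ 4)"

definition hodge :: "real tens2 fld \<Rightarrow> real ^ 4 \<Rightarrow> ('a::real_vector) tens2 \<Rightarrow> 'a tens2" where
  "hodge g x \<eta> = (\<chi> i j. (vol_density g x / 2) *\<^sub>R
      (\<Sum>k\<in>UNIV. \<Sum>l\<in>UNIV. \<Sum>a\<in>UNIV. \<Sum>b\<in>UNIV.
         (levi_civita i j k l * ginv g x $ k $ a * ginv g x $ l $ b) *\<^sub>R \<eta> $ a $ b))"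

definition asd_proj :: "real tens2 fld \<Rightarrow> real ^ 4 \<Rightarrow> real tens2 \<Rightarrow> real tens2" where
  "asd_proj g x \<eta> = (1/2) *\<^sub>R (\<eta> - hodge g x \<eta>)"

definition weyl_minus_op :: "real tens2 fld \<Rightarrow> real ^ 4 \<Rightarrow> real tens2 \<Rightarrow> real tens2" where
  "weyl_minus_op g x = asd_proj g x \<circ> weyl_op g x \<circ> asd_proj g x"

text \<open>
  An endomorphism \<open>A\<close> of the bundle of 2-forms is stored as the 4-tensor with
  \<open>(A\<eta>)\<^sub>i\<^sub>j = 1/2 A\<^sub>i\<^sub>j\<^sub>k\<^sub>l \<eta>\<^sup>k\<^sup>l\<close>. Its component \<open>A\<^sub>i\<^sub>j\<^sub>k\<^sub>l\<close> is the \<open>ij\<close>-component of the value of \<open>A\<close>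
  on the wedge product of the 1-forms dual to \<open>\<partial>\<^sub>k\<close> and \<open>\<partial>\<^sub>l\<close>.
\<close>

definition weyl_minus :: "real tens2 fld \<Rightarrow> real tens4 fld" where
  "weyl_minus g x = (\<chi> i j k l.
      weyl_minus_op g x (\<chi> a b. g x $ k $ a * g x $ l $ b - g x $ k $ b * g x $ l $ a) $ i $ j)"

section \<open>Sections, linearization and formal adjoint\<close>

definition sym_traceless :: "real tens2 fld \<Rightarrow> real ^ 4 \<Rightarrow> ('a::real_vector) tens2 \<Rightarrow> bool" where
  "sym_traceless g x h \<longleftrightarrow> (\<forall>i j. h $ i $ j = h $ j $ i) \<and>
     (\<Sum>i\<in>UNIV. \<Sum>j\<in>UNIV. ginv g x $ i $ j *\<^sub>R h $ i $ j) = 0"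

text \<open>The fibre at \<open>x\<close> of \<open>S\<^sup>2\<^sub>0(\<Lambda>\<^sup>2\<^sub>-)\<close>; by the pair symmetry, the conditions on the first pair of
  indices carry over to the second.\<close>

definition sym_traceless_asd :: "real tens2 fld \<Rightarrow> real ^ 4 \<Rightarrow> ('a::real_vector) tens4 \<Rightarrow> bool" where
  "sym_traceless_asd g x Z \<longleftrightarrow>
     (\<forall>i j k l. Z $ i $ j $ k $ l = - Z $ j $ i $ k $ l \<and> Z $ i $ j $ k $ l = Z $ k $ l $ i $ j) \<and>
     (\<forall>k l. hodge g x (\<chi> i j. Z $ i $ j $ k $ l) = - (\<chi> i j. Z $ i $ j $ k $ l)) \<and>
     (\<Sum>i\<in>UNIV. \<Sum>j\<in>UNIV. \<Sum>k\<in>UNIV. \<Sum>l\<in>UNIV.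
        (ginv g x $ i $ k * ginv g x $ j $ l) *\<^sub>R Z $ i $ j $ k $ l) = 0"

text \<open>\<open>S\<^sup>2\<^sub>0(T\<^sup>*M)\<close> and \<open>S\<^sup>2\<^sub>0(\<Lambda>\<^sup>2\<^sub>-)\<close> carry the tensor norm and the norm of endomorphisms of \<open>\<Lambda>\<^sup>2\<close>
  respectively, extended bilinearly to complex values in the second argument.\<close>

definition inner2 :: "real tens2 fld \<Rightarrow> real ^ 4 \<Rightarrow> real tens2 \<Rightarrow> ('a::real_vector) tens2 \<Rightarrow> 'a" where
  "inner2 g x h \<sigma> = (\<Sum>i\<in>UNIV. \<Sum>j\<in>UNIV. \<Sum>a\<in>UNIV. \<Sum>b\<in>UNIV.
      (ginv g x $ i $ a * ginv g x $ j $ b * h $ i $ j) *\<^sub>R \<sigma> $ a $ b)"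

definition inner4 :: "real tens2 fld \<Rightarrow> real ^ 4 \<Rightarrow> real tens4 \<Rightarrow> ('a::real_vector) tens4 \<Rightarrow> 'a" where
  "inner4 g x A Z = (1/4) *\<^sub>R (\<Sum>i\<in>UNIV. \<Sum>j\<in>UNIV. \<Sum>k\<in>UNIV. \<Sum>l\<in>UNIV.
      \<Sum>a\<in>UNIV. \<Sum>b\<in>UNIV. \<Sum>c\<in>UNIV. \<Sum>d\<in>UNIV.
      (ginv g x $ i $ a * ginv g x $ j $ b * ginv g x $ k $ c * ginv g x $ l $ d * A $ i $ j $ k $ l)
        *\<^sub>R Z $ a $ b $ c $ d)"

definition lin_weyl_minus :: "real tens2 fld \<Rightarrow> real tens2 fld \<Rightarrow> real tens4 fld" where
  "lin_weyl_minus g h x =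
     vector_derivative (\<lambda>s::real. weyl_minus (\<lambda>y. g y + s *\<^sub>R h y) x) (at 0)"

definition test_tensor :: "real tens2 fld \<Rightarrow> (real ^ 4) set \<Rightarrow> real tens2 fld \<Rightarrow> bool" where
  "test_tensor g U h \<longleftrightarrow> smooth_on U h \<and> (\<forall>x\<in>U. sym_traceless g x (h x)) \<and>
     (\<exists>K. compact K \<and> K \<subseteq> U \<and> (\<forall>x. x \<notin> K \<longrightarrow> h x = 0))"

text \<open>\<open>\<sigma>\<close> is the value of the formal \<open>L\<^sup>2\<close>-adjoint of \<open>lin_weyl_minus g\<close> at \<open>Z\<close>. Pairing with real
  \<open>h\<close> suffices for complex \<open>Z\<close> and \<open>\<sigma>\<close>, and determines \<open>\<sigma>\<close> on \<open>U\<close>.\<close>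

definition formal_adjoint_value ::
  "real tens2 fld \<Rightarrow> (real ^ 4) set \<Rightarrow> complex tens4 fld \<Rightarrow> complex tens2 fld \<Rightarrow> bool" where
  "formal_adjoint_value g U Z \<sigma> \<longleftrightarrow>
     smooth_on U \<sigma> \<and> (\<forall>x\<in>U. sym_traceless g x (\<sigma> x)) \<and>
     (\<forall>h. test_tensor g U h \<longrightarrow>
        integral U (\<lambda>x. vol_density g x *\<^sub>R inner4 g x (lin_weyl_minus g h x) (Z x)) =
        integral U (\<lambda>x. vol_density g x *\<^sub>R inner2 g x (h x) (\<sigma> x)))"

definition lin_weyl_minus_adj ::
  "real tens2 fld \<Rightarrow> (real ^ 4) set \<Rightarrow> complex tens4 fld \<Rightarrow> complex tens2 fld" where
  "lin_weyl_minus_adj g U Z = (SOME \<sigma>. formal_adjoint_value g U Z \<sigma>)"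

text \<open>\<open>cov_deriv g \<omega> x i j\<close> is \<open>\<nabla>\<^sub>i\<omega>\<^sub>j\<close>.\<close>

definition cov_deriv ::
  "real tens2 fld \<Rightarrow> ('a::real_normed_vector) tens1 fld \<Rightarrow> real ^ 4 \<Rightarrow> 4 \<Rightarrow> 4 \<Rightarrow> 'a" where
  "cov_deriv g \<omega> x i j =
     pd i (\<lambda>y. \<omega> y $ j) x - (\<Sum>k\<in>UNIV. christoffel g x k i j *\<^sub>R \<omega> x $ k)"

definition delta1 :: "real tens2 fld \<Rightarrow> ('a::real_normed_vector) tens1 fld \<Rightarrow> 'a fld" where
  "delta1 g \<omega> x = (\<Sum>i\<in>UNIV. \<Sum>j\<in>UNIV. ginv g x $ i $ j *\<^sub>R cov_deriv g \<omega> x i j)"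

definition conf_killing_op ::
  "real tens2 fld \<Rightarrow> ('a::real_normed_vector) tens1 fld \<Rightarrow> 'a tens2 fld" where
  "conf_killing_op g \<omega> x = (\<chi> i j.
     cov_deriv g \<omega> x i j + cov_deriv g \<omega> x j i - (g x $ i $ j / 2) *\<^sub>R delta1 g \<omega> x)"

definition laplacian :: "real tens2 fld \<Rightarrow> ('a::real_normed_vector) fld \<Rightarrow> 'a fld" where
  "laplacian g f = delta1 g (\<lambda>x. \<chi> i. pd i f x)"

text \<open>The formal adjoint of \<open>F(h) = (Dh, 2\<delta>h)\<close> on traceless \<open>h\<close>, where \<open>D\<close> is \<open>lin_weyl_minus g\<close> and
  \<open>(\<delta>h)\<^sub>j = \<nabla>\<^sup>ih\<^sub>i\<^sub>j\<close>.\<close>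

definition F_star :: "real tens2 fld \<Rightarrow> (real ^ 4) set \<Rightarrow>
    complex tens4 fld \<Rightarrow> complex tens1 fld \<Rightarrow> complex tens2 fld" where
  "F_star g U Z \<omega> x = lin_weyl_minus_adj g U Z x - conf_killing_op g \<omega> x"

section \<open>The cylinder over a spherical space form\<close>

text \<open>
  \<open>\<real> \<times> S\<^sup>3\<close> is identified with \<open>\<real>\<^sup>4 - {0}\<close> by the diffeomorphism \<open>x \<mapsto> (ln |x|, x/|x|)\<close>; it takes the
  standard orientation of \<open>\<real>\<^sup>4\<close> to \<open>dt \<and> dV\<close>, where \<open>S\<^sup>3\<close> is the oriented boundary of the unit ball.
  The metric below is the pull-back of the product metric \<open>dt\<^sup>2 + g\<close>, with \<open>g\<close> induced from \<open>\<real>\<^sup>4\<close>.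
  A matrix in \<open>\<Gamma>\<close> acts on \<open>\<real> \<times> S\<^sup>3\<close> through the second factor, which becomes its linear action on
  \<open>\<real>\<^sup>4 - {0}\<close>; tensor fields on \<open>\<real> \<times> S\<^sup>3/\<Gamma>\<close> are the \<open>\<Gamma>\<close>-invariant ones on \<open>\<real>\<^sup>4 - {0}\<close>. The formal
  adjoint is a local operator, so it may be computed on the covering \<open>\<real>\<^sup>4 - {0}\<close>.
\<close>

abbreviation S3 :: "(real ^ 4) set" where
  "S3 \<equiv> sphere 0 1"

definition cyl :: "(real ^ 4) set" where
  "cyl = - {0}"

definition cyl_t :: "real fld" where
  "cyl_t x = ln (norm x)"

definition cyl_y :: "(real ^ 4) fld" where
  "cyl_y x = x /\<^sub>R norm x"

definition cyl_metric :: "real tens2 fld" where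
  "cyl_metric x = (\<chi> i j. pd i cyl_t x * pd j cyl_t x + pd i cyl_y x \<bullet> pd j cyl_y x)"

definition SO4 :: "(real ^ 4 ^ 4) monoid" where
  "SO4 = \<lparr>carrier = {A. orthogonal_matrix A \<and> det A = 1}, mult = (**), one = mat 1\<rparr>"

definition acts_freely_on_S3 :: "(real ^ 4 ^ 4) set \<Rightarrow> bool" where
  "acts_freely_on_S3 \<Gamma> \<longleftrightarrow> (\<forall>A\<in>\<Gamma>. \<forall>y\<in>S3. A *v y = y \<longrightarrow> A = mat 1)"

definition invariant1 :: "(real ^ 4 ^ 4) set \<Rightarrow> complex tens1 fld \<Rightarrow> bool" where
  "invariant1 \<Gamma> \<omega> \<longleftrightarrow> (\<forall>A\<in>\<Gamma>. \<forall>x\<in>cyl. \<forall>i. \<omega> x $ i = (\<Sum>a\<in>UNIV. A $ a $ i *\<^sub>R \<omega> (A *v x) $ a))"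

definition invariant4 :: "(real ^ 4 ^ 4) set \<Rightarrow> complex tens4 fld \<Rightarrow> bool" where
  "invariant4 \<Gamma> Z \<longleftrightarrow> (\<forall>A\<in>\<Gamma>. \<forall>x\<in>cyl. \<forall>i j k l. Z x $ i $ j $ k $ l =
     (\<Sum>a\<in>UNIV. \<Sum>b\<in>UNIV. \<Sum>c\<in>UNIV. \<Sum>d\<in>UNIV.
        (A $ a $ i * A $ b $ j * A $ c $ k * A $ d $ l) *\<^sub>R Z (A *v x) $ a $ b $ c $ d))"

definition smooth_on_S3 :: "('a::real_normed_vector) fld \<Rightarrow> bool" where
  "smooth_on_S3 f \<longleftrightarrow> smooth_on cyl (f \<circ> cyl_y)"

definition exp_poly :: "complex \<Rightarrow> complex fld \<Rightarrow> bool" where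
  "exp_poly \<beta> f \<longleftrightarrow> (\<exists>(N::nat) (p :: nat \<Rightarrow> complex fld). (\<forall>n\<le>N. smooth_on_S3 (p n)) \<and>
     (\<forall>x\<in>cyl. f x = exp (\<beta> * of_real (cyl_t x)) * (\<Sum>n\<le>N. of_real (cyl_t x) ^ n * p n (cyl_y x))))"

text \<open>
  Components are taken in the orthonormal frame \<open>|x| \<partial>\<^sub>i\<close>. It is invariant under translations in \<open>t\<close>
  (dilations of \<open>\<real>\<^sup>4\<close>), so this amounts to taking components with respect to \<open>dt\<close> and local coframes
  of \<open>S\<^sup>3/\<Gamma>\<close>; the coordinate components, by contrast, carry extra powers of \<open>|x| = e\<^sup>t\<close>.
\<close>

definition solution :: "(real ^ 4 ^ 4) set \<Rightarrow> complex \<Rightarrow> complex tens4 fld \<Rightarrow> complex tens1 fld \<Rightarrow> bool" where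
  "solution \<Gamma> \<beta> Z \<omega> \<longleftrightarrow>
     smooth_on cyl Z \<and> (\<forall>x\<in>cyl. sym_traceless_asd cyl_metric x (Z x)) \<and> invariant4 \<Gamma> Z \<and>
     smooth_on cyl \<omega> \<and> invariant1 \<Gamma> \<omega> \<and>
     (\<forall>i j k l. exp_poly \<beta> (\<lambda>x. norm x ^ 4 *\<^sub>R Z x $ i $ j $ k $ l)) \<and>
     (\<forall>i. exp_poly \<beta> (\<lambda>x. norm x *\<^sub>R \<omega> x $ i)) \<and>
     (\<forall>x\<in>cyl. F_star cyl_metric cyl Z \<omega> x = 0)"

definition indicial_roots :: "(real ^ 4 ^ 4) set \<Rightarrow> complex set" where
  "indicial_roots \<Gamma> = {\<beta>. \<exists>Z \<omega>. solution \<Gamma> \<beta> Z \<omega> \<and> (\<exists>x\<in>cyl. Z x \<noteq> 0 \<or> \<omega> x \<noteq> 0)}"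

definition dt_form :: "complex tens1 fld" where
  "dt_form x = (\<chi> i. of_real (pd i cyl_t x))"

text \<open>Vector fields on \<open>S\<^sup>3/\<Gamma>\<close> are \<open>\<Gamma>\<close>-equivariant tangent fields on \<open>S\<^sup>3 \<subseteq> \<real>\<^sup>4\<close>. The Levi-Civita
  derivative of \<open>X\<close> along \<open>u\<close> is the tangential part of the derivative of \<open>X\<close>, which
  is computed on the radially constant extension.\<close>

definition killing_field :: "(real ^ 4 ^ 4) set \<Rightarrow> (real ^ 4) fld \<Rightarrow> bool" where
  "killing_field \<Gamma> X \<longleftrightarrow> smooth_on_S3 X \<and> (\<forall>y\<in>S3. X y \<bullet> y = 0) \<and>
     (\<forall>A\<in>\<Gamma>. \<forall>y\<in>S3. X (A *v y) = A *v X y) \<and>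
     (\<forall>y\<in>S3. \<forall>u v. u \<bullet> y = 0 \<and> v \<bullet> y = 0 \<longrightarrow>
        frechet_derivative (X \<circ> cyl_y) (at y) u \<bullet> v + u \<bullet> frechet_derivative (X \<circ> cyl_y) (at y) v = 0)"

text \<open>The metric dual of a tangent field on \<open>S\<^sup>3\<close>, pulled back to the cylinder.\<close>

definition S3_dual :: "(real ^ 4) fld \<Rightarrow> complex tens1 fld" where
  "S3_dual X x = (\<chi> i. of_real (X (cyl_y x) \<bullet> pd i cyl_y x))"

text \<open>For the product metric, the Laplacian of a function that does not depend on \<open>t\<close> is its Laplacian
  on \<open>S\<^sup>3\<close>.\<close>

definition laplacian_S3 :: "complex fld \<Rightarrow> complex fld" where
  "laplacian_S3 \<phi> y = laplacian cyl_metric (\<phi> \<circ> cyl_y) y"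

definition eigenfunction_S3 :: "real \<Rightarrow> complex fld \<Rightarrow> bool" where
  "eigenfunction_S3 \<mu> \<phi> \<longleftrightarrow> smooth_on_S3 \<phi> \<and> (\<exists>y\<in>S3. \<phi> y \<noteq> 0) \<and>
     (\<forall>y\<in>S3. - laplacian_S3 \<phi> y = \<mu> *\<^sub>R \<phi> y)"

definition lowest_nontrivial_eigenfunction :: "complex fld \<Rightarrow> bool" where
  "lowest_nontrivial_eigenfunction \<phi> \<longleftrightarrow>
     (\<exists>\<mu>>0. eigenfunction_S3 \<mu> \<phi> \<and> (\<forall>\<nu>>0. (\<exists>\<psi>. eigenfunction_S3 \<nu> \<psi>) \<longrightarrow> \<mu> \<le> \<nu>))"

text \<open>\<open>e\<^sup>\<epsilon>\<^sup>t (\<phi> dt - \<epsilon> d\<phi>)\<close>, for \<open>\<epsilon> = 1\<close> or \<open>\<epsilon> = - 1\<close>\<close>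

definition eigen_form :: "real \<Rightarrow> complex fld \<Rightarrow> complex tens1 fld" where
  "eigen_form \<epsilon> \<phi> x = (\<chi> i. of_real (exp (\<epsilon> * cyl_t x)) *
     (\<phi> (cyl_y x) * of_real (pd i cyl_t x) - of_real \<epsilon> * pd i (\<phi> \<circ> cyl_y) x))"

section \<open>Sanity checks\<close>

lemma group_SO4: "group SO4"
proof (rule groupI)
  fix A assume A: "A \<in> carrier SO4"
  then have "transpose A \<in> carrier SO4" "transpose A \<otimes>\<^bsub>SO4\<^esub> A = \<one>\<^bsub>SO4\<^esub>"
    by (auto simp: SO4_def orthogonal_matrix_def det_transpose)
  then show "\<exists>B\<in>carrier SO4. B \<otimes>\<^bsub>SO4\<^esub> A = \<one>\<^bsub>SO4\<^esub>"
    by blast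
qed (auto simp: SO4_def orthogonal_matrix_mul orthogonal_matrix_id det_mul matrix_mul_assoc)

lemma levi_civita_1234: "levi_civita 1 2 3 4 = 1"
proof -
  have "(vector [axis 1 1, axis 2 1, axis 3 1, axis 4 1] :: real ^ 4 ^ 4) = mat 1"
    by (auto simp: vector_def vec_eq_iff forall_4 mat_def axis_def)
  then show ?thesis
    by (simp add: levi_civita_def)
qed

lemma pd_eqI: "(f has_derivative f') (at x) \<Longrightarrow> pd i f x = f' (axis i 1)"
  unfolding pd_def by (metis frechet_derivative_at)

lemma pd_cyl_t: "x \<noteq> 0 \<Longrightarrow> pd i cyl_t x = x $ i / (norm x)\<^sup>2"
proof -
  assume "x \<noteq> 0"
  then have "((\<lambda>x. ln (norm x)) has_derivative (\<lambda>v. (v \<bullet> sgn x) / norm x)) (at x)"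
    by (auto intro!: derivative_eq_intros has_derivative_norm simp: divide_inverse mult.commute)
  then show ?thesis
    using \<open>x \<noteq> 0\<close> unfolding cyl_t_def[abs_def]
    by (subst pd_eqI) (auto simp: sgn_div_norm inner_axis' power2_eq_square divide_simps)
qed

lemma pd_cyl_y: "x \<noteq> 0 \<Longrightarrow> pd i cyl_y x = axis i 1 /\<^sub>R norm x - (x $ i / norm x ^ 3) *\<^sub>R x"
proof -
  assume x: "x \<noteq> 0"
  have "((\<lambda>x. inverse (norm x) *\<^sub>R x) has_derivative
      (\<lambda>v. inverse (norm x) *\<^sub>R v + (- (inverse (norm x) * (v \<bullet> sgn x) * inverse (norm x))) *\<^sub>R x)) (at x)"
    using x by (auto intro!: derivative_eq_intros has_derivative_norm)
  from pd_eqI[OF this, of i] show ?thesis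
    using x unfolding cyl_y_def[abs_def]
    by (auto simp: sgn_div_norm inner_axis' power3_eq_cube divide_simps)
qed

lemma cyl_metric_eq: "x \<noteq> 0 \<Longrightarrow> cyl_metric x = mat (1 / (norm x)\<^sup>2)"
proof -
  assume x: "x \<noteq> 0"
  have n: "x \<bullet> x = norm x * norm x" by (simp add: dot_square_norm power2_eq_square)
  have a: "axis i (1::real) \<bullet> (axis j 1 :: real ^ 4) = (if i = j then 1 else 0)" for i j
    by (simp add: inner_axis_axis)
  have b: "axis i (1::real) $ j = (if i = j then 1 else 0)" for i j :: 4
    by (simp add: axis_def)
  have "pd i cyl_t x * pd j cyl_t x + pd i cyl_y x \<bullet> pd j cyl_y x = (if i = j then 1 / (norm x)\<^sup>2 else 0)" for i j
    using x by (simp add: pd_cyl_t pd_cyl_y inner_diff_left inner_diff_right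
        inner_axis inner_axis' a b n power2_eq_square power3_eq_cube field_simps)
  then show ?thesis
    by (simp add: cyl_metric_def vec_eq_iff mat_def)
qed

end

theory Submission
  imports Defs
begin

text \<open>
  The cylinder metric is \<open>|x|\<^sup>-\<^sup>2\<close> times the Euclidean metric on \<open>\<real>\<^sup>4 - {0}\<close>. In terms of \<open>U = |x|\<^sup>2 Z\<close> and
  \<open>V = |x|\<^sup>2 \<omega>\<close>, the equation \<open>F\<^sup>*(Z, \<omega>) = 0\<close> reads \<open>\<partial>\<^sub>i\<partial>\<^sub>k U\<^sub>i\<^sub>j\<^sub>k\<^sub>l = - 2 |x|\<^sup>-\<^sup>4 (K V)\<^sub>j\<^sub>l\<close>, where \<open>K\<close> is the flat conformal
  Killing operator. Since \<open>U\<close> is antisymmetric in \<open>i\<close> and \<open>j\<close>, the left-hand side is divergence free, which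
  leaves an equation for \<open>V\<close> alone. Separation of variables and the spectrum of the sphere show that, for
  \<open>|Re \<beta>| < 2\<close>, this \<open>V\<close> is a combination of finitely many fields built from spherical harmonics of
  degree at most one, with radial coefficients. For such a field, \<open>K V\<close> and its radial multiples
  are annihilated by the linearization of \<open>W\<^sup>-\<close>, so pairing the equation with a cut-off of \<open>K V\<close> gives
  \<open>K V = 0\<close>. Now \<open>\<partial>\<^sub>i\<partial>\<^sub>k U\<^sub>i\<^sub>j\<^sub>k\<^sub>l = 0\<close>. In spinors these are two massless field equations in succession; contracting
  with \<open>x\<close> reduces them to harmonic functions of degree between \<open>-2\<close> and \<open>0\<close> on \<open>\<real>\<^sup>4 - {0}\<close>, which vanish,
  and so \<open>U = 0\<close>. The conformal Killing fields of \<open>\<real>\<^sup>4\<close> have degrees \<open>0\<close>, \<open>1\<close> and \<open>2\<close>, corresponding to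
  \<open>\<beta> = -1, 0, 1\<close>; those of degree \<open>0\<close> and \<open>2\<close> are determined by a vector, which \<open>\<Gamma>\<close> has to fix.
\<close>

section \<open>Smooth functions\<close>

text \<open>The equation for V alone does not force K V = 0. The form t dt, that is V =
  \<open>T\<close> x, satisfies div (|x|^-4 K V) = 0, although its K V is 2 y y - \<delta>/2. Hence
  V is first determined up to radial coefficients only, and the full equation is used a second time,
  through orthogonality. The bound |Re \<beta>| < 2 enters twice. For V it gives Re \<beta>^2 < 4,
  which keeps away the spherical harmonics of degree k \<ge> 2, whose eigenvalues k(k+2) are at
  least 8. The tensor U has degree \<beta> - 2, which then lies between -4 and 0. Calculations take
  place in the commutative ring \<open>sfun\<close> with commuting derivations \<open>D i\<close>.
  It contains |x|^\<beta> and t = ln |x|, so that tensor identities become ring identities, and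
  "exponential times polynomial" becomes nilpotency of a shifted Euler field. The adjoint of the
  linearization is given only through its pairing with test tensors, so an explicit formula for it
  needs a uniqueness proof.\<close>

lemma has_derivative_cong_open:
  assumes "open U" "\<And>x. x \<in> U \<Longrightarrow> f x = g x" "x \<in> U"
  shows "(f has_derivative D) (at x) \<longleftrightarrow> (g has_derivative D) (at x)"
proof
  show "(f has_derivative D) (at x) \<Longrightarrow> (g has_derivative D) (at x)"
    by (rule has_derivative_transform_within_open[OF _ assms(1,3,2)])
  show "(g has_derivative D) (at x) \<Longrightarrow> (f has_derivative D) (at x)"
    by (rule has_derivative_transform_within_open[OF _ assms(1,3) assms(2)[symmetric]])
qed

lemma pd_cong:
  assumes "open U" "\<And>x. x \<in> U \<Longrightarrow> f x = g x" "x \<in> U"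
  shows "pd i f x = pd i g x"
  by (simp add: pd_def frechet_derivative_def has_derivative_cong_open[OF assms])

lemma ck_on_cong:
  assumes "open U" "\<And>x. x \<in> U \<Longrightarrow> f x = g x"
  shows "ck_on k U f \<longleftrightarrow> ck_on k U g"
  using assms(2)
proof (induction k arbitrary: f g)
  case 0
  have "continuous_on U f \<longleftrightarrow> continuous_on U g"
    by (rule continuous_on_cong) (use 0 in auto)
  then show ?case by simp
next
  case (Suc k)
  have 1: "ck_on k U (pd i f) \<longleftrightarrow> ck_on k U (pd i g)" for i
    by (rule Suc.IH, rule pd_cong[of U f g, OF assms(1) Suc.prems]) auto
  have 2: "f differentiable (at x) \<longleftrightarrow> g differentiable (at x)" if "x \<in> U" for x
    unfolding differentiable_def using has_derivative_cong_open[of U f g x, OF assms(1) Suc.prems that] by blast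
  have "f differentiable_on U \<longleftrightarrow> g differentiable_on U"
    using 2 differentiable_on_eq_differentiable_at[OF assms(1)] by blast
  then show ?case
    unfolding ck_on.simps using 1 by blast
qed

lemma smooth_on_cong:
  assumes "open U" "\<And>x. x \<in> U \<Longrightarrow> f x = g x"
  shows "smooth_on U f \<longleftrightarrow> smooth_on U g"
  using ck_on_cong[OF assms] by (simp add: smooth_on_def)

lemma smooth_on_pd: "smooth_on U f \<Longrightarrow> smooth_on U (pd i f)"
  unfolding smooth_on_def using ck_on.simps(2) by blast

lemma smooth_on_imp_continuous_on: "smooth_on U f \<Longrightarrow> continuous_on U f"
  unfolding smooth_on_def using ck_on.simps(1) by blast

lemma smooth_on_imp_differentiable:
  "smooth_on U f \<Longrightarrow> open U \<Longrightarrow> x \<in> U \<Longrightarrow> f differentiable (at x)"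
  unfolding smooth_on_def
  using differentiable_on_eq_differentiable_at ck_on.simps(2) by blast

text \<open>Closure of \<open>S\<close> under partial derivatives on \<open>U\<close> makes the
  induction on the order of differentiability work for all its members at once; no iterated
  derivative has to be computed.\<close>

lemma smooth_on_coinduct:
  assumes "open U" "f \<in> S"
    and diff: "\<And>f x. f \<in> S \<Longrightarrow> x \<in> U \<Longrightarrow> f differentiable (at x)"
    and step: "\<And>f i. f \<in> S \<Longrightarrow> \<exists>g\<in>S. \<forall>x\<in>U. pd i f x = g x"
  shows "smooth_on U f"
proof -
  have "ck_on k U f" if "f \<in> S" for k f
    using that
  proof (induction k arbitrary: f)
    case 0
    then show ?case
      using diff by (auto intro!: continuous_at_imp_continuous_on differentiable_imp_continuous_within)
  next
    case (Suc k)
    have "f differentiable_on U"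
      using diff[OF Suc.prems] assms(1) by (auto simp: differentiable_on_eq_differentiable_at)
    moreover have "ck_on k U (pd i f)" for i
      using step[OF Suc.prems, of i] Suc.IH ck_on_cong[OF assms(1)] by metis
    ultimately show ?case by simp
  qed
  then show ?thesis using assms(2) by (simp add: smooth_on_def)
qed

lemma pd_const [simp]: "pd i (\<lambda>x. c) = (\<lambda>x. 0)"
  by (rule ext) (auto intro!: pd_eqI[THEN trans] derivative_eq_intros)

lemma smooth_on_const [simp, intro]: "smooth_on U (\<lambda>x. c)"
proof -
  have "ck_on k U (\<lambda>x. c)" for k and c :: 'a
    by (induction k arbitrary: c) auto
  then show ?thesis by (simp add: smooth_on_def)
qed

lemma has_derivative_pd:
  assumes "f differentiable (at x)"
  shows "(f has_derivative (\<lambda>v. \<Sum>i\<in>UNIV. v $ i *\<^sub>R pd i f x)) (at x)"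
proof -
  let ?D = "frechet_derivative f (at x)"
  have D: "(f has_derivative ?D) (at x)"
    using assms frechet_derivative_works by blast
  have l: "linear ?D"
    using D has_derivative_linear by blast
  have "?D v = (\<Sum>i\<in>UNIV. v $ i *\<^sub>R pd i f x)" for v
  proof -
    have "v = (\<Sum>i\<in>UNIV. v $ i *\<^sub>R axis i 1)"
      by (simp add: vec_eq_iff axis_def if_distrib cong: if_cong)
    then have "?D v = ?D (\<Sum>i\<in>UNIV. v $ i *\<^sub>R axis i 1)" by simp
    also have "\<dots> = (\<Sum>i\<in>UNIV. v $ i *\<^sub>R ?D (axis i 1))"
      using l by (simp add: linear_sum linear_scale)
    finally show ?thesis by (simp add: pd_def)
  qed
  then have "?D = (\<lambda>v. \<Sum>i\<in>UNIV. v $ i *\<^sub>R pd i f x)" by auto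
  with D show ?thesis by simp
qed

lemma pd_bilinear:
  assumes "bounded_bilinear b" "f differentiable (at x)" "g differentiable (at x)"
  shows "pd i (\<lambda>x. b (f x) (g x)) x = b (pd i f x) (g x) + b (f x) (pd i g x)"
proof -
  interpret bounded_bilinear b by fact
  have 1: "(f has_derivative frechet_derivative f (at x)) (at x)"
    "(g has_derivative frechet_derivative g (at x)) (at x)"
    using assms frechet_derivative_works by blast+
  show ?thesis
    by (rule pd_eqI[OF FDERIV[OF 1], THEN trans]) (simp add: pd_def add.commute)
qed

lemma differentiable_bilinear:
  assumes "bounded_bilinear b" "f differentiable (at x)" "g differentiable (at x)"
  shows "(\<lambda>x. b (f x) (g x)) differentiable (at x)"
  using assms bounded_bilinear.FDERIV[OF assms(1)] unfolding differentiable_def by blast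

lemma pd_add:
  assumes "f differentiable (at x)" "g differentiable (at x)"
  shows "pd i (\<lambda>x. f x + g x) x = pd i f x + pd i g x"
proof -
  have 1: "(f has_derivative frechet_derivative f (at x)) (at x)"
    "(g has_derivative frechet_derivative g (at x)) (at x)"
    using assms frechet_derivative_works by blast+
  show ?thesis
    by (rule pd_eqI[OF has_derivative_add[OF 1], THEN trans]) (simp add: pd_def)
qed

lemma ck_on_add:
  assumes "open U" "ck_on k U f" "ck_on k U g"
  shows "ck_on k U (\<lambda>x. f x + g x)"
  using assms(2,3)
proof (induction k arbitrary: f g)
  case (Suc k)
  have d: "f differentiable (at x)" "g differentiable (at x)" if "x \<in> U" for x
    using Suc.prems assms(1) that by (auto simp: differentiable_on_eq_differentiable_at)
  have "ck_on k U (pd i (\<lambda>x. f x + g x))" for i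
    using ck_on_cong[OF assms(1), of "pd i (\<lambda>x. f x + g x)" "\<lambda>x. pd i f x + pd i g x" k]
      Suc by (auto simp: pd_add d)
  then show ?case using Suc.prems by (auto intro: differentiable_on_add)
qed (auto intro: continuous_on_add)

lemma smooth_on_add:
  "open U \<Longrightarrow> smooth_on U f \<Longrightarrow> smooth_on U g \<Longrightarrow> smooth_on U (\<lambda>x. f x + g x)"
  by (simp add: smooth_on_def ck_on_add)

lemma ck_on_Suc: "open U \<Longrightarrow> ck_on (Suc k) U f \<Longrightarrow> ck_on k U f"
proof (induction k arbitrary: f)
  case 0
  then show ?case by (auto intro: differentiable_imp_continuous_on)
next
  case (Suc k)
  then show ?case by (metis ck_on.simps(2))
qed

lemma ck_on_bilinear:
  assumes "bounded_bilinear b" "open U" "ck_on k U f" "ck_on k U g"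
  shows "ck_on k U (\<lambda>x. b (f x) (g x))"
  using assms(3,4)
proof (induction k arbitrary: f g)
  case 0
  then show ?case by (auto intro: bounded_bilinear.continuous_on[OF assms(1)])
next
  case (Suc k)
  have d: "f differentiable (at x)" "g differentiable (at x)" if "x \<in> U" for x
    using Suc.prems assms(2) that by (auto simp: differentiable_on_eq_differentiable_at)
  have k: "ck_on k U f" "ck_on k U g" "ck_on k U (pd i f)" "ck_on k U (pd i g)" for i
    using Suc.prems ck_on_Suc[OF assms(2)] by (blast, blast, simp_all)
  have "ck_on k U (\<lambda>x. b (pd i f x) (g x) + b (f x) (pd i g x))" for i
    by (intro ck_on_add assms(2) Suc.IH k)
  then have "ck_on k U (pd i (\<lambda>x. b (f x) (g x)))" for i
    by (subst ck_on_cong[OF assms(2), of _ "\<lambda>x. b (pd i f x) (g x) + b (f x) (pd i g x)"])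
      (auto simp: pd_bilinear[OF assms(1)] d)
  moreover have "(\<lambda>x. b (f x) (g x)) differentiable_on U"
    by (simp add: differentiable_on_eq_differentiable_at[OF assms(2)] differentiable_bilinear[OF assms(1)] d)
  ultimately show ?case by simp
qed

lemma smooth_on_bilinear:
  assumes "bounded_bilinear b" "open U" "smooth_on U f" "smooth_on U g"
  shows "smooth_on U (\<lambda>x. b (f x) (g x))"
  using assms ck_on_bilinear unfolding smooth_on_def by blast

lemma pd_linear:
  assumes "bounded_linear L" "f differentiable (at x)"
  shows "pd i (\<lambda>x. L (f x)) x = L (pd i f x)"
proof -
  have 1: "(f has_derivative frechet_derivative f (at x)) (at x)"
    using assms frechet_derivative_works by blast
  show ?thesis
    by (rule pd_eqI[OF bounded_linear.has_derivative[OF assms(1) 1], THEN trans]) (simp add: pd_def)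
qed

lemma smooth_on_linear:
  assumes "bounded_linear L" "open U" "smooth_on U f"
  shows "smooth_on U (\<lambda>x. L (f x))"
proof -
  have "ck_on k U (\<lambda>x. L (f x))" if "ck_on k U f" for k f
    using that
  proof (induction k arbitrary: f)
    case 0
    then show ?case by (auto intro: bounded_linear.continuous_on[OF assms(1)])
  next
    case (Suc k)
    have d: "f differentiable (at x)" if "x \<in> U" for x
      using Suc.prems assms(2) that by (auto simp: differentiable_on_eq_differentiable_at)
    have "ck_on k U (pd i (\<lambda>x. L (f x)))" for i
      using ck_on_cong[OF assms(2), of "pd i (\<lambda>x. L (f x))" "\<lambda>x. L (pd i f x)" k]
        Suc by (auto simp: pd_linear[OF assms(1)] d)
    moreover have "(\<lambda>x. L (f x)) differentiable (at x)" if "x \<in> U" for x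
      using d[OF that] bounded_linear.has_derivative[OF assms(1)] unfolding differentiable_def by blast
    ultimately show ?case
      by (simp add: differentiable_on_eq_differentiable_at[OF assms(2)])
  qed
  then show ?thesis using assms(3) by (simp add: smooth_on_def)
qed

lemma smooth_on_mult:
  fixes f g :: "real ^ 4 \<Rightarrow> 'a::real_normed_algebra"
  shows "open U \<Longrightarrow> smooth_on U f \<Longrightarrow> smooth_on U g \<Longrightarrow> smooth_on U (\<lambda>x. f x * g x)"
  by (rule smooth_on_bilinear[OF bounded_bilinear_mult])

lemma smooth_on_scaleR:
  "open U \<Longrightarrow> smooth_on U f \<Longrightarrow> smooth_on U g \<Longrightarrow> smooth_on U (\<lambda>x. f x *\<^sub>R g x)"
  by (rule smooth_on_bilinear[OF bounded_bilinear_scaleR])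

lemma smooth_on_minus: "open U \<Longrightarrow> smooth_on U f \<Longrightarrow> smooth_on U (\<lambda>x. - f x)"
  by (rule smooth_on_linear[OF bounded_linear_minus[OF bounded_linear_ident]])

lemma smooth_on_diff:
  "open U \<Longrightarrow> smooth_on U f \<Longrightarrow> smooth_on U g \<Longrightarrow> smooth_on U (\<lambda>x. f x - g x)"
  using smooth_on_add[of U f "\<lambda>x. - g x"] smooth_on_minus[of U g] by simp

lemma smooth_on_sum:
  "open U \<Longrightarrow> (\<And>i. i \<in> I \<Longrightarrow> smooth_on U (f i)) \<Longrightarrow> smooth_on U (\<lambda>x. \<Sum>i\<in>I. f i x)"
  by (induction I rule: infinite_finite_induct) (auto intro: smooth_on_add)

lemma smooth_on_of_real:
  "open U \<Longrightarrow> smooth_on U f \<Longrightarrow> smooth_on U (\<lambda>x. of_real (f x) :: 'a::{real_normed_algebra_1})"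
  by (rule smooth_on_linear[OF bounded_linear_of_real])

lemma smooth_on_vec_nth: "open U \<Longrightarrow> smooth_on U f \<Longrightarrow> smooth_on U (\<lambda>x. f x $ i)"
  by (rule smooth_on_linear[OF bounded_linear_vec_nth])

lemma pd_coord: "pd i (\<lambda>x. x $ j) x = (if i = j then 1 else 0)"
proof -
  have "((\<lambda>x::real^4. x $ j) has_derivative (\<lambda>x. x $ j)) (at x)"
    by (rule bounded_linear_imp_has_derivative[OF bounded_linear_vec_nth])
  from pd_eqI[OF this] show ?thesis by (simp add: axis_def)
qed

lemma smooth_on_coord: "open U \<Longrightarrow> smooth_on U (\<lambda>x. x $ j)"
proof (rule smooth_on_coinduct[where S = "insert (\<lambda>x. x $ j) (range (\<lambda>c x. c))"])
  fix f :: "real^4 \<Rightarrow> real" and x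
  assume "f \<in> insert (\<lambda>x. x $ j) (range (\<lambda>c x. c))"
  then show "f differentiable at x"
    by (auto intro: bounded_linear_imp_differentiable[OF bounded_linear_vec_nth])
next
  fix f :: "real^4 \<Rightarrow> real" and i
  assume "f \<in> insert (\<lambda>x. x $ j) (range (\<lambda>c x. c))"
  then show "\<exists>g\<in>insert (\<lambda>x. x $ j) (range (\<lambda>c x. c)). \<forall>x\<in>U. pd i f x = g x"
    by (auto simp: pd_coord)
qed auto

lemma bounded_linear_axis: "bounded_linear (\<lambda>c. axis i c :: 'a::real_normed_vector ^ 'n)"
proof (rule bounded_linear_intro[where K = 1])
  fix c :: 'a
  have "norm (axis i c :: 'a ^ 'n) = L2_set (\<lambda>j. norm ((axis i c :: 'a ^ 'n) $ j)) UNIV"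
    by (simp add: norm_vec_def)
  also have "\<dots> \<le> (\<Sum>j\<in>UNIV. norm ((axis i c :: 'a ^ 'n) $ j))"
    by (rule L2_set_le_sum) simp
  also have "\<dots> = (\<Sum>j\<in>UNIV. if j = i then norm c else 0)"
    by (intro sum.cong) (auto simp: axis_def)
  finally show "norm (axis i c :: 'a ^ 'n) \<le> norm c * 1" by simp
qed (auto simp: axis_def vec_eq_iff)

lemma smooth_on_vec:
  fixes f :: "'n::finite \<Rightarrow> real ^ 4 \<Rightarrow> 'a::real_normed_vector"
  assumes "open U" "\<And>i. smooth_on U (f i)"
  shows "smooth_on U (\<lambda>x. \<chi> i. f i x)"
proof -
  have "(\<chi> i. f i x) = (\<Sum>i\<in>UNIV. axis i (f i x))" for x
    by (simp add: vec_eq_iff axis_def if_distrib cong: if_cong)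
  moreover have "smooth_on U (\<lambda>x. \<Sum>i\<in>UNIV. axis i (f i x) :: 'a ^ 'n)"
    by (intro smooth_on_sum smooth_on_linear[OF bounded_linear_axis] assms)
  ultimately show ?thesis by simp
qed

text \<open>Smoothness in one variable is expressed by a family closed under differentiation at the
  values of \<open>f\<close>. This admits functions such as \<open>ln\<close>, which are
  differentiable only on part of the line, and bump functions, whose iterated derivatives have no
  simple closed form.\<close>

lemma smooth_on_compose:
  fixes f :: "real ^ 4 \<Rightarrow> real" and S :: "(real \<Rightarrow> 'a::real_normed_vector) set"
  assumes "open U" "smooth_on U f" "\<phi> \<in> S"
    and "\<And>\<phi>. \<phi> \<in> S \<Longrightarrow> \<exists>\<psi>\<in>S. \<forall>x\<in>U. (\<phi> has_vector_derivative \<psi> (f x)) (at (f x))"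
  shows "smooth_on U (\<lambda>x. \<phi> (f x))"
proof -
  have *: "\<exists>\<psi>\<in>S. \<forall>x\<in>U. (\<lambda>x. \<phi> (f x)) differentiable (at x) \<and> pd i (\<lambda>x. \<phi> (f x)) x = pd i f x *\<^sub>R \<psi> (f x)"
    if S: "\<phi> \<in> S" for \<phi> i
  proof -
    obtain \<psi> where \<psi>: "\<psi> \<in> S" "\<And>x. x \<in> U \<Longrightarrow> (\<phi> has_vector_derivative \<psi> (f x)) (at (f x))"
      using assms(4)[OF S] by blast
    have D: "((\<lambda>x. \<phi> (f x)) has_derivative (\<lambda>v. frechet_derivative f (at x) v *\<^sub>R \<psi> (f x))) (at x)" if "x \<in> U" for x
    proof -
      have 1: "(f has_derivative frechet_derivative f (at x)) (at x)"
        using smooth_on_imp_differentiable[OF assms(2,1) that] frechet_derivative_works by blast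
      show ?thesis
        using has_derivative_compose[OF 1 \<psi>(2)[OF that, unfolded has_vector_derivative_def]] by simp
    qed
    have "(\<lambda>x. \<phi> (f x)) differentiable (at x) \<and> pd i (\<lambda>x. \<phi> (f x)) x = pd i f x *\<^sub>R \<psi> (f x)"
      if "x \<in> U" for x
      using D[OF that] pd_eqI[OF D[OF that], of i] by (auto simp: pd_def differentiable_def)
    then show ?thesis
      using \<psi>(1) by blast
  qed
  have "ck_on k U (\<lambda>x. \<phi> (f x))" if "\<phi> \<in> S" for k \<phi>
    using that
  proof (induction k arbitrary: \<phi>)
    case 0
    have "continuous (at x) (\<lambda>x. \<phi> (f x))" if "x \<in> U" for x
      using *[OF 0] that differentiable_imp_continuous_within by blast
    then show ?case
      unfolding ck_on.simps by (intro continuous_at_imp_continuous_on ballI)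
  next
    case (Suc k)
    have "(\<lambda>x. \<phi> (f x)) differentiable_on U"
      using *[OF Suc.prems] unfolding differentiable_on_eq_differentiable_at[OF assms(1)] by blast
    moreover have "ck_on k U (pd i (\<lambda>x. \<phi> (f x)))" for i
    proof -
      obtain \<psi> where \<psi>: "\<psi> \<in> S" "\<forall>x\<in>U. pd i (\<lambda>x. \<phi> (f x)) x = pd i f x *\<^sub>R \<psi> (f x)"
        using *[OF Suc.prems, of i] by blast
      have "ck_on k U (\<lambda>x. pd i f x *\<^sub>R \<psi> (f x))"
        using smooth_on_pd[OF assms(2)]
        by (intro ck_on_bilinear[OF bounded_bilinear_scaleR] assms(1) Suc.IH \<psi>(1)) (simp add: smooth_on_def)
      then show ?thesis
        by (subst ck_on_cong[OF assms(1) bspec[OF \<psi>(2)]])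
    qed
    ultimately show ?case by simp
  qed
  then show ?thesis using assms(3) by (simp add: smooth_on_def)
qed

section \<open>Symmetry of second derivatives\<close>

lemma has_vector_derivative_pd:
  assumes "f differentiable (at (x + s *\<^sub>R axis i 1))"
  shows "((\<lambda>s. f (x + s *\<^sub>R axis i 1)) has_vector_derivative pd i f (x + s *\<^sub>R axis i 1)) (at s)"
proof -
  have 1: "((\<lambda>s. x + s *\<^sub>R axis i 1) has_derivative (\<lambda>h. h *\<^sub>R axis i 1)) (at s)"
    by (auto intro!: derivative_eq_intros)
  have 2: "(f has_derivative frechet_derivative f (at (x + s *\<^sub>R axis i 1))) (at (x + s *\<^sub>R axis i 1))"
    using assms frechet_derivative_works by blast
  have "frechet_derivative f (at (x + s *\<^sub>R axis i 1)) (h *\<^sub>R axis i 1) = h *\<^sub>R pd i f (x + s *\<^sub>R axis i 1)" for h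
    using has_derivative_linear[OF 2] by (simp add: pd_def linear_scale)
  then show ?thesis
    using has_derivative_compose[OF 1 2] by (simp add: has_vector_derivative_def)
qed

text \<open>Two applications of the mean value theorem: in direction i to the difference of
  \<open>f\<close> in direction j, then in direction j to \<open>pd i f\<close>.\<close>

lemma second_difference_mean_value:
  fixes f :: "real ^ 4 \<Rightarrow> real"
  assumes "open U" "smooth_on U f" "h > 0"
    and box: "\<And>s t. 0 \<le> s \<Longrightarrow> s \<le> h \<Longrightarrow> 0 \<le> t \<Longrightarrow> t \<le> h \<Longrightarrow> x + s *\<^sub>R axis i 1 + t *\<^sub>R axis j 1 \<in> U"
  shows "\<exists>s t. 0 \<le> s \<and> s \<le> h \<and> 0 \<le> t \<and> t \<le> h \<and>
    f (x + h *\<^sub>R axis i 1 + h *\<^sub>R axis j 1) - f (x + h *\<^sub>R axis i 1) - f (x + h *\<^sub>R axis j 1) + f x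
      = h * h * pd j (pd i f) (x + s *\<^sub>R axis i 1 + t *\<^sub>R axis j 1)"
proof -
  let ?g = "\<lambda>s. f ((x + h *\<^sub>R axis j 1) + s *\<^sub>R axis i 1) - f (x + s *\<^sub>R axis i 1)"
  have box': "x + h *\<^sub>R axis j 1 + s *\<^sub>R axis i 1 \<in> U" "x + s *\<^sub>R axis i 1 \<in> U" if "0 \<le> s" "s \<le> h" for s
    using box[OF that, of h] box[OF that, of 0] \<open>h > 0\<close> by (auto simp: algebra_simps)
  have dg: "(?g has_real_derivative
      (pd i f ((x + h *\<^sub>R axis j 1) + s *\<^sub>R axis i 1) - pd i f (x + s *\<^sub>R axis i 1))) (at s)"
    if "0 \<le> s" "s \<le> h" for s
    unfolding has_real_derivative_iff_has_vector_derivative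
    by (intro has_vector_derivative_diff has_vector_derivative_pd
        smooth_on_imp_differentiable[OF assms(2,1)] box' that)
  obtain s where s: "0 < s" "s < h"
    "?g h - ?g 0 = (h - 0) * (pd i f ((x + h *\<^sub>R axis j 1) + s *\<^sub>R axis i 1) - pd i f (x + s *\<^sub>R axis i 1))"
    using MVT2[OF \<open>h > 0\<close> dg] by blast
  let ?k = "\<lambda>t. pd i f ((x + s *\<^sub>R axis i 1) + t *\<^sub>R axis j 1)"
  have dk: "(?k has_real_derivative pd j (pd i f) ((x + s *\<^sub>R axis i 1) + t *\<^sub>R axis j 1)) (at t)"
    if "0 \<le> t" "t \<le> h" for t
    unfolding has_real_derivative_iff_has_vector_derivative
    using s that by (intro has_vector_derivative_pd smooth_on_imp_differentiable[OF smooth_on_pd[OF assms(2)] assms(1)] box) auto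
  obtain t where t: "0 < t" "t < h"
    "?k h - ?k 0 = (h - 0) * pd j (pd i f) ((x + s *\<^sub>R axis i 1) + t *\<^sub>R axis j 1)"
    using MVT2[OF \<open>h > 0\<close> dk] by blast
  have "f (x + h *\<^sub>R axis i 1 + h *\<^sub>R axis j 1) - f (x + h *\<^sub>R axis i 1) - f (x + h *\<^sub>R axis j 1) + f x = ?g h - ?g 0"
    by (simp add: algebra_simps)
  also have "\<dots> = h * (?k h - ?k 0)"
    using s(3) by (simp add: algebra_simps)
  also have "\<dots> = h * h * pd j (pd i f) (x + s *\<^sub>R axis i 1 + t *\<^sub>R axis j 1)"
    using t(3) by simp
  finally show ?thesis using s t by (intro exI[of _ s] exI[of _ t]) auto
qed

text \<open>The second difference over a small square is symmetric in i and j. So the two mixed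
  derivatives agree at two points close to x, and by continuity at x.\<close>

lemma pd_commute_real:
  fixes f :: "real ^ 4 \<Rightarrow> real"
  assumes "open U" "smooth_on U f" "x \<in> U"
  shows "pd i (pd j f) x = pd j (pd i f) x"
proof (rule ccontr)
  assume ne: "pd i (pd j f) x \<noteq> pd j (pd i f) x"
  define e where "e = \<bar>pd i (pd j f) x - pd j (pd i f) x\<bar> / 2"
  have e: "e > 0" using ne by (simp add: e_def)
  have c: "isCont (pd i (pd j f)) x" "isCont (pd j (pd i f)) x"
    using smooth_on_imp_continuous_on[OF smooth_on_pd[OF smooth_on_pd[OF assms(2)]]] assms
      continuous_on_eq_continuous_at by blast+
  obtain d1 where d1: "d1 > 0" "\<And>y. dist y x < d1 \<Longrightarrow> dist (pd i (pd j f) y) (pd i (pd j f) x) < e"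
    using c(1) e by (auto simp: continuous_at_eps_delta dist_norm)
  obtain d2 where d2: "d2 > 0" "\<And>y. dist y x < d2 \<Longrightarrow> dist (pd j (pd i f) y) (pd j (pd i f) x) < e"
    using c(2) e by (auto simp: continuous_at_eps_delta dist_norm)
  obtain d3 where d3: "d3 > 0" "ball x d3 \<subseteq> U"
    using assms open_contains_ball by blast
  \<comment> \<open>Points of the square are at distance at most 2h from x, which is strictly less
    than a radius bounded below by 3h.\<close>
  define h where "h = min d1 (min d2 d3) / 3"
  have h: "h > 0" "3 * h \<le> d1" "3 * h \<le> d2" "3 * h \<le> d3"
    using d1(1) d2(1) d3(1) by (auto simp: h_def)
  have near: "dist (x + s *\<^sub>R axis i 1 + t *\<^sub>R axis j 1) x < 3 * h"
    if "0 \<le> s" "s \<le> h" "0 \<le> t" "t \<le> h" for s t and i j :: 4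
  proof -
    have "norm (s *\<^sub>R axis i 1 + t *\<^sub>R axis j (1::real)) \<le> s + t"
      using norm_triangle_ineq[of "s *\<^sub>R axis i (1::real)" "t *\<^sub>R axis j 1"] that by simp
    then show ?thesis using that h(1) by (simp add: dist_norm add.assoc)
  qed
  have box: "x + s *\<^sub>R axis i 1 + t *\<^sub>R axis j 1 \<in> U"
    if "0 \<le> s" "s \<le> h" "0 \<le> t" "t \<le> h" for s t and i j :: 4
    using near[OF that, of i j] h(4) d3(2) by (auto simp: dist_commute subset_eq)
  obtain s t where 1: "0 \<le> s" "s \<le> h" "0 \<le> t" "t \<le> h"
    "f (x + h *\<^sub>R axis i 1 + h *\<^sub>R axis j 1) - f (x + h *\<^sub>R axis i 1) - f (x + h *\<^sub>R axis j 1) + f x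
      = h * h * pd j (pd i f) (x + s *\<^sub>R axis i 1 + t *\<^sub>R axis j 1)"
    using second_difference_mean_value[OF assms(1,2) h(1) box, of i j] by blast
  obtain s' t' where 2: "0 \<le> s'" "s' \<le> h" "0 \<le> t'" "t' \<le> h"
    "f (x + h *\<^sub>R axis j 1 + h *\<^sub>R axis i 1) - f (x + h *\<^sub>R axis j 1) - f (x + h *\<^sub>R axis i 1) + f x
      = h * h * pd i (pd j f) (x + s' *\<^sub>R axis j 1 + t' *\<^sub>R axis i 1)"
    using second_difference_mean_value[OF assms(1,2) h(1) box, of j i] by blast
  have "h * h * pd j (pd i f) (x + s *\<^sub>R axis i 1 + t *\<^sub>R axis j 1)
      = h * h * pd i (pd j f) (x + s' *\<^sub>R axis j 1 + t' *\<^sub>R axis i 1)"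
    unfolding 1(5)[symmetric] 2(5)[symmetric] by (simp add: algebra_simps)
  then have "pd j (pd i f) (x + s *\<^sub>R axis i 1 + t *\<^sub>R axis j 1)
      = pd i (pd j f) (x + s' *\<^sub>R axis j 1 + t' *\<^sub>R axis i 1)"
    using h(1) by simp
  moreover have "dist (pd j (pd i f) (x + s *\<^sub>R axis i 1 + t *\<^sub>R axis j 1)) (pd j (pd i f) x) < e"
    using near[OF 1(1-4), of i j] h by (intro d2(2)) linarith
  moreover have "dist (pd i (pd j f) (x + s' *\<^sub>R axis j 1 + t' *\<^sub>R axis i 1)) (pd i (pd j f) x) < e"
    using near[OF 2(1-4), of j i] h by (intro d1(2)) linarith
  ultimately show False
    by (simp add: e_def dist_real_def abs_if split: if_splits)
qed

lemma pd_commute: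
  fixes f :: "real ^ 4 \<Rightarrow> 'a::euclidean_space"
  assumes "open U" "smooth_on U f" "x \<in> U"
  shows "pd i (pd j f) x = pd j (pd i f) x"
proof (rule euclidean_eqI)
  fix b :: 'a
  have L: "bounded_linear (\<lambda>v. v \<bullet> b)" by (rule bounded_linear_inner_left)
  have 1: "pd i (\<lambda>y. g y \<bullet> b) y = pd i g y \<bullet> b" if "smooth_on U g" "y \<in> U" for g :: "real ^ 4 \<Rightarrow> 'a" and i y
    by (rule pd_linear[OF L smooth_on_imp_differentiable[OF that(1) assms(1) that(2)]])
  have 2: "pd i (pd j f) x \<bullet> b = pd i (pd j (\<lambda>y. f y \<bullet> b)) x" for i j
    using pd_cong[OF assms(1) 1[OF assms(2), where i = j] assms(3), where i = i]
      1[OF smooth_on_pd[OF assms(2), where i = j] assms(3), where i = i] by simp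
  show "pd i (pd j f) x \<bullet> b = pd j (pd i f) x \<bullet> b"
    unfolding 2 by (rule pd_commute_real[OF assms(1) smooth_on_linear[OF L assms(1,2)] assms(3)])
qed

section \<open>The differential ring of smooth functions on the cylinder\<close>

lemma open_cyl: "open cyl"
  by (simp add: cyl_def open_Compl)

lemma cyl_iff: "x \<in> cyl \<longleftrightarrow> x \<noteq> 0"
  by (simp add: cyl_def)

text \<open>Making the functions vanish at the origin turns equality on the cylinder into equality.\<close>

typedef sfun = "{f :: real ^ 4 \<Rightarrow> complex. smooth_on cyl f \<and> f 0 = 0}"
  morphisms ev Abs_sfun
  by (intro exI[of _ "\<lambda>x. 0"]) simp

setup_lifting type_definition_sfun

lemma smooth_on_cyl_if:
  "smooth_on cyl (\<lambda>x. if x = 0 then c else f x) \<longleftrightarrow> smooth_on cyl f"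
  by (rule smooth_on_cong[OF open_cyl]) (simp add: cyl_iff)

text \<open>Total, with zero as the value on functions that are not smooth on the cylinder, so that
  functions can be inserted into the ring without a side condition.\<close>

lift_definition sf :: "(real ^ 4 \<Rightarrow> complex) \<Rightarrow> sfun" is
  "\<lambda>f x. if x = 0 \<or> \<not> smooth_on cyl f then 0 else f x"
  subgoal for f
    by (cases "smooth_on cyl f") (simp_all add: smooth_on_cyl_if)
  done

lemma ev_sf: "smooth_on cyl f \<Longrightarrow> ev (sf f) x = (if x = 0 then 0 else f x)"
  by (simp add: sf.rep_eq)

lemma ev_0 [simp]: "ev f 0 = 0"
  using ev[of f] by simp

lemma smooth_ev: "smooth_on cyl (ev f)"
  using ev[of f] by simp

lemma sfun_eqI: "(\<And>x. x \<in> cyl \<Longrightarrow> ev f x = ev g x) \<Longrightarrow> f = g"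
  by (metis cyl_iff ev_0 ev_inject ext)

instantiation sfun :: comm_ring_1
begin

lift_definition zero_sfun :: sfun is "\<lambda>x. 0" by simp

lift_definition one_sfun :: sfun is "\<lambda>x. if x = 0 then 0 else 1"
  by (simp add: smooth_on_cyl_if)

lift_definition plus_sfun :: "sfun \<Rightarrow> sfun \<Rightarrow> sfun" is "\<lambda>f g x. f x + g x"
  by (simp add: smooth_on_add open_cyl)

lift_definition times_sfun :: "sfun \<Rightarrow> sfun \<Rightarrow> sfun" is "\<lambda>f g x. f x * g x"
  by (simp add: smooth_on_mult open_cyl)

lift_definition uminus_sfun :: "sfun \<Rightarrow> sfun" is "\<lambda>f x. - f x"
  by (simp add: smooth_on_minus open_cyl)

lift_definition minus_sfun :: "sfun \<Rightarrow> sfun \<Rightarrow> sfun" is "\<lambda>f g x. f x - g x"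
  by (simp add: smooth_on_diff open_cyl)

instance
proof
  show "(0::sfun) \<noteq> 1"
    by transfer (auto simp: fun_eq_iff intro!: exI[of _ "axis 1 1"])
qed (transfer; auto simp: algebra_simps fun_eq_iff)+

end

lift_definition cst :: "complex \<Rightarrow> sfun" is "\<lambda>c x. if x = 0 then 0 else c"
  by (simp add: smooth_on_cyl_if)

lift_definition D :: "4 \<Rightarrow> sfun \<Rightarrow> sfun" is "\<lambda>i f x. if x = 0 then 0 else pd i f x"
  by (simp add: smooth_on_cyl_if smooth_on_pd)

lift_definition cj :: "sfun \<Rightarrow> sfun" is "\<lambda>f x. cnj (f x)"
  by (simp add: smooth_on_linear[OF bounded_linear_cnj] open_cyl)

lift_definition X :: "4 \<Rightarrow> sfun" is "\<lambda>i x. of_real (x $ i)"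
  by (simp add: smooth_on_of_real smooth_on_coord open_cyl)

lemma ev_simps [simp]:
  "ev (f + g) x = ev f x + ev g x" "ev (f * g) x = ev f x * ev g x" "ev (- f) x = - ev f x"
  "ev (f - g) x = ev f x - ev g x" "ev 0 x = 0" "ev (cj f) x = cnj (ev f x)" "ev (X i) x = of_real (x $ i)"
  by (simp_all add: plus_sfun.rep_eq times_sfun.rep_eq uminus_sfun.rep_eq minus_sfun.rep_eq
      zero_sfun.rep_eq cj.rep_eq X.rep_eq)

lemma ev_cst: "x \<in> cyl \<Longrightarrow> ev (cst c) x = c" and ev_1: "x \<in> cyl \<Longrightarrow> ev 1 x = 1"
  and ev_D: "x \<in> cyl \<Longrightarrow> ev (D i f) x = pd i (ev f) x"
  by (simp_all add: cst.rep_eq one_sfun.rep_eq D.rep_eq cyl_iff)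

lemma ev_sum: "ev (\<Sum>i\<in>I. f i) x = (\<Sum>i\<in>I. ev (f i) x)"
  by (induction I rule: infinite_finite_induct) auto

lemma ev_power: "x \<in> cyl \<Longrightarrow> ev (f ^ n) x = ev f x ^ n"
  by (induction n) (auto simp: ev_1)

lemma diff_ev: "x \<in> cyl \<Longrightarrow> ev f differentiable (at x)"
  by (rule smooth_on_imp_differentiable[OF smooth_ev open_cyl])

lemma cst_hom: "cst (a + b) = cst a + cst b" "cst (a * b) = cst a * cst b" "cst (- a) = - cst a"
  "cst (a - b) = cst a - cst b"
  by (transfer; auto)+

lemma cst_0 [simp]: "cst 0 = 0" and cst_1 [simp]: "cst 1 = 1"
  by (transfer; auto simp: fun_eq_iff)+

lemma cst_of_nat [simp]: "cst (of_nat n) = of_nat n"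
  by (induction n) (auto simp: cst_hom)

lemma cst_numeral [simp]: "cst (numeral n) = numeral n"
  using cst_of_nat[of "numeral n"] by simp

lemma cst_neg_numeral [simp]: "cst (- numeral n) = - numeral n" "cst (-1) = -1"
  by (simp_all add: cst_hom)

lemma cst_eq_0_iff [simp]: "cst c = 0 \<longleftrightarrow> c = 0"
proof
  assume "cst c = 0"
  then have "ev (cst c) (axis 1 1) = 0" by simp
  then show "c = 0" by (simp add: ev_cst cyl_iff)
qed simp

lemma cst_inverse: "c \<noteq> 0 \<Longrightarrow> cst (inverse c) * (cst c * f) = f"
  by (simp add: mult.assoc[symmetric] cst_hom(2)[symmetric])

lemma cst_mult_cancel: "c \<noteq> 0 \<Longrightarrow> cst c * f = 0 \<longleftrightarrow> f = 0"
  using cst_inverse[of c f] by auto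

lemma numeral_mult_cancel: "(numeral n :: sfun) * f = 0 \<longleftrightarrow> f = 0"
  using cst_mult_cancel[of "numeral n" f] by simp

lemma D_add [simp]: "D i (f + g) = D i f + D i g"
  by (rule sfun_eqI) (simp add: ev_D plus_sfun.rep_eq[abs_def] pd_add diff_ev)

lemma D_mult: "D i (f * g) = D i f * g + f * D i g"
  by (rule sfun_eqI)
    (simp add: ev_D times_sfun.rep_eq[abs_def] pd_bilinear[OF bounded_bilinear_mult] diff_ev)

lemma D_cst [simp]: "D i (cst c) = 0"
proof (rule sfun_eqI)
  fix x assume "x \<in> cyl"
  then show "ev (D i (cst c)) x = ev 0 x"
    using pd_cong[OF open_cyl, of "ev (cst c)" "\<lambda>x. c" x i] by (simp add: ev_D ev_cst)
qed

lemma D_0 [simp]: "D i 0 = 0" and D_1 [simp]: "D i 1 = 0"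
  using D_cst[of i 0] D_cst[of i 1] by simp_all

lemma D_numeral [simp]: "D i (numeral n) = 0" "D i (of_nat k) = 0"
  using D_cst[of i "numeral n"] D_cst[of i "of_nat k"] by simp_all

lemma D_minus [simp]: "D i (- f) = - D i f"
  using D_add[of i "- f" f] by (simp add: eq_neg_iff_add_eq_0)

lemma D_diff [simp]: "D i (f - g) = D i f - D i g"
  using D_add[of i f "- g"] by simp

lemma D_sum [simp]: "D i (\<Sum>j\<in>J. f j) = (\<Sum>j\<in>J. D i (f j))"
  by (induction J rule: infinite_finite_induct) auto

lemma D_commute: "D i (D j f) = D j (D i f)"
proof (rule sfun_eqI)
  fix x assume x: "x \<in> cyl"
  have "ev (D i (D j f)) x = pd i (pd j (ev f)) x" for i j
    using pd_cong[OF open_cyl ev_D x] x by (simp add: ev_D)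
  then show "ev (D i (D j f)) x = ev (D j (D i f)) x"
    using pd_commute[OF open_cyl smooth_ev x] by simp
qed

lemma D_X: "D i (X j) = (if i = j then 1 else 0)"
proof (rule sfun_eqI)
  fix x assume x: "x \<in> cyl"
  have "pd i (\<lambda>x. complex_of_real (x $ j)) x = of_real (pd i (\<lambda>x. x $ j) x)"
    by (rule pd_linear[OF bounded_linear_of_real])
      (rule smooth_on_imp_differentiable[OF smooth_on_coord[OF open_cyl] open_cyl x])
  then show "ev (D i (X j)) x = ev (if i = j then 1 else 0) x"
    using x by (simp add: ev_D X.rep_eq[abs_def] pd_coord ev_1)
qed

lemma cj_hom [simp]: "cj (f + g) = cj f + cj g" "cj (f * g) = cj f * cj g" "cj (- f) = - cj f"
  "cj 0 = 0" "cj (cst c) = cst (cnj c)" "cj (X i) = X i"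
  by (transfer; auto simp: fun_eq_iff)+

lemma cj_sum: "cj (\<Sum>i\<in>I. f i) = (\<Sum>i\<in>I. cj (f i))"
  by (induction I rule: infinite_finite_induct) auto

lemma D_cj: "D i (cj f) = cj (D i f)"
  by (rule sfun_eqI) (simp add: ev_D cj.rep_eq[abs_def] pd_linear[OF bounded_linear_cnj] diff_ev)

subsection \<open>Powers and logarithm of the radius\<close>

lemma smooth_on_norm2: "open U \<Longrightarrow> smooth_on U (\<lambda>x :: real ^ 4. (norm x)\<^sup>2)"
proof -
  have "(norm x)\<^sup>2 = (\<Sum>i\<in>UNIV. x $ i * x $ i)" for x :: "real ^ 4"
    by (simp add: norm_vec_def L2_set_def power2_eq_square sum_nonneg)
  then show "open U \<Longrightarrow> smooth_on U (\<lambda>x :: real ^ 4. (norm x)\<^sup>2)"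
    by (simp add: smooth_on_sum smooth_on_mult smooth_on_coord)
qed

lemma smooth_cyl_t: "smooth_on cyl cyl_t"
proof -
  \<comment> \<open>The iterated derivatives of \<open>ln\<close> are multiples of powers of 1/s.
    The inner function is |x|^2, a polynomial; the logarithm is halved at the end.\<close>
  let ?S = "insert ln (range (\<lambda>(c::real, n::nat) s. c * inverse s ^ n))"
  have "smooth_on cyl (\<lambda>x. ln ((norm x)\<^sup>2))"
  proof (rule smooth_on_compose[where S = ?S and \<phi> = ln and f = "\<lambda>x. (norm x)\<^sup>2"])
    fix \<phi> assume "\<phi> \<in> ?S"
    then consider (ln) "\<phi> = ln" | (pow) c n where "\<phi> = (\<lambda>s. c * inverse s ^ n)"
      by (auto simp: image_iff)
    then show "\<exists>\<psi>\<in>?S. \<forall>x\<in>cyl. (\<phi> has_vector_derivative \<psi> ((norm x)\<^sup>2)) (at ((norm x)\<^sup>2))"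
    proof cases
      case ln
      have "(ln has_real_derivative 1 * inverse s ^ 1) (at s)" if "s > 0" for s
        using DERIV_ln[OF that] by simp
      then show ?thesis
        unfolding ln has_real_derivative_iff_has_vector_derivative[symmetric]
        by (intro bexI[of _ "\<lambda>s. 1 * inverse s ^ 1"]) (auto simp: cyl_iff intro!: image_eqI[of _ _ "(1, 1)"])
    next
      case pow
      have "((\<lambda>s. c * inverse s ^ n) has_real_derivative (- (c * of_nat n)) * inverse s ^ (n + 1)) (at s)"
        if "s > 0" for s
        using that
        by (auto intro!: derivative_eq_intros simp: power_Suc[symmetric] simp del: power_Suc)
      then show ?thesis
        unfolding pow has_real_derivative_iff_has_vector_derivative[symmetric]
        by (intro bexI[of _ "\<lambda>s. (- (c * of_nat n)) * inverse s ^ (n + 1)"])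
          (auto simp: cyl_iff intro!: image_eqI[of _ _ "(- (c * of_nat n), n + 1)"])
    qed
  qed (auto simp: open_cyl smooth_on_norm2)
  then have "smooth_on cyl (\<lambda>x. (1/2) * ln ((norm x)\<^sup>2))"
    by (intro smooth_on_mult open_cyl smooth_on_const)
  then show ?thesis
    by (subst smooth_on_cong[OF open_cyl, of _ "\<lambda>x. (1/2) * ln ((norm x)\<^sup>2)"])
      (auto simp: cyl_t_def cyl_iff ln_realpow)
qed

lemma smooth_exp_cyl_t: "smooth_on cyl (\<lambda>x. exp (\<beta> * complex_of_real (cyl_t x)))"
proof (rule smooth_on_compose[where S = "range (\<lambda>c t. c * exp (\<beta> * complex_of_real t))"
      and \<phi> = "\<lambda>t. exp (\<beta> * complex_of_real t)" and f = cyl_t])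
  fix \<phi> :: "real \<Rightarrow> complex" assume "\<phi> \<in> range (\<lambda>c t. c * exp (\<beta> * complex_of_real t))"
  then obtain c where \<phi>: "\<phi> = (\<lambda>t. c * exp (\<beta> * complex_of_real t))" by auto
  have "((\<lambda>t. c * exp (\<beta> * complex_of_real t)) has_vector_derivative (c * \<beta>) * exp (\<beta> * complex_of_real t)) (at t)" for t
    by (auto intro!: derivative_eq_intros has_vector_derivative_real_field simp: algebra_simps)
  then show "\<exists>\<psi>\<in>range (\<lambda>c t. c * exp (\<beta> * complex_of_real t)).
      \<forall>x\<in>cyl. (\<phi> has_vector_derivative \<psi> (cyl_t x)) (at (cyl_t x))"
    unfolding \<phi> by (intro bexI[of _ "\<lambda>t. (c * \<beta>) * exp (\<beta> * complex_of_real t)"]) auto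
qed (auto simp: open_cyl smooth_cyl_t intro: image_eqI[of _ _ 1])

definition T :: sfun where "T = sf (\<lambda>x. of_real (cyl_t x))"

text \<open>The complex power |x|^\<beta>, which is e^{\<beta> t} in cylinder coordinates.\<close>

definition ex :: "complex \<Rightarrow> sfun" where "ex \<beta> = sf (\<lambda>x. exp (\<beta> * of_real (cyl_t x)))"

lemma ev_T: "x \<in> cyl \<Longrightarrow> ev T x = of_real (cyl_t x)"
  and ev_ex: "x \<in> cyl \<Longrightarrow> ev (ex \<beta>) x = exp (\<beta> * of_real (cyl_t x))"
  by (auto simp: T_def ex_def ev_sf smooth_on_of_real smooth_cyl_t smooth_exp_cyl_t open_cyl cyl_iff)

lemma ex_mult: "ex a * ex b = ex (a + b)"
  by (rule sfun_eqI) (simp add: ev_ex exp_add distrib_right)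

lemma ex_mult': "ex a * (ex b * f) = ex (a + b) * f"
  by (simp add: ex_mult mult.assoc[symmetric])

lemma ex_0 [simp]: "ex 0 = 1"
  by (rule sfun_eqI) (simp add: ev_ex ev_1)

lemma ex_cancel: "ex a * f = 0 \<longleftrightarrow> f = 0"
  using ex_mult'[of "- a" a f] by auto

lemma cj_ex: "cj (ex a) = ex (cnj a)"
  by (rule sfun_eqI) (simp add: ev_ex exp_cnj)

lemma ev_ex_nat: "x \<in> cyl \<Longrightarrow> ev (ex (of_nat n)) x = of_real (norm x ^ n)"
  by (simp add: ev_ex cyl_t_def cyl_iff exp_of_nat_mult exp_of_real flip: of_real_mult)

lemma ev_ex_1: "x \<in> cyl \<Longrightarrow> ev (ex 1) x = of_real (norm x)"
  using ev_ex_nat[of x 1] by simp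

lemma ev_ex_minus_1: "x \<in> cyl \<Longrightarrow> ev (ex (-1)) x = of_real (inverse (norm x))"
  by (simp add: ev_ex cyl_t_def cyl_iff exp_minus exp_of_real)

lemma sum_X_sq: "(\<Sum>i\<in>UNIV. X i * X i) = ex 2"
proof (rule sfun_eqI)
  fix x assume "x \<in> cyl"
  moreover have "(\<Sum>i\<in>UNIV. x $ i * x $ i) = (norm x)\<^sup>2"
    by (simp add: norm_vec_def L2_set_def power2_eq_square sum_nonneg)
  ultimately show "ev (\<Sum>i\<in>UNIV. X i * X i) x = ev (ex 2) x"
    using ev_ex_nat[of x 2] by (simp add: ev_sum flip: of_real_mult of_real_sum)
qed

lemma D_T: "D i T = ex (-2) * X i"
proof (rule sfun_eqI)
  fix x assume x: "x \<in> cyl"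
  have "pd i (ev T) x = pd i (\<lambda>x. complex_of_real (cyl_t x)) x"
    by (rule pd_cong[OF open_cyl ev_T x])
  also have "\<dots> = of_real (pd i cyl_t x)"
    by (rule pd_linear[OF bounded_linear_of_real smooth_on_imp_differentiable[OF smooth_cyl_t open_cyl x]])
  also have "\<dots> = of_real (x $ i / (norm x)\<^sup>2)"
    using x by (simp add: pd_cyl_t cyl_iff)
  finally have 1: "ev (D i T) x = of_real (x $ i / (norm x)\<^sup>2)" using x by (simp add: ev_D)
  have "ev (ex (-2) * ex 2) x = 1" unfolding ex_mult using x by (simp add: ev_1)
  then have "ev (ex (-2)) x * of_real ((norm x)\<^sup>2) = 1"
    using ev_ex_nat[OF x, of 2] by simp
  then show "ev (D i T) x = ev (ex (-2) * X i) x"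
    using x unfolding 1 by (auto simp: field_simps cyl_iff)
qed

lemma D_ex: "D i (ex \<beta>) = cst \<beta> * ex (\<beta> - 2) * X i"
proof (rule sfun_eqI)
  fix x assume x: "x \<in> cyl"
  have 1: "(ev T has_derivative frechet_derivative (ev T) (at x)) (at x)"
    using diff_ev[OF x] frechet_derivative_works by blast
  have "((\<lambda>x. exp (\<beta> * ev T x)) has_derivative (\<lambda>v. exp (\<beta> * ev T x) * (\<beta> * frechet_derivative (ev T) (at x) v))) (at x)"
    using has_derivative_compose[OF has_derivative_mult_right[OF 1] DERIV_exp[unfolded has_field_derivative_def]]
    by simp
  from pd_eqI[OF this, of i]
  have "pd i (\<lambda>x. exp (\<beta> * ev T x)) x = exp (\<beta> * ev T x) * (\<beta> * ev (D i T) x)"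
    using x by (simp add: pd_def[symmetric] ev_D)
  moreover have "pd i (ev (ex \<beta>)) x = pd i (\<lambda>x. exp (\<beta> * ev T x)) x"
    by (rule pd_cong[OF open_cyl _ x]) (simp add: ev_ex ev_T)
  ultimately have "ev (D i (ex \<beta>)) x = ev (ex \<beta> * (cst \<beta> * D i T)) x"
    using x by (simp add: ev_D ev_T ev_ex ev_cst)
  also have "ex \<beta> * (cst \<beta> * D i T) = cst \<beta> * (ex \<beta> * ex (-2)) * X i"
    by (simp add: D_T mult_ac)
  finally show "ev (D i (ex \<beta>)) x = ev (cst \<beta> * ex (\<beta> - 2) * X i) x"
    by (simp add: ex_mult)
qed

subsection \<open>The Euler field and the Laplacian\<close>

definition eul :: "sfun \<Rightarrow> sfun" where "eul f = (\<Sum>i\<in>UNIV. X i * D i f)"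

definition lap :: "sfun \<Rightarrow> sfun" where "lap f = (\<Sum>i\<in>UNIV. D i (D i f))"

text \<open>In the coordinates \<open>(t, y)\<close>, the Euler field is \<open>\<partial>\<^sub>t\<close> and \<open>|x|\<^sup>2 \<Delta> = \<partial>\<^sub>t\<^sup>2 + 2 \<partial>\<^sub>t + \<Delta>\<^sub>S\<close>.\<close>

definition lapS :: "sfun \<Rightarrow> sfun" where "lapS f = ex 2 * lap f - eul (eul f) - 2 * eul f"

lemma eul_add [simp]: "eul (f + g) = eul f + eul g"
  and eul_mult: "eul (f * g) = eul f * g + f * eul g"
  and eul_cst [simp]: "eul (cst c) = 0"
  and eul_0 [simp]: "eul 0 = 0" and eul_1 [simp]: "eul 1 = 0"
  and eul_minus [simp]: "eul (- f) = - eul f"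
  and eul_diff [simp]: "eul (f - g) = eul f - eul g"
  and eul_numeral [simp]: "eul (numeral n) = 0"
  by (simp_all add: eul_def D_mult distrib_left sum.distrib sum_distrib_left sum_distrib_right
      mult_ac sum_negf right_diff_distrib sum_subtractf)

lemma eul_sum [simp]: "eul (\<Sum>j\<in>J. f j) = (\<Sum>j\<in>J. eul (f j))"
  by (induction J rule: infinite_finite_induct) auto

lemma eul_X [simp]: "eul (X j) = X j"
  by (simp add: eul_def D_X if_distrib cong: if_cong)

lemma eul_T [simp]: "eul T = 1"
proof -
  have "eul T = ex (-2) * (\<Sum>i\<in>UNIV. X i * X i)"
    by (simp add: eul_def D_T sum_distrib_left mult_ac)
  then show ?thesis by (simp add: sum_X_sq ex_mult)
qed

lemma eul_ex: "eul (ex \<beta>) = cst \<beta> * ex \<beta>"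
proof -
  have "eul (ex \<beta>) = cst \<beta> * ex (\<beta> - 2) * (\<Sum>i\<in>UNIV. X i * X i)"
    by (simp add: eul_def D_ex sum_distrib_left mult_ac)
  then show ?thesis by (simp add: sum_X_sq ex_mult mult.assoc)
qed

lemma eul_power: "eul (f ^ n) = of_nat n * f ^ (n - 1) * eul f"
proof (induction n)
  case (Suc n)
  then show ?case
    by (cases n) (simp_all add: eul_mult algebra_simps)
qed simp

lemma D_eul: "D i (eul f) = D i f + eul (D i f)"
proof -
  have "D i (X j * D j f) = (if j = i then D j f else 0) + X j * D j (D i f)" for j
    by (simp add: D_mult D_X D_commute[of i j])
  then show ?thesis by (simp add: eul_def sum.distrib)
qed

lemma lap_eul: "lap (eul f) = 2 * lap f + eul (lap f)"
  by (simp add: lap_def D_eul sum.distrib) (simp add: sum_distrib_left)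

lemma lap_add [simp]: "lap (f + g) = lap f + lap g"
  and lap_minus [simp]: "lap (- f) = - lap f"
  and lap_diff [simp]: "lap (f - g) = lap f - lap g"
  and lap_0 [simp]: "lap 0 = 0"
  and lap_cst [simp]: "lap (cst c) = 0"
  and lap_mult_cst: "lap (cst c * f) = cst c * lap f"
  by (simp_all add: lap_def sum.distrib sum_subtractf sum_negf D_mult sum_distrib_left)

lemma lap_sum [simp]: "lap (\<Sum>j\<in>J. f j) = (\<Sum>j\<in>J. lap (f j))"
  by (induction J rule: infinite_finite_induct) auto

lemma lap_mult: "lap (f * g) = lap f * g + 2 * (\<Sum>i\<in>UNIV. D i f * D i g) + f * lap g"
  by (simp add: lap_def D_mult sum.distrib sum_distrib_left sum_distrib_right algebra_simps)

lemma D_lap: "D i (lap f) = lap (D i f)"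
  by (simp add: lap_def D_commute[of i])

lemma lap_X [simp]: "lap (X i) = 0"
  by (auto simp: lap_def D_X intro!: sum.neutral)

lemma sum_D_ex: "(\<Sum>i\<in>UNIV. D i (ex a) * D i f) = cst a * ex (a - 2) * eul f"
  by (simp add: D_ex eul_def sum_distrib_left mult_ac)

lemma lap_ex: "lap (ex a) = cst (a * (a + 2)) * ex (a - 2)"
proof -
  have "lap (ex a) = (\<Sum>i\<in>UNIV. cst a * (D i (ex (a - 2)) * X i + ex (a - 2) * D i (X i)))"
    by (simp add: lap_def D_ex D_mult mult_ac distrib_left add.commute)
  also have "\<dots> = cst a * (eul (ex (a - 2)) + 4 * ex (a - 2))"
    by (simp add: eul_def sum.distrib sum_distrib_left D_X mult_ac distrib_left)
  also have "\<dots> = cst (a * (a + 2)) * ex (a - 2)"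
    by (simp add: eul_ex cst_hom algebra_simps)
  finally show ?thesis .
qed

section \<open>Harmonic functions and the spectrum of the sphere\<close>

lemma eul_zero_imp_radially_constant:
  assumes "eul p = 0" "x \<in> cyl" "s > 0"
  shows "ev p (s *\<^sub>R x) = ev p x"
proof -
  have d: "((\<lambda>s. ev p (s *\<^sub>R x)) has_derivative (\<lambda>h. 0)) (at s within {0<..})" if "s \<in> {0<..}" for s :: real
  proof -
    have sx: "s *\<^sub>R x \<in> cyl" using that assms(2) by (simp add: cyl_iff)
    have 1: "((\<lambda>s. s *\<^sub>R x) has_derivative (\<lambda>h. h *\<^sub>R x)) (at s)"
      by (auto intro!: derivative_eq_intros)
    have 2: "(\<Sum>i\<in>UNIV. (h *\<^sub>R x) $ i *\<^sub>R pd i (ev p) (s *\<^sub>R x)) = 0" for h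
    proof -
      have "ev (eul p) (s *\<^sub>R x) = (\<Sum>i\<in>UNIV. of_real ((s *\<^sub>R x) $ i) * pd i (ev p) (s *\<^sub>R x))"
        using sx by (simp add: eul_def ev_sum ev_D)
      then have "of_real s * (\<Sum>i\<in>UNIV. of_real (x $ i) * pd i (ev p) (s *\<^sub>R x)) = 0"
        using assms(1) by (simp add: sum_distrib_left mult.assoc)
      then have "(\<Sum>i\<in>UNIV. x $ i *\<^sub>R pd i (ev p) (s *\<^sub>R x)) = 0"
        using that by (simp add: scaleR_conv_of_real)
      then have "h *\<^sub>R (\<Sum>i\<in>UNIV. x $ i *\<^sub>R pd i (ev p) (s *\<^sub>R x)) = 0" by simp
      then show ?thesis by (simp add: scaleR_sum_right)
    qed
    show ?thesis
      using has_derivative_compose[OF 1 has_derivative_pd[OF diff_ev[OF sx, of p]]]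
      by (simp only: 2 has_derivative_at_withinI)
  qed
  have "ev p (s *\<^sub>R x) = ev p (1 *\<^sub>R x)"
    by (rule has_derivative_zero_unique[OF _ d]) (use assms in auto)
  then show ?thesis by simp
qed

lemma second_derivative_at_max:
  fixes \<phi> :: "real \<Rightarrow> real"
  assumes "e > 0" "\<And>s. \<bar>s\<bar> < e \<Longrightarrow> (\<phi> has_real_derivative \<phi>' s) (at s)"
    and "(\<phi>' has_real_derivative d) (at 0)" "\<And>s. \<bar>s\<bar> < e \<Longrightarrow> \<phi> s \<le> \<phi> 0"
  shows "d \<le> 0"
proof (rule ccontr)
  assume "\<not> d \<le> 0"
  then obtain r where r: "r > 0" "\<And>h. 0 < h \<Longrightarrow> h < r \<Longrightarrow> \<phi>' 0 < \<phi>' h"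
    using DERIV_pos_inc_right[OF assms(3)] by auto
  have "\<phi>' 0 = 0"
    by (rule DERIV_local_max[OF assms(2)[of 0] assms(1)]) (use assms in auto)
  define h where "h = min r e / 2"
  have h: "0 < h" "h < r" "h < e" using r(1) assms(1) by (auto simp: h_def)
  obtain z where z: "0 < z" "z < h" "\<phi> h - \<phi> 0 = (h - 0) * \<phi>' z"
    using MVT2[OF h(1), of \<phi> \<phi>'] assms(2) h by (metis abs_of_nonneg order.strict_trans1)
  have "\<phi>' z > 0" using r(2)[of z] z h \<open>\<phi>' 0 = 0\<close> by auto
  then have "\<phi> h > \<phi> 0" using z h by (simp add: algebra_simps)
  then show False using assms(4)[of h] h by auto
qed

lemma D_D_at_max:
  assumes "x \<in> cyl" "\<And>y. y \<in> cyl \<Longrightarrow> Re (ev q y) \<le> Re (ev q x)"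
  shows "Re (ev (D i (D i q)) x) \<le> 0"
proof -
  obtain e where e: "e > 0" "ball x e \<subseteq> cyl"
    using assms(1) open_cyl open_contains_ball by blast
  have in_cyl: "x + s *\<^sub>R axis i 1 \<in> cyl" if "\<bar>s\<bar> < e" for s
    using that e(2) by (auto simp: subset_eq dist_norm)
  have d: "((\<lambda>s. Re (ev f (x + s *\<^sub>R axis i 1))) has_real_derivative Re (ev (D i f) (x + s *\<^sub>R axis i 1))) (at s)"
    if "\<bar>s\<bar> < e" for f s
    unfolding has_real_derivative_iff_has_vector_derivative
    using bounded_linear.has_vector_derivative[OF bounded_linear_Re has_vector_derivative_pd[OF diff_ev[OF in_cyl[OF that]]]]
    by (simp add: ev_D in_cyl[OF that])
  have "Re (ev (D i (D i q)) (x + 0 *\<^sub>R axis i 1)) \<le> 0"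
    by (rule second_derivative_at_max[OF e(1) d d]) (use e assms(2) in_cyl in auto)
  then show ?thesis by simp
qed

text \<open>Maximum principle. The function |p|^2 is constant along rays, so its maximum is attained
  at a point of the unit sphere, and its Laplacian is nonpositive there. But at such a point
  \<Delta>|p|^2 = 2 Re (\<Delta>p \<open>cnj\<close> p) + 2 |\<nabla>p|^2 \<ge> 2 Re(c)
  |p|^2.\<close>

lemma lapS_positive_eigenvalue:
  assumes "eul p = 0" "lapS p = cst c * p" "Re c > 0"
  shows "p = 0"
proof -
  let ?q = "p * cj p"
  have "continuous_on S3 (ev ?q)"
    by (rule continuous_on_subset[OF smooth_on_imp_continuous_on[OF smooth_ev]]) (auto simp: cyl_def)
  then have "continuous_on S3 (\<lambda>x. Re (ev ?q x))"
    by (rule continuous_on_Re)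
  moreover have "S3 \<noteq> {}" by simp
  ultimately obtain x where x: "x \<in> S3" "\<And>y. y \<in> S3 \<Longrightarrow> Re (ev ?q y) \<le> Re (ev ?q x)"
    using continuous_attains_sup[OF compact_sphere] by blast
  have xc: "x \<in> cyl" using x(1) by (auto simp: cyl_def)
  have max: "Re (ev ?q y) \<le> Re (ev ?q x)" if "y \<in> cyl" for y
  proof -
    have "ev p ((1 / norm y) *\<^sub>R y) = ev p y"
      by (rule eul_zero_imp_radially_constant[OF assms(1) that]) (use that in \<open>simp add: cyl_iff\<close>)
    then show ?thesis
      using x(2)[of "(1 / norm y) *\<^sub>R y"] that by (simp add: cyl_iff)
  qed
  have "Re (ev (lap ?q) x) \<le> 0"
    unfolding lap_def ev_sum Re_sum by (intro sum_nonpos D_D_at_max xc max)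
  moreover have "ev (lap ?q) x = ev (lap p) x * cnj (ev p x) + 2 * (\<Sum>i\<in>UNIV. ev (D i p) x * cnj (ev (D i p) x))
      + ev p x * cnj (ev (lap p) x)"
  proof -
    have "lap (cj p) = cj (lap p)" by (simp add: lap_def D_cj cj_sum)
    moreover have "ev 2 x = 2" using xc ev_cst[of x 2] by simp
    ultimately show ?thesis by (simp add: lap_mult ev_sum D_cj)
  qed
  moreover have "Re (\<Sum>i\<in>UNIV. ev (D i p) x * cnj (ev (D i p) x)) \<ge> 0"
    unfolding Re_sum by (intro sum_nonneg) (simp add: complex_mult_cnj)
  ultimately have "Re (ev (lap p) x * cnj (ev p x)) \<le> 0"
    by (simp add: mult.commute)
  moreover have "ev (lap p) x = c * ev p x"
  proof -
    have "ex 2 * lap p = cst c * p"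
      using assms(2) by (simp add: lapS_def assms(1))
    then have "ev (ex 2) x * ev (lap p) x = c * ev p x"
      using xc by (metis ev_cst ev_simps(2))
    then show ?thesis using ev_ex_nat[OF xc, of 2] x(1) by simp
  qed
  ultimately have "Re c * (norm (ev p x))\<^sup>2 \<le> 0"
    by (simp add: mult.assoc complex_norm_square[symmetric] del: of_real_power)
  then have "norm (ev p x) = 0"
    using assms(3) by (simp add: mult_le_0_iff)
  then have "Re (ev ?q x) = 0" by simp
  then have "ev p y = 0" if "y \<in> cyl" for y
    using max[OF that] by (simp add: complex_mult_cnj sum_power2_le_zero_iff complex_eq_iff)
  then show ?thesis by (intro sfun_eqI) simp
qed

lemma D_zero_imp_cst:
  assumes "\<And>i. D i f = 0"
  obtains c where "f = cst c"
proof -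
  have c: "connected cyl"
    unfolding cyl_def by (rule connected_punctured_universe) simp
  have "(ev f has_derivative (\<lambda>h. 0)) (at x)" if "x \<in> cyl" for x
  proof -
    have "pd i (ev f) x = 0" for i using ev_D[OF that, of i f] assms by simp
    then show ?thesis using has_derivative_pd[OF diff_ev[OF that], of f] by simp
  qed
  then have "\<forall>x\<in>cyl - {}. (ev f has_derivative (\<lambda>h. 0)) (at x within cyl)"
    using has_derivative_at_withinI by blast
  then have "ev f constant_on cyl"
    using has_derivative_zero_connected_constant_on[OF c open_cyl finite.emptyI]
      smooth_on_imp_continuous_on[OF smooth_ev] by blast
  then obtain c where "\<And>x. x \<in> cyl \<Longrightarrow> ev f x = c"
    by (auto simp: constant_on_def)
  then have "f = cst c" by (intro sfun_eqI) (simp add: ev_cst)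
  then show ?thesis by (rule that)
qed

subsection \<open>Functions of the form exponential times polynomial\<close>

definition shift_eul :: "complex \<Rightarrow> sfun \<Rightarrow> sfun" where
  "shift_eul d f = eul f - cst d * f"

text \<open>Exactly the products of \<open>e\<^sup>d\<^sup>t\<close> and a polynomial in \<open>t\<close> are annihilated by a power of \<open>\<partial>\<^sub>t - d\<close>.\<close>

definition nil :: "complex \<Rightarrow> nat \<Rightarrow> sfun \<Rightarrow> bool" where
  "nil d n f \<longleftrightarrow> (shift_eul d ^^ n) f = 0"

lemma shift_eul_simps [simp]:
  "shift_eul d (f + g) = shift_eul d f + shift_eul d g" "shift_eul d (f - g) = shift_eul d f - shift_eul d g"
  "shift_eul d (- f) = - shift_eul d f" "shift_eul d 0 = 0"
  by (simp_all add: shift_eul_def algebra_simps)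

lemma shift_eul_funpow_add: "(shift_eul d ^^ n) (f + g) = (shift_eul d ^^ n) f + (shift_eul d ^^ n) g"
  and shift_eul_funpow_diff: "(shift_eul d ^^ n) (f - g) = (shift_eul d ^^ n) f - (shift_eul d ^^ n) g"
  and shift_eul_funpow_0: "(shift_eul d ^^ n) 0 = 0"
  by (induction n) auto

lemma shift_eul_cst_mult: "shift_eul d (cst c * f) = cst c * shift_eul d f"
  by (simp add: shift_eul_def eul_mult algebra_simps)

lemma funpow_intertwine:
  assumes "\<And>f. P (L f) = L (Q f)"
  shows "(P ^^ n) (L f) = L ((Q ^^ n) f)"
  by (induction n) (auto simp: assms)

text \<open>An operator that shifts homogeneous degrees from d to d' turns \<partial>_t - d into
  \<partial>_t - d' and so preserves the order of nilpotency. Derivatives, coordinates and powers of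
  |x| are all of this kind.\<close>

lemma nil_intertwine:
  assumes "\<And>f. shift_eul d' (L f) = L (shift_eul d f)" "L 0 = 0" "nil d n f"
  shows "nil d' n (L f)"
  using assms(3) by (simp add: nil_def funpow_intertwine[of "shift_eul d'" L, OF assms(1)] assms(2))

lemma nil_cst_mult: "nil d n f \<Longrightarrow> nil d n (cst c * f)"
  by (rule nil_intertwine[where L = "\<lambda>f. cst c * f"]) (simp_all add: shift_eul_cst_mult)

lemma nil_D: "nil d n f \<Longrightarrow> nil (d - 1) n (D i f)"
  by (rule nil_intertwine) (simp_all add: shift_eul_def D_eul D_mult cst_hom algebra_simps)

lemma nil_X_mult: "nil d n f \<Longrightarrow> nil (d + 1) n (X i * f)"
  by (rule nil_intertwine[where L = "\<lambda>f. X i * f"]) (simp_all add: shift_eul_def eul_mult cst_hom algebra_simps)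

lemma nil_ex_mult: "nil d n f \<Longrightarrow> nil (d + a) n (ex a * f)"
  by (rule nil_intertwine[where L = "\<lambda>f. ex a * f"]) (simp_all add: shift_eul_def eul_mult eul_ex cst_hom algebra_simps)

lemma nil_eul: "nil d n f \<Longrightarrow> nil d n (eul f)"
  by (rule nil_intertwine[where L = eul]) (simp_all add: shift_eul_def eul_mult)

lemma lap_mult_cst': "lap (f * cst c) = cst c * lap f"
  using lap_mult_cst[of c f] by (simp add: mult.commute)

lemma shift_eul_lap: "shift_eul (d - 2) (lap f) = lap (shift_eul d f)"
  by (simp add: shift_eul_def lap_eul lap_mult_cst' cst_hom algebra_simps)

lemma nil_add: "nil d n f \<Longrightarrow> nil d n g \<Longrightarrow> nil d n (f + g)"
  and nil_diff: "nil d n f \<Longrightarrow> nil d n g \<Longrightarrow> nil d n (f - g)"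
  by (simp_all add: nil_def shift_eul_funpow_add shift_eul_funpow_diff)

lemma nil_0 [simp]: "nil d n 0"
  by (simp add: nil_def shift_eul_funpow_0)

lemma nil_minus: "nil d n f \<Longrightarrow> nil d n (- f)"
  using nil_diff[of d n 0 f] by simp

lemma nil_sum: "(\<And>i. i \<in> I \<Longrightarrow> nil d n (f i)) \<Longrightarrow> nil d n (\<Sum>i\<in>I. f i)"
  by (induction I rule: infinite_finite_induct) (auto intro: nil_add)

lemma nil_mono: "nil d m f \<Longrightarrow> m \<le> n \<Longrightarrow> nil d n f"
  unfolding nil_def using shift_eul_funpow_0[where d = d and n = "n - m"]
  by (metis funpow_add comp_apply le_add_diff_inverse2)

lemma nil_Suc: "nil d (Suc n) f \<longleftrightarrow> nil d n (shift_eul d f)"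
  by (simp add: nil_def funpow_Suc_right del: funpow.simps)

text \<open>The induction behind all arguments about the functions above: the highest power of \<open>t\<close> is
  split off first.\<close>

lemma nil_induct_homogeneous:
  assumes "nil d n f" "P f"
    and "\<And>f. P f \<Longrightarrow> P (shift_eul d f)"
    and "\<And>f. P f \<Longrightarrow> eul f = cst d * f \<Longrightarrow> f = 0"
  shows "f = 0"
  using assms(1,2)
proof (induction n arbitrary: f)
  case (Suc n)
  then have "shift_eul d f = 0"
    using assms(3) by (simp add: nil_Suc)
  then show ?case
    using assms(4)[OF Suc.prems(2)] by (simp add: shift_eul_def)
qed (simp add: nil_def)

section \<open>Homogeneous harmonic functions and eigenvalues of the sphere\<close>

lemma lap_ex_mult:
  assumes "eul p = 0"
  shows "lap (ex d * p) = ex (d - 2) * (lapS p + cst (d * (d + 2)) * p)"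
proof -
  have "lap (ex d * p) = cst (d * (d + 2)) * ex (d - 2) * p + ex d * lap p"
    by (simp add: lap_mult sum_D_ex assms lap_ex)
  also have "ex d * lap p = ex (d - 2) * lapS p"
    by (simp add: lapS_def assms ex_mult')
  finally show ?thesis by (simp add: algebra_simps)
qed

lemma homogeneous_eq_ex_mult:
  assumes "eul f = cst d * f"
  shows "f = ex d * (ex (- d) * f)" "eul (ex (- d) * f) = 0"
  using assms by (simp add: ex_mult') (simp add: assms eul_mult eul_ex cst_hom algebra_simps)

text \<open>For f = |x|^d p, harmonicity reads \<Delta>_S p = -d(d+2) p, and the real part of
  -d(d+2) is positive for Re d between -2 and 0. This replaces a theorem on removable singularities
  together with Liouville's theorem.\<close>

lemma harmonic_homogeneous_zero:
  assumes "lap f = 0" "eul f = cst d * f" "-2 < Re d" "Re d < 0"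
  shows "f = 0"
proof -
  let ?p = "ex (- d) * f"
  note p = homogeneous_eq_ex_mult[OF assms(2)]
  have "ex (d - 2) * (lapS ?p + cst (d * (d + 2)) * ?p) = 0"
    using lap_ex_mult[OF p(2), of d] p(1) assms(1) by simp
  then have "lapS ?p = cst (- (d * (d + 2))) * ?p"
    by (simp add: ex_cancel cst_hom(3) eq_neg_iff_add_eq_0)
  moreover have "Re (- (d * (d + 2))) > 0"
  proof -
    have "Re d * (Re d + 2) < 0" using assms(3,4) by (simp add: mult_less_0_iff)
    from less_le_trans[OF this zero_le_square[of "Im d"]] show ?thesis by simp
  qed
  ultimately have "?p = 0" using lapS_positive_eigenvalue[OF p(2)] by blast
  then show ?thesis using p(1) by simp
qed

lemma harmonic_nil_zero:
  assumes "lap f = 0" "nil d n f" "-2 < Re d" "Re d < 0"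
  shows "f = 0"
  by (rule nil_induct_homogeneous[OF assms(2), where P = "\<lambda>f. lap f = 0"])
    (use assms harmonic_homogeneous_zero in \<open>auto simp flip: shift_eul_lap\<close>)

text \<open>Partial derivatives are harmonic of degree d - 1, so repeated differentiation leads
  below degree 0, where the function vanishes. Conversely, if all D_i f are 0, then Euler's relation
  gives d f = 0, and d is nonzero since it is not a natural number.\<close>

lemma harmonic_homogeneous_nonnatural_zero:
  assumes "lap f = 0" "eul f = cst d * f" "-2 < Re d" "d \<notin> \<nat>"
  shows "f = 0"
proof -
  have "f = 0" if "Re d < of_nat n" for n
    using that assms
  proof (induction n arbitrary: d f)
    case 0
    then show ?case using harmonic_homogeneous_zero by simp
  next
    case (Suc n)
    show ?case
    proof (cases "Re d < 0")
      case True
      then show ?thesis using Suc.prems harmonic_homogeneous_zero by blast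
    next
      case False
      have "D i f = 0" for i
      proof (rule Suc.IH[of "d - 1"])
        show "lap (D i f) = 0" using Suc.prems D_lap[of i f] by simp
        show "eul (D i f) = cst (d - 1) * D i f"
          using D_eul[of i f] Suc.prems(3) by (simp add: D_mult cst_hom algebra_simps)
        show "d - 1 \<notin> \<nat>"
          using Suc.prems(5) Nats_add[of "d - 1" 1] by auto
      qed (use False Suc.prems in auto)
      then have "cst d * f = 0" using Suc.prems(3) by (simp add: eul_def)
      moreover have "d \<noteq> 0" using Suc.prems(5) by auto
      ultimately show ?thesis by (simp add: cst_mult_cancel)
    qed
  qed
  then show ?thesis using reals_Archimedean2[of "Re d"] by blast
qed

text \<open>With d(d+2) = \<mu>, the function |x|^d p is harmonic and homogeneous. The principal
  square root selects the solution d with Re d \<ge> -1, for which the degree is above -2; d is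
  natural only for the excluded values of \<mu>.\<close>

lemma lapS_eigenvalue:
  assumes "eul p = 0" "lapS p + cst \<mu> * p = 0" "\<And>k::nat. \<mu> \<noteq> of_nat k * (of_nat k + 2)"
  shows "p = 0"
proof -
  define d where "d = csqrt (1 + \<mu>) - 1"
  have \<mu>: "\<mu> = d * (d + 2)"
  proof -
    have "(d + 1)\<^sup>2 = 1 + \<mu>" by (simp add: d_def)
    then show ?thesis by (simp add: power2_eq_square algebra_simps)
  qed
  have "ex d * p = 0"
  proof (rule harmonic_homogeneous_nonnatural_zero)
    show "lap (ex d * p) = 0"
      unfolding lap_ex_mult[OF assms(1)] \<mu>[symmetric] assms(2) by simp
    show "eul (ex d * p) = cst d * (ex d * p)"
      by (simp add: eul_mult eul_ex assms(1))
    have "Re (csqrt (1 + \<mu>)) \<ge> 0"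
      using csqrt_principal[of "1 + \<mu>"] by (auto simp del: csqrt.simps)
    then show "-2 < Re d" by (simp add: d_def del: csqrt.simps)
    show "d \<notin> \<nat>" using assms(3) \<mu> by (auto simp: Nats_def)
  qed
  then show ?thesis by (simp add: ex_cancel)
qed

section \<open>Spherical harmonics of degree at most one\<close>

definition y :: "4 \<Rightarrow> sfun" where "y i = ex (-1) * X i"

lemma eul_y [simp]: "eul (y i) = 0"
  by (simp add: y_def eul_mult eul_ex cst_hom)

lemma ex_1_y: "ex 1 * y i = X i"
  by (simp add: y_def ex_mult')

lemma D_y: "D i (y j) = ex (-1) * ((if i = j then 1 else 0) - y i * y j)"
proof -
  have "ex (-3) = ex (-1) * ex (-1) * ex (-1)" by (simp add: ex_mult)
  then show ?thesis
    by (simp add: y_def D_mult D_ex D_X cst_hom algebra_simps)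
qed

lemma sum_y_sq: "(\<Sum>i\<in>UNIV. y i * y i) = 1"
proof -
  have "(\<Sum>i\<in>UNIV. y i * y i) = ex (-2) * (\<Sum>i\<in>UNIV. X i * X i)"
    using ex_mult[of "-1" "-1"] by (simp add: y_def sum_distrib_left algebra_simps)
  then show ?thesis by (simp add: sum_X_sq ex_mult)
qed

lemma lapS_add [simp]: "lapS (f + g) = lapS f + lapS g"
  and lapS_diff [simp]: "lapS (f - g) = lapS f - lapS g"
  and lapS_minus [simp]: "lapS (- f) = - lapS f"
  and lapS_0 [simp]: "lapS 0 = 0"
  and lapS_cst [simp]: "lapS (cst c) = 0"
  and lapS_cst_mult: "lapS (cst c * f) = cst c * lapS f"
  by (simp_all add: lapS_def lap_mult_cst' eul_mult algebra_simps)

lemma lapS_sum: "lapS (\<Sum>j\<in>J. f j) = (\<Sum>j\<in>J. lapS (f j))"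
  by (induction J rule: infinite_finite_induct) auto

lemma lapS_y: "lapS (y i) = - 3 * y i"
proof -
  have "lap (ex 1 * y i) = ex (1 - 2) * (lapS (y i) + cst (1 * (1 + 2)) * y i)"
    by (rule lap_ex_mult) simp
  then have "lapS (y i) + 3 * y i = 0" by (simp add: ex_1_y ex_cancel)
  then show ?thesis by (simp add: eq_neg_iff_add_eq_0)
qed

lemma shift_eul_lapS: "shift_eul d (lapS f) = lapS (shift_eul d f)"
proof -
  have "eul (lapS f) = lapS (eul f)"
    by (simp add: lapS_def eul_mult eul_ex lap_eul algebra_simps)
  then show ?thesis by (simp add: shift_eul_def lapS_cst_mult)
qed

lemma lap_T: "lap T = 2 * ex (-2)"
proof -
  have "lap T = (\<Sum>i\<in>UNIV. ex (-2) - 2 * ex (-4) * (X i * X i))"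
    by (simp add: lap_def D_T D_mult D_X D_ex algebra_simps)
  also have "\<dots> = 4 * ex (-2) - 2 * ex (-4) * (\<Sum>i\<in>UNIV. X i * X i)"
    by (simp add: sum_subtractf sum_distrib_left)
  finally show ?thesis by (simp add: sum_X_sq mult.assoc ex_mult)
qed

definition ylin :: "(4 \<Rightarrow> complex) \<Rightarrow> sfun" where "ylin d = (\<Sum>i\<in>UNIV. cst (d i) * y i)"

lemma eul_ylin [simp]: "eul (ylin d) = 0"
  by (simp add: ylin_def eul_mult)

lemma lapS_ylin: "lapS (ylin d) = - 3 * ylin d"
  by (simp add: ylin_def lapS_sum lapS_cst_mult lapS_y sum_distrib_left sum_negf mult.left_commute)

lemma cst_mult_ylin: "cst c * ylin d = ylin (\<lambda>i. c * d i)"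
  by (simp add: ylin_def sum_distrib_left cst_hom mult.assoc)

lemma ylin_minus: "- ylin d = ylin (\<lambda>i. - d i)"
  by (simp add: ylin_def cst_hom sum_negf)

lemma ex_1_ylin: "ex 1 * ylin d = (\<Sum>i\<in>UNIV. cst (d i) * X i)"
  by (simp add: ylin_def sum_distrib_left mult.left_commute[of "ex 1"] ex_1_y)

lemma D_ex_1_ylin: "D i (ex 1 * ylin d) = cst (d i)"
  by (simp add: ex_1_ylin D_mult D_X if_distrib cong: if_cong)

definition sph_affine :: "sfun \<Rightarrow> bool" where
  "sph_affine p \<longleftrightarrow> (\<exists>c d. p = cst c + ylin d)"

lemma sph_affineI: "p = cst c + ylin d \<Longrightarrow> sph_affine p"
  by (auto simp: sph_affine_def)

text \<open>Since \<Delta> \<open>T\<close> = 2 |x|^-2, the function q - (c/2) \<open>T\<close> is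
  harmonic, of degree 0 up to a logarithm. Its derivatives have degree -1 and vanish, so it is
  constant; the Euler field then gives c = 0.\<close>

lemma lapS_const_imp_const:
  assumes "eul q = 0" "lapS q = cst c"
  obtains e where "q = cst e"
proof -
  let ?g = "q - cst (c / 2) * T"
  have "cst (c / 2) * 2 = cst c"
    using cst_hom(2)[of "c / 2" 2] by simp
  moreover have "lap q = ex (-2) * lapS q"
    using lap_ex_mult[OF assms(1), of 0] by simp
  ultimately have "lap ?g = 0"
    by (simp add: assms lap_T lap_mult_cst mult.assoc[symmetric])
  moreover have "nil 0 2 ?g"
    by (simp add: nil_def numeral_2_eq_2 shift_eul_def assms eul_mult)
  ultimately have "D i ?g = 0" for i
    using harmonic_nil_zero[of "D i ?g" "-1" 2] nil_D[of 0 2 ?g i] D_lap[of i ?g] by simp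
  then obtain e where e: "?g = cst e" using D_zero_imp_cst by blast
  then have "eul ?g = 0" by simp
  then have "c = 0" by (simp add: assms eul_mult)
  then show thesis using e that by simp
qed

lemma lapS_plus_3_linear_imp_linear:
  assumes "eul q = 0" "lapS q + 3 * q = ylin d"
  obtains e where "q = ylin e"
proof -
  let ?d = "ex 1 * ylin d"
  \<comment> \<open>For a linear function l, \<Delta>(l \<open>T\<close>) = 4 |x|^-2 l, so a quarter
    of this term makes ?g harmonic. The second derivatives of ?g have degree -1 and vanish, so ?g is
    affine, and comparison of the logarithmic terms shows that the linear function ?d is 0.\<close>
  let ?g = "ex 1 * q - cst (1/4) * (?d * T)"
  have eul_d: "eul ?d = ?d" by (simp add: eul_mult eul_ex)
  have lapd: "lap ?d = 0" by (simp add: ex_1_ylin lap_mult_cst)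
  have "lap (?d * T) = 4 * (ex (-2) * ?d)"
  proof -
    have "(\<Sum>i\<in>UNIV. D i ?d * D i T) = ex (-2) * ?d"
      unfolding D_ex_1_ylin by (simp add: D_T ex_1_ylin sum_distrib_left mult_ac)
    then show ?thesis
      by (simp add: lap_mult[of ?d] lapd lap_T)
  qed
  moreover have "lap (ex 1 * q) = ex (-2) * ?d"
    using lap_ex_mult[OF assms(1), of 1] assms(2) by (simp add: ex_mult')
  moreover have "cst (1/4) * (4 * f) = f" for f
    using cst_inverse[of 4 f] by (simp add: inverse_eq_divide)
  ultimately have "lap ?g = 0"
    by (simp add: lap_mult_cst)
  moreover have "nil 1 2 ?g"
    by (simp add: nil_def numeral_2_eq_2 shift_eul_def assms eul_mult eul_ex algebra_simps)
  ultimately have "D i (D j ?g) = 0" for i j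
    using harmonic_nil_zero[of "D i (D j ?g)" "-1" 2] nil_D[OF nil_D[of 1 2 ?g j], of i]
    by (simp flip: D_lap del: D_diff)
  then have "\<forall>j. \<exists>e. D j ?g = cst e" using D_zero_imp_cst by metis
  then obtain e where e: "\<And>j. D j ?g = cst (e j)" by metis
  have "D i (?g - ex 1 * ylin e) = 0" for i
    using e[of i] D_ex_1_ylin[of i e] by (simp only: D_diff) simp
  then obtain e0 where e0: "?g - ex 1 * ylin e = cst e0"
    using D_zero_imp_cst by blast
  then have "shift_eul 1 (?g - ex 1 * ylin e) = shift_eul 1 (cst e0)" by simp
  then have *: "cst (1/4) * ?d = cst e0"
    by (simp add: shift_eul_def assms eul_mult eul_ex algebra_simps)
  then have "D i (cst (1/4) * ?d) = D i (cst e0)" for i by simp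
  then have d0: "d i = 0" for i
    by (simp add: D_mult[of _ "cst (1/4)"] D_ex_1_ylin flip: cst_hom(2))
  then have "?d = 0" by (simp add: ylin_def)
  then have "ex 1 * q = ex 1 * ylin e" using * e0 by simp
  then have "ex 1 * (q - ylin e) = 0" by (simp add: right_diff_distrib)
  then have "q = ylin e" by (simp add: ex_cancel)
  then show thesis by (rule that)
qed

text \<open>On harmonics of degree 0 and 1, \<Delta>_S + \<mu> acts as \<mu> and \<mu> - 3. In the
  resonant cases \<mu> = 0 and \<mu> = 3 the two preceding lemmas apply; otherwise a particular
  solution is subtracted, and the difference is an eigenfunction for a number outside the
  spectrum.\<close>

lemma lapS_shifted_sph_affine:
  assumes p: "eul p = 0" "sph_affine (lapS p + cst \<mu> * p)"
    and \<mu>: "\<And>k::nat. k \<ge> 2 \<Longrightarrow> \<mu> \<noteq> of_nat k * (of_nat k + 2)"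
  shows "sph_affine p"
proof -
  obtain c d where cd: "lapS p + cst \<mu> * p = cst c + ylin d"
    using p(2) by (auto simp: sph_affine_def)
  consider "\<mu> = 0" | "\<mu> = 3" | "\<mu> \<noteq> 0" "\<mu> \<noteq> 3" by blast
  then show ?thesis
  proof cases
    case 1
    define q where "q = p + ylin (\<lambda>i. 1/3 * d i)"
    have "3 * ylin (\<lambda>i. 1/3 * d i) = ylin d"
      using cst_mult_ylin[of 3 "\<lambda>i. 1/3 * d i"] by simp
    then have "eul q = 0" "lapS q = cst c"
      using cd 1 by (simp_all add: q_def p lapS_ylin)
    then obtain e where "q = cst e" using lapS_const_imp_const by blast
    then have "p = cst e + ylin (\<lambda>i. - (1/3 * d i))"
      unfolding ylin_minus[symmetric] q_def by (simp add: algebra_simps)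
    then show ?thesis by (rule sph_affineI)
  next
    case 2
    define q where "q = p - cst (c / 3)"
    have "3 * cst (c / 3) = cst c" using cst_hom(2)[of 3 "c/3"] by simp
    then have "eul q = 0" "lapS q + 3 * q = ylin d"
      using cd 2 by (simp_all add: q_def p algebra_simps)
    then obtain e where "q = ylin e" using lapS_plus_3_linear_imp_linear by blast
    then have "p = cst (c / 3) + ylin e" by (simp add: q_def algebra_simps)
    then show ?thesis by (rule sph_affineI)
  next
    case 3
    define q where "q = p - (cst (c / \<mu>) + ylin (\<lambda>i. 1 / (\<mu> - 3) * d i))"
    have "q = 0"
    proof (rule lapS_eigenvalue)
      show "eul q = 0" by (simp add: q_def p)
      have "cst \<mu> * cst (c / \<mu>) = cst c"
        using 3 by (simp flip: cst_hom(2))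
      moreover have "cst (\<mu> - 3) * ylin (\<lambda>i. 1 / (\<mu> - 3) * d i) = ylin d"
        using 3 by (simp add: cst_mult_ylin)
      ultimately show "lapS q + cst \<mu> * q = 0"
        using cd by (simp add: q_def lapS_ylin cst_hom algebra_simps)
      show "\<mu> \<noteq> of_nat k * (of_nat k + 2)" for k :: nat
      proof (cases "k \<ge> 2")
        case False
        then have "k = 0 \<or> k = 1" by auto
        then show ?thesis using 3 by auto
      qed (rule \<mu>)
    qed
    then show ?thesis unfolding q_def using sph_affineI by simp
  qed
qed

section \<open>The equation for the one-form\<close>

subsection \<open>Radial coefficients\<close>

text \<open>A function of |x| alone: its gradient is a multiple of x, and contraction with x
  determines the factor.\<close>

definition radial :: "sfun \<Rightarrow> bool" where
  "radial A \<longleftrightarrow> (\<forall>i. D i A = ex (-2) * X i * eul A)"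

lemma D_radial: "radial A \<Longrightarrow> D i A = ex (-2) * X i * eul A"
  by (simp add: radial_def)

lemma ex_1_D_radial: "radial A \<Longrightarrow> ex 1 * D i A = y i * eul A"
  by (simp add: D_radial y_def mult.assoc ex_mult')

lemma radial_cst [simp]: "radial (cst c)" and radial_0 [simp]: "radial 0" and radial_1 [simp]: "radial 1"
  and radial_numeral [simp]: "radial (numeral n)"
  by (simp_all add: radial_def)

lemma radial_add [simp]: "radial A \<Longrightarrow> radial B \<Longrightarrow> radial (A + B)"
  and radial_diff [simp]: "radial A \<Longrightarrow> radial B \<Longrightarrow> radial (A - B)"
  and radial_minus [simp]: "radial A \<Longrightarrow> radial (- A)"
  and radial_mult [simp]: "radial A \<Longrightarrow> radial B \<Longrightarrow> radial (A * B)"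
  by (simp_all add: radial_def D_mult eul_mult algebra_simps)

lemma radial_sum [simp]: "(\<And>i. i \<in> I \<Longrightarrow> radial (A i)) \<Longrightarrow> radial (\<Sum>i\<in>I. A i)"
  by (induction I rule: infinite_finite_induct) auto

lemma radial_power [simp]: "radial A \<Longrightarrow> radial (A ^ n)"
  by (induction n) auto

lemma radial_ex [simp]: "radial (ex d)"
  by (simp add: radial_def D_ex eul_ex ex_mult' mult_ac ex_mult)

lemma radial_T [simp]: "radial T"
  by (simp add: radial_def D_T)

lemma radial_eul [simp]: "radial A \<Longrightarrow> radial (eul A)"
proof -
  assume A: "radial A"
  have "eul (D i A) = ex (-2) * X i * eul (eul A) - ex (-2) * X i * eul A" for i
    unfolding D_radial[OF A] by (simp add: eul_mult eul_ex cst_hom algebra_simps)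
  then show ?thesis
    by (simp add: radial_def D_eul D_radial[OF A])
qed

lemma radial_shift_eul [simp]: "radial A \<Longrightarrow> radial (shift_eul d A)"
  by (simp add: shift_eul_def)

lemma radial_shift_eul_funpow [simp]: "radial A \<Longrightarrow> radial ((shift_eul d ^^ n) A)"
  by (induction n) auto

lemma eul_cj: "eul (cj A) = cj (eul A)"
  by (simp add: eul_def D_cj cj_sum)

lemma radial_cj: "radial A \<Longrightarrow> radial (cj A)"
  by (simp add: radial_def[of "cj A"] D_cj D_radial eul_cj cj_ex)

lemma lapS_radial_mult:
  assumes "radial A"
  shows "lapS (A * f) = A * lapS f"
proof -
  have l: "ex 2 * lap A = eul (eul A) + 2 * eul A"
  proof -
    have "lap A = (\<Sum>i\<in>UNIV. ex (-2) * (eul A - 2 * ex (-2) * X i * X i * eul A + X i * D i (eul A)))"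
      unfolding lap_def D_radial[OF assms]
      by (intro sum.cong refl) (simp add: D_mult D_ex D_X cst_hom algebra_simps ex_mult)
    also have "\<dots> = ex (-2) * (4 * eul A - 2 * ex (-2) * (\<Sum>i\<in>UNIV. X i * X i) * eul A + eul (eul A))"
      by (simp add: sum_distrib_left sum.distrib sum_subtractf eul_def[of "eul A"]
          sum_distrib_right algebra_simps)
    also have "\<dots> = ex (-2) * (eul (eul A) + 2 * eul A)"
      by (simp add: sum_X_sq mult.assoc ex_mult ex_mult' add.commute)
    finally show ?thesis by (simp add: ex_mult')
  qed
  have c: "ex 2 * (\<Sum>i\<in>UNIV. D i A * D i f) = eul A * eul f"
    by (simp add: D_radial[OF assms] eul_def[of f] sum_distrib_left mult_ac ex_mult)
  have "ex 2 * lap (A * f) = (ex 2 * lap A) * f + 2 * (ex 2 * (\<Sum>i\<in>UNIV. D i A * D i f)) + A * (ex 2 * lap f)"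
    by (simp add: lap_mult algebra_simps)
  also have "\<dots> = (eul (eul A) + 2 * eul A) * f + 2 * (eul A * eul f) + A * (ex 2 * lap f)"
    by (simp only: l c)
  finally show ?thesis
    by (simp add: lapS_def eul_mult algebra_simps)
qed

lemma lapS_radial: "radial A \<Longrightarrow> lapS A = 0"
  using lapS_radial_mult[of A 1] lapS_cst[of 1] by simp

definition rlin :: "(4 \<Rightarrow> sfun) \<Rightarrow> sfun" where "rlin A = (\<Sum>i\<in>UNIV. A i * y i)"

lemma eul_rlin: "eul (rlin A) = rlin (\<lambda>i. eul (A i))"
  by (simp add: rlin_def eul_mult)

lemma rlin_add: "rlin A + rlin B = rlin (\<lambda>i. A i + B i)"
  and rlin_diff: "rlin A - rlin B = rlin (\<lambda>i. A i - B i)"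
  and rlin_minus: "- rlin A = rlin (\<lambda>i. - A i)"
  and rlin_mult: "f * rlin A = rlin (\<lambda>i. f * A i)"
  by (simp_all add: rlin_def distrib_right left_diff_distrib sum.distrib sum_subtractf sum_negf
      sum_distrib_left mult.assoc)

lemma lapS_rlin: "(\<And>i. radial (A i)) \<Longrightarrow> lapS (rlin A) = rlin (\<lambda>i. - 3 * A i)"
  by (simp add: rlin_def lapS_sum lapS_radial_mult lapS_y mult_ac)

lemma shift_eul_rlin: "shift_eul d (rlin A) = rlin (\<lambda>i. shift_eul d (A i))"
  by (simp add: shift_eul_def eul_rlin rlin_mult rlin_diff)

lemma shift_eul_funpow_rlin: "(shift_eul d ^^ n) (rlin A) = rlin (\<lambda>i. (shift_eul d ^^ n) (A i))"
  by (induction n) (simp_all add: shift_eul_rlin)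

lemma ex_1_D_y: "ex 1 * D j (y i) = (if j = i then 1 else 0) - y j * y i"
  by (simp add: D_y ex_mult')

lemma ex_1_D_rlin:
  assumes "\<And>i. radial (A i)"
  shows "ex 1 * D j (rlin A) = y j * eul (rlin A) + A j - y j * rlin A"
proof -
  have "ex 1 * D j (A i * y i) = y j * (eul (A i) * y i) + (if j = i then A i else 0) - y j * (A i * y i)" for i
  proof -
    have "ex 1 * D j (A i * y i) = (ex 1 * D j (A i)) * y i + A i * (ex 1 * D j (y i))"
      by (simp add: D_mult algebra_simps)
    then show ?thesis unfolding ex_1_D_y ex_1_D_radial[OF assms] by (simp add: algebra_simps)
  qed
  then show ?thesis
    unfolding eul_rlin rlin_def
    by (simp add: sum_distrib_left sum.distrib sum_subtractf eul_mult)
qed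

text \<open>Linear independence of 1 and the y_i over the radial functions. Differentiating the
  relation gives A_j = - y_j A0. As A_j is radial, differentiating this once more gives (\<delta>_kj
  - y_k y_j) A0 = 0, whose trace is 3 A0 = 0.\<close>

lemma radial_affine_eq_0:
  assumes "radial A0" "\<And>i. radial (A i)" "A0 + rlin A = 0"
  shows "A0 = 0" "A i = 0"
proof -
  have rl: "rlin A = - A0" using assms(3) by (simp add: eq_neg_iff_add_eq_0 add.commute)
  have Aj: "A j = - (y j * A0)" for j
  proof -
    have "ex 1 * D j A0 + ex 1 * D j (rlin A) = 0" unfolding rl by simp
    then show ?thesis
      unfolding ex_1_D_rlin[OF assms(2)] ex_1_D_radial[OF assms(1)]
      by (simp add: rl eul_rlin[symmetric]) (simp add: eq_neg_iff_add_eq_0 algebra_simps)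
  qed
  have "((if k = j then 1 else 0) - y k * y j) * A0 = 0" for j k
  proof -
    have "ex 1 * D k (y j * A0) = y k * (y j * eul A0)"
      using ex_1_D_radial[OF assms(2)[of j], of k] unfolding Aj by (simp add: eul_mult)
    moreover have "ex 1 * D k (y j * A0) = (ex 1 * D k (y j)) * A0 + y j * (ex 1 * D k A0)"
      by (simp add: D_mult algebra_simps)
    ultimately show ?thesis
      unfolding ex_1_D_radial[OF assms(1)] ex_1_D_y by (simp add: algebra_simps)
  qed
  from this[of j j for j] have "(\<Sum>j\<in>UNIV. (1 - y j * y j) * A0) = 0"
    by (intro sum.neutral) simp
  then have "3 * A0 = 0"
    by (simp add: sum_distrib_right[symmetric] sum_subtractf sum_y_sq)
  then show "A0 = 0" by (simp add: numeral_mult_cancel)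
  then show "A i = 0" by (simp add: Aj)
qed

definition raffine :: "sfun \<Rightarrow> bool" where
  "raffine f \<longleftrightarrow> (\<exists>A0 A. radial A0 \<and> (\<forall>i. radial (A i)) \<and> f = A0 + rlin A)"

lemma affineI: "radial A0 \<Longrightarrow> (\<And>i. radial (A i)) \<Longrightarrow> f = A0 + rlin A \<Longrightarrow> raffine f"
  by (auto simp: raffine_def)

lemma raffine_radial: "radial A \<Longrightarrow> raffine A"
  by (rule affineI[of A "\<lambda>_. 0"]) (auto simp: rlin_def)

lemma raffine_add: "raffine f \<Longrightarrow> raffine g \<Longrightarrow> raffine (f + g)"
proof -
  assume "raffine f" "raffine g"
  then obtain A0 A B0 B where "radial A0" "\<And>i. radial (A i)" "f = A0 + rlin A"
    "radial B0" "\<And>i. radial (B i)" "g = B0 + rlin B" by (auto simp: raffine_def)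
  then show ?thesis
    by (intro affineI[of "A0 + B0" "\<lambda>i. A i + B i"]) (auto simp: rlin_add[symmetric])
qed

lemma raffine_mult: "radial c \<Longrightarrow> raffine f \<Longrightarrow> raffine (c * f)"
proof -
  assume c: "radial c" and "raffine f"
  then obtain A0 A where "radial A0" "\<And>i. radial (A i)" "f = A0 + rlin A" by (auto simp: raffine_def)
  then show ?thesis using c
    by (intro affineI[of "c * A0" "\<lambda>i. c * A i"]) (auto simp: rlin_mult distrib_left)
qed

lemma raffine_diff: "raffine f \<Longrightarrow> raffine g \<Longrightarrow> raffine (f - g)"
  using raffine_add[of f "cst (-1) * g"] raffine_mult[of "cst (-1)" g] by (simp add: cst_hom)

lemma raffine_eul: "raffine f \<Longrightarrow> raffine (eul f)"
  unfolding raffine_def using radial_eul by (metis eul_add eul_rlin)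

lemma raffine_lapS: "raffine f \<Longrightarrow> raffine (lapS f)"
proof -
  assume "raffine f"
  then obtain A0 A where "radial A0" "\<And>i. radial (A i)" "f = A0 + rlin A" by (auto simp: raffine_def)
  then show ?thesis
    by (intro affineI[of 0 "\<lambda>i. - 3 * A i"]) (auto simp: lapS_radial lapS_rlin)
qed

lemma raffine_shift_eul: "raffine f \<Longrightarrow> raffine (shift_eul d f)"
  unfolding shift_eul_def by (intro raffine_diff raffine_eul raffine_mult) auto

lemma raffine_y: "radial A \<Longrightarrow> raffine (A * y i)"
proof (rule affineI[of 0 "\<lambda>j. if j = i then A else 0"])
  show "A * y i = 0 + rlin (\<lambda>j. if j = i then A else 0)"
    by (simp add: rlin_def if_distrib[of "\<lambda>f. f * _"] cong: if_cong)
qed auto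

lemma homogeneous_radial:
  assumes "radial A" "eul A = cst d * A"
  obtains c where "A = ex d * cst c"
proof -
  note p = homogeneous_eq_ex_mult[OF assms(2)]
  have "D i (ex (- d) * A) = 0" for i
    using D_radial[of "ex (- d) * A"] assms(1) p(2) by simp
  then show thesis using D_zero_imp_cst p(1) that by metis
qed

text \<open>By linear independence, homogeneity passes to each radial coefficient, and a homogeneous
  radial function is a constant multiple of |x|^d.\<close>

lemma homogeneous_affine:
  assumes "raffine f" "eul f = cst d * f"
  shows "sph_affine (ex (- d) * f)"
proof -
  obtain A0 A where A: "radial A0" "\<And>i. radial (A i)" "f = A0 + rlin A"
    using assms(1) by (auto simp: raffine_def)
  have "shift_eul d A0 + rlin (\<lambda>i. shift_eul d (A i)) = 0"
    using assms(2) unfolding A(3) shift_eul_rlin[symmetric] by (simp add: shift_eul_def algebra_simps)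
  note z = radial_affine_eq_0[OF _ _ this]
  have "shift_eul d A0 = 0" by (rule z(1)) (simp_all add: A(1,2))
  moreover have "shift_eul d (A i) = 0" for i by (rule z(2)) (simp_all add: A(1,2))
  ultimately have "\<exists>c. A0 = ex d * cst c" "\<forall>i. \<exists>c. A i = ex d * cst c"
    using homogeneous_radial A by (metis eq_iff_diff_eq_0 shift_eul_def)+
  then obtain c c' where c: "A0 = ex d * cst c" "\<And>i. A i = ex d * cst (c' i)"
    by metis
  have "ex (- d) * f = cst c + ylin c'"
    by (simp add: A(3) c rlin_def ylin_def distrib_left sum_distrib_left mult.assoc ex_mult')
  then show ?thesis by (rule sph_affineI)
qed

text \<open>The highest coefficient in \<open>t\<close> is affine in \<open>y\<close> by the homogeneous case; subtracting the
  corresponding term lowers the degree in \<open>t\<close>.\<close>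

lemma raffine_induct:
  assumes "nil d n f" "P f"
    and shift: "\<And>f. P f \<Longrightarrow> P (shift_eul d f)"
    and diff: "\<And>f g. P f \<Longrightarrow> raffine g \<Longrightarrow> P (f - g)"
    and hom: "\<And>f. P f \<Longrightarrow> eul f = cst d * f \<Longrightarrow> sph_affine (ex (- d) * f)"
  shows "raffine f"
  using assms(1,2)
proof (induction n arbitrary: f)
  case 0
  then show ?case using raffine_radial[of 0] by (simp add: nil_def)
next
  case (Suc n)
  define g where "g = (shift_eul d ^^ n) f"
  have "P g" unfolding g_def using Suc.prems(2) shift by (induction n) auto
  moreover have g: "eul g = cst d * g"
    using Suc.prems(1) by (simp add: nil_def g_def shift_eul_def)
  ultimately obtain c e where ce: "ex (- d) * g = cst c + ylin e"
    using hom unfolding sph_affine_def by blast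
  then have g_eq: "g = ex d * cst c + rlin (\<lambda>i. ex d * cst (e i))"
    using homogeneous_eq_ex_mult(1)[OF g] by (simp add: ylin_def rlin_def distrib_left sum_distrib_left mult.assoc)
  then have "raffine g" by (intro affineI) auto
  define h where "h = cst (1 / of_nat (fact n)) * T ^ n * g"
  have h: "raffine h"
    unfolding h_def by (intro raffine_mult \<open>raffine g\<close>) auto
  \<comment> \<open>Each application of \<open>shift_eul d\<close> lowers the power of
    \<open>T\<close> by one and brings down the exponent, whence the factorial in
    \<open>h\<close>.\<close>
  have "(shift_eul d ^^ n) (T ^ n * g) = of_nat (fact n) * g"
  proof -
    have s: "shift_eul d (T ^ Suc m * g) = of_nat (Suc m) * (T ^ m * g)" for m
      by (simp add: shift_eul_def eul_mult eul_power g algebra_simps del: power_Suc of_nat_Suc)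
    have sm: "(shift_eul d ^^ m) (of_nat k * f) = of_nat k * (shift_eul d ^^ m) f" for m k f
      using funpow_intertwine[of "shift_eul d" "\<lambda>f. of_nat k * f" "shift_eul d"]
        shift_eul_cst_mult[of d "of_nat k"] by simp
    show ?thesis
    proof (induction n)
      case (Suc m)
      have "(shift_eul d ^^ Suc m) (T ^ Suc m * g) = (shift_eul d ^^ m) (of_nat (Suc m) * (T ^ m * g))"
        by (simp only: funpow_Suc_right comp_apply s)
      then show ?case
        by (simp only: sm Suc) (simp add: algebra_simps)
    qed simp
  qed
  then have "(shift_eul d ^^ n) h = cst (1 / of_nat (fact n)) * (of_nat (fact n) * g)"
    unfolding h_def mult.assoc
    using funpow_intertwine[of "shift_eul d" "\<lambda>f. cst (1 / of_nat (fact n)) * f" "shift_eul d", OF shift_eul_cst_mult]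
    by simp
  also have "\<dots> = g"
    using cst_inverse[of "of_nat (fact n)" g] by (simp add: inverse_eq_divide del: of_nat_fact)
  finally have "nil d n (f - h)"
    by (simp add: nil_def shift_eul_funpow_diff g_def)
  then have "raffine (f - h)"
    using Suc.IH diff[OF Suc.prems(2) h] by blast
  then show ?case
    using raffine_add[OF _ h, of "f - h"] by simp
qed

section \<open>The Laplacian of the cylinder and its resonances\<close>

lemma lapS_cst_mult': "lapS (f * cst c) = cst c * lapS f"
  using lapS_cst_mult[of c f] by (simp add: mult.commute)

text \<open>The Laplacian of the product metric, \<partial>_t^2 + \<Delta>_S.\<close>

definition lapC :: "sfun \<Rightarrow> sfun" where "lapC f = ex 2 * lap f - 2 * eul f"

lemma lapC_eq: "lapC f = eul (eul f) + lapS f"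
  by (simp add: lapC_def lapS_def)

lemma lapC_add [simp]: "lapC (f + g) = lapC f + lapC g"
  and lapC_diff [simp]: "lapC (f - g) = lapC f - lapC g"
  and lapC_0 [simp]: "lapC 0 = 0"
  by (simp_all add: lapC_eq)

lemma lapC_cst_mult: "lapC (cst c * f) = cst c * lapC f"
  by (simp add: lapC_eq eul_mult lapS_cst_mult' algebra_simps)

lemma eul_lapS: "eul (lapS f) = lapS (eul f)"
  using shift_eul_lapS[of 0 f] by (simp add: shift_eul_def)

lemma eul_lapC: "eul (lapC f) = lapC (eul f)"
  by (simp add: lapC_eq eul_lapS)

lemma shift_eul_lapC: "shift_eul d (lapC f) = lapC (shift_eul d f)"
  by (simp add: shift_eul_def eul_lapC lapC_cst_mult)

lemma raffine_lapC: "raffine f \<Longrightarrow> raffine (lapC f)"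
  unfolding lapC_eq by (intro raffine_add raffine_eul raffine_lapS)

lemma lapC_homogeneous:
  assumes "eul p = 0"
  shows "lapC (ex d * p) = ex d * (lapS p + cst (d * d) * p)"
  by (simp add: lapC_eq eul_mult eul_ex assms lapS_radial_mult) (simp add: cst_hom algebra_simps)

text \<open>On e^{d t} p the operator is \<Delta>_S + d^2 + \<kappa>, and Re (d^2 + \<kappa>) < 4 +
  4 = 8. The eigenvalues k(k+2) with k \<ge> 2 are at least 8, so no harmonic of degree two or more
  is resonant.\<close>

lemma second_order_affine:
  assumes "nil d n f" "\<bar>Re d\<bar> < 2" "\<kappa> < 4" "raffine (lapC f + cst (of_real \<kappa>) * f)"
  shows "raffine f"
proof (rule raffine_induct[OF assms(1), where P = "\<lambda>f. raffine (lapC f + cst (of_real \<kappa>) * f)"])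
  show "raffine (lapC f + cst (of_real \<kappa>) * f)" by fact
next
  fix f assume f: "raffine (lapC f + cst (of_real \<kappa>) * f)"
  then show "raffine (lapC (shift_eul d f) + cst (of_real \<kappa>) * shift_eul d f)"
    using raffine_shift_eul[OF f, of d] by (simp add: shift_eul_lapC shift_eul_cst_mult)
  show "raffine (lapC (f - g) + cst (of_real \<kappa>) * (f - g))" if "raffine g" for g
  proof -
    have "raffine (lapC g + cst (of_real \<kappa>) * g)"
      by (intro raffine_add raffine_lapC raffine_mult that) simp
    from raffine_diff[OF f this] show ?thesis by (simp add: algebra_simps)
  qed
  assume e: "eul f = cst d * f"
  let ?p = "ex (- d) * f"
  note p = homogeneous_eq_ex_mult[OF e]
  let ?\<mu> = "d * d + of_real \<kappa>"
  have "lapC f + cst (of_real \<kappa>) * f = ex d * (lapS ?p + cst ?\<mu> * ?p)"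
  proof -
    have "lapC f = ex d * (lapS ?p + cst (d * d) * ?p)"
      using lapC_homogeneous[OF p(2), of d] unfolding p(1)[symmetric] .
    moreover have "cst (of_real \<kappa>) * f = ex d * (cst (of_real \<kappa>) * ?p)"
      by (subst p(1)) (simp only: mult_ac)
    ultimately show ?thesis by (simp add: cst_hom(1) distrib_right distrib_left add.assoc)
  qed
  moreover have "eul (lapC f + cst (of_real \<kappa>) * f) = cst d * (lapC f + cst (of_real \<kappa>) * f)"
    by (simp add: eul_lapC e lapC_cst_mult eul_mult) (simp add: algebra_simps)
  ultimately have "sph_affine (lapS ?p + cst ?\<mu> * ?p)"
    using homogeneous_affine[OF f, of d] by (simp add: ex_mult')
  then show "sph_affine ?p"
  proof (rule lapS_shifted_sph_affine[OF p(2)])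
    fix k :: nat assume "k \<ge> 2"
    then have k: "8 \<le> real k * (real k + 2)"
      using mult_mono[of 2 "real k" "2 + 2" "real k + 2"] by simp
    have "Re d * Re d < 2 * 2"
      using abs_mult_less[OF assms(2,2)] by simp
    then have "Re d * Re d - Im d * Im d + \<kappa> < 8"
      using zero_le_square[of "Im d"] assms(3) by linarith
    from less_le_trans[OF this k] have "Re d * Re d - Im d * Im d + \<kappa> < real k * (real k + 2)" .
    then have "Re ?\<mu> \<noteq> Re (of_nat k * (of_nat k + 2))" by simp
    then show "?\<mu> \<noteq> of_nat k * (of_nat k + 2)" by metis
  qed
qed

text \<open>Put m = k(k+2). If d^2 + c = m, the quadratic equation for c becomes (d^2 - (m - 2))^2 =
  4 - 4m/3. This is negative for m \<ge> 8, so Re d^2 = m - 2 \<ge> 6, against Re d^2 < 4.\<close>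

lemma fourth_order_root_not_eigenvalue:
  fixes k :: nat
  assumes "\<bar>Re d\<bar> < 2" "k \<ge> 2" "(c - 4/3) * (c - 4/3) = 16/9 - 4/3 * (d * d)"
  shows "d * d + c \<noteq> of_nat k * (of_nat k + 2)"
proof
  define m where "m = real k * (real k + 2)"
  assume "d * d + c = of_nat k * (of_nat k + 2)"
  then have c: "c = of_real m - d * d" by (simp add: m_def algebra_simps)
  define z where "z = d * d - of_real (m - 2)"
  have "z * z - of_real (4 - 4/3 * m) = (c - 4/3) * (c - 4/3) - (16/9 - 4/3 * (d * d))"
    unfolding c z_def by (simp add: algebra_simps)
  then have z: "z * z = of_real (4 - 4/3 * m)" using assms(3) by simp
  have m: "m \<ge> 8"
    unfolding m_def using mult_mono[of 2 "real k" "2 + 2" "real k + 2"] assms(2) by simp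
  have "Re z = 0"
  proof (rule ccontr)
    assume "Re z \<noteq> 0"
    moreover have "Re z * Im z = 0" using arg_cong[OF z, of Im] by auto
    ultimately have "Im z = 0" by simp
    then have "Re z * Re z = 4 - 4/3 * m" using arg_cong[OF z, of Re] by simp
    then show False using zero_le_square[of "Re z"] m by linarith
  qed
  then have "Re d * Re d - Im d * Im d = m - 2" by (simp add: z_def)
  moreover have "Re d * Re d < 2 * 2"
    using abs_mult_less[OF assms(1,1)] by simp
  ultimately show False using zero_le_square[of "Im d"] m by linarith
qed

text \<open>With L = \<Delta>_S + d^2, the operator is 3 L^2 + 8 L + 4 d^2 on e^{d t} p. It factors
  as 3 (L + c1)(L + c2), where c1 + c2 = 8/3 and c1 c2 = 4 d^2/3, and the second order argument
  applies to each factor in turn.\<close>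

lemma fourth_order_homogeneous:
  assumes p: "eul p = 0" and d: "\<bar>Re d\<bar> < 2"
    and aff: "raffine (3 * lapC (lapC (ex d * p)) + 8 * lapC (ex d * p) + 4 * eul (eul (ex d * p)))"
  shows "sph_affine p"
proof -
  define r where "r = csqrt (16/9 - 4/3 * (d * d))"
  define c1 c2 where "c1 = 4/3 + r" "c2 = 4/3 - r"
  have r: "r * r = 16/9 - 4/3 * (d * d)"
    using power2_csqrt[of "16/9 - 4/3 * (d * d)"] by (simp add: r_def power2_eq_square)
  define m s t where "m = cst (d * d)" "s = cst c1" "t = cst c2"
  have st: "3 * t + 3 * s = 8" "3 * (s * t) = 4 * m"
  proof -
    have "3 * c2 + 3 * c1 = 8" "3 * (c1 * c2) = 4 * (d * d)"
      using r by (simp_all add: c1_c2_def algebra_simps)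
    from this[THEN arg_cong, of cst] show "3 * t + 3 * s = 8" "3 * (s * t) = 4 * m"
      by (simp_all add: m_s_t_def cst_hom)
  qed
  have lm: "lapS (m * g) = m * lapS g" "lapS (s * g) = s * lapS g" "eul (m * g) = m * eul g" "eul (s * g) = s * eul g" "eul (t * g) = t * eul g" for g
    by (simp_all add: m_s_t_def lapS_cst_mult eul_mult)
  define q where "q = lapS p + (m + s) * p"
  have q: "eul q = 0" by (simp add: q_def lm distrib_right eul_lapS p)
  let ?F = "3 * lapC (lapC (ex d * p)) + 8 * lapC (ex d * p) + 4 * eul (eul (ex d * p))"
  let ?G = "lapS q + (m + t) * q"
  have 1: "lapC (ex d * p) = ex d * (lapS p + m * p)"
    unfolding m_s_t_def by (rule lapC_homogeneous[OF p])
  have 2: "lapC (lapC (ex d * p)) = ex d * (lapS (lapS p + m * p) + m * (lapS p + m * p))"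
    unfolding 1 unfolding m_s_t_def
    by (rule lapC_homogeneous) (simp add: eul_mult[of "cst _"] eul_lapS p)
  have 3: "eul (eul (ex d * p)) = ex d * (m * p)"
    by (simp add: eul_mult eul_ex p m_s_t_def) (simp add: cst_hom mult_ac)
  have "3 * ?G = 3 * lapS (lapS p) + 6 * m * lapS p + 3 * m * m * p + (3 * t + 3 * s) * (lapS p + m * p) + 3 * (s * t) * p"
    by (simp add: q_def lm distrib_right) (simp add: algebra_simps)
  then have F: "?F = 3 * (ex d * ?G)"
    unfolding st 2 unfolding 1 3 by (simp add: lm mult.left_commute[of 3]) (simp add: algebra_simps)
  have "eul ?F = cst d * ?F"
  proof -
    have "eul ?G = 0" by (simp add: lm distrib_right eul_lapS q)
    then show ?thesis
      unfolding F by (simp only: eul_mult eul_ex eul_numeral) (simp add: algebra_simps)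
  qed
  from homogeneous_affine[OF aff this] have "sph_affine (3 * ?G)"
    unfolding F by (simp add: mult.left_commute[of _ 3] ex_mult')
  then obtain c0 e where "3 * ?G = cst c0 + ylin e"
    by (auto simp: sph_affine_def)
  moreover have "?G = cst (inverse 3) * (3 * ?G)"
    using cst_inverse[of 3 ?G] by simp
  ultimately have "?G = cst (inverse 3 * c0) + ylin (\<lambda>i. inverse 3 * e i)"
    by (simp only: distrib_left cst_mult_ylin cst_hom(2))
  then have G: "sph_affine (lapS q + cst (d * d + c2) * q)"
    by (intro sph_affineI) (simp add: m_s_t_def cst_hom(1))
  have "sph_affine q"
    by (rule lapS_shifted_sph_affine[OF q G], rule fourth_order_root_not_eigenvalue[OF d])
      (use r in \<open>simp_all add: c1_c2_def\<close>)
  then have "sph_affine (lapS p + cst (d * d + c1) * p)"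
    by (simp add: q_def m_s_t_def cst_hom(1))
  then show ?thesis
    by (rule lapS_shifted_sph_affine[OF p], intro fourth_order_root_not_eigenvalue[OF d])
      (use r in \<open>simp_all add: c1_c2_def\<close>)
qed

lemma fourth_order_affine:
  assumes "nil d n f" "\<bar>Re d\<bar> < 2" "raffine (3 * lapC (lapC f) + 8 * lapC f + 4 * eul (eul f))"
  shows "raffine f"
proof (rule raffine_induct[OF assms(1), where P = "\<lambda>f. raffine (3 * lapC (lapC f) + 8 * lapC f + 4 * eul (eul f))"])
  show "raffine (3 * lapC (lapC f) + 8 * lapC f + 4 * eul (eul f))" by fact
next
  fix f assume f: "raffine (3 * lapC (lapC f) + 8 * lapC f + 4 * eul (eul f))"
  have ee: "shift_eul d (eul f) = eul (shift_eul d f)" for f by (simp add: shift_eul_def eul_mult)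
  show "raffine (3 * lapC (lapC (shift_eul d f)) + 8 * lapC (shift_eul d f) + 4 * eul (eul (shift_eul d f)))"
    using raffine_shift_eul[OF f, of d] shift_eul_cst_mult[of d 3] shift_eul_cst_mult[of d 8] shift_eul_cst_mult[of d 4]
    by (simp add: shift_eul_lapC ee)
  show "raffine (3 * lapC (lapC (f - g)) + 8 * lapC (f - g) + 4 * eul (eul (f - g)))" if "raffine g" for g
  proof -
    have "raffine (3 * lapC (lapC g) + 8 * lapC g + 4 * eul (eul g))"
      by (intro raffine_add raffine_lapC raffine_mult raffine_eul that radial_numeral)
    from raffine_diff[OF f this] show ?thesis by (simp add: algebra_simps)
  qed
  assume e: "eul f = cst d * f"
  note p = homogeneous_eq_ex_mult[OF e]
  show "sph_affine (ex (- d) * f)"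
    by (rule fourth_order_homogeneous[OF p(2) assms(2)]) (use f p(1) in simp)
qed

subsection \<open>The decoupled equation\<close>

definition conf_killing :: "(4 \<Rightarrow> sfun) \<Rightarrow> 4 \<Rightarrow> 4 \<Rightarrow> sfun" where
  "conf_killing V j l = D j (V l) + D l (V j) - (if j = l then cst (1/2) * (\<Sum>i\<in>UNIV. D i (V i)) else 0)"

lemma half_half: "cst (1/2) * f + cst (1/2) * f = f"
proof -
  have "cst (1/2) * f + cst (1/2) * f = cst (1/2 + 1/2) * f"
    by (simp only: cst_hom(1) distrib_right)
  then show ?thesis by simp
qed

lemma numeral_mult_hom [simp]:
  "D i (numeral n * f) = numeral n * D i f" "eul (numeral n * f) = numeral n * eul f"
  "lap (numeral n * f) = numeral n * lap f" "lapS (numeral n * f) = numeral n * lapS f"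
  "lapC (numeral n * f) = numeral n * lapC f"
  using lap_mult_cst[of "numeral n"] lapS_cst_mult[of "numeral n"] lapC_cst_mult[of "numeral n"]
  by (simp_all add: D_mult eul_mult)

lemma sum_if_eq:
  fixes f :: "4 \<Rightarrow> sfun"
  shows "(\<Sum>j\<in>UNIV. if j = l then f j else 0) = f l"
  by simp_all

lemma sum_X_lap: "(\<Sum>l\<in>UNIV. X l * lap (V l)) = lap (\<Sum>l\<in>UNIV. X l * V l) - 2 * (\<Sum>l\<in>UNIV. D l (V l))"
proof -
  have "lap (X l * V l) = 2 * D l (V l) + X l * lap (V l)" for l
  proof -
    have "D k (X l) * D k (V l) = (if k = l then D l (V l) else 0)" for k
      by (simp add: D_X)
    then show ?thesis by (simp add: lap_mult)
  qed
  then show ?thesis by (simp add: sum.distrib sum_distrib_left)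
qed

lemma div_conf_killing_expand:
  fixes V :: "4 \<Rightarrow> sfun"
  defines "q \<equiv> (\<Sum>i\<in>UNIV. X i * V i)" and "h \<equiv> cst (1/2) * (\<Sum>i\<in>UNIV. D i (V i))"
  assumes "(\<Sum>j\<in>UNIV. D j (ex (-4) * conf_killing V j l)) = 0"
  shows "ex 2 * lap (V l) + ex 2 * D l h - 4 * eul (V l) - 4 * D l q + 4 * V l + 4 * (X l * h) = 0"
proof -
  have h2: "(\<Sum>i\<in>UNIV. D i (V i)) = 2 * h"
    unfolding h_def by (simp only: mult_2 half_half)
  have K: "conf_killing V j l = D j (V l) + D l (V j) - (if j = l then h else 0)" for j
    by (simp add: conf_killing_def h_def)
  have XK: "(\<Sum>j\<in>UNIV. X j * conf_killing V j l) = eul (V l) + (D l q - V l) - X l * h"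
  proof -
    have "D l (X j * V j) = (if l = j then V j else 0) + X j * D l (V j)" for j
      by (simp add: D_mult D_X)
    then have "D l q = V l + (\<Sum>j\<in>UNIV. X j * D l (V j))"
      by (simp add: q_def sum.distrib)
    moreover have "(\<Sum>j\<in>UNIV. X j * conf_killing V j l)
        = eul (V l) + (\<Sum>j\<in>UNIV. X j * D l (V j)) - (\<Sum>j\<in>UNIV. if j = l then X j * h else 0)"
      unfolding K eul_def sum.distrib[symmetric] sum_subtractf[symmetric]
      by (intro sum.cong) (auto simp: algebra_simps)
    ultimately show ?thesis unfolding sum_if_eq by simp
  qed
  have DK: "(\<Sum>j\<in>UNIV. D j (conf_killing V j l)) = lap (V l) + D l h"
  proof -
    have "(\<Sum>j\<in>UNIV. D j (conf_killing V j l))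
        = lap (V l) + D l (\<Sum>j\<in>UNIV. D j (V j)) - (\<Sum>j\<in>UNIV. if j = l then D j h else 0)"
      unfolding K lap_def D_sum sum.distrib[symmetric] sum_subtractf[symmetric]
      by (intro sum.cong) (auto simp: D_commute[of l])
    then show ?thesis unfolding sum_if_eq h2 by (simp add: D_mult algebra_simps)
  qed
  have "(\<Sum>j\<in>UNIV. D j (ex (-4) * conf_killing V j l)) =
      ex (-4) * (\<Sum>j\<in>UNIV. D j (conf_killing V j l)) - 4 * (ex (-6) * (\<Sum>j\<in>UNIV. X j * conf_killing V j l))"
    by (simp add: D_mult D_ex sum.distrib sum_distrib_left sum_subtractf sum_negf algebra_simps)
  also have "\<dots> = ex (-6) * (ex 2 * lap (V l) + ex 2 * D l h - 4 * eul (V l) - 4 * D l q + 4 * V l + 4 * (X l * h))"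
  proof -
    have "ex (-4) = ex (-6) * ex 2" by (simp add: ex_mult)
    then show ?thesis unfolding XK DK by (simp add: algebra_simps)
  qed
  finally show ?thesis using assms(3) by (simp add: ex_cancel)
qed

text \<open>In terms of the dual one-form, \<open>a\<close> is the \<open>dt\<close>-component, \<open>s\<close> half the divergence and \<open>w\<close> the
  components in the frame \<open>|x| \<partial>\<^sub>i\<close>.\<close>

lemma div_conf_killing_system:
  fixes V :: "4 \<Rightarrow> sfun"
  defines "a \<equiv> ex (-2) * (\<Sum>i\<in>UNIV. X i * V i)"
  defines "s \<equiv> cst (1/2) * (\<Sum>i\<in>UNIV. D i (V i)) - 2 * a"
  defines "w \<equiv> \<lambda>l. ex (-1) * V l"
  assumes eq: "\<And>l. (\<Sum>j\<in>UNIV. D j (ex (-4) * conf_killing V j l)) = 0"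
  shows "lapC a + eul s = 0"
    and "3 * lapC s + 8 * s - 4 * eul a = 0"
    and "lapC (w l) + 3 * w l = ex 1 * D l (2 * a - s) - 4 * (y l * s)"
    and "(\<Sum>l\<in>UNIV. y l * w l) = a"
proof -
  define q where "q = (\<Sum>i\<in>UNIV. X i * V i)"
  define h where "h = cst (1/2) * (\<Sum>i\<in>UNIV. D i (V i))"
  have h2: "(\<Sum>i\<in>UNIV. D i (V i)) = 2 * h"
    unfolding h_def by (simp only: mult_2 half_half)
  have q: "q = ex 2 * a" by (simp add: q_def a_def ex_mult')
  have h: "h = s + 2 * a" by (simp add: s_def h_def)
  have E: "ex 2 * lap (V l) + ex 2 * D l h - 4 * eul (V l) - 4 * D l q + 4 * V l + 4 * (X l * h) = 0" for l
    unfolding q_def h_def by (rule div_conf_killing_expand[OF eq])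
  have lap2: "lap (ex 2 * f) = 8 * f + 4 * eul f + ex 2 * lap f" for f
    by (simp add: lap_mult sum_D_ex lap_ex)
  have eul2: "eul (ex 2 * f) = 2 * (ex 2 * f) + ex 2 * eul f" for f
    by (simp add: eul_mult eul_ex)
  \<comment> \<open>Contracting the vector equation \<open>E\<close> with x gives an equation in the
    scalars q and h only.\<close>
  have "(\<Sum>l\<in>UNIV. X l * (ex 2 * lap (V l) + ex 2 * D l h - 4 * eul (V l) - 4 * D l q + 4 * V l + 4 * (X l * h)))
      = ex 2 * (\<Sum>l\<in>UNIV. X l * lap (V l)) + ex 2 * eul h - 4 * (\<Sum>l\<in>UNIV. X l * eul (V l)) - 4 * eul q + 4 * q
        + 4 * ((\<Sum>l\<in>UNIV. X l * X l) * h)"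
    by (simp add: eul_def[of h] eul_def[of q] q_def[symmetric] sum_distrib_left sum_distrib_right
        distrib_left right_diff_distrib sum.distrib sum_subtractf mult_ac) (simp add: q_def sum_distrib_left mult_ac)
  moreover have "(\<Sum>l\<in>UNIV. X l * eul (V l)) = eul q - q"
    by (simp add: q_def eul_mult sum.distrib)
  moreover have "(\<Sum>l\<in>UNIV. X l * lap (V l)) = lap q - 4 * h"
    unfolding sum_X_lap h2 q_def by simp
  ultimately have "ex 2 * lap q + ex 2 * eul h - 8 * eul q + 8 * q = 0"
    unfolding E by (simp add: sum_X_sq algebra_simps)
  then have "ex 2 * (ex 2 * lap a - 2 * eul a + eul s) = 0"
    unfolding q h lap2 eul2 by simp (simp add: algebra_simps)
  then show 1: "lapC a + eul s = 0"
    by (simp add: ex_cancel lapC_def)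
  \<comment> \<open>The divergence of \<open>E\<close> is the second equation in q and h.\<close>
  have "(\<Sum>l\<in>UNIV. D l (ex 2 * lap (V l) + ex 2 * D l h - 4 * eul (V l) - 4 * D l q + 4 * V l + 4 * (X l * h)))
      = 2 * (\<Sum>l\<in>UNIV. X l * lap (V l)) + ex 2 * lap (\<Sum>l\<in>UNIV. D l (V l)) + 2 * eul h + ex 2 * lap h
        - 4 * ((\<Sum>l\<in>UNIV. D l (V l)) + eul (\<Sum>l\<in>UNIV. D l (V l))) - 4 * lap q + 4 * (\<Sum>l\<in>UNIV. D l (V l))
        + 4 * (4 * h + eul h)"
  proof -
    have "D l (ex 2 * lap (V l) + ex 2 * D l h - 4 * eul (V l) - 4 * D l q + 4 * V l + 4 * (X l * h))
      = 2 * (X l * lap (V l)) + ex 2 * lap (D l (V l)) + 2 * (X l * D l h) + ex 2 * D l (D l h)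
        - 4 * (D l (V l) + eul (D l (V l))) - 4 * D l (D l q) + 4 * D l (V l) + 4 * (h + X l * D l h)" for l
      by (simp add: D_mult D_ex D_X D_eul D_lap algebra_simps)
    then show ?thesis
      by (simp only: sum.distrib sum_subtractf sum_distrib_left[symmetric] lap_sum[symmetric] eul_sum[symmetric]
          eul_def[of h, symmetric] lap_def[of h, symmetric] lap_def[of q, symmetric]) simp
  qed
  then have "3 * (ex 2 * lap h) - 2 * lap q - 2 * eul h + 8 * h = 0"
    unfolding E \<open>(\<Sum>l\<in>UNIV. X l * lap (V l)) = lap q - 4 * h\<close> h2 by simp (simp add: algebra_simps)
  then have *: "3 * (ex 2 * lap s) + 4 * (ex 2 * lap a) - 12 * eul a - 2 * eul s + 8 * s = 0"
    unfolding q h lap2 by simp (simp add: algebra_simps)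
  \<comment> \<open>The Laplacian of a is eliminated by means of the first scalar equation.\<close>
  have "3 * lapC s + 8 * s - 4 * eul a
      = (3 * (ex 2 * lap s) + 4 * (ex 2 * lap a) - 12 * eul a - 2 * eul s + 8 * s) - 4 * (lapC a + eul s)"
    by (simp add: lapC_def algebra_simps)
  then show "3 * lapC s + 8 * s - 4 * eul a = 0" unfolding * 1 by simp
  have V: "V l = ex 1 * w l" for l by (simp add: w_def ex_mult')
  have "lap (ex 1 * w l) = 3 * (ex (-1) * w l) + 2 * (ex (-1) * eul (w l)) + ex 1 * lap (w l)" for l
    by (simp add: lap_mult sum_D_ex lap_ex algebra_simps)
  then have lw: "ex 2 * lap (V l) = ex 1 * (3 * w l + 2 * eul (w l) + ex 2 * lap (w l))" for l
    unfolding V by (simp add: distrib_left mult.left_commute[of _ 3] mult.left_commute[of _ 2] ex_mult')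
  have "ex 1 * (lapC (w l) + 3 * w l) + (ex 2 * D l (s - 2 * a) + 4 * (X l * s)) = 0"
  proof -
    have Dq: "D l q = 2 * (X l * a) + ex 2 * D l a"
      by (simp add: q D_mult D_ex algebra_simps)
    have ev: "eul (V l) = V l + ex 1 * eul (w l)"
      unfolding V by (simp add: eul_mult eul_ex)
    have D2: "D l (s + 2 * a) = D l s + 2 * D l a" "D l (s - 2 * a) = D l s - 2 * D l a" by (simp_all add: D_mult)
    have "ex 2 * lap (V l) + ex 2 * D l h - 4 * eul (V l) - 4 * D l q + 4 * V l + 4 * (X l * h)
        = ex 1 * (lapC (w l) + 3 * w l) + (ex 2 * D l (s - 2 * a) + 4 * (X l * s))"
      unfolding lw Dq ev h D2 lapC_def by (simp add: algebra_simps)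
    then show ?thesis unfolding E by simp
  qed
  then have "ex (-1) * (ex 1 * (lapC (w l) + 3 * w l)) + ex (-1) * (ex 2 * D l (s - 2 * a) + 4 * (X l * s)) = 0"
    unfolding distrib_left[symmetric] by simp
  then have "lapC (w l) + 3 * w l + (ex 1 * D l (s - 2 * a) + 4 * (y l * s)) = 0"
    by (simp add: ex_mult' y_def distrib_left mult.left_commute[of _ 4] mult.assoc del: D_diff)
  then show "lapC (w l) + 3 * w l = ex 1 * D l (2 * a - s) - 4 * (y l * s)"
    by (simp add: algebra_simps eq_neg_iff_add_eq_0)
  show "(\<Sum>l\<in>UNIV. y l * w l) = a"
    by (simp add: a_def y_def w_def sum_distrib_left) (simp add: ex_mult' mult_ac ex_mult)
qed

section \<open>Solution of the vector equation by separation of variables\<close>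

lemma lapS_yy: "lapS (y i * y j) = - 8 * (y i * y j) + (if i = j then 2 else 0)"
proof -
  have "ex 2 * (y i * y j) = X i * X j"
  proof -
    have "ex 2 = ex 1 * ex 1" by (simp add: ex_mult)
    then show ?thesis by (simp add: ex_1_y[symmetric] mult_ac)
  qed
  moreover have "lap (X i * X j) = (if i = j then 2 else 0)"
  proof -
    have "D k (X i) * D k (X j) = (if k = i then if i = j then 1 else 0 else 0)" for k
      by (simp add: D_X)
    then show ?thesis by (simp add: lap_mult)
  qed
  moreover have "lap (ex 2 * (y i * y j)) = ex (2 - 2) * (lapS (y i * y j) + cst (2 * (2 + 2)) * (y i * y j))"
    by (rule lap_ex_mult) (simp add: eul_mult)
  ultimately show ?thesis by (simp add: algebra_simps)
qed

text \<open>\<Delta>_S is -3 on the linear part and, up to the trace of H, -8 on the quadratic part,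
  which separates the two. Differentiating the vanishing quadratic form gives a linear relation with
  coefficients H_ki + H_ik, which is trivial by independence.\<close>

lemma radial_quadratic_eq_0:
  assumes "\<And>i. radial (A i)" "\<And>i j. radial (H i j)"
    and "rlin A + (\<Sum>i\<in>UNIV. \<Sum>j\<in>UNIV. H i j * (y i * y j)) = 0"
  shows "A i = 0" "H i j = - H j i"
proof -
  let ?Q = "\<Sum>i\<in>UNIV. \<Sum>j\<in>UNIV. H i j * (y i * y j)"
  let ?t = "\<Sum>i\<in>UNIV. H i i"
  have Q: "?Q = - rlin A" using assms(3) by (simp add: eq_neg_iff_add_eq_0 add.commute)
  have "lapS (H i j * (y i * y j)) = - 8 * (H i j * (y i * y j)) + (if i = j then 2 * H i j else 0)" for i j
    by (simp add: lapS_radial_mult assms lapS_yy) (simp add: algebra_simps)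
  then have "lapS ?Q = - 8 * ?Q + 2 * ?t"
    by (simp add: lapS_sum sum.distrib sum_subtractf sum_distrib_left sum_negf)
  moreover have "lapS ?Q = rlin (\<lambda>i. 3 * A i)"
    unfolding Q by (simp add: lapS_rlin assms rlin_minus)
  ultimately have "2 * ?t + rlin (\<lambda>i. 5 * A i) = 0"
    unfolding Q using rlin_mult[of 8 A] rlin_diff[of "\<lambda>i. 8 * A i" "\<lambda>i. 3 * A i"] by (simp add: algebra_simps)
  from radial_affine_eq_0(2)[OF _ _ this] have A0: "A i = 0" for i
    using assms by (simp add: numeral_mult_cancel)
  then show "A i = 0" .
  have Q0: "?Q = 0" using Q A0 by (simp add: rlin_def)
  have "rlin (\<lambda>i. H k i + H i k) = 0" for k
  proof -
    have "ex 1 * D k (H i j * (y i * y j)) = y k * eul (H i j * (y i * y j)) + (if k = i then H i j * y j else 0)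
        + (if k = j then H i j * y i else 0) - 2 * (y k * (H i j * (y i * y j)))" for i j
    proof -
      have "ex 1 * D k (H i j * (y i * y j)) = (ex 1 * D k (H i j)) * (y i * y j)
          + H i j * ((ex 1 * D k (y i)) * y j + y i * (ex 1 * D k (y j)))"
        by (simp add: D_mult algebra_simps)
      then show ?thesis
        unfolding ex_1_D_y ex_1_D_radial[OF assms(2)] by (simp add: eul_mult algebra_simps)
    qed
    then have "ex 1 * D k ?Q = y k * eul ?Q + (\<Sum>i\<in>UNIV. \<Sum>j\<in>UNIV. if k = i then H i j * y j else 0)
        + (\<Sum>i\<in>UNIV. \<Sum>j\<in>UNIV. if k = j then H i j * y i else 0) - 2 * (y k * ?Q)"
      by (simp add: sum_distrib_left sum.distrib sum_subtractf)
    moreover have "(\<Sum>i\<in>UNIV. \<Sum>j\<in>UNIV. if k = i then H i j * y j else 0) = (\<Sum>j\<in>UNIV. H k j * y j)"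
      by (subst sum.swap) simp
    moreover have "(\<Sum>i\<in>UNIV. \<Sum>j\<in>UNIV. if k = j then H i j * y i else 0) = (\<Sum>i\<in>UNIV. H i k * y i)"
      by simp
    ultimately show ?thesis
      unfolding Q0 by (simp add: rlin_def distrib_right sum.distrib)
  qed
  then have "0 + rlin (\<lambda>i. H k i + H i k) = 0" for k by simp
  from radial_affine_eq_0(2)[OF _ _ this] show "H i j = - H j i"
    using assms(2) by (simp add: eq_neg_iff_add_eq_0)
qed

text \<open>The vector fields in the next statement include those for which \<open>conf_killing\<close> vanishes, but also
  those for double roots of the indicial polynomial.\<close>

lemma div_conf_killing_solution:
  fixes V :: "4 \<Rightarrow> sfun"
  assumes eq: "\<And>l. (\<Sum>j\<in>UNIV. D j (ex (-4) * conf_killing V j l)) = 0"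
    and nil: "\<And>l. nil (\<beta> + 1) n (V l)" and \<beta>: "\<bar>Re \<beta>\<bar> < 2"
  obtains F0 F1 G H where
    "radial F0" "\<And>i. radial (F1 i)" "\<And>i. radial (G i)" "\<And>i j. radial (H i j)" "\<And>i j. H i j = - H j i"
    "\<And>l. V l = ex 1 * (F0 * y l + rlin F1 * y l + G l + rlin (H l))"
proof -
  define a where "a = ex (-2) * (\<Sum>i\<in>UNIV. X i * V i)"
  define s where "s = cst (1/2) * (\<Sum>i\<in>UNIV. D i (V i)) - 2 * a"
  define w where "w = (\<lambda>l. ex (-1) * V l)"
  have sys: "lapC a + eul s = 0" "3 * lapC s + 8 * s - 4 * eul a = 0"
    "lapC (w l) + 3 * w l = ex 1 * D l (2 * a - s) - 4 * (y l * s)" "(\<Sum>l\<in>UNIV. y l * w l) = a" for l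
    using div_conf_killing_system[OF eq] by (simp_all only: a_def s_def w_def)
  have nil_a: "nil \<beta> n a"
  proof -
    have "nil (\<beta> + 1 + 1) n (\<Sum>i\<in>UNIV. X i * V i)" by (intro nil_sum nil_X_mult nil)
    from nil_ex_mult[OF this, of "-2"] show ?thesis by (simp add: a_def)
  qed
  have nil_s: "nil \<beta> n s"
    unfolding s_def
    using nil_D[OF nil] nil_cst_mult[OF nil_a, of 2]
    by (intro nil_diff nil_cst_mult nil_sum) simp_all
  have nil_w: "nil \<beta> n (w l)" for l
    unfolding w_def using nil_ex_mult[OF nil, of "-1"] by simp
  have lC: "lapC (numeral k * f) = numeral k * lapC f" for k f
    using lapC_cst_mult[of "numeral k" f] by simp
  \<comment> \<open>Elimination of s from the two scalar equations leaves a fourth order equation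
    for a.\<close>
  have "raffine a"
  proof (rule fourth_order_affine[OF nil_a \<beta>])
    have "3 * lapC (lapC a) + 8 * lapC a + 4 * eul (eul a)
      = 3 * lapC (lapC a + eul s) + 8 * (lapC a + eul s) - eul (3 * lapC s + 8 * s - 4 * eul a)"
      by (simp add: eul_lapC eul_mult algebra_simps)
    also have "\<dots> = 0" unfolding sys(1,2) by simp
    finally show "raffine (3 * lapC (lapC a) + 8 * lapC a + 4 * eul (eul a))"
      using raffine_radial[of 0] by simp
  qed
  \<comment> \<open>With a known to be affine, the second scalar equation is a second order equation
    for s with constant 8/3 < 4.\<close>
  moreover have "raffine s"
  proof (rule second_order_affine[OF nil_s \<beta>, of "8/3"])
    have "lapC s + cst (of_real (8/3)) * s = cst (1/3) * (3 * lapC s + 8 * s - 4 * eul a) + cst (4/3) * eul a"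
    proof -
      have "cst (1/3) * (3 * f) = f" for f using cst_inverse[of 3 f] by (simp add: inverse_eq_divide)
      moreover have "cst (1/3) * (8 * f) = cst (8/3) * f" "cst (1/3) * (4 * f) = cst (4/3) * f" for f
        using cst_hom(2)[of "1/3" 8] cst_hom(2)[of "1/3" 4] by (simp_all add: mult.assoc[symmetric])
      ultimately show ?thesis by (simp add: distrib_left right_diff_distrib)
    qed
    also have "\<dots> = cst (4/3) * eul a" unfolding sys(2) by simp
    finally show "raffine (lapC s + cst (of_real (8/3)) * s)"
      using \<open>raffine a\<close> by (simp only:) (intro raffine_mult raffine_eul; simp)
  qed simp
  ultimately obtain a0 a1 s0 s1 where as: "radial a0" "\<And>i. radial (a1 i)" "a = a0 + rlin a1"
    "radial s0" "\<And>i. radial (s1 i)" "s = s0 + rlin s1"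
    by (auto simp: raffine_def)
  have "(eul (eul a0) + eul s0) + rlin (\<lambda>i. eul (eul (a1 i)) - 3 * a1 i + eul (s1 i)) = 0"
  proof -
    have "lapC a + eul s = (eul (eul a0) + eul s0) + rlin (\<lambda>i. eul (eul (a1 i)) - 3 * a1 i + eul (s1 i))"
      unfolding as(3,6) lapC_eq by (simp add: eul_rlin lapS_rlin lapS_radial as rlin_add) (simp add: algebra_simps)
    then show ?thesis using sys(1) by simp
  qed
  from radial_affine_eq_0(2)[OF _ _ this] have e1: "eul (eul (a1 i)) = 3 * a1 i - eul (s1 i)" for i
    using as by (simp add: algebra_simps eq_neg_iff_add_eq_0)
  have "(3 * eul (eul s0) + 8 * s0 - 4 * eul a0) + rlin (\<lambda>i. 3 * (eul (eul (s1 i)) - 3 * s1 i) + 8 * s1 i - 4 * eul (a1 i)) = 0"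
  proof -
    have "3 * lapC s + 8 * s - 4 * eul a
        = (3 * eul (eul s0) + 8 * s0 - 4 * eul a0) + rlin (\<lambda>i. 3 * (eul (eul (s1 i)) - 3 * s1 i) + 8 * s1 i - 4 * eul (a1 i))"
    proof -
      have "3 * lapC s + 8 * s - 4 * eul a = (3 * eul (eul s0) + 8 * s0 - 4 * eul a0)
          + (3 * (rlin (\<lambda>i. eul (eul (s1 i))) - rlin (\<lambda>i. 3 * s1 i)) + 8 * rlin s1 - 4 * rlin (\<lambda>i. eul (a1 i)))"
        unfolding as(3,6) lapC_eq
        by (simp add: eul_rlin lapS_rlin lapS_radial as flip: rlin_minus)
      then show ?thesis by (simp only: rlin_mult rlin_add rlin_diff)
    qed
    then show ?thesis using sys(2) by simp
  qed
  from radial_affine_eq_0(2)[OF _ _ this] have e2: "3 * eul (eul (s1 i)) = s1 i + 4 * eul (a1 i)" for i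
    using as by (simp add: algebra_simps)
  \<comment> \<open>The field a0 y + (f \<cdot> y) y + b has radial component a, because f + b = a1,
    and b is chosen so that the terms quadratic in y on the two sides of the vector equation agree.
    The remainder \<open>z\<close> is tangential and solves an equation with affine right-hand side
    and constant 3 < 4.\<close>
  define b where "b = (\<lambda>i. cst (1/3) * (eul (a1 i) - 2 * s1 i))"
  define f where "f = (\<lambda>i. a1 i - b i)"
  have b3: "3 * b i = eul (a1 i) - 2 * s1 i" for i
  proof -
    have "3 * (cst (1/3) * g) = g" for g
      using cst_inverse[of 3 g] by (simp add: inverse_eq_divide mult.left_commute[of 3])
    then show ?thesis unfolding b_def .
  qed
  have rb: "radial (b i)" "radial (f i)" for i by (simp_all add: b_def f_def as)
  define z where "z = (\<lambda>l. w l - (a0 * y l + rlin f * y l + b l))"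
  have lapC_ry: "lapC (A * y l) = (eul (eul A) - 3 * A) * y l" if "radial A" for A l
    by (simp add: lapC_eq eul_mult lapS_radial_mult that lapS_y algebra_simps)
  have lapC_r: "lapC A = eul (eul A)" if "radial A" for A
    by (simp add: lapC_eq lapS_radial that)
  have lapC_rl: "lapC (rlin A * y l) = rlin (\<lambda>i. eul (eul (A i)) - 8 * A i) * y l + 2 * A l" if "\<And>i. radial (A i)" for A l
  proof -
    have "lapC (A i * (y i * y l)) = (eul (eul (A i)) - 8 * A i) * (y i * y l) + (if i = l then 2 * A i else 0)" for i
      by (simp add: lapC_eq eul_mult lapS_radial_mult that lapS_yy algebra_simps)
    moreover have "rlin A * y l = (\<Sum>i\<in>UNIV. A i * (y i * y l))"
      by (simp add: rlin_def sum_distrib_right mult.assoc)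
    moreover have "lapC (\<Sum>i\<in>UNIV. g i) = (\<Sum>i\<in>UNIV. lapC (g i))" for g :: "4 \<Rightarrow> sfun"
      by (simp add: lapC_eq lapS_sum sum.distrib)
    ultimately show ?thesis by (simp add: sum.distrib rlin_def sum_distrib_right mult.assoc)
  qed
  have "raffine (lapC (z l) + cst (of_real 3) * z l)" for l
  proof -
    let ?c = "eul (2 * a0 - s0) - 4 * s0 - eul (eul a0)"
    have rhs: "ex 1 * D l (2 * a - s) - 4 * (y l * s)
        = (eul (2 * a0 - s0) - 4 * s0) * y l + rlin (\<lambda>i. eul (2 * a1 i - s1 i) - (2 * a1 i - s1 i) - 4 * s1 i) * y l
          + (2 * a1 l - s1 l)"
    proof -
      have "2 * a - s = (2 * a0 - s0) + rlin (\<lambda>i. 2 * a1 i - s1 i)"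
        unfolding as(3,6) by (simp add: rlin_def sum_subtractf sum_distrib_left algebra_simps)
      moreover have "ex 1 * D l (A0 + rlin A) = y l * eul A0 + (y l * eul (rlin A) + A l - y l * rlin A)"
        if "radial A0" "\<And>i. radial (A i)" for A0 A
        by (simp add: distrib_left ex_1_D_radial ex_1_D_rlin that)
      ultimately have "ex 1 * D l (2 * a - s) = y l * eul (2 * a0 - s0) + (y l * eul (rlin (\<lambda>i. 2 * a1 i - s1 i))
          + (2 * a1 l - s1 l) - y l * rlin (\<lambda>i. 2 * a1 i - s1 i))"
        by (metis (no_types, lifting) as(1,2,4,5) radial_diff radial_mult radial_numeral)
      moreover have "rlin (\<lambda>i. eul (2 * a1 i - s1 i) - (2 * a1 i - s1 i) - 4 * s1 i)
          = rlin (\<lambda>i. eul (2 * a1 i - s1 i)) - rlin (\<lambda>i. 2 * a1 i - s1 i) - 4 * rlin s1"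
        by (simp only: rlin_mult rlin_diff)
      moreover have "y l * s = y l * s0 + y l * rlin s1" by (simp add: as(6) distrib_left)
      ultimately show ?thesis
        by (simp only: eul_rlin) (simp add: algebra_simps del: eul_diff)
    qed
    have lhs: "lapC (z l) + 3 * z l = (lapC (w l) + 3 * w l)
        - (eul (eul a0) * y l + rlin (\<lambda>i. eul (eul (f i)) - 5 * f i) * y l + 2 * f l + eul (eul (b l)) + 3 * b l)"
    proof -
      have "rlin (\<lambda>i. eul (eul (f i)) - 5 * f i) = rlin (\<lambda>i. eul (eul (f i)) - 8 * f i) + 3 * rlin f"
        by (simp only: rlin_mult rlin_add) (simp add: algebra_simps)
      then show ?thesis
        unfolding z_def by (simp add: lapC_ry lapC_rl lapC_r as rb) (simp add: algebra_simps)
    qed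
    have quad: "eul (2 * a1 i - s1 i) - (2 * a1 i - s1 i) - 4 * s1 i = eul (eul (f i)) - 5 * f i" for i
    proof -
      let ?d = "eul (2 * a1 i - s1 i) - (2 * a1 i - s1 i) - 4 * s1 i - (eul (eul (f i)) - 5 * f i)"
      have "3 * ?d = 6 * eul (a1 i) - 3 * eul (s1 i) - 6 * a1 i - 9 * s1 i - 3 * eul (eul (a1 i))
          + eul (eul (3 * b i)) + 15 * a1 i - 5 * (3 * b i)"
        by (simp add: f_def eul_mult algebra_simps)
      also have "\<dots> = 0"
        unfolding b3 using e2[of i] by (simp add: e1 eul_mult algebra_simps)
      finally have "?d = 0" unfolding numeral_mult_cancel .
      then show ?thesis by simp
    qed
    have "lapC (z l) + 3 * z l = ?c * y l + (2 * a1 l - s1 l - 2 * f l - eul (eul (b l)) - 3 * b l)"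
      unfolding lhs sys(3) rhs quad by (simp add: algebra_simps)
    moreover have "raffine (?c * y l + (2 * a1 l - s1 l - 2 * f l - eul (eul (b l)) - 3 * b l))"
      by (intro raffine_add raffine_y raffine_radial) (simp_all add: as rb)
    ultimately show ?thesis by simp
  qed
  moreover have "nil \<beta> n (z l)" for l
  proof -
    \<comment> \<open>Linear independence over the radial functions passes the nilpotency of an
      affine function on to its coefficients.\<close>
    have c: "nil \<beta> n A0 \<and> (\<forall>i. nil \<beta> n (A i))" if "radial A0" "\<And>i. radial (A i)" "nil \<beta> n (A0 + rlin A)" for A0 A
    proof -
      have "(shift_eul \<beta> ^^ n) A0 + rlin (\<lambda>i. (shift_eul \<beta> ^^ n) (A i)) = 0"
        using that(3) by (simp add: nil_def shift_eul_funpow_add shift_eul_funpow_rlin)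
      from radial_affine_eq_0[OF _ _ this] that show ?thesis by (simp add: nil_def)
    qed
    have na: "nil \<beta> n a0" "\<And>i. nil \<beta> n (a1 i)" "\<And>i. nil \<beta> n (s1 i)"
      using c[of a0 a1] c[of s0 s1] nil_a nil_s as by simp_all
    have nb: "nil \<beta> n (b i)" for i
      unfolding b_def using nil_cst_mult[OF na(3), of 2 i] by (intro nil_cst_mult nil_diff nil_eul na) simp
    have ny: "nil \<beta> n (A * y l)" if "nil \<beta> n A" for A l
      using nil_X_mult[OF nil_ex_mult[OF that, of "-1"], of l] by (simp add: y_def mult_ac)
    show ?thesis
      unfolding z_def rlin_def f_def by (intro nil_diff nil_add nil_w ny nil_sum na nb)
  qed
  ultimately have "raffine (z l)" for l
    using second_order_affine[OF _ \<beta>, of n "z l" 3] by simp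
  then have "\<forall>l. \<exists>G H. radial G \<and> (\<forall>i. radial (H i)) \<and> z l = G + rlin H"
    by (simp add: raffine_def)
  then obtain G H where GH: "\<And>l. radial (G l)" "\<And>l i. radial (H l i)" "\<And>l. z l = G l + rlin (H l)"
    by metis
  \<comment> \<open>Tangency of \<open>z\<close> removes the degree zero part \<open>G\<close> and
    makes \<open>H\<close> antisymmetric, so that \<open>z\<close> consists of infinitesimal
    rotations with radial coefficients.\<close>
  have "rlin G + (\<Sum>l\<in>UNIV. \<Sum>j\<in>UNIV. H l j * (y l * y j)) = 0"
  proof -
    have "(\<Sum>l\<in>UNIV. y l * z l) = 0"
    proof -
      have "(\<Sum>l\<in>UNIV. y l * z l) = (\<Sum>l\<in>UNIV. y l * w l) - (a0 * (\<Sum>l\<in>UNIV. y l * y l)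
          + rlin f * (\<Sum>l\<in>UNIV. y l * y l) + rlin b)"
        by (simp add: z_def right_diff_distrib distrib_left sum_subtractf sum.distrib sum_distrib_left rlin_def[of b] mult_ac)
      also have "\<dots> = 0"
        unfolding sys(4) sum_y_sq as(3) f_def by (simp flip: rlin_diff)
      finally show ?thesis .
    qed
    then show ?thesis
      unfolding GH(3) by (simp add: distrib_left sum.distrib rlin_def sum_distrib_left mult_ac)
  qed
  note G0 = radial_quadratic_eq_0[OF GH(1,2) this]
  show thesis
  proof (rule that[of a0 f b H])
    show "V l = ex 1 * (a0 * y l + rlin f * y l + b l + rlin (H l))" for l
    proof -
      have "V l = ex 1 * w l" by (simp add: w_def ex_mult')
      also have "w l = a0 * y l + rlin f * y l + b l + rlin (H l)"
        using GH(3)[of l] G0(1)[of l] by (simp add: z_def algebra_simps)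
      finally show ?thesis .
    qed
  qed (rule as(1) rb GH(2) G0(2))+
qed

subsection \<open>Conformal Killing fields\<close>

lemma radial_eul_0_imp_cst:
  assumes "radial A" "eul A = 0"
  shows "\<exists>c. A = cst c"
proof -
  have "D i A = 0" for i using D_radial[OF assms(1)] assms(2) by simp
  then show ?thesis using D_zero_imp_cst by metis
qed

text \<open>The equation says that \<open>2 (a + b \<cdot> y) y\<^sub>j y\<^sub>l + y\<^sub>j (u + hy)\<^sub>l + y\<^sub>l (u + hy)\<^sub>j\<close> is a multiple of the identity;
  contractions with \<open>y\<close> and the linear independence of spherical harmonics of different degrees give
  the conclusion.\<close>

lemma radial_trace_free_part_eq_0:
  assumes r: "radial a" "\<And>i. radial (b i)" "\<And>i. radial (u i)" "\<And>i j. radial (h i j)"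
    and h: "\<And>i j. h i j = - h j i"
    and eq: "\<And>j l. 2 * ((a + rlin b) * (y j * y l)) + y j * (u l + rlin (h l)) + y l * (u j + rlin (h j))
      = (if j = l then \<tau> else 0)"
  shows "a = 0" "b i = 0" "u i = 0" "h i j = 0"
proof -
  have hyy: "(\<Sum>l\<in>UNIV. y l * rlin (h l)) = 0"
  proof -
    define S where "S = (\<Sum>l\<in>UNIV. \<Sum>i\<in>UNIV. h l i * (y l * y i))"
    have "S = (\<Sum>i\<in>UNIV. \<Sum>l\<in>UNIV. h l i * (y l * y i))"
      unfolding S_def by (rule sum.swap)
    also have "\<dots> = (\<Sum>i\<in>UNIV. \<Sum>l\<in>UNIV. - (h i l * (y i * y l)))"
    proof (intro sum.cong refl)
      show "h l i * (y l * y i) = - (h i l * (y i * y l))" for i l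
        by (subst h) (simp add: mult_ac)
    qed
    also have "\<dots> = - S" by (simp add: S_def sum_negf)
    finally have "2 * S = 0" by (simp only: mult_2 eq_neg_iff_add_eq_0)
    then have "S = 0" unfolding numeral_mult_cancel .
    then show ?thesis by (simp add: S_def rlin_def sum_distrib_left mult_ac)
  qed
  have yu: "(\<Sum>l\<in>UNIV. y l * u l) = rlin u" by (simp add: rlin_def mult_ac)
  have tr: "2 * (a + rlin b) + 2 * rlin u = 4 * \<tau>"
  proof -
    have "(\<Sum>j\<in>UNIV. 2 * ((a + rlin b) * (y j * y j)) + y j * (u j + rlin (h j)) + y j * (u j + rlin (h j)))
        = 2 * ((a + rlin b) * (\<Sum>j\<in>UNIV. y j * y j)) + 2 * ((\<Sum>j\<in>UNIV. y j * u j) + (\<Sum>j\<in>UNIV. y j * rlin (h j)))"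
      by (simp add: sum.distrib sum_distrib_left distrib_left)
    moreover have "(\<Sum>j\<in>UNIV. 2 * ((a + rlin b) * (y j * y j)) + y j * (u j + rlin (h j)) + y j * (u j + rlin (h j))) = 4 * \<tau>"
      unfolding eq by simp
    ultimately show ?thesis by (simp add: sum_y_sq hyy yu)
  qed
  have c: "2 * ((a + rlin b) * y l) + (u l + rlin (h l)) + y l * rlin u = y l * \<tau>" for l
  proof -
    have "(\<Sum>j\<in>UNIV. y j * (2 * ((a + rlin b) * (y j * y l)) + y j * (u l + rlin (h l)) + y l * (u j + rlin (h j))))
        = 2 * ((a + rlin b) * y l) * (\<Sum>j\<in>UNIV. y j * y j) + (u l + rlin (h l)) * (\<Sum>j\<in>UNIV. y j * y j)
          + y l * ((\<Sum>j\<in>UNIV. y j * u j) + (\<Sum>j\<in>UNIV. y j * rlin (h j)))"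
      by (simp add: sum.distrib sum_distrib_left distrib_left algebra_simps)
    then show ?thesis unfolding eq by (simp add: sum_y_sq hyy yu if_distrib cong: if_cong)
  qed
  \<comment> \<open>A second contraction with y has the same left-hand side as the trace, but gives
    \<tau> in place of 4 \<tau>; hence \<tau> = 0.\<close>
  have "2 * (a + rlin b) + 2 * rlin u = \<tau>"
  proof -
    have "(\<Sum>l\<in>UNIV. y l * (2 * ((a + rlin b) * y l) + (u l + rlin (h l)) + y l * rlin u))
        = 2 * ((a + rlin b) * (\<Sum>l\<in>UNIV. y l * y l)) + ((\<Sum>l\<in>UNIV. y l * u l) + (\<Sum>l\<in>UNIV. y l * rlin (h l)))
          + rlin u * (\<Sum>l\<in>UNIV. y l * y l)"
      by (simp add: sum.distrib sum_distrib_left distrib_left algebra_simps)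
    moreover have "(\<Sum>l\<in>UNIV. y l * (y l * \<tau>)) = \<tau>"
      using sum_y_sq by (simp add: mult.assoc[symmetric] sum_distrib_right[symmetric])
    ultimately show ?thesis unfolding c by (simp add: sum_y_sq hyy yu)
  qed
  with tr have "3 * \<tau> = 0" by (simp add: algebra_simps)
  then have \<tau>: "\<tau> = 0" unfolding numeral_mult_cancel .
  with tr have "2 * (a + rlin b + rlin u) = 0" by (simp add: algebra_simps)
  then have abu: "a + rlin b + rlin u = 0" unfolding numeral_mult_cancel .
  have uh: "u l + rlin (h l) = rlin u * y l" for l
  proof -
    have "u l + rlin (h l) - rlin u * y l = 2 * ((a + rlin b) * y l) + (u l + rlin (h l)) + y l * rlin u - 2 * ((a + rlin b + rlin u) * y l)"
      by (simp add: algebra_simps)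
    then show ?thesis unfolding c \<tau> abu by simp
  qed
  \<comment> \<open>By \<open>uh\<close>, an affine function equals a quadratic one. Evaluating
    \<Delta>_S on both sides leaves an affine relation.\<close>
  have "6 * u l + rlin (\<lambda>i. 5 * h l i) = 0" for l
  proof -
    have "lapS (u i * (y i * y l)) = - 8 * (u i * (y i * y l)) + (if i = l then 2 * u i else 0)" for i
      by (simp add: lapS_radial_mult r lapS_yy) (simp add: algebra_simps)
    then have "lapS (rlin u * y l) = - 8 * (rlin u * y l) + 2 * u l"
      by (simp add: rlin_def sum_distrib_right mult.assoc lapS_sum sum.distrib sum_distrib_left sum_subtractf sum_negf)
    moreover have "lapS (rlin u * y l) = - 3 * rlin (h l)"
      unfolding uh[symmetric] by (simp add: lapS_radial r lapS_rlin rlin_mult)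
    ultimately have "- 3 * rlin (h l) = - 8 * (u l + rlin (h l)) + 2 * u l"
      unfolding uh by simp
    moreover have "rlin (\<lambda>i. 5 * h l i) = 5 * rlin (h l)" by (simp add: rlin_mult)
    ultimately show ?thesis by (simp add: algebra_simps)
  qed
  from radial_affine_eq_0[OF _ _ this] have "6 * u l = 0" "5 * h l i = 0" for l i
    using r by auto
  then show u0: "u i = 0" and "h i j = 0" for i j unfolding numeral_mult_cancel by auto
  have "a + rlin b = 0" using abu by (simp add: u0 rlin_def)
  from radial_affine_eq_0[OF r(1,2) this] show "a = 0" "b i = 0" by auto
qed

text \<open>H itself cancels by antisymmetry and only its t-derivative survives. The resulting shape
  is that of \<open>radial_trace_free_part_eq_0\<close>; it also exhibits
  \<open>conf_killing V\<close> as a symmetric product with y up to a multiple of the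
  identity.\<close>

lemma conf_killing_radial_coefficients:
  assumes V: "\<And>l. V l = ex 1 * (F0 * y l + rlin F1 * y l + G l + rlin (H l))"
    and r: "radial F0" "\<And>i. radial (F1 i)" "\<And>i. radial (G i)" "\<And>i j. radial (H i j)" "\<And>i j. H i j = - H j i"
  shows "conf_killing V j l = 2 * ((eul F0 + rlin (\<lambda>i. eul (F1 i) - F1 i)) * (y j * y l))
      + y j * (G l + eul (G l) + F1 l + rlin (\<lambda>i. eul (H l i)))
      + y l * (G j + eul (G j) + F1 j + rlin (\<lambda>i. eul (H j i)))
      - (if j = l then cst (1/2) * (\<Sum>i\<in>UNIV. D i (V i)) - 2 * (F0 + rlin F1) else 0)"
proof -
  have D1: "D j (ex 1 * f) = y j * f + ex 1 * D j f" for j f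
    by (simp add: D_mult D_ex y_def)
  have "D j (V l) = (eul F0 + rlin (\<lambda>i. eul (F1 i) - F1 i)) * (y j * y l) + (if j = l then F0 + rlin F1 else 0)
      + F1 j * y l + y j * (G l + eul (G l)) + y j * rlin (\<lambda>i. eul (H l i)) + H l j" for j l
  proof -
    have "ex 1 * D j (F0 * y l) = (ex 1 * D j F0) * y l + F0 * (ex 1 * D j (y l))"
      "ex 1 * D j (rlin F1 * y l) = (ex 1 * D j (rlin F1)) * y l + rlin F1 * (ex 1 * D j (y l))"
      by (simp_all add: D_mult algebra_simps)
    moreover have "rlin (\<lambda>i. eul (F1 i) - F1 i) = rlin (\<lambda>i. eul (F1 i)) - rlin F1"
      by (simp add: rlin_diff)
    ultimately show ?thesis
      unfolding V D1 D_add distrib_left[of "ex 1"]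
      by (simp add: ex_1_D_radial ex_1_D_rlin ex_1_D_y r(1-4) eul_rlin) (simp add: algebra_simps)
  qed
  moreover have "H l j + H j l = 0" using r(5)[of l j] by simp
  ultimately show ?thesis
    unfolding conf_killing_def by (auto simp: algebra_simps)
qed

text \<open>The coefficients satisfy ordinary differential equations in t: F0 and H are constant, F1
  is a constant times e^t, and e^t G + e^{2t} p/2 is constant. These constants are the parameters of
  the dilation, the rotations, the special conformal fields and the translations.\<close>

lemma conf_killing_radial_solution:
  assumes V: "\<And>l. V l = ex 1 * (F0 * y l + rlin F1 * y l + G l + rlin (H l))"
    and r: "radial F0" "\<And>i. radial (F1 i)" "\<And>i. radial (G i)" "\<And>i j. radial (H i j)" "\<And>i j. H i j = - H j i"
    and K: "\<And>j l. conf_killing V j l = 0"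
  obtains f p c h where "\<And>i j. h i j = - h j i"
    "\<And>l. V l = cst f * X l + (\<Sum>i\<in>UNIV. cst (h l i) * X i)
      + ((\<Sum>i\<in>UNIV. cst (p i) * X i) * (2 * X l) - cst (p l) * ex 2) + cst (c l)"
proof -
  define u where "u = (\<lambda>l. G l + eul (G l) + F1 l)"
  have e: "2 * ((eul F0 + rlin (\<lambda>i. eul (F1 i) - F1 i)) * (y j * y l))
      + y j * (u l + rlin (\<lambda>i. eul (H l i))) + y l * (u j + rlin (\<lambda>i. eul (H j i)))
      = (if j = l then cst (1/2) * (\<Sum>i\<in>UNIV. D i (V i)) - 2 * (F0 + rlin F1) else 0)" for j l
    using conf_killing_radial_coefficients[OF V r, of j l] unfolding K u_def by simp
  have eH: "eul (H i j) = - eul (H j i)" for i j by (subst r(5)) simp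
  have ru: "radial (u i)" for i by (simp add: u_def r(1-4))
  note z' = radial_trace_free_part_eq_0[where h = "\<lambda>i j. eul (H i j)", OF _ _ ru _ eH e]
  have z: "eul F0 = 0" "eul (F1 i) - F1 i = 0" "u i = 0" "eul (H i j) = 0" for i j
    by (rule z'; simp add: r(1-4))+
  obtain f where f: "F0 = cst f" using radial_eul_0_imp_cst[OF r(1) z(1)] by blast
  have "\<forall>i j. \<exists>c. H i j = cst c" using radial_eul_0_imp_cst[OF r(4) z(4)] by blast
  then obtain h where h: "\<And>i j. H i j = cst (h i j)" by metis
  have "eul (ex (-1) * F1 i) = 0" for i using z(2)[of i] by (simp add: eul_mult eul_ex cst_hom)
  then have "\<forall>i. \<exists>c. ex (-1) * F1 i = cst c" using radial_eul_0_imp_cst[of "ex (-1) * F1 _"] r(2) by auto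
  then obtain p where "\<And>i. ex (-1) * F1 i = cst (p i)" by metis
  then have p: "F1 i = ex 1 * cst (p i)" for i by (metis (no_types) ex_mult' add.right_inverse ex_0 mult_1)
  have "eul (ex 1 * G i + cst (1/2) * (ex 2 * cst (p i))) = 0" for i
  proof -
    have "cst (1/2) * (2 * f) = f" for f using cst_inverse[of 2 f] by (simp add: inverse_eq_divide)
    moreover have "eul (cst (1/2) * (ex 2 * cst (p i))) = cst (1/2) * (2 * (ex 2 * cst (p i)))"
      by (simp add: eul_mult eul_ex)
    ultimately have "eul (cst (1/2) * (ex 2 * cst (p i))) = ex 2 * cst (p i)" by (simp only:)
    then have "eul (ex 1 * G i + cst (1/2) * (ex 2 * cst (p i))) = ex 1 * (G i + eul (G i)) + ex 2 * cst (p i)"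
      by (simp only: eul_add eul_mult[of "ex 1"]) (simp add: eul_ex distrib_left)
    also have "\<dots> = ex 1 * u i" by (simp add: u_def p distrib_left ex_mult')
    finally show ?thesis by (simp add: z(3))
  qed
  then have "\<forall>i. \<exists>c. ex 1 * G i + cst (1/2) * (ex 2 * cst (p i)) = cst c"
    using radial_eul_0_imp_cst[of "ex 1 * G _ + cst (1/2) * (ex 2 * cst (p _))"] r(3) by auto
  then obtain c where "\<And>i. ex 1 * G i + cst (1/2) * (ex 2 * cst (p i)) = cst (c i)" by metis
  then have G: "ex 1 * G i = cst (c i) - cst (p i / 2) * ex 2" for i
    using cst_hom(2)[of "1/2" "p i"] by (simp add: eq_diff_eq mult_ac)
  show thesis
  proof (rule that[of h f "\<lambda>i. p i / 2" c])
    show "h i j = - h j i" for i j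
    proof -
      have "cst (h i j + h j i) = 0" using r(5)[of i j] by (simp add: h cst_hom(1))
      then show ?thesis by (simp add: eq_neg_iff_add_eq_0)
    qed
    fix l
    have "cst (p i) = 2 * cst (p i / 2)" for i using cst_hom(2)[of 2 "p i / 2"] by simp
    then have "(\<Sum>i\<in>UNIV. cst (p i) * X i) * X l = (\<Sum>i\<in>UNIV. cst (p i / 2) * X i) * (2 * X l)"
      by (simp add: sum_distrib_left sum_distrib_right mult_ac)
    moreover have "V l = F0 * (ex 1 * y l) + (\<Sum>i\<in>UNIV. cst (p i) * (ex 1 * y i)) * (ex 1 * y l) + ex 1 * G l
        + (\<Sum>i\<in>UNIV. H l i * (ex 1 * y i))"
      unfolding V by (simp add: rlin_def p sum_distrib_left sum_distrib_right distrib_left mult_ac)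
    ultimately show "V l = cst f * X l + (\<Sum>i\<in>UNIV. cst (h l i) * X i)
      + ((\<Sum>i\<in>UNIV. cst (p i / 2) * X i) * (2 * X l) - cst (p l / 2) * ex 2) + cst (c l)"
      unfolding ex_1_y G f h by (simp add: algebra_simps)
  qed
qed

text \<open>On a component of degree k, (E - d)^n for the Euler field E is multiplication by (k -
  d)^n, which is nonzero unless k = d. The three degrees are separated by applying E twice
  more.\<close>

lemma homogeneous_components_zero:
  assumes "nil d n (a + b + c)" "eul a = 0" "eul b = b" "eul c = 2 * c"
  shows "d \<noteq> 0 \<Longrightarrow> a = 0" "d \<noteq> 1 \<Longrightarrow> b = 0" "d \<noteq> 2 \<Longrightarrow> c = 0"
proof -
  have s: "(shift_eul d ^^ n) f = cst ((k - d) ^ n) * f" if "eul f = cst k * f" for f k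
  proof (induction n)
    case (Suc n)
    then show ?case
      by (simp add: shift_eul_cst_mult) (simp add: shift_eul_def that cst_hom algebra_simps)
  qed simp
  define \<alpha> \<beta> \<gamma> where "\<alpha> = cst ((0 - d) ^ n) * a" "\<beta> = cst ((1 - d) ^ n) * b" "\<gamma> = cst ((2 - d) ^ n) * c"
  have 0: "\<alpha> + \<beta> + \<gamma> = 0"
    using assms s[of a 0] s[of b 1] s[of c 2]
    by (simp add: nil_def shift_eul_funpow_add \<alpha>_\<beta>_\<gamma>_def)
  have e: "eul \<alpha> = 0" "eul \<beta> = \<beta>" "eul \<gamma> = 2 * \<gamma>"
    by (simp_all add: \<alpha>_\<beta>_\<gamma>_def eul_mult assms mult_ac)
  have 1: "\<beta> + 2 * \<gamma> = 0" using arg_cong[OF 0, of eul] by (simp add: e)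
  have "\<beta> + 4 * \<gamma> = 0" using arg_cong[OF 1, of eul] by (simp add: e)
  moreover have "2 * \<gamma> = (\<beta> + 4 * \<gamma>) - (\<beta> + 2 * \<gamma>)" by simp
  ultimately have "2 * \<gamma> = 0" using 1 by simp
  then have \<gamma>: "\<gamma> = 0" unfolding numeral_mult_cancel .
  then have \<beta>: "\<beta> = 0" using 1 by simp
  then have \<alpha>: "\<alpha> = 0" using 0 \<gamma> by simp
  show "d \<noteq> 0 \<Longrightarrow> a = 0" using \<alpha> by (simp add: \<alpha>_\<beta>_\<gamma>_def cst_mult_cancel)
  show "d \<noteq> 1 \<Longrightarrow> b = 0" using \<beta> by (simp add: \<alpha>_\<beta>_\<gamma>_def cst_mult_cancel)
  show "d \<noteq> 2 \<Longrightarrow> c = 0" using \<gamma> by (simp add: \<alpha>_\<beta>_\<gamma>_def cst_mult_cancel)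
qed

lemma conf_killing_cases:
  fixes V :: "4 \<Rightarrow> sfun"
  assumes V: "\<And>l. V l = ex 1 * (F0 * y l + rlin F1 * y l + G l + rlin (H l))"
    and r: "radial F0" "\<And>i. radial (F1 i)" "\<And>i. radial (G i)" "\<And>i j. radial (H i j)" "\<And>i j. H i j = - H j i"
    and K: "\<And>j l. conf_killing V j l = 0" and nil: "\<And>l. nil (\<beta> + 1) n (V l)"
  obtains (zero) "\<And>l. V l = 0"
  | (rotation) f h where "\<beta> = 0" "\<And>i j. h i j = - h j i" "\<And>l. V l = cst f * X l + (\<Sum>i\<in>UNIV. cst (h l i) * X i)"
  | (special) p where "\<beta> = 1" "\<And>l. V l = (\<Sum>i\<in>UNIV. cst (p i) * X i) * (2 * X l) - cst (p l) * ex 2"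
  | (translation) c where "\<beta> = -1" "\<And>l. V l = cst (c l)"
proof -
  obtain f p c h where h: "\<And>i j. h i j = - h j i" and
    V': "\<And>l. V l = cst f * X l + (\<Sum>i\<in>UNIV. cst (h l i) * X i)
      + ((\<Sum>i\<in>UNIV. cst (p i) * X i) * (2 * X l) - cst (p l) * ex 2) + cst (c l)"
    by (rule conf_killing_radial_solution[OF V r K]) (rule that)
  define V1 V2 where "V1 = (\<lambda>l. cst f * X l + (\<Sum>i\<in>UNIV. cst (h l i) * X i))"
    "V2 = (\<lambda>l. (\<Sum>i\<in>UNIV. cst (p i) * X i) * (2 * X l) - cst (p l) * ex 2)"
  have e: "eul (cst (c l)) = 0" "eul (V1 l) = V1 l" "eul (V2 l) = 2 * V2 l" for l
    by (simp_all add: V1_V2_def eul_mult eul_ex algebra_simps)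
  have "nil (\<beta> + 1) n (cst (c l) + V1 l + V2 l)" for l
    using nil[of l] unfolding V' V1_V2_def by (simp add: add_ac)
  note z = homogeneous_components_zero[OF this e]
  have V3: "V l = cst (c l) + V1 l + V2 l" for l unfolding V' V1_V2_def by (simp add: add_ac)
  consider "\<beta> = 0" | "\<beta> = 1" | "\<beta> = -1" | "\<beta> \<noteq> 0" "\<beta> \<noteq> 1" "\<beta> \<noteq> -1" by blast
  then show thesis
  proof cases
    case 1
    then have "V l = V1 l" for l using z(1,3)[of l] by (simp add: V3)
    then show thesis using rotation[OF 1 h] by (simp add: V1_V2_def)
  next
    case 2
    then have "V l = V2 l" for l using z(1,2)[of l] by (simp add: V3)
    then show thesis using special[OF 2] by (simp add: V1_V2_def)
  next
    case 3
    then have "V l = cst (c l)" for l using z(2,3)[of l] by (simp add: V3)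
    then show thesis using translation[OF 3] by blast
  next
    case 4
    then have "V l = 0" for l using z[of l] by (simp add: V3 eq_neg_iff_add_eq_0)
    then show thesis using zero by blast
  qed
qed

section \<open>The equation for the Weyl tensor\<close>

subsection \<open>Massless fields\<close>

text \<open>In spinor notation, \<open>wirtP A f\<close> and \<open>wirtQ A f\<close> are the components of the derivative of \<open>f\<close> with
  primed index \<open>A\<close>, and \<open>massless n \<phi>\<close> is the equation of a massless field with \<open>n\<close> unprimed indices.
  All operators are complex linear combinations of the \<open>D i\<close>.\<close>

definition imu :: sfun where "imu = cst \<i>"

lemma imu_sq: "imu * imu = - 1" "imu * (imu * f) = - f"
  by (simp_all add: imu_def mult.assoc[symmetric] flip: cst_hom(2))

lemma D_imu [simp]: "D i imu = 0"
  by (simp add: imu_def)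

definition wirtP :: "bool \<Rightarrow> sfun \<Rightarrow> sfun" where
  "wirtP A f = (if A then D 1 f - imu * D 2 f else D 3 f + imu * D 4 f)"

definition wirtQ :: "bool \<Rightarrow> sfun \<Rightarrow> sfun" where
  "wirtQ A f = (if A then imu * D 4 f - D 3 f else D 1 f + imu * D 2 f)"

text \<open>The coordinates in the same spinor components. They form a two by two matrix with
  determinant |x|^2, see \<open>coord_sq\<close>.\<close>

definition coordP :: "bool \<Rightarrow> sfun" where
  "coordP A = (if A then X 1 - imu * X 2 else X 3 + imu * X 4)"

definition coordQ :: "bool \<Rightarrow> sfun" where
  "coordQ A = (if A then imu * X 4 - X 3 else X 1 + imu * X 2)"

definition massless :: "nat \<Rightarrow> (nat \<Rightarrow> sfun) \<Rightarrow> bool" where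
  "massless n \<phi> \<longleftrightarrow> (\<forall>m\<le>n. lap (\<phi> m) = 0) \<and> (\<forall>m<n. \<forall>A. wirtP A (\<phi> (Suc m)) = wirtQ A (\<phi> m))"

lemma wirt_simps [simp]:
  "wirtP A (f - g) = wirtP A f - wirtP A g" "wirtQ A (f - g) = wirtQ A f - wirtQ A g"
  by (simp_all add: wirtP_def wirtQ_def algebra_simps)

lemma wirt_mult: "wirtP A (f * g) = wirtP A f * g + f * wirtP A g" "wirtQ A (f * g) = wirtQ A f * g + f * wirtQ A g"
  by (simp_all add: wirtP_def wirtQ_def D_mult algebra_simps)

lemma wirt_commute: "wirtP A (wirtQ B f) = wirtQ B (wirtP A f)" "wirtP A (wirtP B f) = wirtP B (wirtP A f)"
  "wirtQ A (wirtQ B f) = wirtQ B (wirtQ A f)"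
  by (simp_all add: wirtP_def wirtQ_def D_mult D_commute[of 2 1] D_commute[of 3 1] D_commute[of 4 1]
      D_commute[of 3 2] D_commute[of 4 2] D_commute[of 4 3] algebra_simps)

lemma wirt_lap: "wirtP True (wirtQ False f) - wirtP False (wirtQ True f) = lap f"
  by (simp add: wirtP_def wirtQ_def lap_def D_mult sum_4 D_commute[of 2 1] D_commute[of 4 3]
      algebra_simps imu_sq)

lemma coord_sq: "coordP True * coordQ False - coordP False * coordQ True = ex 2"
  unfolding sum_X_sq[symmetric] by (simp add: coordP_def coordQ_def sum_4 algebra_simps imu_sq)

lemma wirt_coord: "wirtP A (coordP B) = 0" "wirtQ A (coordQ B) = 0" "wirtP A (coordQ B) + wirtQ A (coordP B) = 0"
  by (cases A; cases B; simp add: wirtP_def wirtQ_def coordP_def coordQ_def D_mult D_X imu_sq algebra_simps)+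

lemma lap_coord: "lap (coordP A * f) = 2 * wirtP A f + coordP A * lap f"
  "lap (coordQ A * f) = 2 * wirtQ A f + coordQ A * lap f"
proof -
  have lX: "lap (X i * f) = 2 * D i f + X i * lap f" for i
  proof -
    have "D k (X i) * D k f = (if k = i then D i f else 0)" for k by (simp add: D_X)
    then show ?thesis by (simp add: lap_mult)
  qed
  have li: "lap (imu * g) = imu * lap g" for g by (simp add: imu_def lap_mult_cst)
  show "lap (coordP A * f) = 2 * wirtP A f + coordP A * lap f"
    "lap (coordQ A * f) = 2 * wirtQ A f + coordQ A * lap f"
    by (simp_all add: coordP_def coordQ_def wirtP_def wirtQ_def distrib_right left_diff_distrib mult.assoc lX li)
      (simp_all add: algebra_simps)
qed

text \<open>Cross-differentiation of the equations for the two values of A gives \<Delta> \<phi> =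
  0, because the derivatives in spinor components have the Laplacian as determinant. For n = 0 there
  is no first order equation to start from.\<close>

lemma masslessI:
  assumes "n > 0" "\<And>m A. m < n \<Longrightarrow> wirtP A (\<phi> (Suc m)) = wirtQ A (\<phi> m)"
  shows "massless n \<phi>"
proof -
  have "lap (\<phi> m) = 0" if "m < n" for m
  proof -
    have "wirtP True (wirtQ False (\<phi> m)) = wirtP False (wirtQ True (\<phi> m))"
      using assms(2)[OF that, symmetric] by (simp add: wirt_commute(2)[of True])
    then show ?thesis using wirt_lap[of "\<phi> m"] by simp
  qed
  moreover have "lap (\<phi> (Suc m)) = 0" if "m < n" for m
  proof -
    have "wirtQ False (wirtP True (\<phi> (Suc m))) = wirtQ True (wirtP False (\<phi> (Suc m)))"
      using assms(2)[OF that] by (simp add: wirt_commute(3)[of True])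
    then show ?thesis using wirt_lap[of "\<phi> (Suc m)"] by (simp add: wirt_commute(1))
  qed
  moreover have "m < n \<or> (\<exists>k<n. m = Suc k)" if "m \<le> n" for m
    using that assms(1) by (cases m) auto
  ultimately have "\<forall>m\<le>n. lap (\<phi> m) = 0" by blast
  then show ?thesis
    using assms(2) by (auto simp: massless_def)
qed

text \<open>Contracting one index with \<open>x\<close> turns a massless field into one with an unprimed index less and
  raises the degree by one, until the degree is in the range of the removable singularity theorem above.\<close>

lemma massless_zero:
  assumes "massless n \<phi>" "\<And>m. m \<le> n \<Longrightarrow> nil d N (\<phi> m)" "- 2 - of_nat n < Re d" "Re d < 0" "m \<le> n"
  shows "\<phi> m = 0"
  using assms
proof (induction n arbitrary: \<phi> d m)
  case 0
  then show ?case using harmonic_nil_zero[of "\<phi> 0" d N] by (simp add: massless_def)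
next
  case (Suc n)
  show ?case
  proof (cases "Re d > -2")
    case True
    then show ?thesis using Suc.prems harmonic_nil_zero[of "\<phi> m" d N] by (simp add: massless_def)
  next
    case False
    define \<psi> where "\<psi> = (\<lambda>A m. coordP A * \<phi> (Suc m) - coordQ A * \<phi> m)"
    have "\<psi> A m = 0" if "m \<le> n" for A m
    proof (rule Suc.IH[of "\<psi> A" "d + 1"])
      have 1: "wirtP B (\<phi> (Suc m)) = wirtQ B (\<phi> m)" if "m < Suc n" for m B
        using Suc.prems(1) that by (simp add: massless_def)
      have "lap (\<psi> A m) = 0" if "m \<le> n" for m
      proof -
        have "lap (\<psi> A m) = 2 * (wirtP A (\<phi> (Suc m)) - wirtQ A (\<phi> m)) + coordP A * lap (\<phi> (Suc m)) - coordQ A * lap (\<phi> m)"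
          unfolding \<psi>_def by (simp add: lap_coord algebra_simps)
        then show ?thesis using that Suc.prems(1) by (simp add: massless_def)
      qed
      moreover have "wirtP B (\<psi> A (Suc m)) = wirtQ B (\<psi> A m)" if "m < n" for m B
      proof -
        have "wirtP B (\<psi> A (Suc m)) - wirtQ B (\<psi> A m)
            = wirtP B (coordP A) * \<phi> (Suc (Suc m)) - (wirtP B (coordQ A) + wirtQ B (coordP A)) * \<phi> (Suc m)
              + wirtQ B (coordQ A) * \<phi> m + coordP A * (wirtP B (\<phi> (Suc (Suc m))) - wirtQ B (\<phi> (Suc m)))
              - coordQ A * (wirtP B (\<phi> (Suc m)) - wirtQ B (\<phi> m))"
          unfolding \<psi>_def by (simp add: wirt_mult algebra_simps)
        then show ?thesis unfolding wirt_coord using 1[of m B] 1[of "Suc m" B] that by simp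
      qed
      ultimately show "massless n (\<psi> A)" by (simp add: massless_def)
      show "nil (d + 1) N (\<psi> A m)" if "m \<le> n" for m
      proof -
        have nilc: "nil (d + 1) N (coordP A * f)" "nil (d + 1) N (coordQ A * f)" if "nil d N f" for f
          unfolding coordP_def coordQ_def
          using nil_X_mult[OF that] nil_cst_mult[OF nil_X_mult[OF that], of \<i>]
          by (auto simp: distrib_right left_diff_distrib mult.assoc imu_def intro!: nil_add nil_diff)
        show ?thesis unfolding \<psi>_def using that by (intro nil_diff nilc Suc.prems(2)) auto
      qed
    qed (use that Suc.prems False in auto)
    then have eq: "coordP A * \<phi> (Suc m) = coordQ A * \<phi> m" if "m \<le> n" for m A
      using that by (simp add: \<psi>_def)
    have "ex 2 * \<phi> m = 0" if "m \<le> n" for m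
    proof -
      have "ex 2 * \<phi> m = coordP True * (coordQ False * \<phi> m) - coordP False * (coordQ True * \<phi> m)"
        unfolding coord_sq[symmetric] by (simp add: algebra_simps)
      then show ?thesis unfolding eq[OF that, symmetric] by (simp add: mult.left_commute)
    qed
    moreover have "ex 2 * \<phi> (Suc m) = 0" if "m \<le> n" for m
    proof -
      have "ex 2 * \<phi> (Suc m) = coordQ False * (coordP True * \<phi> (Suc m)) - coordQ True * (coordP False * \<phi> (Suc m))"
        unfolding coord_sq[symmetric] by (simp add: algebra_simps)
      then show ?thesis unfolding eq[OF that] by (simp add: mult.left_commute)
    qed
    moreover have "m \<le> n \<or> (\<exists>k\<le>n. m = Suc k)" using Suc.prems(5) by (cases m) auto
    ultimately show ?thesis by (auto simp: ex_cancel)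
  qed
qed

lemma nil_wirt: "nil d N f \<Longrightarrow> nil (d - 1) N (wirtP A f)" "nil d N f \<Longrightarrow> nil (d - 1) N (wirtQ A f)"
  unfolding wirtP_def wirtQ_def imu_def
  by (auto intro!: nil_add nil_diff nil_cst_mult nil_D)

text \<open>The field \<psi> has three unprimed indices and degree d - 1 between -5 and -1, within
  the range from -2 - 3 to 0 of \<open>massless_zero\<close>. After it has vanished, \<phi> is
  massless with four indices and degree between -4 and 0, within the range from -6 to 0.\<close>

lemma second_order_massless_zero:
  fixes \<phi> :: "nat \<Rightarrow> sfun"
  defines "\<psi> \<equiv> \<lambda>A m. wirtP A (\<phi> (Suc m)) - wirtQ A (\<phi> m)"
  assumes eq: "\<And>A B m. m < 3 \<Longrightarrow> wirtP B (\<psi> A (Suc m)) = wirtQ B (\<psi> A m)"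
    and nil: "\<And>m. m \<le> 4 \<Longrightarrow> nil d N (\<phi> m)" and d: "-4 < Re d" "Re d < 0" and m: "m \<le> 4"
  shows "\<phi> m = 0"
proof -
  have "\<psi> A m = 0" if "m \<le> 3" for A m
  proof (rule massless_zero[where n = 3 and d = "d - 1" and N = N])
    show "massless 3 (\<psi> A)" by (rule masslessI) (use eq in auto)
    show "nil (d - 1) N (\<psi> A m)" if "m \<le> 3" for m
      unfolding \<psi>_def using that by (intro nil_diff nil_wirt nil) auto
  qed (use that d in auto)
  then have "massless 4 \<phi>"
    by (intro masslessI) (auto simp: \<psi>_def)
  then show ?thesis
    by (rule massless_zero[where n = 4 and d = d and N = N]) (use nil d m in auto)
qed

subsection \<open>Anti-self-dual Weyl tensors\<close>

text \<open>\<open>asd_form p q r\<close> is \<open>p (e\<^sub>1\<^sub>2 - e\<^sub>3\<^sub>4) + q (e\<^sub>1\<^sub>3 + e\<^sub>2\<^sub>4) + r (e\<^sub>1\<^sub>4 - e\<^sub>2\<^sub>3)\<close>.\<close>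

definition asd_form :: "'a::comm_ring_1 \<Rightarrow> 'a \<Rightarrow> 'a \<Rightarrow> 4 \<Rightarrow> 4 \<Rightarrow> 'a" where
  "asd_form p q r i j =
    (if (i, j) = (1, 2) \<or> (i, j) = (4, 3) then p else if (i, j) = (2, 1) \<or> (i, j) = (3, 4) then - p
     else if (i, j) = (1, 3) \<or> (i, j) = (2, 4) then q else if (i, j) = (3, 1) \<or> (i, j) = (4, 2) then - q
     else if (i, j) = (1, 4) \<or> (i, j) = (3, 2) then r else if (i, j) = (4, 1) \<or> (i, j) = (2, 3) then - r
     else 0)"

lemma asd_form_values:
  "asd_form p q r 1 2 = p" "asd_form p q r 2 1 = - p" "asd_form p q r 3 4 = - p" "asd_form p q r 4 3 = p"
  "asd_form p q r 1 3 = q" "asd_form p q r 3 1 = - q" "asd_form p q r 2 4 = q" "asd_form p q r 4 2 = - q"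
  "asd_form p q r 1 4 = r" "asd_form p q r 4 1 = - r" "asd_form p q r 2 3 = - r" "asd_form p q r 3 2 = r"
  "asd_form p q r i i = 0"
  by (auto simp: asd_form_def)

lemma asd_form_0: "asd_form 0 0 0 i j = 0"
  by (simp add: asd_form_def)

text \<open>A traceless symmetric three by three matrix in the basis of anti-self-dual forms. With
  five explicit parameters, algebraic identities can be checked by enumerating the indices.\<close>

definition asd_weyl :: "(4 \<Rightarrow> 4 \<Rightarrow> 4 \<Rightarrow> 4 \<Rightarrow> 'a::comm_ring_1) \<Rightarrow> bool" where
  "asd_weyl U \<longleftrightarrow> (\<exists>a b c d e. U = (\<lambda>i j k l. asd_form
     (asd_form a b c k l) (asd_form b d e k l) (asd_form c e (- a - d) k l) i j))"

lemma asd_form_antisym: "asd_form p q r j i = - asd_form p q r i j"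
proof -
  have "\<forall>i j. asd_form p q r j i = - asd_form p q r i j"
    by (simp add: forall_4 asd_form_values)
  then show ?thesis by blast
qed

lemma asd_weyl_antisym: "asd_weyl U \<Longrightarrow> U j i k l = - U i j k l"
  and asd_weyl_diag: "asd_weyl U \<Longrightarrow> U i i k l = 0"
  by (auto simp: asd_weyl_def asd_form_values asd_form_antisym[of _ _ _ j i])

lemma asd_weyl_pair:
  assumes "asd_weyl U"
  shows "U k l i j = U i j k l"
proof -
  have "\<forall>i j k l. asd_form (asd_form a b c k l) (asd_form b d e k l) (asd_form c e f k l) i j
      = asd_form (asd_form a b c i j) (asd_form b d e i j) (asd_form c e f i j) k l" for a b c d e f :: 'a
    by (simp add: forall_4 asd_form_values)
  then show ?thesis using assms by (auto simp: asd_weyl_def)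
qed

lemma asd_weyl_antisym2: "asd_weyl U \<Longrightarrow> U i j l k = - U i j k l"
  and asd_weyl_diag2: "asd_weyl U \<Longrightarrow> U i j k k = 0"
  using asd_weyl_pair[of U] asd_weyl_antisym[of U] asd_weyl_diag[of U] by metis+

lemma asd_weyl_trace:
  assumes "asd_weyl U"
  shows "(\<Sum>i\<in>UNIV. U i j i l) = 0"
proof -
  have "\<forall>j l. (\<Sum>i\<in>UNIV. asd_form (asd_form a b c i l) (asd_form b d e i l) (asd_form c e (- a - d) i l) i j) = 0"
    for a b c d e :: 'a
    by (simp add: forall_4 sum_4 asd_form_values)
  then show ?thesis using assms by (auto simp: asd_weyl_def)
qed

lemma asd_weyl_trace_snd:
  assumes U: "asd_weyl U"
  shows "(\<Sum>i\<in>UNIV. U j i k i) = 0"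
proof -
  have "(\<Sum>i\<in>UNIV. U j i k i) = (\<Sum>i\<in>UNIV. U i j i k)"
    using asd_weyl_antisym[OF U] asd_weyl_antisym2[OF U] by (intro sum.cong refl) (metis add.inverse_inverse)
  then show ?thesis by (simp add: asd_weyl_trace[OF U])
qed

section \<open>Contractions with an anti-self-dual Weyl tensor\<close>

definition contr :: "(4 \<Rightarrow> 4 \<Rightarrow> 4 \<Rightarrow> 4 \<Rightarrow> 'a::comm_ring_1) \<Rightarrow> (4 \<Rightarrow> 4 \<Rightarrow> 4 \<Rightarrow> 4 \<Rightarrow> 'a) \<Rightarrow> 'a" where
  "contr U M = (\<Sum>i\<in>UNIV. \<Sum>j\<in>UNIV. \<Sum>k\<in>UNIV. \<Sum>l\<in>UNIV. U i j k l * M i j k l)"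

lemma contr_add: "contr U (\<lambda>i j k l. M i j k l + N i j k l) = contr U M + contr U N"
  and contr_diff: "contr U (\<lambda>i j k l. M i j k l - N i j k l) = contr U M - contr U N"
  and contr_mult: "contr U (\<lambda>i j k l. c * M i j k l) = c * contr U M"
  by (simp_all add: contr_def distrib_left right_diff_distrib sum.distrib sum_subtractf sum_negf
      sum_distrib_left mult.left_commute)

lemma contr_swap_pairs:
  assumes "asd_weyl U"
  shows "contr U M = contr U (\<lambda>i j k l. M k l i j)"
proof -
  have "contr U M = (\<Sum>i\<in>UNIV. \<Sum>j\<in>UNIV. \<Sum>k\<in>UNIV. \<Sum>l\<in>UNIV. U k l i j * M i j k l)"
    unfolding contr_def by (intro sum.cong refl) (simp add: asd_weyl_pair[OF assms])
  also have "\<dots> = (\<Sum>i\<in>UNIV. \<Sum>k\<in>UNIV. \<Sum>j\<in>UNIV. \<Sum>l\<in>UNIV. U k l i j * M i j k l)"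
    by (intro sum.cong refl sum.swap)
  also have "\<dots> = (\<Sum>k\<in>UNIV. \<Sum>i\<in>UNIV. \<Sum>j\<in>UNIV. \<Sum>l\<in>UNIV. U k l i j * M i j k l)"
    by (rule sum.swap)
  also have "\<dots> = (\<Sum>k\<in>UNIV. \<Sum>i\<in>UNIV. \<Sum>l\<in>UNIV. \<Sum>j\<in>UNIV. U k l i j * M i j k l)"
    by (intro sum.cong refl sum.swap)
  also have "\<dots> = (\<Sum>k\<in>UNIV. \<Sum>l\<in>UNIV. \<Sum>i\<in>UNIV. \<Sum>j\<in>UNIV. U k l i j * M i j k l)"
    by (intro sum.cong refl sum.swap)
  finally show ?thesis by (simp add: contr_def)
qed

lemma contr_swap_12:
  assumes "asd_weyl U"
  shows "contr U M = - contr U (\<lambda>i j k l. M j i k l)"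
proof -
  have "contr U M = (\<Sum>j\<in>UNIV. \<Sum>i\<in>UNIV. \<Sum>k\<in>UNIV. \<Sum>l\<in>UNIV. U i j k l * M i j k l)"
    unfolding contr_def by (rule sum.swap)
  also have "\<dots> = (\<Sum>j\<in>UNIV. \<Sum>i\<in>UNIV. \<Sum>k\<in>UNIV. \<Sum>l\<in>UNIV. - (U j i k l * M i j k l))"
    by (intro sum.cong refl) (subst asd_weyl_antisym[OF assms], simp)
  finally show ?thesis by (simp add: contr_def sum_negf)
qed

lemma contr_swap_34:
  assumes "asd_weyl U"
  shows "contr U M = - contr U (\<lambda>i j k l. M i j l k)"
  using contr_swap_pairs[OF assms, of M] contr_swap_12[OF assms, of "\<lambda>i j k l. M k l i j"]
    contr_swap_pairs[OF assms, of "\<lambda>i j k l. M i j l k"] by simp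

text \<open>Antisymmetry removes deltas within a pair of indices, and the vanishing Ricci
  contraction removes those across the pairs. Trace terms of all kinds therefore disappear under the
  contraction.\<close>

lemma contr_delta:
  assumes U: "asd_weyl U"
  shows "contr U (\<lambda>i j k l. if i = j then M i j k l else 0) = 0"
    and "contr U (\<lambda>i j k l. if k = l then M i j k l else 0) = 0"
    and "contr U (\<lambda>i j k l. if i = k then N j l else 0) = 0"
    and "contr U (\<lambda>i j k l. if k = j then N i l else 0) = 0"
    and "contr U (\<lambda>i j k l. if i = l then N k j else 0) = 0"
    and "contr U (\<lambda>i j k l. if j = l then N i k else 0) = 0"
proof -
  show "contr U (\<lambda>i j k l. if i = j then M i j k l else 0) = 0"
    by (auto simp: contr_def asd_weyl_diag[OF U] intro!: sum.neutral)
  show "contr U (\<lambda>i j k l. if k = l then M i j k l else 0) = 0"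
    by (auto simp: contr_def asd_weyl_diag2[OF U] intro!: sum.neutral)
  show 3: "contr U (\<lambda>i j k l. if i = k then N j l else 0) = 0" for N
  proof -
    have "contr U (\<lambda>i j k l. if i = k then N j l else 0)
        = (\<Sum>i\<in>UNIV. \<Sum>j\<in>UNIV. \<Sum>k\<in>UNIV. if i = k then \<Sum>l\<in>UNIV. U i j k l * N j l else 0)"
      unfolding contr_def by (intro sum.cong refl) simp
    also have "\<dots> = (\<Sum>j\<in>UNIV. \<Sum>i\<in>UNIV. \<Sum>l\<in>UNIV. U i j i l * N j l)"
      by simp (rule sum.swap)
    also have "\<dots> = (\<Sum>j\<in>UNIV. \<Sum>l\<in>UNIV. (\<Sum>i\<in>UNIV. U i j i l) * N j l)"
      unfolding sum_distrib_right by (intro sum.cong refl sum.swap)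
    finally show ?thesis by (simp add: asd_weyl_trace[OF U])
  qed
  have 4: "contr U (\<lambda>i j k l. if j = k then N i l else 0) = 0" for N
    using contr_swap_12[OF U, of "\<lambda>i j k l. if j = k then N i l else 0"] 3[of N] by simp
  have "(\<lambda>i j k l. if k = j then N i l else 0) = (\<lambda>(i::4) j k l. if j = k then N i l else 0)"
    by (auto simp: fun_eq_iff)
  from trans[OF arg_cong[OF this, of "contr U"] 4[of N]]
  show "contr U (\<lambda>i j k l. if k = j then N i l else 0) = 0" .
  show "contr U (\<lambda>i j k l. if i = l then N k j else 0) = 0"
    using contr_swap_34[OF U, of "\<lambda>i j k l. if i = l then N k j else 0"] 3[of "\<lambda>j l. N l j"] by simp
  show "contr U (\<lambda>i j k l. if j = l then N i k else 0) = 0"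
    using contr_swap_34[OF U, of "\<lambda>i j k l. if j = l then N i k else 0"] 4[of N] by simp
qed

lemma contr_outer:
  assumes U: "asd_weyl U"
  shows "contr U (\<lambda>i j k l. x i * x j * N k l) = 0"
    and "contr U (\<lambda>i j k l. x k * x l * N i j) = 0"
proof -
  have s: "(\<Sum>k\<in>UNIV. \<Sum>l\<in>UNIV. U i j k l * (x k * x l)) = 0" for i j
    by (simp add: sum_4 asd_weyl_diag2[OF U] asd_weyl_antisym2[OF U, of i j 2 1] asd_weyl_antisym2[OF U, of i j 3 1]
        asd_weyl_antisym2[OF U, of i j 4 1] asd_weyl_antisym2[OF U, of i j 3 2]
        asd_weyl_antisym2[OF U, of i j 4 2] asd_weyl_antisym2[OF U, of i j 4 3] algebra_simps)
  show 2: "contr U (\<lambda>i j k l. x k * x l * N i j) = 0" for N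
  proof -
    have "contr U (\<lambda>i j k l. x k * x l * N i j) = (\<Sum>i\<in>UNIV. \<Sum>j\<in>UNIV. N i j * (\<Sum>k\<in>UNIV. \<Sum>l\<in>UNIV. U i j k l * (x k * x l)))"
      by (simp add: contr_def sum_distrib_left mult_ac)
    then show ?thesis by (simp add: s)
  qed
  show "contr U (\<lambda>i j k l. x i * x j * N k l) = 0"
    using contr_swap_pairs[OF U, of "\<lambda>i j k l. x i * x j * N k l"] 2[of N] by simp
qed

text \<open>By the pair symmetry of U, its contraction with an antisymmetric h over the outer
  indices is antisymmetric in j and k, and so vanishes against x_j x_k.\<close>

lemma contr_antisym:
  fixes U :: "4 \<Rightarrow> 4 \<Rightarrow> 4 \<Rightarrow> 4 \<Rightarrow> 'a::comm_ring_1"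
  assumes U: "asd_weyl U" and h: "\<And>i j. h i j = - h j i" "\<And>i. h i i = 0"
  shows "contr U (\<lambda>i j k l. x j * x k * h l i) = 0"
proof -
  define M where "M = (\<lambda>j k. \<Sum>i\<in>UNIV. \<Sum>l\<in>UNIV. U i j k l * h l i)"
  obtain a b c d e where "U = (\<lambda>i j k l. asd_form
     (asd_form a b c k l) (asd_form b d e k l) (asd_form c e (- a - d) k l) i j)"
    using U by (auto simp: asd_weyl_def)
  then have M: "\<forall>j k. M j k = - M k j" "\<forall>j. M j j = 0"
    unfolding M_def
    by (simp_all add: forall_4 sum_4 asd_form_values h(2) h(1)[of 2 1] h(1)[of 3 1] h(1)[of 4 1] h(1)[of 3 2]
        h(1)[of 4 2] h(1)[of 4 3] algebra_simps)
  have "contr U (\<lambda>i j k l. x j * x k * h l i) = (\<Sum>j\<in>UNIV. \<Sum>k\<in>UNIV. x j * x k * M j k)"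
  proof -
    have "contr U (\<lambda>i j k l. x j * x k * h l i) = (\<Sum>j\<in>UNIV. \<Sum>i\<in>UNIV. \<Sum>k\<in>UNIV. \<Sum>l\<in>UNIV. U i j k l * (x j * x k * h l i))"
      unfolding contr_def by (rule sum.swap)
    also have "\<dots> = (\<Sum>j\<in>UNIV. \<Sum>k\<in>UNIV. \<Sum>i\<in>UNIV. \<Sum>l\<in>UNIV. U i j k l * (x j * x k * h l i))"
      by (intro sum.cong refl sum.swap)
    finally show ?thesis by (simp add: M_def sum_distrib_left mult_ac)
  qed
  also have "\<dots> = 0"
    using M(2) M(1)[rule_format, of 2 1] M(1)[rule_format, of 3 1] M(1)[rule_format, of 4 1]
      M(1)[rule_format, of 3 2] M(1)[rule_format, of 4 2] M(1)[rule_format, of 4 3]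
    by (simp add: sum_4 algebra_simps)
  finally show ?thesis .
qed

subsection \<open>Tensors orthogonal to the image\<close>

text \<open>In terms of representations of \<open>SO(4)\<close>, the tensors \<open>h\<close> in the next definition belong to isotypic
  components that do not occur in the space of anti-self-dual Weyl tensors on the sphere.\<close>

definition low_vector :: "(4 \<Rightarrow> sfun) \<Rightarrow> bool" where
  "low_vector W \<longleftrightarrow> (\<exists>A B C H. radial A \<and> (\<forall>i. radial (B i)) \<and> (\<forall>i. radial (C i)) \<and> (\<forall>i j. radial (H i j))
     \<and> (\<forall>i j. H i j = - H j i)
     \<and> (\<forall>l. W l = A * X l + (\<Sum>m\<in>UNIV. B m * X m) * X l + C l + (\<Sum>m\<in>UNIV. H l m * X m)))"

text \<open>The multiple \<tau> of the identity is arbitrary, because its second derivatives still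
  carry a delta. The class is stable under radial factors, so cut-offs do not leave it.\<close>

definition low_tensor :: "(4 \<Rightarrow> 4 \<Rightarrow> sfun) \<Rightarrow> bool" where
  "low_tensor h \<longleftrightarrow> (\<exists>W \<tau>. low_vector W \<and> (\<forall>j l. h j l = X j * W l + X l * W j + (if j = l then \<tau> else 0)))"

lemma low_vector_mult:
  assumes "radial r" "low_vector W"
  shows "low_vector (\<lambda>l. r * W l)"
proof -
  obtain A B C H where r: "radial A" "\<And>i. radial (B i)" "\<And>i. radial (C i)" "\<And>i j. radial (H i j)"
    "\<And>i j. H i j = - H j i" "\<And>l. W l = A * X l + (\<Sum>m\<in>UNIV. B m * X m) * X l + C l + (\<Sum>m\<in>UNIV. H l m * X m)"
    using assms(2) unfolding low_vector_def by blast
  show ?thesis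
    unfolding low_vector_def
  proof (intro exI conjI allI)
    show "radial (r * A)" "radial (r * B i)" "radial (r * C i)" "radial (r * H i j)" for i j
      using assms(1) r(1-4) by simp_all
    show "r * H i j = - (r * H j i)" for i j by (subst r(5)) simp
    show "r * W l = r * A * X l + (\<Sum>m\<in>UNIV. r * B m * X m) * X l + r * C l + (\<Sum>m\<in>UNIV. r * H l m * X m)" for l
      unfolding r(6) by (simp add: distrib_left sum_distrib_left sum_distrib_right mult.assoc)
  qed
qed

lemma low_vector_add:
  assumes "low_vector V" "low_vector W"
  shows "low_vector (\<lambda>l. V l + W l)"
proof -
  obtain A B C H where r: "radial A" "\<And>i. radial (B i)" "\<And>i. radial (C i)" "\<And>i j. radial (H i j)"
    "\<And>i j. H i j = - H j i" "\<And>l. V l = A * X l + (\<Sum>m\<in>UNIV. B m * X m) * X l + C l + (\<Sum>m\<in>UNIV. H l m * X m)"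
    using assms(1) unfolding low_vector_def by blast
  obtain A' B' C' H' where r': "radial A'" "\<And>i. radial (B' i)" "\<And>i. radial (C' i)" "\<And>i j. radial (H' i j)"
    "\<And>i j. H' i j = - H' j i" "\<And>l. W l = A' * X l + (\<Sum>m\<in>UNIV. B' m * X m) * X l + C' l + (\<Sum>m\<in>UNIV. H' l m * X m)"
    using assms(2) unfolding low_vector_def by blast
  show ?thesis
    unfolding low_vector_def
  proof (intro exI conjI allI)
    show "radial (A + A')" "radial (B i + B' i)" "radial (C i + C' i)" "radial (H i j + H' i j)" for i j
      using r(1-4) r'(1-4) by simp_all
    show "H i j + H' i j = - (H j i + H' j i)" for i j by (subst r(5), subst r'(5)) simp
    show "V l + W l = (A + A') * X l + (\<Sum>m\<in>UNIV. (B m + B' m) * X m) * X l + (C l + C' l) + (\<Sum>m\<in>UNIV. (H l m + H' l m) * X m)" for l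
      unfolding r(6) r'(6) by (simp add: distrib_right sum.distrib)
  qed
qed

lemma low_vector_cj:
  assumes "low_vector W"
  shows "low_vector (\<lambda>l. cj (W l))"
proof -
  obtain A B C H where r: "radial A" "\<And>i. radial (B i)" "\<And>i. radial (C i)" "\<And>i j. radial (H i j)"
    "\<And>i j. H i j = - H j i" "\<And>l. W l = A * X l + (\<Sum>m\<in>UNIV. B m * X m) * X l + C l + (\<Sum>m\<in>UNIV. H l m * X m)"
    using assms unfolding low_vector_def by blast
  show ?thesis
    unfolding low_vector_def
  proof (intro exI conjI allI)
    show "radial (cj A)" "radial (cj (B i))" "radial (cj (C i))" "radial (cj (H i j))" for i j
      using r(1-4) by (simp_all add: radial_cj)
    show "cj (H i j) = - cj (H j i)" for i j by (subst r(5)) simp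
    show "cj (W l) = cj A * X l + (\<Sum>m\<in>UNIV. cj (B m) * X m) * X l + cj (C l) + (\<Sum>m\<in>UNIV. cj (H l m) * X m)" for l
      unfolding r(6) by (simp add: cj_sum)
  qed
qed

lemma low_tensor_mult: "radial r \<Longrightarrow> low_tensor h \<Longrightarrow> low_tensor (\<lambda>j l. r * h j l)"
proof -
  assume r: "radial r" and "low_tensor h"
  then obtain W \<tau> where W: "low_vector W" "\<And>j l. h j l = X j * W l + X l * W j + (if j = l then \<tau> else 0)"
    unfolding low_tensor_def by blast
  have "\<forall>j l. r * h j l = X j * (r * W l) + X l * (r * W j) + (if j = l then r * \<tau> else 0)"
    by (simp add: W(2) algebra_simps)
  then show ?thesis using low_vector_mult[OF r W(1)] unfolding low_tensor_def by blast
qed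

lemma low_tensor_add: "low_tensor g \<Longrightarrow> low_tensor h \<Longrightarrow> low_tensor (\<lambda>j l. g j l + h j l)"
proof -
  assume "low_tensor g" "low_tensor h"
  then obtain V \<sigma> W \<tau> where W: "low_vector V" "\<And>j l. g j l = X j * V l + X l * V j + (if j = l then \<sigma> else 0)"
    "low_vector W" "\<And>j l. h j l = X j * W l + X l * W j + (if j = l then \<tau> else 0)"
    unfolding low_tensor_def by blast
  have "\<forall>j l. g j l + h j l = X j * (V l + W l) + X l * (V j + W j) + (if j = l then \<sigma> + \<tau> else 0)"
    by (simp add: W(2,4) algebra_simps)
  then show ?thesis using low_vector_add[OF W(1,3)] unfolding low_tensor_def by blast
qed

lemma low_tensor_cj: "low_tensor h \<Longrightarrow> low_tensor (\<lambda>j l. cj (h j l))"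
proof -
  assume "low_tensor h"
  then obtain W \<tau> where W: "low_vector W" "\<And>j l. h j l = X j * W l + X l * W j + (if j = l then \<tau> else 0)"
    unfolding low_tensor_def by blast
  have "\<forall>j l. cj (h j l) = X j * cj (W l) + X l * cj (W j) + (if j = l then cj \<tau> else 0)"
    by (simp add: W(2))
  then show ?thesis using low_vector_cj[OF W(1)] unfolding low_tensor_def by blast
qed

lemma D_D_radial:
  assumes "radial A"
  shows "D i (D k A) = (if i = k then ex (-2) * eul A else 0) + X i * X k * (ex (-2) * eul (ex (-2) * eul A))"
proof -
  define p where "p = ex (-2) * eul A"
  have "D k A = X k * p" for k by (simp add: p_def D_radial[OF assms] mult_ac)
  moreover have "D i p = X i * (ex (-2) * eul p)"
    using D_radial[of p i] assms by (simp add: p_def mult_ac)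
  ultimately show ?thesis
    unfolding p_def[symmetric] by (simp add: D_mult D_X mult_ac)
qed

text \<open>After multiplication by x_j, each term of the second derivative contains a delta, a
  product x_i x_j or x_k x_l, or x_j x_k times an antisymmetric array in l and i. The contraction
  with U annihilates each of these.\<close>

lemma contr_D_D_low_vector:
  assumes U: "asd_weyl U" and "low_vector W"
  shows "contr U (\<lambda>i j k l. X j * D i (D k (W l))) = 0"
proof -
  obtain A B C H where r: "radial A" "\<And>i. radial (B i)" "\<And>i. radial (C i)" "\<And>i j. radial (H i j)"
    "\<And>i j. H i j = - H j i" "\<And>l. W l = A * X l + (\<Sum>m\<in>UNIV. B m * X m) * X l + C l + (\<Sum>m\<in>UNIV. H l m * X m)"
    using assms(2) unfolding low_vector_def by blast
  define p where "p = (\<lambda>A. ex (-2) * eul A)"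
  define q where "q = (\<lambda>A. ex (-2) * eul (p A))"
  have DD: "D i (D k A) = (if i = k then p A else 0) + X i * X k * q A" if "radial A" for i k A
    unfolding p_def q_def by (rule D_D_radial[OF that])
  have D1: "D i A = X i * p A" if "radial A" for i A
    unfolding p_def D_radial[OF that] by (simp add: mult_ac)
  define b where "b = A + (\<Sum>m\<in>UNIV. B m * X m)"
  have DDX: "D i (D k (f * X l)) = X l * D i (D k f) + (if k = l then D i f else 0) + (if i = l then D k f else 0)" for i k l f
    by (simp add: D_mult D_X algebra_simps)
  have DDs: "D i (D k (\<Sum>m\<in>UNIV. F m * X m)) = (if i = k then \<Sum>m\<in>UNIV. p (F m) * X m else 0)
      + X i * X k * (\<Sum>m\<in>UNIV. q (F m) * X m) + X i * p (F k) + X k * p (F i)" if "\<And>m. radial (F m)" for F i k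
  proof -
    have "D i (D k (F m * X m)) = (if i = k then p (F m) * X m else 0) + X i * X k * (q (F m) * X m)
        + (if k = m then X i * p (F m) else 0) + (if i = m then X k * p (F m) else 0)" for m
      unfolding DDX DD[OF that] unfolding D1[OF that] by (simp add: algebra_simps)
    then show ?thesis
      by (simp add: sum.distrib sum_distrib_left)
  qed
  have db: "D i (D k b) = (if i = k then p A + (\<Sum>m\<in>UNIV. p (B m) * X m) else 0)
      + X i * X k * (q A + (\<Sum>m\<in>UNIV. q (B m) * X m)) + X i * p (B k) + X k * p (B i)" for i k
    unfolding b_def D_add DD[OF r(1)] DDs[OF r(2)] by (simp add: algebra_simps)
  have "X j * D i (D k (W l)) =
      (if i = k then (p A + (\<Sum>m\<in>UNIV. p (B m) * X m)) * X l * X j + p (C l) * X j + (\<Sum>m\<in>UNIV. p (H l m) * X m) * X j else 0)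
      + X i * X j * (X k * X l * (q A + (\<Sum>m\<in>UNIV. q (B m) * X m)) + p (B k) * X l + X k * q (C l)
          + X k * (\<Sum>m\<in>UNIV. q (H l m) * X m) + p (H l k))
      + X k * X l * (X j * p (B i))
      + ((if k = l then X j * D i b else 0) + (if i = l then X j * D k b else 0))
      + X j * X k * p (H l i)" for i j k l
  proof -
    have W: "W l = b * X l + C l + (\<Sum>m\<in>UNIV. H l m * X m)" by (simp add: r(6) b_def distrib_right)
    show ?thesis
      unfolding W D_add DDX db DD[OF r(3)] DDs[OF r(4)] by (simp add: algebra_simps)
  qed
  moreover have "contr U (\<lambda>i j k l. X j * X k * p (H l i)) = 0"
  proof (rule contr_antisym[OF U])
    show "p (H i j) = - p (H j i)" for i j by (subst r(5)) (simp add: p_def)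
    have "2 * H i i = 0" for i using r(5)[of i i] by (simp only: mult_2 eq_neg_iff_add_eq_0)
    then show "p (H i i) = 0" for i by (simp add: p_def numeral_mult_cancel)
  qed
  ultimately show ?thesis
    using contr_outer(1)[OF U, of X] contr_outer(2)[OF U, of X] contr_delta(3)[OF U]
      contr_delta(2)[OF U, of "\<lambda>i j k l. X j * D i b"] contr_delta(5)[OF U, of "\<lambda>k j. X j * D k b"]
    by (simp only: contr_add add_0_left)
qed

lemma contr_D_D_low_tensor:
  assumes U: "asd_weyl U" and "low_tensor h"
  shows "contr U (\<lambda>i j k l. D i (D k (h j l))) = 0"
proof -
  obtain W \<tau> where W: "low_vector W" "\<And>j l. h j l = X j * W l + X l * W j + (if j = l then \<tau> else 0)"
    using assms(2) unfolding low_tensor_def by blast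
  have "D i (D k (h j l)) = (if k = j then D i (W l) else 0) + (if i = j then D k (W l) else 0) + X j * D i (D k (W l))
      + ((if k = l then D i (W j) else 0) + (if i = l then D k (W j) else 0) + X l * D k (D i (W j)))
      + (if j = l then D i (D k \<tau>) else 0)" for i j k l
    unfolding W(2) by (simp add: D_mult D_X D_commute[of k i])
  moreover have "contr U (\<lambda>i j k l. X l * D k (D i (W j))) = 0"
    using contr_swap_pairs[OF U, of "\<lambda>i j k l. X j * D i (D k (W l))"] contr_D_D_low_vector[OF U W(1)] by simp
  ultimately show ?thesis
    using contr_delta[OF U] contr_D_D_low_vector[OF U W(1)] by (simp only: contr_add add_0_left)
qed

subsection \<open>The double divergence\<close>

definition div_div :: "(4 \<Rightarrow> 4 \<Rightarrow> 4 \<Rightarrow> 4 \<Rightarrow> sfun) \<Rightarrow> 4 \<Rightarrow> 4 \<Rightarrow> sfun" where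
  "div_div U j l = (\<Sum>i\<in>UNIV. \<Sum>k\<in>UNIV. D i (D k (U i j k l)))"

lemma div_div_div:
  assumes "asd_weyl U"
  shows "(\<Sum>j\<in>UNIV. D j (div_div U j l)) = 0"
proof -
  define S where "S = (\<Sum>j\<in>UNIV. \<Sum>i\<in>UNIV. D j (D i (\<Sum>k\<in>UNIV. D k (U i j k l))))"
  have "S = (\<Sum>i\<in>UNIV. \<Sum>j\<in>UNIV. D j (D i (\<Sum>k\<in>UNIV. D k (U i j k l))))"
    unfolding S_def by (rule sum.swap)
  also have "\<dots> = (\<Sum>i\<in>UNIV. \<Sum>j\<in>UNIV. - D i (D j (\<Sum>k\<in>UNIV. D k (U j i k l))))"
  proof (intro sum.cong refl)
    show "D j (D i (\<Sum>k\<in>UNIV. D k (U i j k l))) = - D i (D j (\<Sum>k\<in>UNIV. D k (U j i k l)))" for i j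
      unfolding asd_weyl_antisym[OF assms, of i j]
      by (subst D_commute) (simp add: sum_negf)
  qed
  also have "\<dots> = - S" unfolding S_def by (simp only: sum_negf)
  finally have "2 * S = 0" by (simp only: mult_2 eq_neg_iff_add_eq_0)
  then have "S = 0" unfolding numeral_mult_cancel .
  then show ?thesis by (simp add: S_def div_div_def)
qed

lemma div_div_zero_imp_zero:
  assumes U: "asd_weyl U" and nil: "\<And>i j k l. nil d N (U i j k l)" and d: "-4 < Re d" "Re d < 0"
    and 0: "\<And>j l. div_div U j l = 0"
  shows "U i j k l = 0"
proof -
  obtain a b c f e where U_eq: "U = (\<lambda>i j k l. asd_form
     (asd_form a b c k l) (asd_form b f e k l) (asd_form c e (- a - f) k l) i j)"
    using U by (auto simp: asd_weyl_def)
  \<comment> \<open>The five components of the Weyl spinor of U, a totally symmetric spinor with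
    four unprimed indices.\<close>
  define \<phi> where "\<phi> = (\<lambda>m. [2 * f + a + 2 * (imu * e), imu * b - c, - a, imu * b + c, 2 * f + a - 2 * (imu * e)] ! m)"
  have comp: "nil d N a" "nil d N b" "nil d N c" "nil d N f" "nil d N e"
    using nil[of 1 2 1 2] nil[of 1 2 1 3] nil[of 1 2 1 4] nil[of 1 3 1 3] nil[of 1 3 1 4]
    by (simp_all add: U_eq asd_form_values)
  have n2: "nil d N (2 * g)" "nil d N (imu * g)" if "nil d N g" for g
    using nil_cst_mult[OF that, of 2] nil_cst_mult[OF that, of \<i>] by (simp_all add: imu_def)
  have le4: "m \<le> 4 \<Longrightarrow> m = 0 \<or> m = 1 \<or> m = 2 \<or> m = 3 \<or> m = (4::nat)" for m by auto
  have nil_phi: "nil d N (\<phi> m)" if "m \<le> 4" for m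
    using le4[OF that] by (auto simp: \<phi>_def intro!: nil_add nil_diff nil_minus n2 comp)
  define \<psi> where "\<psi> = (\<lambda>A m. wirtP A (\<phi> (Suc m)) - wirtQ A (\<phi> m))"
  \<comment> \<open>Each of the twelve second order spinor equations is a complex linear combination
    of components of the double divergence.\<close>
  have key:
    "wirtP False (\<psi> False (Suc 0)) - wirtQ False (\<psi> False 0) = div_div U 3 3 + imu * div_div U 3 4 + imu * div_div U 4 3 - div_div U 4 4"
    "wirtP True (\<psi> False (Suc 0)) - wirtQ True (\<psi> False 0) = div_div U 3 1 - imu * div_div U 3 2 + imu * div_div U 4 1 + div_div U 4 2"
    "wirtP False (\<psi> True (Suc 0)) - wirtQ False (\<psi> True 0) = div_div U 1 3 + imu * div_div U 1 4 - imu * div_div U 2 3 + div_div U 2 4"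
    "wirtP True (\<psi> True (Suc 0)) - wirtQ True (\<psi> True 0) = div_div U 1 1 - imu * div_div U 1 2 - imu * div_div U 2 1 - div_div U 2 2"
    "wirtP False (\<psi> False (Suc (Suc 0))) - wirtQ False (\<psi> False (Suc 0)) = div_div U 3 1 + imu * div_div U 3 2 + imu * div_div U 4 1 - div_div U 4 2"
    "wirtP True (\<psi> False (Suc (Suc 0))) - wirtQ True (\<psi> False (Suc 0)) = - (div_div U 3 3 - imu * div_div U 3 4 + imu * div_div U 4 3 + div_div U 4 4)"
    "wirtP False (\<psi> True (Suc (Suc 0))) - wirtQ False (\<psi> True (Suc 0)) = div_div U 1 1 + imu * div_div U 1 2 - imu * div_div U 2 1 + div_div U 2 2"
    "wirtP True (\<psi> True (Suc (Suc 0))) - wirtQ True (\<psi> True (Suc 0)) = - (div_div U 1 3 - imu * div_div U 1 4 - imu * div_div U 2 3 - div_div U 2 4)"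
    "wirtP False (\<psi> False (Suc (Suc (Suc 0)))) - wirtQ False (\<psi> False (Suc (Suc 0))) = div_div U 1 1 + imu * div_div U 1 2 + imu * div_div U 2 1 - div_div U 2 2"
    "wirtP True (\<psi> False (Suc (Suc (Suc 0)))) - wirtQ True (\<psi> False (Suc (Suc 0))) = - (div_div U 1 3 - imu * div_div U 1 4 + imu * div_div U 2 3 + div_div U 2 4)"
    "wirtP False (\<psi> True (Suc (Suc (Suc 0)))) - wirtQ False (\<psi> True (Suc (Suc 0))) = - (div_div U 3 1 + imu * div_div U 3 2 - imu * div_div U 4 1 + div_div U 4 2)"
    "wirtP True (\<psi> True (Suc (Suc (Suc 0)))) - wirtQ True (\<psi> True (Suc (Suc 0))) = div_div U 3 3 - imu * div_div U 3 4 - imu * div_div U 4 3 - div_div U 4 4"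
    unfolding \<psi>_def \<phi>_def div_div_def U_eq
    by (simp_all add: wirtP_def wirtQ_def sum_4 asd_form_values D_mult D_commute[of 2 1] D_commute[of 3 1]
        D_commute[of 4 1] D_commute[of 3 2] D_commute[of 4 2] D_commute[of 4 3] algebra_simps imu_sq)
  have "wirtP B (\<psi> A (Suc m)) - wirtQ B (\<psi> A m) = 0" if "m < 3" for A B m
  proof -
    have "m = 0 \<or> m = Suc 0 \<or> m = Suc (Suc 0)" using that by auto
    then show ?thesis
      using key unfolding 0 by (cases A; cases B) auto
  qed
  then have "\<phi> m = 0" if "m \<le> 4" for m
    using second_order_massless_zero[of \<phi> d N m] nil_phi d that unfolding \<psi>_def by simp
  from this[of 0] this[of 1] this[of 2] this[of 3] this[of 4]
  have z: "2 * f + a + 2 * (imu * e) = 0" "imu * b - c = 0" "a = 0" "imu * b + c = 0" "2 * f + a - 2 * (imu * e) = 0"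
    by (simp_all add: \<phi>_def)
  have i0: "g = 0" if "imu * g = 0" for g using imu_sq(2)[of g] that by simp
  have "2 * (imu * b) = (imu * b - c) + (imu * b + c)" "2 * c = (imu * b + c) - (imu * b - c)"
    "4 * f = (2 * f + a + 2 * (imu * e)) + (2 * f + a - 2 * (imu * e)) - 2 * a"
    "4 * (imu * e) = (2 * f + a + 2 * (imu * e)) - (2 * f + a - 2 * (imu * e))"
    by simp_all
  then have "2 * (imu * b) = 0" "2 * c = 0" "4 * f = 0" "4 * (imu * e) = 0"
    unfolding z(1,2,4,5) by (simp_all add: z(3))
  then have "b = 0" "c = 0" "f = 0" "e = 0"
    unfolding numeral_mult_cancel using i0 by simp_all
  then show ?thesis by (simp add: U_eq z(3) asd_form_0)
qed

section \<open>The linearized Weyl tensor\<close>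

subsection \<open>The Hodge operator of the cylinder\<close>

lemma levi_civita_swap:
  "levi_civita j i k l = - levi_civita i j k l"
  "levi_civita i k j l = - levi_civita i j k l"
  "levi_civita i j l k = - levi_civita i j k l"
proof -
  have s: "det (\<chi> m. A $ Transposition.transpose a b m) = - det A" if "a \<noteq> b" for A :: "real ^ 4 ^ 4" and a b
    using det_permute_rows[OF permutes_swap_id[of a UNIV b], of A] that by (simp add: sign_swap_id)
  have e: "(\<chi> m. (vector [p, q, r, t] :: real ^ 4 ^ 4) $ Transposition.transpose 1 2 m) = vector [q, p, r, t]"
    "(\<chi> m. (vector [p, q, r, t] :: real ^ 4 ^ 4) $ Transposition.transpose 2 3 m) = vector [p, r, q, t]"
    "(\<chi> m. (vector [p, q, r, t] :: real ^ 4 ^ 4) $ Transposition.transpose 3 4 m) = vector [p, q, t, r]" for p q r t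
    by (simp_all add: vec_eq_iff forall_4 vector_def Transposition.transpose_def)
  let ?A = "vector [axis i 1, axis j 1, axis k 1, axis l 1] :: real ^ 4 ^ 4"
  show "levi_civita j i k l = - levi_civita i j k l"
    using s[of 1 2 ?A] unfolding e levi_civita_def by simp
  show "levi_civita i k j l = - levi_civita i j k l"
    using s[of 2 3 ?A] unfolding e levi_civita_def by simp
  show "levi_civita i j l k = - levi_civita i j k l"
    using s[of 3 4 ?A] unfolding e levi_civita_def by simp
qed

lemma levi_civita_repeated:
  "levi_civita i i k l = 0" "levi_civita i j i l = 0" "levi_civita i j k i = 0"
  "levi_civita i j j l = 0" "levi_civita i j k j = 0" "levi_civita i j k k = 0"
proof -
  have 1: "levi_civita i i k l = 0" for i k l using levi_civita_swap(1)[of i i k l] by simp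
  have 2: "levi_civita i j i l = 0" for i j l using levi_civita_swap(2)[of i i j l] 1[of i j l] by simp
  have 3: "levi_civita i j k i = 0" for i j k using levi_civita_swap(3)[of i j i k] 2[of i j k] by simp
  have 4: "levi_civita i j j l = 0" for i j l using levi_civita_swap(2)[of i j j l] by simp
  have 5: "levi_civita i j k j = 0" for i j k using levi_civita_swap(3)[of i j j k] 4[of i j k] by simp
  have 6: "levi_civita i j k k = 0" for i j k using levi_civita_swap(3)[of i j k k] by simp
  show "levi_civita i i k l = 0" "levi_civita i j i l = 0" "levi_civita i j k i = 0"
    "levi_civita i j j l = 0" "levi_civita i j k j = 0" "levi_civita i j k k = 0"
    by (rule 1 2 3 4 5 6)+
qed

lemma levi_civita_values:
  "levi_civita 1 2 3 4 = 1" "levi_civita 1 2 4 3 = -1" "levi_civita 1 3 2 4 = -1" "levi_civita 1 3 4 2 = 1"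
  "levi_civita 1 4 2 3 = 1" "levi_civita 1 4 3 2 = -1"
proof -
  show 1: "levi_civita 1 2 3 4 = 1" by (rule levi_civita_1234)
  show 2: "levi_civita 1 2 4 3 = -1" using levi_civita_swap(3)[of 1 2 4 3] 1 by simp
  show 3: "levi_civita 1 3 2 4 = -1" using levi_civita_swap(2)[of 1 3 2 4] 1 by simp
  show "levi_civita 1 3 4 2 = 1" using levi_civita_swap(3)[of 1 3 4 2] 3 by simp
  show 4: "levi_civita 1 4 2 3 = 1" using levi_civita_swap(2)[of 1 4 2 3] 2 by simp
  show "levi_civita 1 4 3 2 = -1" using levi_civita_swap(3)[of 1 4 3 2] 4 by simp
qed

lemma levi_civita_pair: "levi_civita k l i j = levi_civita i j k l"
  using levi_civita_swap(2)[of i k j l] levi_civita_swap(1)[of k i j l] levi_civita_swap(3)[of k i l j]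
    levi_civita_swap(2)[of k l i j] by simp

section \<open>The cylinder metric and its Hodge operator\<close>

lemma matrix_inv_inverse:
  assumes "invertible A"
  shows "A ** matrix_inv A = mat 1" "matrix_inv A ** A = mat 1"
  using someI_ex[OF assms[unfolded invertible_def]] unfolding matrix_inv_def by auto

lemma matrix_inv_unique:
  assumes "A ** B = mat 1" "B ** A = mat 1"
  shows "matrix_inv A = B"
proof -
  have "invertible A" using assms unfolding invertible_def by blast
  then have "matrix_inv A ** (A ** B) = B"
    by (simp add: matrix_mul_assoc matrix_inv_inverse)
  then show ?thesis by (simp add: assms)
qed

lemma matrix_inv_mat:
  assumes "c \<noteq> 0"
  shows "matrix_inv (mat c :: real ^ 'n ^ 'n) = mat (1 / c)"
proof (rule matrix_inv_unique)
  show "(mat c :: real ^ 'n ^ 'n) ** mat (1 / c) = mat 1" "(mat (1 / c) :: real ^ 'n ^ 'n) ** mat c = mat 1"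
    using assms by (simp_all add: matrix_matrix_mult_def mat_def vec_eq_iff mult_delta_left)
qed

lemma ginv_cyl_metric: "x \<in> cyl \<Longrightarrow> ginv cyl_metric x $ i $ j = (if i = j then (norm x)\<^sup>2 else 0)"
  by (simp add: cyl_metric_eq cyl_iff matrix_inv_mat) (simp add: mat_def)

lemma cyl_metric_entry: "x \<in> cyl \<Longrightarrow> cyl_metric x $ i $ j = (if i = j then 1 / (norm x)\<^sup>2 else 0)"
  by (simp add: cyl_metric_eq cyl_iff mat_def)

lemma vol_density_cyl_metric: "x \<in> cyl \<Longrightarrow> vol_density cyl_metric x = 1 / (norm x) ^ 4"
proof -
  assume x: "x \<in> cyl"
  have "det (mat (1 / (norm x)\<^sup>2) :: real ^ 4 ^ 4) = (1 / (norm x)\<^sup>2) ^ 4"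
    by (subst det_diagonal) (simp_all add: mat_def)
  also have "\<dots> = (1 / (norm x) ^ 4)\<^sup>2" by (simp add: power_divide flip: power_mult)
  finally show ?thesis using x by (simp add: vol_density_def cyl_metric_eq cyl_iff)
qed

lemma sum_delta_scaleR:
  fixes f :: "4 \<Rightarrow> 4 \<Rightarrow> 'a::real_vector"
  shows "(\<Sum>a\<in>UNIV. \<Sum>b\<in>UNIV. (c * (if k = a then r else 0) * (if l = b then r else 0)) *\<^sub>R f a b) = (c * r * r) *\<^sub>R f k l"
proof -
  have "(c * (if k = a then r else 0) * (if l = b then r else 0)) *\<^sub>R f a b
      = (if k = a then if l = b then (c * r * r) *\<^sub>R f a b else 0 else 0)" for a b
    by simp
  moreover have "(\<Sum>b\<in>UNIV. if k = a then if l = b then (c * r * r) *\<^sub>R f a b else 0 else 0)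
      = (if k = a then (c * r * r) *\<^sub>R f a l else 0)" for a
    by simp
  ultimately show ?thesis by simp
qed

text \<open>Conformal invariance of the Hodge operator on 2-forms in dimension four: the volume
  density |x|^-4 cancels the two inverse metrics.\<close>

lemma hodge_cyl_metric:
  assumes "x \<in> cyl"
  shows "hodge cyl_metric x \<eta> $ i $ j = (1/2) *\<^sub>R (\<Sum>k\<in>UNIV. \<Sum>l\<in>UNIV. levi_civita i j k l *\<^sub>R \<eta> $ k $ l)"
proof -
  let ?r = "(norm x)\<^sup>2"
  have "(\<Sum>a\<in>UNIV. \<Sum>b\<in>UNIV. (levi_civita i j k l * ginv cyl_metric x $ k $ a * ginv cyl_metric x $ l $ b) *\<^sub>R \<eta> $ a $ b)
      = (levi_civita i j k l * ?r * ?r) *\<^sub>R \<eta> $ k $ l" for k l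
    unfolding ginv_cyl_metric[OF assms] by (rule sum_delta_scaleR)
  then have "hodge cyl_metric x \<eta> $ i $ j = (vol_density cyl_metric x / 2) *\<^sub>R
      (\<Sum>k\<in>UNIV. \<Sum>l\<in>UNIV. (levi_civita i j k l * ?r * ?r) *\<^sub>R \<eta> $ k $ l)"
    by (simp add: hodge_def)
  also have "\<dots> = (1/2) *\<^sub>R (\<Sum>k\<in>UNIV. \<Sum>l\<in>UNIV. levi_civita i j k l *\<^sub>R \<eta> $ k $ l)"
    using assms unfolding scaleR_sum_right
    by (intro sum.cong refl) (simp add: vol_density_cyl_metric cyl_iff power2_eq_square power4_eq_xxxx)
  finally show ?thesis .
qed

lemma sym_traceless_asd_imp_asd_weyl:
  assumes x: "x \<in> cyl" and Z: "sym_traceless_asd cyl_metric x (Z :: complex tens4)"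
  shows "asd_weyl (\<lambda>i j k l. Z $ i $ j $ k $ l)"
proof -
  have anti: "Z $ i $ j $ k $ l = - Z $ j $ i $ k $ l" and pair: "Z $ i $ j $ k $ l = Z $ k $ l $ i $ j" for i j k l
    using Z unfolding sym_traceless_asd_def by blast+
  have diag: "Z $ i $ i $ k $ l = 0" for i k l using anti[of i i k l] by simp
  have hd: "(1/2) *\<^sub>R (\<Sum>a\<in>UNIV. \<Sum>b\<in>UNIV. levi_civita i j a b *\<^sub>R Z $ a $ b $ k $ l) = - Z $ i $ j $ k $ l" for i j k l
  proof -
    have "hodge cyl_metric x (\<chi> i j. Z $ i $ j $ k $ l) $ i $ j = (- (\<chi> i j. Z $ i $ j $ k $ l)) $ i $ j"
      using Z unfolding sym_traceless_asd_def by metis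
    then show ?thesis unfolding hodge_cyl_metric[OF x] by simp
  qed
  have 12: "Z $ 3 $ 4 $ k $ l = - Z $ 1 $ 2 $ k $ l" "Z $ 2 $ 4 $ k $ l = Z $ 1 $ 3 $ k $ l" "Z $ 2 $ 3 $ k $ l = - Z $ 1 $ 4 $ k $ l" for k l
    using hd[of 1 2 k l] hd[of 1 3 k l] hd[of 1 4 k l] anti[of 4 3 k l] anti[of 4 2 k l] anti[of 3 2 k l]
    by (simp_all add: sum_4 levi_civita_repeated levi_civita_values scaleR_add_right[symmetric])
  have form: "\<forall>i j. Z $ i $ j $ k $ l = asd_form (Z $ 1 $ 2 $ k $ l) (Z $ 1 $ 3 $ k $ l) (Z $ 1 $ 4 $ k $ l) i j" for k l
    using 12[of k l] anti[of 2 1 k l] anti[of 3 1 k l] anti[of 4 1 k l] anti[of 3 2 k l] anti[of 4 2 k l] anti[of 4 3 k l]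
    by (simp add: forall_4 asd_form_values diag)
  have tr: "Z $ 1 $ 4 $ 1 $ 4 = - Z $ 1 $ 2 $ 1 $ 2 - Z $ 1 $ 3 $ 1 $ 3"
  proof -
    let ?r = "(norm x)\<^sup>2"
    have "(\<Sum>i\<in>UNIV. \<Sum>j\<in>UNIV. \<Sum>k\<in>UNIV. \<Sum>l\<in>UNIV. (ginv cyl_metric x $ i $ k * ginv cyl_metric x $ j $ l) *\<^sub>R Z $ i $ j $ k $ l) = 0"
      using Z unfolding sym_traceless_asd_def by blast
    moreover have "(\<Sum>k\<in>UNIV. \<Sum>l\<in>UNIV. (ginv cyl_metric x $ i $ k * ginv cyl_metric x $ j $ l) *\<^sub>R Z $ i $ j $ k $ l)
        = (?r * ?r) *\<^sub>R Z $ i $ j $ i $ j" for i j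
      unfolding ginv_cyl_metric[OF x] using sum_delta_scaleR[of 1 i ?r j "\<lambda>k l. Z $ i $ j $ k $ l"] by simp
    ultimately have "(?r * ?r) *\<^sub>R (\<Sum>i\<in>UNIV. \<Sum>j\<in>UNIV. Z $ i $ j $ i $ j) = 0"
      by (simp add: scaleR_sum_right)
    then have "(\<Sum>i\<in>UNIV. \<Sum>j\<in>UNIV. Z $ i $ j $ i $ j) = 0" using x by (simp add: cyl_iff)
    moreover have "Z $ i $ j $ i $ j = Z $ j $ i $ j $ i" for i j
      using anti[of i j i j] pair[of j i i j] anti[of i j j i] by simp
    moreover have "Z $ 3 $ 4 $ 3 $ 4 = Z $ 1 $ 2 $ 1 $ 2" "Z $ 2 $ 4 $ 2 $ 4 = Z $ 1 $ 3 $ 1 $ 3" "Z $ 2 $ 3 $ 2 $ 3 = Z $ 1 $ 4 $ 1 $ 4"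
      using 12 pair by (metis add.inverse_inverse)+
    ultimately have "4 * (Z $ 1 $ 2 $ 1 $ 2 + Z $ 1 $ 3 $ 1 $ 3 + Z $ 1 $ 4 $ 1 $ 4) = 0"
      by (simp add: sum_4 diag add_ac)
    then have "Z $ 1 $ 2 $ 1 $ 2 + Z $ 1 $ 3 $ 1 $ 3 + Z $ 1 $ 4 $ 1 $ 4 = 0" unfolding mult_eq_0_iff by simp
    then show ?thesis by (simp add: eq_diff_eq eq_neg_iff_add_eq_0 add_ac)
  qed
  show ?thesis
    unfolding asd_weyl_def
  proof (intro exI ext)
    fix i j k l
    have sw: "Z $ i $ j $ k $ l = asd_form (Z $ i $ j $ 1 $ 2) (Z $ i $ j $ 1 $ 3) (Z $ i $ j $ 1 $ 4) k l" for i j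
      using form[of i j] pair by metis
    show "Z $ i $ j $ k $ l = asd_form
      (asd_form (Z $ 1 $ 2 $ 1 $ 2) (Z $ 1 $ 2 $ 1 $ 3) (Z $ 1 $ 2 $ 1 $ 4) k l)
      (asd_form (Z $ 1 $ 2 $ 1 $ 3) (Z $ 1 $ 3 $ 1 $ 3) (Z $ 1 $ 3 $ 1 $ 4) k l)
      (asd_form (Z $ 1 $ 2 $ 1 $ 4) (Z $ 1 $ 3 $ 1 $ 4) (- Z $ 1 $ 2 $ 1 $ 2 - Z $ 1 $ 3 $ 1 $ 3) k l) i j"
      unfolding form[rule_format, of i j] sw[of 1 2] sw[of 1 3] sw[of 1 4]
      using pair[of 1 3 1 2] pair[of 1 4 1 2] pair[of 1 4 1 3] tr by simp
  qed
qed

subsection \<open>The derivative of the inverse matrix\<close>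

lemma det_has_derivative:
  fixes A :: "'b::real_normed_vector \<Rightarrow> real ^ 'n ^ 'n"
  assumes "\<And>i j. (\<lambda>t. A t $ i $ j) differentiable (at p)"
  shows "(\<lambda>t. det (A t)) differentiable (at p)"
proof -
  have pr: "(\<lambda>t. \<Prod>i\<in>I. A t $ i $ q i) differentiable (at p)" for I q
    by (induction I rule: infinite_finite_induct) (auto intro: differentiable_mult assms)
  show ?thesis
    unfolding det_def by (intro differentiable_sum ballI differentiable_mult pr differentiable_const) simp
qed

lemma matrix_inv_cramer:
  fixes A :: "real ^ 'n ^ 'n"
  assumes "det A \<noteq> 0"
  shows "matrix_inv A $ k $ j = det (\<chi> a b. if b = k then axis j 1 $ a else A $ a $ b) / det A"
proof -
  have "A ** matrix_inv A = mat 1"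
    using assms invertible_det_nz matrix_inv_inverse by blast
  then have "A *v (matrix_inv A *v axis j 1) = axis j 1"
    by (simp add: matrix_vector_mul_assoc)
  then have "matrix_inv A *v axis j 1 = (\<chi> k. det (\<chi> a b. if b = k then axis j 1 $ a else A $ a $ b) / det A)"
    using cramer[OF assms] by blast
  moreover have "(matrix_inv A *v axis j 1) $ k = matrix_inv A $ k $ j"
    by (simp add: matrix_vector_mult_def axis_def if_distrib cong: if_cong)
  ultimately show ?thesis by simp
qed

text \<open>Cramer's rule shows that the entries of the inverse are differentiable. The formula for
  the derivative then follows from the product rule for A A^-1 = 1, which holds near p, where the
  determinant is nonzero.\<close>

lemma matrix_inv_has_derivative:
  fixes A :: "'b::real_normed_vector \<Rightarrow> real ^ 'n ^ 'n"
  assumes d: "\<And>i j. ((\<lambda>t. A t $ i $ j) has_derivative A' i j) (at p)" and nz: "det (A p) \<noteq> 0"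
  shows "((\<lambda>t. matrix_inv (A t) $ k $ l) has_derivative
    (\<lambda>v. - (\<Sum>a\<in>UNIV. \<Sum>b\<in>UNIV. matrix_inv (A p) $ k $ a * A' a b v * matrix_inv (A p) $ b $ l))) (at p)"
proof -
  have df: "(\<lambda>t. A t $ i $ j) differentiable (at p)" for i j
    using d by (auto simp: differentiable_def)
  have ev: "eventually (\<lambda>t. det (A t) \<noteq> 0) (nhds p)"
  proof -
    have "isCont (\<lambda>t. det (A t)) p"
      using det_has_derivative[OF df] differentiable_imp_continuous_within by blast
    then have "((\<lambda>t. det (A t)) \<longlongrightarrow> det (A p)) (nhds p)"
      unfolding isCont_def by (rule tendsto_at_iff_tendsto_nhds[THEN iffD1])
    then show ?thesis using nz by (rule tendsto_imp_eventually_ne)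
  qed
  have "(\<lambda>t. matrix_inv (A t) $ k $ j) differentiable (at p)" for k j
  proof -
    have "(\<lambda>t. det (\<chi> a b. if b = k then axis j 1 $ a else A t $ a $ b) / det (A t)) differentiable (at p)"
    proof (intro differentiable_divide det_has_derivative df nz)
      show "(\<lambda>t. (\<chi> a b. if b = k then axis j 1 $ a else A t $ a $ b) $ i $ m) differentiable (at p)" for i m
        by (cases "m = k") (simp_all add: df)
    qed
    then obtain D where D: "((\<lambda>t. det (\<chi> a b. if b = k then axis j 1 $ a else A t $ a $ b) / det (A t)) has_derivative D) (at p)"
      by (auto simp: differentiable_def)
    have "((\<lambda>t. matrix_inv (A t) $ k $ j) has_derivative D) (at p)"
      by (rule has_derivative_transform_eventually[OF D])
        (use ev nz in \<open>auto simp: matrix_inv_cramer eventually_at_filter elim: eventually_mono\<close>)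
    then show ?thesis by (auto simp: differentiable_def)
  qed
  then obtain B' where B': "\<And>k j. ((\<lambda>t. matrix_inv (A t) $ k $ j) has_derivative B' k j) (at p)"
    unfolding differentiable_def by metis
  have inv: "A t ** matrix_inv (A t) = mat 1" "matrix_inv (A t) ** A t = mat 1" if "det (A t) \<noteq> 0" for t
    using that invertible_det_nz matrix_inv_inverse by blast+
  have eq: "(\<Sum>b\<in>UNIV. A' a b v * matrix_inv (A p) $ b $ l + A p $ a $ b * B' b l v) = 0" for a l v
  proof -
    have 1: "((\<lambda>t. \<Sum>b\<in>UNIV. A t $ a $ b * matrix_inv (A t) $ b $ l) has_derivative
        (\<lambda>v. \<Sum>b\<in>UNIV. A p $ a $ b * B' b l v + A' a b v * matrix_inv (A p) $ b $ l)) (at p)"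
      by (intro has_derivative_sum has_derivative_mult d B')
    have 2: "((\<lambda>t. \<Sum>b\<in>UNIV. A t $ a $ b * matrix_inv (A t) $ b $ l) has_derivative (\<lambda>v. 0)) (at p)"
    proof (rule has_derivative_transform_eventually[OF has_derivative_const[of "mat 1 $ a $ l :: real"]])
      have *: "(mat 1 :: real ^ 'n ^ 'n) $ a $ l = (\<Sum>b\<in>UNIV. A t $ a $ b * matrix_inv (A t) $ b $ l)" if "det (A t) \<noteq> 0" for t
        using arg_cong[OF inv(1)[OF that], of "\<lambda>M. M $ a $ l"] by (simp add: matrix_matrix_mult_def)
      show "\<forall>\<^sub>F t in at p. (mat 1 :: real ^ 'n ^ 'n) $ a $ l = (\<Sum>b\<in>UNIV. A t $ a $ b * matrix_inv (A t) $ b $ l)"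
        using ev * by (auto simp: eventually_at_filter elim: eventually_mono)
      show "(mat 1 :: real ^ 'n ^ 'n) $ a $ l = (\<Sum>b\<in>UNIV. A p $ a $ b * matrix_inv (A p) $ b $ l)"
        by (rule *[OF nz])
    qed simp
    from fun_cong[OF has_derivative_unique[OF 1 2], of v] show ?thesis
      by (simp add: add.commute)
  qed
  have "B' k l v = - (\<Sum>a\<in>UNIV. \<Sum>b\<in>UNIV. matrix_inv (A p) $ k $ a * A' a b v * matrix_inv (A p) $ b $ l)" for v
  proof -
    have "(\<Sum>a\<in>UNIV. matrix_inv (A p) $ k $ a * (\<Sum>b\<in>UNIV. A' a b v * matrix_inv (A p) $ b $ l + A p $ a $ b * B' b l v)) = 0"
      unfolding eq by simp
    then have "(\<Sum>a\<in>UNIV. \<Sum>b\<in>UNIV. matrix_inv (A p) $ k $ a * A' a b v * matrix_inv (A p) $ b $ l)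
        + (\<Sum>a\<in>UNIV. \<Sum>b\<in>UNIV. matrix_inv (A p) $ k $ a * A p $ a $ b * B' b l v) = 0"
      by (simp add: sum_distrib_left sum.distrib distrib_left mult.assoc)
    moreover have "(\<Sum>a\<in>UNIV. \<Sum>b\<in>UNIV. matrix_inv (A p) $ k $ a * A p $ a $ b * B' b l v) = B' k l v"
    proof -
      have "(\<Sum>a\<in>UNIV. matrix_inv (A p) $ k $ a * A p $ a $ b) = (if k = b then 1 else 0)" for b
        using arg_cong[OF inv(2)[OF nz], of "\<lambda>M. M $ k $ b"] by (simp add: matrix_matrix_mult_def mat_def)
      then show ?thesis
        by (subst sum.swap) (simp only: sum_distrib_right[symmetric], simp add: mult_delta_left)
    qed
    ultimately show ?thesis by simp
  qed
  then have "B' k l = (\<lambda>v. - (\<Sum>a\<in>UNIV. \<Sum>b\<in>UNIV. matrix_inv (A p) $ k $ a * A' a b v * matrix_inv (A p) $ b $ l))"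
    by auto
  then show ?thesis using B'[of k l] by simp
qed

subsection \<open>The algebra of the linearized curvature\<close>

text \<open>The metric \<open>e\<^sup>2\<^sup>u (\<delta> + s K)\<close> is treated to first order in \<open>s\<close>; the arrays \<open>u\<close> and \<open>u2\<close> contain the
  first and second derivatives of the function \<open>u\<close>, and \<open>K1\<close> and \<open>K2\<close> those of \<open>K\<close>, with the indices of the
  derivatives in front.\<close>

definition kr :: "4 \<Rightarrow> 4 \<Rightarrow> real" where "kr i j = (if i = j then 1 else 0)"

lemma sum_kr: "(\<Sum>p\<in>UNIV. kr i p * f p) = f i" "(\<Sum>p\<in>UNIV. kr p i * f p) = f i"
  "(\<Sum>p\<in>UNIV. f p * kr i p) = f i" "(\<Sum>p\<in>UNIV. f p * kr p i) = f i"
  by (simp_all add: kr_def mult_delta_left mult_delta_right)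

lemma contr_kr:
  assumes U: "asd_weyl U"
  shows "contr U (\<lambda>i j k l. kr i j * M i j k l) = 0"
    and "contr U (\<lambda>i j k l. kr k l * M i j k l) = 0"
    and "contr U (\<lambda>i j k l. kr i k * N j l) = 0"
    and "contr U (\<lambda>i j k l. kr k i * N j l) = 0"
    and "contr U (\<lambda>i j k l. kr k j * N i l) = 0"
    and "contr U (\<lambda>i j k l. kr i l * N k j) = 0"
    and "contr U (\<lambda>i j k l. kr j l * N i k) = 0"
    and "contr U (\<lambda>i j k l. kr l j * N i k) = 0"
    and "contr U (\<lambda>i j k l. kr j k * N i l) = 0"
proof -
  have c: "kr i j = kr j i" for i j by (simp add: kr_def)
  have e: "kr i j * x = (if i = j then x else 0)" for i j x by (simp add: kr_def)
  show 1: "contr U (\<lambda>i j k l. kr i j * M i j k l) = 0" "contr U (\<lambda>i j k l. kr k l * M i j k l) = 0"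
    "contr U (\<lambda>i j k l. kr i k * N j l) = 0" "contr U (\<lambda>i j k l. kr k j * N i l) = 0"
    "contr U (\<lambda>i j k l. kr i l * N k j) = 0" "contr U (\<lambda>i j k l. kr j l * N i k) = 0"
    unfolding e by (rule contr_delta[OF U])+
  have "(\<lambda>i j k l. kr k i * N j l) = (\<lambda>i j k l. kr i k * N j l)"
    "(\<lambda>i j k l. kr l j * N i k) = (\<lambda>i j k l. kr j l * N i k)"
    "(\<lambda>i j k l. kr j k * N i l) = (\<lambda>i j k l. kr k j * N i l)"
    by (intro ext; subst c; rule refl)+
  from this[THEN arg_cong, of "contr U"] 1
  show "contr U (\<lambda>i j k l. kr k i * N j l) = 0" "contr U (\<lambda>i j k l. kr l j * N i k) = 0"
    "contr U (\<lambda>i j k l. kr j k * N i l) = 0"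
    by simp_all
qed

lemma contr_sym:
  fixes U :: "4 \<Rightarrow> 4 \<Rightarrow> 4 \<Rightarrow> 4 \<Rightarrow> real"
  assumes U: "asd_weyl U"
  shows "(\<And>i j k l. M i j k l = M j i k l) \<Longrightarrow> contr U M = 0"
    and "(\<And>i j k l. M i j k l = M i j l k) \<Longrightarrow> contr U M = 0"
proof -
  assume "\<And>i j k l. M i j k l = M j i k l"
  then have "(\<lambda>i j k l. M j i k l) = M" by (intro ext) metis
  then show "contr U M = 0" using contr_swap_12[OF U, of M] by simp
next
  assume "\<And>i j k l. M i j k l = M i j l k"
  then have "(\<lambda>i j k l. M i j l k) = M" by (intro ext) metis
  then show "contr U M = 0" using contr_swap_34[OF U, of M] by simp
qed

text \<open>\<open>Gam0\<close> and \<open>Gam1\<close> are the Christoffel symbols to order zero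
  and one in s, with the upper index first; \<open>dGam0\<close> and \<open>dGam1\<close> are their
  derivatives, and \<open>rup0\<close> and \<open>rup1\<close> the corresponding terms of the
  curvature.\<close>

definition Gam0 :: "(4 \<Rightarrow> real) \<Rightarrow> 4 \<Rightarrow> 4 \<Rightarrow> 4 \<Rightarrow> real" where
  "Gam0 u k i j = kr j k * u i + kr i k * u j - kr i j * u k"

definition Gam1 :: "(4 \<Rightarrow> 4 \<Rightarrow> real) \<Rightarrow> (4 \<Rightarrow> 4 \<Rightarrow> 4 \<Rightarrow> real) \<Rightarrow> (4 \<Rightarrow> real) \<Rightarrow> 4 \<Rightarrow> 4 \<Rightarrow> 4 \<Rightarrow> real" where
  "Gam1 K K1 u k i j = (K1 i j k + K1 j i k - K1 k i j) / 2 - K i j * u k + kr i j * (\<Sum>l\<in>UNIV. K k l * u l)"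

definition dGam0 :: "(4 \<Rightarrow> 4 \<Rightarrow> real) \<Rightarrow> 4 \<Rightarrow> 4 \<Rightarrow> 4 \<Rightarrow> 4 \<Rightarrow> real" where
  "dGam0 u2 m k i j = kr j k * u2 m i + kr i k * u2 m j - kr i j * u2 m k"

definition dGam1 :: "(4 \<Rightarrow> 4 \<Rightarrow> real) \<Rightarrow> (4 \<Rightarrow> 4 \<Rightarrow> 4 \<Rightarrow> real) \<Rightarrow> (4 \<Rightarrow> 4 \<Rightarrow> 4 \<Rightarrow> 4 \<Rightarrow> real) \<Rightarrow> (4 \<Rightarrow> real) \<Rightarrow> (4 \<Rightarrow> 4 \<Rightarrow> real)
    \<Rightarrow> 4 \<Rightarrow> 4 \<Rightarrow> 4 \<Rightarrow> 4 \<Rightarrow> real" where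
  "dGam1 K K1 K2 u u2 m k i j = (K2 m i j k + K2 m j i k - K2 m k i j) / 2 - K i j * u2 m k - K1 m i j * u k
     + kr i j * (\<Sum>l\<in>UNIV. K k l * u2 m l + K1 m k l * u l)"

definition rup0 :: "(4 \<Rightarrow> real) \<Rightarrow> (4 \<Rightarrow> 4 \<Rightarrow> real) \<Rightarrow> 4 \<Rightarrow> 4 \<Rightarrow> 4 \<Rightarrow> 4 \<Rightarrow> real" where
  "rup0 u u2 l k i j = dGam0 u2 i l j k - dGam0 u2 j l i k
     + (\<Sum>m\<in>UNIV. Gam0 u l i m * Gam0 u m j k - Gam0 u l j m * Gam0 u m i k)"

definition rup1 :: "(4 \<Rightarrow> 4 \<Rightarrow> real) \<Rightarrow> (4 \<Rightarrow> 4 \<Rightarrow> 4 \<Rightarrow> real) \<Rightarrow> (4 \<Rightarrow> 4 \<Rightarrow> 4 \<Rightarrow> 4 \<Rightarrow> real) \<Rightarrow> (4 \<Rightarrow> real) \<Rightarrow> (4 \<Rightarrow> 4 \<Rightarrow> real)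
    \<Rightarrow> 4 \<Rightarrow> 4 \<Rightarrow> 4 \<Rightarrow> 4 \<Rightarrow> real" where
  "rup1 K K1 K2 u u2 l k i j = dGam1 K K1 K2 u u2 i l j k - dGam1 K K1 K2 u u2 j l i k
     + (\<Sum>m\<in>UNIV. Gam1 K K1 u l i m * Gam0 u m j k + Gam0 u l i m * Gam1 K K1 u m j k
                - (Gam1 K K1 u l j m * Gam0 u m i k + Gam0 u l j m * Gam1 K K1 u m i k))"

lemma sum_mult_Gam0:
  "(\<Sum>m\<in>UNIV. F m * Gam0 u m j k) = F k * u j + F j * u k - kr j k * (\<Sum>m\<in>UNIV. F m * u m)"
  "(\<Sum>m\<in>UNIV. Gam0 u l i m * F m) = u i * F l + kr i l * (\<Sum>m\<in>UNIV. u m * F m) - u l * F i"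
proof -
  have "F m * Gam0 u m j k = (F m * kr k m) * u j + (F m * kr j m) * u k - kr j k * (F m * u m)" for m
    by (simp add: Gam0_def algebra_simps)
  then show "(\<Sum>m\<in>UNIV. F m * Gam0 u m j k) = F k * u j + F j * u k - kr j k * (\<Sum>m\<in>UNIV. F m * u m)"
    by (simp add: sum.distrib sum_subtractf sum_distrib_left[symmetric] sum_distrib_right[symmetric] sum_kr)
  have "Gam0 u l i m * F m = u i * (kr m l * F m) + kr i l * (u m * F m) - u l * (kr i m * F m)" for m
    by (simp add: Gam0_def algebra_simps)
  then show "(\<Sum>m\<in>UNIV. Gam0 u l i m * F m) = u i * F l + kr i l * (\<Sum>m\<in>UNIV. u m * F m) - u l * F i"
    by (simp add: sum.distrib sum_subtractf sum_distrib_left[symmetric] sum_kr)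
qed

lemma sum_mult_dGam0:
  "(\<Sum>m\<in>UNIV. F m * dGam0 u2 n m j k) = F k * u2 n j + F j * u2 n k - kr j k * (\<Sum>m\<in>UNIV. F m * u2 n m)"
  using sum_mult_Gam0(1)[of F "u2 n" j k] by (simp add: Gam0_def dGam0_def)

text \<open>Up to terms with a delta or symmetric in one pair of indices, which U annihilates, the
  linearized curvature consists of second derivatives of K and of products of K with derivatives of
  u. The terms with first derivatives of K cancel.\<close>

lemma contr_linearized_riem:
  fixes U :: "4 \<Rightarrow> 4 \<Rightarrow> 4 \<Rightarrow> 4 \<Rightarrow> real"
  assumes U: "asd_weyl U"
    and K: "\<And>i j. K i j = K j i" and K1: "\<And>m i j. K1 m i j = K1 m j i"
    and K2: "\<And>m n i j. K2 m n i j = K2 n m i j" "\<And>m n i j. K2 m n i j = K2 m n j i"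
    and u2: "\<And>i j. u2 i j = u2 j i"
  shows "contr U (\<lambda>i j k l. rup1 K K1 K2 u u2 i j k l + (\<Sum>m\<in>UNIV. K i m * rup0 u u2 m j k l))
    = - 2 * contr U (\<lambda>i j k l. K2 i k j l) - 4 * contr U (\<lambda>i j k l. K j l * u2 i k)
      + 4 * contr U (\<lambda>i j k l. K j l * (u i * u k))"
proof -
  \<comment> \<open>Half of the linearized curvature; the other half arises by exchanging k and l,
    so the contraction with U is twice that of M.\<close>
  define M where "M = (\<lambda>i j k l. dGam1 K K1 K2 u u2 k i l j
      + (\<Sum>m\<in>UNIV. Gam1 K K1 u i k m * Gam0 u m l j + Gam0 u i k m * Gam1 K K1 u m l j)
      + (\<Sum>m\<in>UNIV. K i m * dGam0 u2 k m l j) + (\<Sum>m\<in>UNIV. K i m * (\<Sum>p\<in>UNIV. Gam0 u m k p * Gam0 u p l j)))"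
  have R: "rup1 K K1 K2 u u2 i j k l + (\<Sum>m\<in>UNIV. K i m * rup0 u u2 m j k l) = M i j k l - M i j l k" for i j k l
    unfolding rup1_def rup0_def M_def
    by (simp add: sum_subtractf sum.distrib distrib_left right_diff_distrib)
  define b1 b2 a1 a2 a3 where "b1 = contr U (\<lambda>i j k l. K1 k l j * u i)" "b2 = contr U (\<lambda>i j k l. K1 i l j * u k)"
    "a1 = contr U (\<lambda>i j k l. K2 k i l j)" "a2 = contr U (\<lambda>i j k l. K l j * u2 k i)"
    "a3 = contr U (\<lambda>i j k l. K l j * (u i * u k))"
  note ab = b1_b2_a1_a2_a3_def
  define N1 N2 N3 N4 where
    "N1 = (\<lambda>i k. (\<Sum>l\<in>UNIV. K i l * u2 k l + K1 k i l * u l) - (\<Sum>m\<in>UNIV. Gam1 K K1 u i k m * u m)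
        + u k * (\<Sum>l\<in>UNIV. K i l * u l) - u i * (\<Sum>l\<in>UNIV. K k l * u l) - (\<Sum>m\<in>UNIV. K i m * u2 k m)
        - (\<Sum>m\<in>UNIV. K i m * (\<Sum>p\<in>UNIV. Gam0 u m k p * u p)))"
    "N2 = (\<lambda>i l. (\<Sum>p\<in>UNIV. K i p * u p) * u l - (\<Sum>p\<in>UNIV. K i p * u p) * u l)"
    "N3 = (\<lambda>j l. \<Sum>m\<in>UNIV. u m * Gam1 K K1 u m l j)"
    "N4 = (\<lambda>i k l. (\<Sum>m\<in>UNIV. K i m * Gam0 u m k l))"
  \<comment> \<open>The terms are sorted for the contraction: every delta is a factor in front of a
    function of at most the remaining indices, as \<open>contr_kr\<close> requires, and the other
    terms can be compared by exchanging indices.\<close>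
  have M: "M i j k l =
      K2 k l j i / 2 + K2 k j l i / 2 - K2 k i l j / 2 - K l j * u2 k i - K1 k l j * u i
      + (K1 k j i * u l / 2 + K1 j k i * u l / 2 - K1 i k j * u l / 2 - K k j * (u i * u l)) + Gam1 K K1 u i k l * u j
      + (K1 l j i * u k / 2 + K1 j l i * u k / 2 - K1 i l j * u k / 2 - K l j * (u i * u k))
      + (K1 k l j * u i / 2 - K1 l j k * u i / 2 - K1 j l k * u i / 2 + K l j * (u i * u k))
      + (K i j * u2 k l + K i l * u2 k j)
      + (K i j * (u k * u l) + K i k * (u j * u l) + N4 i k l * u j)
      + kr l j * N1 i k + kr k j * N2 i l + kr k i * N3 j l" for i j k l
  proof -
    have e1: "(\<Sum>m\<in>UNIV. Gam1 K K1 u i k m * Gam0 u m l j + Gam0 u i k m * Gam1 K K1 u m l j)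
        = Gam1 K K1 u i k j * u l + Gam1 K K1 u i k l * u j - kr l j * (\<Sum>m\<in>UNIV. Gam1 K K1 u i k m * u m)
          + (u k * Gam1 K K1 u i l j + kr k i * (\<Sum>m\<in>UNIV. u m * Gam1 K K1 u m l j) - u i * Gam1 K K1 u k l j)"
      unfolding sum.distrib sum_mult_Gam0 ..
    have "K i m * (\<Sum>p\<in>UNIV. Gam0 u m k p * Gam0 u p l j) = K i m * Gam0 u m k j * u l + K i m * Gam0 u m k l * u j
        - kr l j * (K i m * (\<Sum>p\<in>UNIV. Gam0 u m k p * u p))" for m
      unfolding sum_mult_Gam0(1)[of "Gam0 u m k"] by (simp add: algebra_simps)
    then have e2: "(\<Sum>m\<in>UNIV. K i m * (\<Sum>p\<in>UNIV. Gam0 u m k p * Gam0 u p l j)) = N4 i k j * u l + N4 i k l * u j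
        - kr l j * (\<Sum>m\<in>UNIV. K i m * (\<Sum>p\<in>UNIV. Gam0 u m k p * u p))"
      by (simp add: sum.distrib sum_subtractf sum_distrib_left sum_distrib_right N1_N2_N3_N4_def)
    have e3: "N4 i k j = K i j * u k + K i k * u j - kr k j * (\<Sum>m\<in>UNIV. K i m * u m)"
      unfolding N1_N2_N3_N4_def sum_mult_Gam0(1) ..
    have e4: "Gam1 K K1 u i k j * u l = (K1 k j i * u l / 2 + K1 j k i * u l / 2 - K1 i k j * u l / 2 - K k j * (u i * u l))
        + kr k j * ((\<Sum>p\<in>UNIV. K i p * u p) * u l)"
      "u k * Gam1 K K1 u i l j = (K1 l j i * u k / 2 + K1 j l i * u k / 2 - K1 i l j * u k / 2 - K l j * (u i * u k))
        + kr l j * (u k * (\<Sum>l\<in>UNIV. K i l * u l))"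
      "u i * Gam1 K K1 u k l j = - (K1 k l j * u i / 2 - K1 l j k * u i / 2 - K1 j l k * u i / 2 + K l j * (u i * u k))
        + kr l j * (u i * (\<Sum>l\<in>UNIV. K k l * u l))"
      unfolding Gam1_def[of _ _ _ i k j] Gam1_def[of _ _ _ i l j] Gam1_def[of _ _ _ k l j]
      by (simp_all add: algebra_simps add_divide_distrib diff_divide_distrib)
    show ?thesis
      unfolding M_def e1 e2 e3 e4 sum_mult_dGam0 dGam1_def
      unfolding N1_N2_N3_N4_def(1-3) by (simp add: algebra_simps add_divide_distrib diff_divide_distrib)
  qed
  have half: "contr U (\<lambda>i j k l. F i j k l / 2) = contr U F / 2" for F
    using contr_mult[of U "1/2" F] by simp
  have c: "contr U M = - a1 - 2 * a2 + 2 * a3"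
  proof -
    have t: "contr U (\<lambda>i j k l. K2 k l j i) = 0" "contr U (\<lambda>i j k l. K1 k j i * u l) = 0"
      "contr U (\<lambda>i j k l. K1 l j i * u k) = 0" "contr U (\<lambda>i j k l. K1 j l k * u i) = 0"
      "contr U (\<lambda>i j k l. K i j * u2 k l) = 0" "contr U (\<lambda>i j k l. K i j * (u k * u l)) = 0"
      "contr U (\<lambda>i j k l. Gam1 K K1 u i k l * u j) = 0" "contr U (\<lambda>i j k l. N4 i k l * u j) = 0"
      subgoal by (rule contr_sym(2)[OF U]) (rule K2(1))
      subgoal by (rule contr_sym(1)[OF U]) (subst K1, rule refl)
      subgoal by (rule contr_sym(1)[OF U]) (subst K1, rule refl)
      subgoal by (rule contr_sym(2)[OF U]) (subst K1, rule refl)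
      subgoal by (rule contr_sym(1)[OF U]) (subst K, rule refl)
      subgoal by (rule contr_sym(1)[OF U]) (subst K, rule refl)
      subgoal by (rule contr_sym(2)[OF U]) (simp add: Gam1_def kr_def K[of _ "_ :: 4"] K1 add.commute eq_commute) 
      subgoal by (rule contr_sym(2)[OF U]) (simp add: N1_N2_N3_N4_def Gam0_def kr_def add.commute eq_commute)
      done
    have s1: "contr U (\<lambda>i j k l. K2 k j l i) = - a1" unfolding ab by (rule contr_swap_12[OF U])
    have s2: "contr U (\<lambda>i j k l. K1 j k i * u l) = - contr U (\<lambda>i j k l. K1 i k j * u l)"
      by (rule contr_swap_12[OF U])
    have s3: "contr U (\<lambda>i j k l. K1 i k j * u l) = - b2" unfolding ab by (rule contr_swap_34[OF U])
    have s4: "contr U (\<lambda>i j k l. K k j * (u i * u l)) = - a3" unfolding ab by (rule contr_swap_34[OF U])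
    have s5: "contr U (\<lambda>i j k l. K1 j l i * u k) = - b2" unfolding ab by (rule contr_swap_12[OF U])
    have s6: "contr U (\<lambda>i j k l. K1 l j k * u i) = - b1"
    proof -
      have "contr U (\<lambda>i j k l. K1 l j k * u i) = contr U (\<lambda>i j k l. K1 l k j * u i)" by (subst K1) rule
      also have "\<dots> = - b1" unfolding ab by (rule contr_swap_34[OF U])
      finally show ?thesis .
    qed
    have s7: "contr U (\<lambda>i j k l. K i l * u2 k j) = - a2"
    proof -
      have "contr U (\<lambda>i j k l. K i l * u2 k j) = - contr U (\<lambda>i j k l. K j l * u2 k i)" by (rule contr_swap_12[OF U])
      also have "\<dots> = - a2" unfolding ab by (subst K) rule
      finally show ?thesis .
    qed
    have s8: "contr U (\<lambda>i j k l. K i k * (u j * u l)) = a3"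
    proof -
      have "contr U (\<lambda>i j k l. K i k * (u j * u l)) = - contr U (\<lambda>i j k l. K j k * (u i * u l))" by (rule contr_swap_12[OF U])
      also have "\<dots> = contr U (\<lambda>i j k l. K j l * (u i * u k))"
        using contr_swap_34[OF U, of "\<lambda>i j k l. K j k * (u i * u l)"] by simp
      also have "\<dots> = a3" unfolding ab by (subst K) rule
      finally show ?thesis .
    qed
    have "contr U M = contr U (\<lambda>i j k l.
      K2 k l j i / 2 + K2 k j l i / 2 - K2 k i l j / 2 - K l j * u2 k i - K1 k l j * u i
      + (K1 k j i * u l / 2 + K1 j k i * u l / 2 - K1 i k j * u l / 2 - K k j * (u i * u l)) + Gam1 K K1 u i k l * u j
      + (K1 l j i * u k / 2 + K1 j l i * u k / 2 - K1 i l j * u k / 2 - K l j * (u i * u k))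
      + (K1 k l j * u i / 2 - K1 l j k * u i / 2 - K1 j l k * u i / 2 + K l j * (u i * u k))
      + (K i j * u2 k l + K i l * u2 k j)
      + (K i j * (u k * u l) + K i k * (u j * u l) + N4 i k l * u j)
      + kr l j * N1 i k + kr k j * N2 i l + kr k i * N3 j l)"
      by (intro arg_cong[of _ _ "contr U"] ext M)
    also have "\<dots> = - a1 - 2 * a2 + 2 * a3"
      unfolding contr_add contr_diff half t s1 s2 s3 s4 s5 s6 s7 s8 contr_kr[OF U] ab[symmetric] by simp
    finally show ?thesis .
  qed
  have "contr U (\<lambda>i j k l. M i j k l - M i j l k) = 2 * contr U M"
    unfolding contr_diff using contr_swap_34[OF U, of M] by simp
  moreover have "a1 = contr U (\<lambda>i j k l. K2 i k j l)" "a2 = contr U (\<lambda>i j k l. K j l * u2 i k)"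
    "a3 = contr U (\<lambda>i j k l. K j l * (u i * u k))"
    unfolding ab using K K2 u2 by (metis (no_types))+
  ultimately show ?thesis
    unfolding R c by simp
qed

text \<open>For q nonzero the right-hand side is q (p_il p_jk - p_jl p_ik), where p = \<delta> - u
  u/q projects orthogonally to u: the curvature of the sphere factor.\<close>

lemma rup0_cylinder:
  assumes q: "(\<Sum>m\<in>UNIV. u m * u m) = q" and u2: "\<And>m i. u2 m i = 2 * u m * u i - q * kr m i"
  shows "rup0 u u2 l k i j = q * (kr i l * kr j k - kr j l * kr i k)
    + kr j l * u i * u k - kr j k * u i * u l - kr i l * u j * u k + kr i k * u j * u l"
proof -
  have s: "(\<Sum>m\<in>UNIV. Gam0 u l i m * u m) = kr i l * q" for i
    unfolding sum_mult_Gam0(2) q by simp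
  have A: "(\<Sum>m\<in>UNIV. Gam0 u l i m * Gam0 u m j k) = Gam0 u l i k * u j + Gam0 u l i j * u k - kr j k * (kr i l * q)" for i j
    unfolding sum_mult_Gam0(1)[of "Gam0 u l i"] s ..
  have kr: "kr i j = kr j i" "kr l j = kr j l" "kr l i = kr i l" "kr k j = kr j k" "kr k i = kr i k" "kr l k = kr k l"
    by (simp_all add: kr_def)
  have "rup0 u u2 l k i j = dGam0 u2 i l j k - dGam0 u2 j l i k
     + ((\<Sum>m\<in>UNIV. Gam0 u l i m * Gam0 u m j k) - (\<Sum>m\<in>UNIV. Gam0 u l j m * Gam0 u m i k))"
    unfolding rup0_def sum_subtractf ..
  then show ?thesis
    unfolding A by (simp add: dGam0_def Gam0_def u2 kr algebra_simps)
qed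

subsection \<open>Variations of the cylinder metric\<close>

definition vary :: "real tens2 fld \<Rightarrow> real \<Rightarrow> real tens2 fld" where
  "vary h s = (\<lambda>z. cyl_metric z + s *\<^sub>R h z)"

text \<open>The array K of the expansion: \<open>vary h s\<close> is |x|^-2 (\<delta> + s
  K).\<close>

definition flat_var :: "real tens2 fld \<Rightarrow> real tens2 fld" where
  "flat_var h z = (norm z)\<^sup>2 *\<^sub>R h z"

definition flat_metric :: "real tens2 fld \<Rightarrow> real \<Rightarrow> real tens2 fld" where
  "flat_metric h s z = mat 1 + s *\<^sub>R flat_var h z"

text \<open>The components of \<open>du\<close>, where \<open>u = - ln |x|\<close> is the function with \<open>cyl_metric = e\<^sup>2\<^sup>u \<delta>\<close>.\<close>

definition dlog :: "4 \<Rightarrow> real fld" where "dlog i z = - z $ i / (norm z)\<^sup>2"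

lemma vary_eq: "z \<in> cyl \<Longrightarrow> vary h s z = (1 / (norm z)\<^sup>2) *\<^sub>R flat_metric h s z"
  by (simp add: vary_def flat_metric_def flat_var_def cyl_metric_eq cyl_iff mat_def scaleR_add_right) (simp add: vec_eq_iff)

lemma vary_entry: "z \<in> cyl \<Longrightarrow> vary h s z $ j $ l = (1 / (norm z)\<^sup>2) * (kr j l + s * flat_var h z $ j $ l)"
  by (simp add: vary_eq flat_metric_def mat_def kr_def)

lemma flat_metric_entry: "flat_metric h s z $ j $ l = kr j l + s * flat_var h z $ j $ l"
  by (simp add: flat_metric_def mat_def kr_def)

lemma dlog_eq: "z \<in> cyl \<Longrightarrow> dlog i z = - pd i cyl_t z"
  by (simp add: dlog_def pd_cyl_t cyl_iff)

lemma smooth_dlog: "smooth_on cyl (dlog i)"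
  by (subst smooth_on_cong[OF open_cyl dlog_eq]) (auto intro: smooth_on_minus smooth_on_pd smooth_cyl_t open_cyl)

lemma smooth_flat_var: "smooth_on cyl h \<Longrightarrow> smooth_on cyl (\<lambda>z. flat_var h z $ i $ j)"
  unfolding flat_var_def
  by (simp add: smooth_on_mult smooth_on_norm2 smooth_on_vec_nth open_cyl)

lemma diff_smooth: "smooth_on cyl f \<Longrightarrow> z \<in> cyl \<Longrightarrow> f differentiable (at z)"
  by (rule smooth_on_imp_differentiable[OF _ open_cyl])

lemma pd_mult:
  fixes f g :: "real fld"
  shows "f differentiable (at z) \<Longrightarrow> g differentiable (at z) \<Longrightarrow>
    pd i (\<lambda>z. f z * g z) z = pd i f z * g z + f z * pd i g z"
  by (rule pd_bilinear[OF bounded_bilinear_mult])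

lemma pd_cmult: "f differentiable (at z) \<Longrightarrow> pd i (\<lambda>z. c * f z) z = c * pd i f z" for f :: "real fld"
  by (rule pd_linear[OF bounded_linear_mult_right])

lemma pd_diff:
  fixes f g :: "'a::real_normed_vector fld"
  assumes "f differentiable (at x)" "g differentiable (at x)"
  shows "pd i (\<lambda>x. f x - g x) x = pd i f x - pd i g x"
proof -
  have 1: "(f has_derivative frechet_derivative f (at x)) (at x)"
    "(g has_derivative frechet_derivative g (at x)) (at x)"
    using assms frechet_derivative_works by blast+
  show ?thesis
    by (rule pd_eqI[OF has_derivative_diff[OF 1], THEN trans]) (simp add: pd_def)
qed

lemma pd_sum:
  assumes "\<And>j. j \<in> J \<Longrightarrow> f j differentiable (at x)"
  shows "pd i (\<lambda>x. \<Sum>j\<in>J. f j x) x = (\<Sum>j\<in>J. pd i (f j) x)"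
proof -
  have 1: "(f j has_derivative frechet_derivative (f j) (at x)) (at x)" if "j \<in> J" for j
    using assms[OF that] frechet_derivative_works by blast
  show ?thesis
    by (rule pd_eqI[OF has_derivative_sum[OF 1], THEN trans]) (simp_all add: pd_def)
qed

lemma pd_inverse_norm2: "z \<in> cyl \<Longrightarrow> pd i (\<lambda>z. 1 / (norm z)\<^sup>2) z = 2 * dlog i z / (norm z)\<^sup>2"
  and diff_inverse_norm2: "z \<in> cyl \<Longrightarrow> (\<lambda>z::real^4. 1 / (norm z)\<^sup>2) differentiable (at z)"
proof -
  assume z: "z \<in> cyl"
  have "((\<lambda>z::real^4. 1 / (z \<bullet> z)) has_derivative (\<lambda>v. - (2 * (v \<bullet> z)) / (z \<bullet> z)\<^sup>2)) (at z)"
    using z by (auto intro!: derivative_eq_intros simp: cyl_iff inner_commute power2_eq_square divide_simps)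
  then have d: "((\<lambda>z::real^4. 1 / (norm z)\<^sup>2) has_derivative (\<lambda>v. - (2 * (v \<bullet> z)) / (z \<bullet> z)\<^sup>2)) (at z)"
    by (simp add: dot_square_norm)
  show "pd i (\<lambda>z. 1 / (norm z)\<^sup>2) z = 2 * dlog i z / (norm z)\<^sup>2"
    using pd_eqI[OF d, of i] by (simp add: inner_axis' dlog_def power2_eq_square[of "z \<bullet> z"]) (simp add: dot_square_norm)
  show "(\<lambda>z::real^4. 1 / (norm z)\<^sup>2) differentiable (at z)"
    using d by (auto simp: differentiable_def)
qed

lemma pd_dlog: "z \<in> cyl \<Longrightarrow> pd m (dlog i) z = 2 * dlog m z * dlog i z - (1 / (norm z)\<^sup>2) * kr m i"
proof -
  assume z: "z \<in> cyl"
  have d: "(\<lambda>z::real^4. - z $ i) differentiable (at z)"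
    by (intro differentiable_minus bounded_linear_imp_differentiable bounded_linear_vec_nth)
  have "pd m (\<lambda>z. (1 / (norm z)\<^sup>2) * (- z $ i)) z = 2 * dlog m z / (norm z)\<^sup>2 * (- z $ i) + (1 / (norm z)\<^sup>2) * pd m (\<lambda>z. - z $ i) z"
    unfolding pd_mult[OF diff_inverse_norm2[OF z] d] pd_inverse_norm2[OF z] ..
  moreover have "pd m (\<lambda>z. - z $ i) z = - kr m i"
    using pd_cmult[OF bounded_linear_imp_differentiable[OF bounded_linear_vec_nth[of i]], of m "-1" z]
    by (simp add: pd_coord kr_def)
  moreover have "dlog i = (\<lambda>z. (1 / (norm z)\<^sup>2) * (- z $ i))" by (auto simp: dlog_def)
  ultimately show ?thesis by (simp add: dlog_def)
qed

lemma sum_dlog_sq: "z \<in> cyl \<Longrightarrow> (\<Sum>m\<in>UNIV. dlog m z * dlog m z) = 1 / (norm z)\<^sup>2"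
proof -
  assume z: "z \<in> cyl"
  have "(\<Sum>m\<in>UNIV. dlog m z * dlog m z) = (\<Sum>m\<in>UNIV. z $ m * z $ m) / ((norm z)\<^sup>2 * (norm z)\<^sup>2)"
    by (simp add: dlog_def sum_divide_distrib)
  also have "(\<Sum>m\<in>UNIV. z $ m * z $ m) = (norm z)\<^sup>2"
    by (simp add: norm_vec_def L2_set_def power2_eq_square sum_nonneg)
  also have "(norm z)\<^sup>2 / ((norm z)\<^sup>2 * (norm z)\<^sup>2) = 1 / (norm z)\<^sup>2"
    using z by (intro nonzero_divide_mult_cancel_left) (simp add: cyl_iff)
  finally show ?thesis .
qed

lemma pd_vary_entry:
  assumes h: "smooth_on cyl h" and z: "z \<in> cyl"
  shows "pd i (\<lambda>z. vary h s z $ j $ l) z = (1 / (norm z)\<^sup>2) *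
    (2 * dlog i z * (kr j l + s * flat_var h z $ j $ l) + s * pd i (\<lambda>z. flat_var h z $ j $ l) z)"
proof -
  have d: "(\<lambda>z. flat_var h z $ j $ l) differentiable (at z)" by (rule diff_smooth[OF smooth_flat_var[OF h] z])
  have d2: "(\<lambda>z. kr j l + s * flat_var h z $ j $ l) differentiable (at z)"
    by (intro differentiable_add differentiable_mult differentiable_const d)
  have "pd i (\<lambda>z. vary h s z $ j $ l) z = pd i (\<lambda>z. (1 / (norm z)\<^sup>2) * (kr j l + s * flat_var h z $ j $ l)) z"
    by (rule pd_cong[OF open_cyl vary_entry z])
  also have "\<dots> = 2 * dlog i z / (norm z)\<^sup>2 * (kr j l + s * flat_var h z $ j $ l)
      + (1 / (norm z)\<^sup>2) * pd i (\<lambda>z. kr j l + s * flat_var h z $ j $ l) z"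
    unfolding pd_mult[OF diff_inverse_norm2[OF z] d2] pd_inverse_norm2[OF z] ..
  also have "pd i (\<lambda>z. kr j l + s * flat_var h z $ j $ l) z = s * pd i (\<lambda>z. flat_var h z $ j $ l) z"
    by (subst pd_add) (auto simp: pd_cmult[OF d] intro!: differentiable_mult d)
  finally show ?thesis by (simp add: algebra_simps add_divide_distrib)
qed

lemma matrix_inv_scaleR:
  fixes A :: "real ^ 'n ^ 'n"
  assumes "c \<noteq> 0" "det A \<noteq> 0"
  shows "matrix_inv (c *\<^sub>R A) = (1 / c) *\<^sub>R matrix_inv A"
proof (rule matrix_inv_unique)
  have inv: "A ** matrix_inv A = mat 1" "matrix_inv A ** A = mat 1"
    using assms invertible_det_nz matrix_inv_inverse by blast+
  have "(c *\<^sub>R A) ** ((1 / c) *\<^sub>R matrix_inv A) = A ** matrix_inv A"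
    "((1 / c) *\<^sub>R matrix_inv A) ** (c *\<^sub>R A) = matrix_inv A ** A"
    using assms(1) by (simp_all add: matrix_matrix_mult_def vec_eq_iff mult.commute mult.left_commute)
  then show "(c *\<^sub>R A) ** ((1 / c) *\<^sub>R matrix_inv A) = mat 1" "((1 / c) *\<^sub>R matrix_inv A) ** (c *\<^sub>R A) = mat 1"
    by (simp_all add: inv)
qed

lemma ginv_vary:
  assumes "z \<in> cyl" "det (flat_metric h s z) \<noteq> 0"
  shows "ginv (vary h s) z $ k $ l = (norm z)\<^sup>2 * matrix_inv (flat_metric h s z) $ k $ l"
  using matrix_inv_scaleR[OF _ assms(2), of "1 / (norm z)\<^sup>2"] assms(1) by (simp add: vary_eq cyl_iff)

text \<open>The Christoffel symbols of \<open>vary h s\<close> in a form that is explicit in s up to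
  the inverse matrix, valid wherever the metric is nonsingular.\<close>

definition chris :: "real tens2 fld \<Rightarrow> real \<Rightarrow> real ^ 4 \<Rightarrow> 4 \<Rightarrow> 4 \<Rightarrow> 4 \<Rightarrow> real" where
  "chris h s z k i j = (\<Sum>l\<in>UNIV. matrix_inv (flat_metric h s z) $ k $ l *
      (s * ((pd i (\<lambda>z. flat_var h z $ j $ l) z + pd j (\<lambda>z. flat_var h z $ i $ l) z - pd l (\<lambda>z. flat_var h z $ i $ j) z) / 2)))
    + kr j k * dlog i z + kr i k * dlog j z
    - (kr i j + s * flat_var h z $ i $ j) * (\<Sum>l\<in>UNIV. matrix_inv (flat_metric h s z) $ k $ l * dlog l z)"

lemma christoffel_vary:
  assumes h: "smooth_on cyl h" and sym: "\<And>i j. h z $ i $ j = h z $ j $ i" and z: "z \<in> cyl"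
    and nz: "det (flat_metric h s z) \<noteq> 0"
  shows "christoffel (vary h s) z k i j = chris h s z k i j"
proof -
  let ?C = "matrix_inv (flat_metric h s z)" and ?G = "flat_metric h s z"
  let ?k = "\<lambda>m a b. pd m (\<lambda>z. flat_var h z $ a $ b) z"
  have inv: "?C ** ?G = mat 1"
    using nz invertible_det_nz matrix_inv_inverse by blast
  have Gsym: "?G $ a $ b = ?G $ b $ a" for a b
    using sym[of a b] by (simp add: flat_metric_entry flat_var_def kr_def)
  have CG: "(\<Sum>l\<in>UNIV. ?C $ k $ l * ?G $ j $ l) = kr j k" for j
  proof -
    have "(\<Sum>l\<in>UNIV. ?C $ k $ l * ?G $ l $ j) = kr j k"
      using arg_cong[OF inv, of "\<lambda>M. M $ k $ j"] by (simp add: matrix_matrix_mult_def mat_def kr_def eq_commute)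
    then show ?thesis by (subst Gsym)
  qed
  have e: "ginv (vary h s) z $ k $ l *
        (pd i (\<lambda>z. vary h s z $ j $ l) z + pd j (\<lambda>z. vary h s z $ i $ l) z - pd l (\<lambda>z. vary h s z $ i $ j) z)
      = ?C $ k $ l * (s * (?k i j l + ?k j i l - ?k l i j)) + 2 * dlog i z * (?C $ k $ l * ?G $ j $ l)
        + 2 * dlog j z * (?C $ k $ l * ?G $ i $ l) - 2 * ?G $ i $ j * (?C $ k $ l * dlog l z)" for l
  proof -
    have "(norm z)\<^sup>2 \<noteq> 0" using z by (simp add: cyl_iff)
    then show ?thesis
      unfolding pd_vary_entry[OF h z] ginv_vary[OF z nz] flat_metric_entry[symmetric]
      by (simp add: field_simps)
  qed
  have "christoffel (vary h s) z k i j = (1/2) * ((\<Sum>l\<in>UNIV. ?C $ k $ l * (s * (?k i j l + ?k j i l - ?k l i j)))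
      + 2 * dlog i z * kr j k + 2 * dlog j z * kr i k - 2 * ?G $ i $ j * (\<Sum>l\<in>UNIV. ?C $ k $ l * dlog l z))"
    unfolding christoffel_def e
    by (simp only: sum.distrib sum_subtractf sum_distrib_left[symmetric] CG)
  also have "\<dots> = chris h s z k i j"
    unfolding chris_def flat_metric_entry[symmetric]
    by (simp add: sum_distrib_left algebra_simps add_divide_distrib diff_divide_distrib)
  finally show ?thesis .
qed

lemma open_nonsingular:
  assumes h: "smooth_on cyl h"
  shows "open {z \<in> cyl. det (flat_metric h s z) \<noteq> 0}"
proof -
  have "continuous_on cyl (\<lambda>z. det (flat_metric h s z))"
    unfolding det_def flat_metric_entry
    by (intro continuous_intros smooth_on_imp_continuous_on smooth_flat_var h) simp
  from continuous_open_preimage[OF this open_cyl, of "- {0}"] show ?thesis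
    by (auto simp: vimage_def Int_def open_Compl)
qed

text \<open>The derivative of \<open>chris\<close> in direction m. Derivatives in space are carried
  out at fixed s and the result is then expanded in s, so that derivatives in s and in space never
  have to be interchanged. \<open>P\<close> is the derivative of the inverse matrix.\<close>

definition dchris :: "real tens2 fld \<Rightarrow> real \<Rightarrow> real ^ 4 \<Rightarrow> 4 \<Rightarrow> 4 \<Rightarrow> 4 \<Rightarrow> 4 \<Rightarrow> real" where
  "dchris h s x m k i j =
    (let C = (\<lambda>k l. matrix_inv (flat_metric h s x) $ k $ l);
         K = (\<lambda>i j. flat_var h x $ i $ j);
         K1 = (\<lambda>m a b. pd m (\<lambda>z. flat_var h z $ a $ b) x);
         K2 = (\<lambda>n m a b. pd n (pd m (\<lambda>z. flat_var h z $ a $ b)) x);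
         P = (\<lambda>k l. - (\<Sum>a\<in>UNIV. \<Sum>b\<in>UNIV. C k a * (s * K1 m a b) * C b l))
     in (\<Sum>l\<in>UNIV. P k l * (s * ((K1 i j l + K1 j i l - K1 l i j) / 2)) + C k l * (s * ((K2 m i j l + K2 m j i l - K2 m l i j) / 2)))
       + kr j k * pd m (dlog i) x + kr i k * pd m (dlog j) x
       - (s * K1 m i j * (\<Sum>l\<in>UNIV. C k l * dlog l x) + (kr i j + s * K i j) * (\<Sum>l\<in>UNIV. P k l * dlog l x + C k l * pd m (dlog l) x)))"

lemma pd_chris:
  assumes h: "smooth_on cyl h" and x: "x \<in> cyl" and nz: "det (flat_metric h s x) \<noteq> 0"
  shows "pd m (\<lambda>z. chris h s z k i j) x = dchris h s x m k i j"
proof -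
  define K where "K = (\<lambda>i j z. flat_var h z $ i $ j)"
  have sK: "smooth_on cyl (K i j)" for i j unfolding K_def by (rule smooth_flat_var[OF h])
  have dK: "K i j differentiable (at x)" "pd m (K i j) differentiable (at x)" for m i j
    by (rule diff_smooth[OF sK x], rule diff_smooth[OF smooth_on_pd[OF sK] x])
  have du: "dlog i differentiable (at x)" for i by (rule diff_smooth[OF smooth_dlog x])
  let ?C = "\<lambda>z k l. matrix_inv (flat_metric h s z) $ k $ l"
  have dC: "((\<lambda>z. ?C z k l) has_derivative (\<lambda>v. - (\<Sum>a\<in>UNIV. \<Sum>b\<in>UNIV. ?C x k a * (s * frechet_derivative (K a b) (at x) v) * ?C x b l))) (at x)" for k l
  proof (rule matrix_inv_has_derivative[where A = "flat_metric h s"])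
    fix a b
    have "(K a b has_derivative frechet_derivative (K a b) (at x)) (at x)"
      using dK(1) frechet_derivative_works by blast
    then have "((\<lambda>z. kr a b + s * K a b z) has_derivative (\<lambda>v. s * frechet_derivative (K a b) (at x) v)) (at x)"
      by (auto intro!: derivative_eq_intros)
    then show "((\<lambda>z. flat_metric h s z $ a $ b) has_derivative (\<lambda>v. s * frechet_derivative (K a b) (at x) v)) (at x)"
      by (simp add: flat_metric_entry K_def)
  qed (rule nz)
  have pC: "pd m (\<lambda>z. ?C z k l) x = - (\<Sum>a\<in>UNIV. \<Sum>b\<in>UNIV. ?C x k a * (s * pd m (K a b) x) * ?C x b l)" for k l
    using pd_eqI[OF dC] by (simp add: pd_def)
  have dC': "(\<lambda>z. ?C z k l) differentiable (at x)" for k l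
    using dC by (auto simp: differentiable_def)
  define S where "S = (\<lambda>l z. s * ((pd i (K j l) z + pd j (K i l) z - pd l (K i j) z) / 2))"
  have S_eq: "S l = (\<lambda>z. (s / 2) * (pd i (K j l) z + pd j (K i l) z - pd l (K i j) z))" for l
    by (simp add: S_def)
  have dS: "S l differentiable (at x)" for l
    unfolding S_eq by (intro differentiable_mult differentiable_const differentiable_add differentiable_diff dK)
  have pS: "pd m (S l) x = s * ((pd m (pd i (K j l)) x + pd m (pd j (K i l)) x - pd m (pd l (K i j)) x) / 2)" for l
    unfolding S_eq
    by (subst pd_cmult) (simp_all add: pd_add pd_diff dK differentiable_add differentiable_diff)
  have d1: "(\<lambda>z. \<Sum>l\<in>UNIV. ?C z k l * S l z) differentiable (at x)"
    "(\<lambda>z. \<Sum>l\<in>UNIV. ?C z k l * dlog l z) differentiable (at x)"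
    by (intro differentiable_sum ballI differentiable_mult dC' dS du; simp)+
  have d2: "(\<lambda>z. kr i j + s * K i j z) differentiable (at x)"
    by (intro differentiable_add differentiable_const differentiable_mult dK)
  have d3: "(\<lambda>z. kr j k * dlog i z) differentiable (at x)" "(\<lambda>z. kr i k * dlog j z) differentiable (at x)"
    by (intro differentiable_const differentiable_mult du)+
  have p2: "pd m (\<lambda>z. kr i j + s * K i j z) x = s * pd m (K i j) x"
    by (subst pd_add) (auto simp: pd_cmult[OF dK(1)] intro!: differentiable_mult dK)
  have pS1: "pd m (\<lambda>z. \<Sum>l\<in>UNIV. ?C z k l * S l z) x = (\<Sum>l\<in>UNIV. pd m (\<lambda>z. ?C z k l) x * S l x + ?C x k l * pd m (S l) x)"
    by (subst pd_sum) (auto simp: pd_mult dC' dS intro!: differentiable_mult)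
  have pS2: "pd m (\<lambda>z. \<Sum>l\<in>UNIV. ?C z k l * dlog l z) x = (\<Sum>l\<in>UNIV. pd m (\<lambda>z. ?C z k l) x * dlog l x + ?C x k l * pd m (dlog l) x)"
    by (subst pd_sum) (auto simp: pd_mult dC' du intro!: differentiable_mult)
  have "(\<lambda>z. chris h s z k i j) = (\<lambda>z. (\<Sum>l\<in>UNIV. ?C z k l * S l z) + kr j k * dlog i z + kr i k * dlog j z
      - (kr i j + s * K i j z) * (\<Sum>l\<in>UNIV. ?C z k l * dlog l z))"
    by (simp add: chris_def S_def K_def)
  then have "pd m (\<lambda>z. chris h s z k i j) x
      = pd m (\<lambda>z. \<Sum>l\<in>UNIV. ?C z k l * S l z) x + kr j k * pd m (dlog i) x + kr i k * pd m (dlog j) x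
      - (pd m (\<lambda>z. kr i j + s * K i j z) x * (\<Sum>l\<in>UNIV. ?C x k l * dlog l x)
         + (kr i j + s * K i j x) * pd m (\<lambda>z. \<Sum>l\<in>UNIV. ?C z k l * dlog l z) x)"
    by (simp add: pd_diff pd_add pd_mult pd_cmult d1 d2 d3 du differentiable_add differentiable_mult)
  then show ?thesis
    unfolding p2 pS1 pS2 pC pS by (simp add: dchris_def Let_def S_def K_def)
qed

subsection \<open>First order expansions\<close>

text \<open>Carrying the value and the derivative at s = 0 together lets resolution with the rules
  compute both in one pass.\<close>

definition jet :: "(real \<Rightarrow> real) \<Rightarrow> real \<Rightarrow> real \<Rightarrow> bool" where
  "jet f a b \<longleftrightarrow> f 0 = a \<and> (f has_real_derivative b) (at 0)"

lemma jet_const: "jet (\<lambda>s. c) c 0"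
  and jet_ident: "jet (\<lambda>s. s) 0 1"
  and jet_add: "jet f a b \<Longrightarrow> jet g c d \<Longrightarrow> jet (\<lambda>s. f s + g s) (a + c) (b + d)"
  and jet_diff: "jet f a b \<Longrightarrow> jet g c d \<Longrightarrow> jet (\<lambda>s. f s - g s) (a - c) (b - d)"
  and jet_minus: "jet f a b \<Longrightarrow> jet (\<lambda>s. - f s) (- a) (- b)"
  and jet_mult: "jet f a b \<Longrightarrow> jet g c d \<Longrightarrow> jet (\<lambda>s. f s * g s) (a * c) (a * d + b * c)"
  unfolding jet_def by (auto intro!: derivative_eq_intros)

lemma jet_divide: "jet f a b \<Longrightarrow> jet (\<lambda>s. f s / r) (a / r) (b / r)"
  using jet_mult[OF _ jet_const, of f a b "1 / r"] by simp

lemma jet_sum: "(\<And>i. jet (f i) (a i) (b i)) \<Longrightarrow> jet (\<lambda>s. \<Sum>i\<in>I. f i s) (\<Sum>i\<in>I. a i) (\<Sum>i\<in>I. b i)"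
  unfolding jet_def by (auto intro!: DERIV_sum)

lemma jet_eqI: "jet f a b \<Longrightarrow> a = c \<Longrightarrow> b = d \<Longrightarrow> jet f c d"
  by simp

text \<open>The closed formulas hold only for those s for which the metric at the point is
  nonsingular; these include all s near 0, which is enough for a jet.\<close>

lemma jet_cong: "eventually (\<lambda>s. f s = g s) (nhds 0) \<Longrightarrow> jet f a b \<longleftrightarrow> jet g a b"
  unfolding jet_def using DERIV_cong_ev[of "0::real" 0 f g b b] by (auto dest: eventually_nhds_x_imp_x)

lemmas jet_intros = jet_const jet_ident jet_mult jet_add jet_diff jet_minus jet_divide jet_sum

abbreviation "var0 h x \<equiv> \<lambda>i j. flat_var h x $ i $ j"
abbreviation "var1 h x \<equiv> \<lambda>m i j. pd m (\<lambda>z. flat_var h z $ i $ j) x"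
abbreviation "var2 h x \<equiv> \<lambda>n m i j. pd n (pd m (\<lambda>z. flat_var h z $ i $ j)) x"
abbreviation "dlog1 x \<equiv> \<lambda>i. dlog i x"
abbreviation "dlog2 x \<equiv> \<lambda>m i. pd m (dlog i) x"

lemma eventually_nonsingular: "\<forall>\<^sub>F s in nhds 0. det (flat_metric h s x) \<noteq> 0"
proof -
  have "continuous_on UNIV (\<lambda>s. det (flat_metric h s x))"
    unfolding det_def flat_metric_entry by (intro continuous_intros)
  then have "open ((\<lambda>s. det (flat_metric h s x)) -` (- {0}))"
    by (intro open_vimage) auto
  moreover have "det (flat_metric h 0 x) \<noteq> 0" by (simp add: flat_metric_def)
  ultimately show ?thesis
    unfolding eventually_nhds by (intro exI[of _ "(\<lambda>s. det (flat_metric h s x)) -` (- {0})"]) auto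
qed

lemma jet_inverse: "jet (\<lambda>s. matrix_inv (flat_metric h s x) $ k $ l) (kr k l) (- var0 h x k l)"
proof -
  have i: "matrix_inv (flat_metric h 0 x) $ k $ l = kr k l" for k l
    by (simp add: flat_metric_def matrix_inv_mat) (simp add: mat_def kr_def)
  have "((\<lambda>s. matrix_inv (flat_metric h s x) $ k $ l) has_derivative
    (\<lambda>v. - (\<Sum>a\<in>UNIV. \<Sum>b\<in>UNIV. matrix_inv (flat_metric h 0 x) $ k $ a * (v * var0 h x a b) * matrix_inv (flat_metric h 0 x) $ b $ l))) (at 0)"
  proof (rule matrix_inv_has_derivative[where A = "\<lambda>s. flat_metric h s x"])
    show "((\<lambda>s. flat_metric h s x $ i $ j) has_derivative (\<lambda>v. v * flat_var h x $ i $ j)) (at 0)" for i j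
      unfolding flat_metric_entry by (auto intro!: derivative_eq_intros)
    show "det (flat_metric h 0 x) \<noteq> 0" by (simp add: flat_metric_def)
  qed
  moreover have "(\<Sum>a\<in>UNIV. \<Sum>b\<in>UNIV. kr k a * (v * var0 h x a b) * kr b l) = var0 h x k l * v" for v
    by (simp add: sum_kr mult.assoc sum_distrib_left[symmetric])
  moreover have "(\<lambda>v. - (var0 h x k l * v)) = (*) (- var0 h x k l)" by (simp add: fun_eq_iff)
  ultimately show ?thesis
    unfolding jet_def i has_field_derivative_def by simp
qed

lemma jet_chris: "jet (\<lambda>s. chris h s x k i j) (Gam0 (dlog1 x) k i j) (Gam1 (var0 h x) (var1 h x) (dlog1 x) k i j)"
  unfolding chris_def
  by (rule jet_eqI, (rule jet_intros jet_inverse)+) (simp_all add: Gam0_def Gam1_def sum_kr sum_negf sum_divide_distrib[symmetric])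

lemma jet_dchris: "jet (\<lambda>s. dchris h s x m k i j) (dGam0 (dlog2 x) m k i j)
    (dGam1 (var0 h x) (var1 h x) (var2 h x) (dlog1 x) (dlog2 x) m k i j)"
proof -
  let ?C = "\<lambda>s k l. matrix_inv (flat_metric h s x) $ k $ l"
  have P: "jet (\<lambda>s. - (\<Sum>a\<in>UNIV. \<Sum>b\<in>UNIV. ?C s k a * (s * var1 h x m a b) * ?C s b l)) 0 (- var1 h x m k l)" for k l
  proof (rule jet_eqI, (rule jet_intros jet_inverse)+)
    show "- (\<Sum>a\<in>UNIV. \<Sum>b\<in>UNIV. (kr k a * (0 * var1 h x m a b)) * kr b l) = 0" by simp
    have "(\<Sum>a\<in>UNIV. \<Sum>b\<in>UNIV. kr k a * (var1 h x m a b * kr b l)) = var1 h x m k l"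
      by (simp add: sum_kr sum_distrib_left[symmetric])
    then show "- (\<Sum>a\<in>UNIV. \<Sum>b\<in>UNIV. kr k a * (0 * var1 h x m a b) * - var0 h x b l
        + (kr k a * (0 * 0 + 1 * var1 h x m a b) + - var0 h x k a * (0 * var1 h x m a b)) * kr b l) = - var1 h x m k l"
      by (simp add: mult.assoc)
  qed
  show ?thesis
    unfolding dchris_def Let_def
    by (rule jet_eqI, (rule P jet_intros jet_inverse)+)
      (simp_all add: dGam0_def dGam1_def sum_kr sum_negf sum.distrib sum_subtractf sum_divide_distrib[symmetric] right_diff_distrib distrib_left)
qed

lemma riem_up_vary:
  assumes h: "smooth_on cyl h" and sym: "\<And>z i j. h z $ i $ j = h z $ j $ i" and x: "x \<in> cyl"
    and nz: "det (flat_metric h s x) \<noteq> 0"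
  shows "riem_up (vary h s) x l k i j = dchris h s x i l j k - dchris h s x j l i k
    + (\<Sum>m\<in>UNIV. chris h s x l i m * chris h s x m j k - chris h s x l j m * chris h s x m i k)"
proof -
  have c: "christoffel (vary h s) x k i j = chris h s x k i j" for k i j
    by (rule christoffel_vary[OF h sym x nz])
  \<comment> \<open>The closed formula holds on an open set of points and may therefore be
    differentiated in space.\<close>
  have "pd m (\<lambda>z. christoffel (vary h s) z k i j) x = pd m (\<lambda>z. chris h s z k i j) x" for m k i j
    by (rule pd_cong[OF open_nonsingular[OF h, of s]]) (use christoffel_vary[OF h sym] x nz in auto)
  then show ?thesis unfolding riem_up_def c pd_chris[OF h x nz] by simp
qed

context
  fixes h :: "real tens2 fld" and x :: "real ^ 4"
  assumes h: "smooth_on cyl h" and sym: "\<And>z i j. h z $ i $ j = h z $ j $ i" and x: "x \<in> cyl"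
begin

lemma jet_riem_up: "jet (\<lambda>s. riem_up (vary h s) x l k i j) (rup0 (dlog1 x) (dlog2 x) l k i j)
    (rup1 (var0 h x) (var1 h x) (var2 h x) (dlog1 x) (dlog2 x) l k i j)"
proof -
  have e: "jet (\<lambda>s. riem_up (vary h s) x l k i j) a b \<longleftrightarrow> jet (\<lambda>s. dchris h s x i l j k - dchris h s x j l i k
    + (\<Sum>m\<in>UNIV. chris h s x l i m * chris h s x m j k - chris h s x l j m * chris h s x m i k)) a b" for a b
    by (rule jet_cong, rule eventually_mono[OF eventually_nonsingular[of h x]]) (rule riem_up_vary[OF h sym x])
  show ?thesis
    unfolding e by (rule jet_eqI, (rule jet_dchris jet_chris jet_intros)+, simp_all add: rup0_def rup1_def algebra_simps)
qed

lemma jet_ginv: "jet (\<lambda>s. ginv (vary h s) x $ k $ l) ((norm x)\<^sup>2 * kr k l) (- (norm x)\<^sup>2 * var0 h x k l)"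
proof -
  have e: "jet (\<lambda>s. ginv (vary h s) x $ k $ l) a b \<longleftrightarrow> jet (\<lambda>s. (norm x)\<^sup>2 * matrix_inv (flat_metric h s x) $ k $ l) a b" for a b
    by (rule jet_cong, rule eventually_mono[OF eventually_nonsingular[of h x]]) (rule ginv_vary[OF x])
  show ?thesis
    unfolding e by (rule jet_eqI, (rule jet_inverse jet_intros)+, simp_all)
qed

lemma jet_metric: "jet (\<lambda>s. vary h s x $ k $ l) (1 / (norm x)\<^sup>2 * kr k l) (1 / (norm x)\<^sup>2 * var0 h x k l)"
  unfolding vary_entry[OF x] by (rule jet_eqI, (rule jet_intros)+, simp_all)

definition riem1 :: "4 \<Rightarrow> 4 \<Rightarrow> 4 \<Rightarrow> 4 \<Rightarrow> real" where
  "riem1 i j k l = 1 / (norm x)\<^sup>2 * (rup1 (var0 h x) (var1 h x) (var2 h x) (dlog1 x) (dlog2 x) i j k l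
    + (\<Sum>m\<in>UNIV. var0 h x i m * rup0 (dlog1 x) (dlog2 x) m j k l))"

lemma jet_riem: "jet (\<lambda>s. riem (vary h s) x i j k l) (1 / (norm x)\<^sup>2 * rup0 (dlog1 x) (dlog2 x) i j k l) (riem1 i j k l)"
proof -
  have "jet (\<lambda>s. riem (vary h s) x i j k l)
     (\<Sum>m\<in>UNIV. 1 / (norm x)\<^sup>2 * kr i m * rup0 (dlog1 x) (dlog2 x) m j k l)
     (\<Sum>m\<in>UNIV. 1 / (norm x)\<^sup>2 * kr i m * rup1 (var0 h x) (var1 h x) (var2 h x) (dlog1 x) (dlog2 x) m j k l
       + 1 / (norm x)\<^sup>2 * var0 h x i m * rup0 (dlog1 x) (dlog2 x) m j k l)"
    unfolding riem_def by (rule jet_sum jet_mult jet_metric jet_riem_up)+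
  then show ?thesis
    by (simp add: riem1_def mult.assoc sum_divide_distrib[symmetric] sum_distrib_left[symmetric] sum_kr sum.distrib add_divide_distrib)
qed

text \<open>The Ricci tensor 2 (g - dt^2) of the cylinder, with dt = - \<open>dlog\<close>.\<close>

definition ric0 :: "4 \<Rightarrow> 4 \<Rightarrow> real" where
  "ric0 j l = 2 / (norm x)\<^sup>2 * kr j l - 2 * dlog j x * dlog l x"

definition ric1 :: "4 \<Rightarrow> 4 \<Rightarrow> real" where
  "ric1 j l = (\<Sum>i\<in>UNIV. \<Sum>k\<in>UNIV. (norm x)\<^sup>2 * kr i k * riem1 i j k l
     + (- (norm x)\<^sup>2 * var0 h x i k) * (1 / (norm x)\<^sup>2 * rup0 (dlog1 x) (dlog2 x) i j k l))"

lemma rup0_dlog: "rup0 (dlog1 x) (dlog2 x) l k i j = 1 / (norm x)\<^sup>2 * (kr i l * kr j k - kr j l * kr i k)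
    + kr j l * dlog i x * dlog k x - kr j k * dlog i x * dlog l x - kr i l * dlog j x * dlog k x + kr i k * dlog j x * dlog l x"
  by (rule rup0_cylinder[OF sum_dlog_sq[OF x] pd_dlog[OF x]])

lemma jet_ricci: "jet (\<lambda>s. ricci (vary h s) x j l) (ric0 j l) (ric1 j l)"
proof -
  have "jet (\<lambda>s. ricci (vary h s) x j l)
     (\<Sum>i\<in>UNIV. \<Sum>k\<in>UNIV. (norm x)\<^sup>2 * kr i k * (1 / (norm x)\<^sup>2 * rup0 (dlog1 x) (dlog2 x) i j k l)) (ric1 j l)"
    unfolding ricci_def ric1_def by (rule jet_sum jet_mult jet_ginv jet_riem)+
  moreover have "(\<Sum>i\<in>UNIV. \<Sum>k\<in>UNIV. (norm x)\<^sup>2 * kr i k * (1 / (norm x)\<^sup>2 * rup0 (dlog1 x) (dlog2 x) i j k l)) = ric0 j l"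
  proof -
    have "(norm x)\<^sup>2 * kr i k * (1 / (norm x)\<^sup>2 * rup0 (dlog1 x) (dlog2 x) i j k l) = kr i k * rup0 (dlog1 x) (dlog2 x) i j k l" for i k
      using x by (simp add: cyl_iff)
    then have "(\<Sum>i\<in>UNIV. \<Sum>k\<in>UNIV. (norm x)\<^sup>2 * kr i k * (1 / (norm x)\<^sup>2 * rup0 (dlog1 x) (dlog2 x) i j k l))
       = (\<Sum>i\<in>UNIV. rup0 (dlog1 x) (dlog2 x) i j i l)"
      by (simp add: sum_kr)
    also have "\<dots> = (\<Sum>i\<in>UNIV. (1 / (norm x)\<^sup>2 - dlog i x * dlog i x) * kr j l
        - 1 / (norm x)\<^sup>2 * (kr i l * kr i j) + kr i l * (dlog i x * dlog j x) + kr i j * (dlog i x * dlog l x) - dlog j x * dlog l x)"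
      by (intro sum.cong refl) (simp add: rup0_dlog kr_def algebra_simps)
    also have "\<dots> = (4 / (norm x)\<^sup>2 - 1 / (norm x)\<^sup>2) * kr j l - 1 / (norm x)\<^sup>2 * kr l j - 2 * (dlog j x * dlog l x)"
      by (simp only: sum.distrib sum_subtractf sum_distrib_left[symmetric] sum_distrib_right[symmetric] sum_kr sum_dlog_sq[OF x]) 
        (simp add: mult.commute kr_def)
    also have "\<dots> = ric0 j l"
      by (simp add: ric0_def kr_def)
    finally show ?thesis .
  qed
  ultimately show ?thesis by simp
qed

definition scal1 :: real where
  "scal1 = (\<Sum>j\<in>UNIV. \<Sum>l\<in>UNIV. (norm x)\<^sup>2 * kr j l * ric1 j l + (- (norm x)\<^sup>2 * var0 h x j l) * ric0 j l)"

lemma jet_scal: "jet (\<lambda>s. scal (vary h s) x) 6 scal1"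
proof -
  have "jet (\<lambda>s. scal (vary h s) x) (\<Sum>j\<in>UNIV. \<Sum>l\<in>UNIV. (norm x)\<^sup>2 * kr j l * ric0 j l) scal1"
    unfolding scal_def scal1_def by (rule jet_sum jet_mult jet_ginv jet_ricci)+
  moreover have "(\<Sum>j\<in>UNIV. \<Sum>l\<in>UNIV. (norm x)\<^sup>2 * kr j l * ric0 j l) = 6"
  proof -
    have "(\<Sum>j\<in>UNIV. \<Sum>l\<in>UNIV. (norm x)\<^sup>2 * kr j l * ric0 j l) = (\<Sum>j\<in>UNIV. (norm x)\<^sup>2 * ric0 j j)"
      by (simp add: mult.assoc sum_distrib_left[symmetric] sum_kr)
    also have "\<dots> = (norm x)\<^sup>2 * (\<Sum>j\<in>UNIV. 2 / (norm x)\<^sup>2 - 2 * (dlog j x * dlog j x))"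
      by (simp add: ric0_def kr_def sum_distrib_left mult.assoc)
    also have "\<dots> = 6"
      unfolding sum_subtractf sum_distrib_left[symmetric] sum_dlog_sq[OF x] using x by (simp add: cyl_iff)
    finally show ?thesis .
  qed
  ultimately show ?thesis by simp
qed

text \<open>The background values are \<open>ric0\<close> for the Ricci tensor and 6 for the scalar
  curvature, which cancels the factor 1/6. Terms with a delta are written with the delta in front,
  in the shape accepted by \<open>contr_kr\<close>.\<close>

definition weyl1 :: "4 \<Rightarrow> 4 \<Rightarrow> 4 \<Rightarrow> 4 \<Rightarrow> real" where
  "weyl1 i j k l = riem1 i j k l
    - 1 / (2 * (norm x)\<^sup>2) * (ric0 i k * var0 h x j l - ric0 i l * var0 h x j k + ric0 j l * var0 h x i k - ric0 j k * var0 h x i l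
      + kr j l * ric1 i k - kr j k * ric1 i l + kr i k * ric1 j l - kr i l * ric1 j k)
    + 1 / (norm x) ^ 4 * (kr i k * var0 h x j l + kr j l * var0 h x i k - kr i l * var0 h x j k - kr j k * var0 h x i l
      + kr i k * (scal1 / 6 * kr j l) - kr i l * (scal1 / 6 * kr k j))"

text \<open>The value is 0 since the cylinder is locally conformally flat. As a consequence, the
  variation of the metric and of the projections around the Weyl operator does not contribute to the
  linearization.\<close>

lemma jet_weyl: "jet (\<lambda>s. weyl (vary h s) x i j k l) 0 (weyl1 i j k l)"
  unfolding weyl_def
proof (rule jet_eqI, (rule jet_intros jet_riem jet_ricci jet_scal jet_metric)+)
  have p: "(norm x)\<^sup>2 * (norm x)\<^sup>2 = (norm x) ^ 4" by simp
  have c: "kr k i = kr i k" "kr k j = kr j k" for k i j by (simp_all add: kr_def)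
  show "1 / (norm x)\<^sup>2 * rup0 (dlog1 x) (dlog2 x) i j k l - 1 / 2 *
      (ric0 i k * (1 / (norm x)\<^sup>2 * kr j l) - ric0 i l * (1 / (norm x)\<^sup>2 * kr j k)
      + 1 / (norm x)\<^sup>2 * kr i k * ric0 j l - 1 / (norm x)\<^sup>2 * kr i l * ric0 j k)
      + 6 / 6 * (1 / (norm x)\<^sup>2 * kr i k * (1 / (norm x)\<^sup>2 * kr j l) - 1 / (norm x)\<^sup>2 * kr i l * (1 / (norm x)\<^sup>2 * kr j k)) = 0"
    unfolding rup0_dlog ric0_def by (simp add: kr_def algebra_simps)
qed (simp add: weyl1_def kr_def algebra_simps power2_eq_square power4_eq_xxxx)

text \<open>The terms with derivatives of the conformal factor cancel: the Riemann tensor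
  contributes -4a and the Ricci terms 4a, both divided by |x|^2. What is left is the flat
  expression, as conformal invariance of the Weyl tensor suggests.\<close>

lemma contr_weyl1:
  assumes U: "asd_weyl U"
  shows "contr U weyl1 = - 2 / (norm x)\<^sup>2 * contr U (\<lambda>i j k l. var2 h x i k j l)"
proof -
  define a where "a = contr U (\<lambda>i j k l. var0 h x j l * (dlog i x * dlog k x))"
  have K: "var0 h x i j = var0 h x j i" for i j by (simp add: flat_var_def sym[of x i j])
  have fs: "(\<lambda>z. flat_var h z $ i $ j) = (\<lambda>z. flat_var h z $ j $ i)" for i j
    by (simp add: flat_var_def sym[of _ i j])
  have K1: "var1 h x m i j = var1 h x m j i" and K2b: "var2 h x m n i j = var2 h x m n j i" for m n i j
    by (simp_all only: fs[of i j])
  have K2a: "var2 h x m n i j = var2 h x n m i j" for m n i j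
    by (rule pd_commute_real[OF open_cyl smooth_flat_var[OF h] x])
  have u2: "dlog2 x i j = dlog2 x j i" for i j by (simp add: pd_dlog[OF x] kr_def)
  have r1: "contr U (\<lambda>i j k l. ric0 i k * var0 h x j l) = - 2 * a"
  proof -
    have "(\<lambda>i j k l. ric0 i k * var0 h x j l)
        = (\<lambda>i j k l. kr i k * (2 / (norm x)\<^sup>2 * var0 h x j l) - 2 * (var0 h x j l * (dlog i x * dlog k x)))"
      by (intro ext) (simp add: ric0_def algebra_simps)
    then show ?thesis
      unfolding a_def by (simp only: contr_diff contr_mult contr_kr(3)[OF U])
  qed
  have r2: "contr U (\<lambda>i j k l. ric0 i l * var0 h x j k) = 2 * a"
    using contr_swap_34[OF U, of "\<lambda>i j k l. ric0 i l * var0 h x j k"] r1 by simp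
  have r3: "contr U (\<lambda>i j k l. ric0 j l * var0 h x i k) = - 2 * a"
    using contr_swap_12[OF U, of "\<lambda>i j k l. ric0 j l * var0 h x i k"] r2 by simp
  have r4: "contr U (\<lambda>i j k l. ric0 j k * var0 h x i l) = 2 * a"
    using contr_swap_12[OF U, of "\<lambda>i j k l. ric0 j k * var0 h x i l"] r1 by simp
  have "contr U (\<lambda>i j k l. var0 h x j l * dlog2 x i k) = 2 * a"
  proof -
    have "(\<lambda>i j k l. var0 h x j l * dlog2 x i k)
        = (\<lambda>i j k l. 2 * (var0 h x j l * (dlog i x * dlog k x)) - kr i k * (1 / (norm x)\<^sup>2 * var0 h x j l))"
      by (intro ext) (simp add: pd_dlog[OF x] algebra_simps)
    then show ?thesis
      unfolding a_def by (simp only: contr_diff contr_mult contr_kr(3)[OF U])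
  qed
  with contr_linearized_riem[OF U, of "var0 h x" "var1 h x" "var2 h x" "dlog2 x" "dlog1 x", OF K K1 K2a K2b u2]
  have riem: "contr U riem1 = 1 / (norm x)\<^sup>2 * (- 2 * contr U (\<lambda>i j k l. var2 h x i k j l) - 4 * (2 * a) + 4 * a)"
    unfolding riem1_def[abs_def] contr_mult a_def by simp
  show ?thesis
    unfolding weyl1_def[abs_def] contr_add contr_diff contr_mult r1 r2 r3 r4 contr_kr[OF U] riem[unfolded riem1_def[abs_def]]
    using riem by (simp add: algebra_simps)
qed

end

subsection \<open>Pairing the linearization with anti-self-dual Weyl tensors\<close>

lemma has_vector_derivative_vecI:
  fixes f :: "real \<Rightarrow> 'b::euclidean_space ^ 'n"
  assumes "\<And>i. ((\<lambda>s. f s $ i) has_vector_derivative d $ i) (at a)"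
  shows "(f has_vector_derivative d) (at a)"
  unfolding has_vector_derivative_def
proof (subst has_derivative_componentwise_within, intro ballI)
  fix b :: "'b ^ 'n" assume "b \<in> Basis"
  then obtain i u where "b = axis i u" by (auto simp: Basis_vec_def)
  then show "((\<lambda>s. f s \<bullet> b) has_derivative (\<lambda>s. s *\<^sub>R d \<bullet> b)) (at a)"
    using has_derivative_inner_left[OF assms[of i, unfolded has_vector_derivative_def], of u]
    by (simp add: inner_axis)
qed

text \<open>Because f vanishes at 0, its difference quotient is f(s)/s and the factor c need only be
  continuous. So the determinant, the inverse metric and the projections in
  \<open>weyl_minus\<close> do not have to be differentiated.\<close>

lemma jet_mult_isCont:
  assumes "jet f 0 b" "isCont c 0"
  shows "jet (\<lambda>s. c s * f s) 0 (c 0 * b)"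
proof -
  have "f 0 = 0" using assms(1) unfolding jet_def by blast
  then have "((\<lambda>s. f s / s) \<longlongrightarrow> b) (at 0)"
    using assms(1) by (simp add: jet_def has_field_derivative_iff)
  from tendsto_mult[OF assms(2)[unfolded isCont_def] this] \<open>f 0 = 0\<close>
  show ?thesis by (simp add: jet_def has_field_derivative_iff)
qed

lemma jet_isCont: "jet f a b \<Longrightarrow> isCont f 0"
  unfolding jet_def using DERIV_isCont by blast

definition asdp :: "(4 \<Rightarrow> 4 \<Rightarrow> real) \<Rightarrow> 4 \<Rightarrow> 4 \<Rightarrow> real" where
  "asdp A i j = 1/2 * (A i j - 1/2 * (\<Sum>a\<in>UNIV. \<Sum>b\<in>UNIV. levi_civita i j a b * A a b))"

lemma asd_proj_cyl_metric: "x \<in> cyl \<Longrightarrow> asd_proj cyl_metric x \<eta> $ i $ j = asdp (\<lambda>a b. \<eta> $ a $ b) i j"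
  by (simp add: asd_proj_def asdp_def hodge_cyl_metric)

lemma asdp_linear:
  "asdp (\<lambda>a b. c * A a b) i j = c * asdp A i j"
  "asdp (\<lambda>a b. \<Sum>k\<in>I. F k a b) i j = (\<Sum>k\<in>I. asdp (F k) i j)"
proof -
  show "asdp (\<lambda>a b. c * A a b) i j = c * asdp A i j"
    by (simp add: asdp_def sum_distrib_left algebra_simps)
  have e: "(\<Sum>a\<in>UNIV. \<Sum>b\<in>UNIV. levi_civita i j a b * (\<Sum>k\<in>I. F k a b)) = (\<Sum>k\<in>I. \<Sum>a\<in>UNIV. \<Sum>b\<in>UNIV. levi_civita i j a b * F k a b)"
    unfolding sum_distrib_left by (subst sum.swap[of _ I UNIV]) (intro sum.cong refl sum.swap)
  have "asdp (\<lambda>a b. \<Sum>k\<in>I. F k a b) i j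
      = 1/2 * ((\<Sum>k\<in>I. F k i j) - 1/2 * (\<Sum>k\<in>I. \<Sum>a\<in>UNIV. \<Sum>b\<in>UNIV. levi_civita i j a b * F k a b))"
    unfolding asdp_def e ..
  then show "asdp (\<lambda>a b. \<Sum>k\<in>I. F k a b) i j = (\<Sum>k\<in>I. asdp (F k) i j)"
    by (simp only: asdp_def sum_distrib_left[symmetric] sum_subtractf)
qed

lemma levi_civita_asd_form:
  "(\<Sum>a\<in>UNIV. \<Sum>b\<in>UNIV. levi_civita i j a b * asd_form p q r a b) = - 2 * asd_form p q r i j"
proof -
  have v: "levi_civita 3 4 1 2 = 1" "levi_civita 3 4 2 1 = -1" "levi_civita 2 4 1 3 = -1" "levi_civita 2 4 3 1 = 1"
    "levi_civita 2 3 1 4 = 1" "levi_civita 2 3 4 1 = -1"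
    using levi_civita_values levi_civita_pair[of 3 4 1 2] levi_civita_pair[of 2 4 1 3] levi_civita_pair[of 2 3 1 4]
      levi_civita_swap(3)[of 3 4 2 1] levi_civita_swap(3)[of 2 4 3 1] levi_civita_swap(3)[of 2 3 4 1]
    by simp_all
  note w = levi_civita_swap(1)[of 2 1] levi_civita_swap(1)[of 3 1] levi_civita_swap(1)[of 4 1]
    levi_civita_swap(1)[of 3 2] levi_civita_swap(1)[of 4 2] levi_civita_swap(1)[of 4 3]
  have "\<forall>i j. (\<Sum>a\<in>UNIV. \<Sum>b\<in>UNIV. levi_civita i j a b * asd_form p q r a b) = - 2 * asd_form p q r i j"
    by (simp add: forall_4 sum_4 asd_form_values levi_civita_repeated levi_civita_values v w)
  then show ?thesis by blast
qed

lemma asd_weyl_levi_civita: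
  fixes U :: "4 \<Rightarrow> 4 \<Rightarrow> 4 \<Rightarrow> 4 \<Rightarrow> real"
  assumes U: "asd_weyl U"
  shows "(\<Sum>a\<in>UNIV. \<Sum>b\<in>UNIV. levi_civita i j a b * U a b k l) = - 2 * U i j k l"
  using U by (auto simp: asd_weyl_def levi_civita_asd_form)

lemma asdp_asd_weyl:
  fixes U :: "4 \<Rightarrow> 4 \<Rightarrow> 4 \<Rightarrow> 4 \<Rightarrow> real"
  assumes U: "asd_weyl U"
  shows "asdp (U p q) m n = U p q m n"
    and "(\<Sum>i\<in>UNIV. \<Sum>j\<in>UNIV. U i j k l * asdp A i j) = (\<Sum>i\<in>UNIV. \<Sum>j\<in>UNIV. U i j k l * A i j)"
proof -
  have "U p q = (\<lambda>a b. U a b p q)" by (intro ext) (rule asd_weyl_pair[OF U])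
  then show "asdp (U p q) m n = U p q m n" by (simp add: asdp_def asd_weyl_levi_civita[OF U])
  have "(\<Sum>i\<in>UNIV. \<Sum>j\<in>UNIV. U i j k l * (\<Sum>a\<in>UNIV. \<Sum>b\<in>UNIV. levi_civita i j a b * A a b))
      = (\<Sum>(i, j)\<in>UNIV. \<Sum>(a, b)\<in>UNIV. U i j k l * (levi_civita i j a b * A a b))"
    by (simp add: UNIV_Times_UNIV[symmetric] sum.cartesian_product[symmetric] sum_distrib_left del: UNIV_Times_UNIV)
  also have "\<dots> = (\<Sum>(a, b)\<in>UNIV. \<Sum>(i, j)\<in>UNIV. U i j k l * (levi_civita i j a b * A a b))"
    unfolding case_prod_unfold by (rule sum.swap)
  also have "\<dots> = (\<Sum>a\<in>UNIV. \<Sum>b\<in>UNIV. (\<Sum>i\<in>UNIV. \<Sum>j\<in>UNIV. levi_civita a b i j * U i j k l) * A a b)"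
    by (simp add: UNIV_Times_UNIV[symmetric] sum.cartesian_product[symmetric] sum_distrib_right sum_distrib_left levi_civita_pair[of _ _ "_ :: 4"] mult_ac
       del: UNIV_Times_UNIV)
  also have "\<dots> = (\<Sum>i\<in>UNIV. \<Sum>j\<in>UNIV. - 2 * (U i j k l * A i j))"
    unfolding asd_weyl_levi_civita[OF U] by (simp add: mult_ac)
  finally have "(\<Sum>i\<in>UNIV. \<Sum>j\<in>UNIV. U i j k l * (\<Sum>a\<in>UNIV. \<Sum>b\<in>UNIV. levi_civita i j a b * A a b))
     = - 2 * (\<Sum>i\<in>UNIV. \<Sum>j\<in>UNIV. U i j k l * A i j)" by (simp add: sum_distrib_left)
  moreover have "U i j k l * asdp A i j = 1/2 * (U i j k l * A i j) - 1/4 * (U i j k l * (\<Sum>a\<in>UNIV. \<Sum>b\<in>UNIV. levi_civita i j a b * A a b))" for i j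
    by (simp add: asdp_def algebra_simps)
  ultimately show "(\<Sum>i\<in>UNIV. \<Sum>j\<in>UNIV. U i j k l * asdp A i j) = (\<Sum>i\<in>UNIV. \<Sum>j\<in>UNIV. U i j k l * A i j)"
    by (simp add: sum_subtractf sum_distrib_left[symmetric] sum_divide_distrib[symmetric])
qed

definition wedge :: "real tens2 fld \<Rightarrow> real ^ 4 \<Rightarrow> 4 \<Rightarrow> 4 \<Rightarrow> real tens2" where
  "wedge g x k l = (\<chi> a b. g x $ k $ a * g x $ l $ b - g x $ k $ b * g x $ l $ a)"

context
  fixes h :: "real tens2 fld" and x :: "real ^ 4"
  assumes h: "smooth_on cyl h" and sym: "\<And>z i j. h z $ i $ j = h z $ j $ i" and x: "x \<in> cyl"
begin

lemma isCont_vary: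
  "isCont (\<lambda>s. vary h s x $ k $ l) 0" "isCont (\<lambda>s. ginv (vary h s) x $ k $ l) 0" "isCont (\<lambda>s. vol_density (vary h s) x) 0"
proof -
  show 1: "isCont (\<lambda>s. vary h s x $ k $ l) 0" for k l by (rule jet_isCont[OF jet_metric[OF h sym x]])
  show "isCont (\<lambda>s. ginv (vary h s) x $ k $ l) 0" by (rule jet_isCont[OF jet_ginv[OF h sym x]])
  show "isCont (\<lambda>s. vol_density (vary h s) x) 0"
    unfolding vol_density_def det_def by (rule 1 continuous_intros)+
qed

lemma isCont_asd_proj:
  assumes "\<And>a b. isCont (\<lambda>s. \<eta> s $ a $ b) 0"
  shows "isCont (\<lambda>s. asd_proj (vary h s) x (\<eta> s) $ i $ j) 0"
proof -
  have "isCont (\<lambda>s. 1/2 * (\<eta> s $ i $ j - vol_density (vary h s) x * (1/2) * (\<Sum>k\<in>UNIV. \<Sum>l\<in>UNIV. \<Sum>a\<in>UNIV. \<Sum>b\<in>UNIV.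
         (levi_civita i j k l * ginv (vary h s) x $ k $ a * ginv (vary h s) x $ l $ b) * \<eta> s $ a $ b))) 0"
    by (rule assms isCont_vary continuous_intros)+
  then show ?thesis by (simp add: asd_proj_def hodge_def)
qed

lemma vary_0: "vary h 0 = cyl_metric"
  by (simp add: vary_def)

lemma jet_asd_proj:
  assumes "\<And>a b. jet (\<lambda>s. \<eta> s $ a $ b) 0 (d a b)"
  shows "jet (\<lambda>s. asd_proj (vary h s) x (\<eta> s) $ i $ j) 0 (asdp d i j)"
proof -
  have c: "isCont (\<lambda>s. levi_civita i j k l * ginv (vary h s) x $ k $ a * ginv (vary h s) x $ l $ b) 0"
    "isCont (\<lambda>s. vol_density (vary h s) x * (1/2)) 0" for k l a b
    by (rule isCont_vary continuous_intros)+
  have "jet (\<lambda>s. (vol_density (vary h s) x * (1/2)) * (\<Sum>k\<in>UNIV. \<Sum>l\<in>UNIV. \<Sum>a\<in>UNIV. \<Sum>b\<in>UNIV.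
         (levi_civita i j k l * ginv (vary h s) x $ k $ a * ginv (vary h s) x $ l $ b) * \<eta> s $ a $ b)) 0
      ((vol_density (vary h 0) x * (1/2)) * (\<Sum>k\<in>UNIV. \<Sum>l\<in>UNIV. \<Sum>a\<in>UNIV. \<Sum>b\<in>UNIV.
         (levi_civita i j k l * ginv (vary h 0) x $ k $ a * ginv (vary h 0) x $ l $ b) * d a b))"
    by (rule jet_mult_isCont[OF jet_eqI c(2)], (rule jet_sum jet_mult_isCont assms c)+) simp_all
  from jet_mult_isCont[OF jet_eqI[OF jet_diff[OF assms[of i j] this]], where c = "\<lambda>_. 1/2"]
  have "jet (\<lambda>s. asd_proj (vary h s) x (\<eta> s) $ i $ j) 0 (asd_proj cyl_metric x (\<chi> a b. d a b) $ i $ j)"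
    by (simp add: asd_proj_def hodge_def vary_0)
  then show ?thesis by (simp add: asd_proj_cyl_metric[OF x])
qed

definition lin_weyl where
  "lin_weyl i j k l = asdp (\<lambda>p q. (norm x) ^ 4 / 2 * (\<Sum>m\<in>UNIV. \<Sum>n\<in>UNIV.
    weyl1 h x p q m n * asdp (\<lambda>a b. wedge cyl_metric x k l $ a $ b) m n)) i j"

lemma jet_weyl_minus: "jet (\<lambda>s. weyl_minus (vary h s) x $ i $ j $ k $ l) 0 (lin_weyl i j k l)"
proof -
  let ?P = "\<lambda>s a b. asd_proj (vary h s) x (wedge (vary h s) x k l) $ a $ b"
  have w: "isCont (\<lambda>s. wedge (vary h s) x k l $ a $ b) 0" for a b
    unfolding wedge_def by (simp, (rule isCont_vary continuous_intros)+)
  have c: "isCont (\<lambda>s. 1/2 * (ginv (vary h s) x $ m $ a * ginv (vary h s) x $ n $ b * ?P s a b)) 0" for m n a b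
    by (rule isCont_vary isCont_asd_proj w continuous_intros)+
  have W: "jet (\<lambda>s. weyl_op (vary h s) x (asd_proj (vary h s) x (wedge (vary h s) x k l)) $ p $ q) 0
      ((norm x) ^ 4 / 2 * (\<Sum>m\<in>UNIV. \<Sum>n\<in>UNIV. weyl1 h x p q m n * asdp (\<lambda>a b. wedge cyl_metric x k l $ a $ b) m n))" for p q
  proof -
    have A: "jet (\<lambda>s. \<Sum>m\<in>UNIV. \<Sum>n\<in>UNIV. \<Sum>a\<in>UNIV. \<Sum>b\<in>UNIV. 
        (1/2 * (ginv (vary h s) x $ m $ a * ginv (vary h s) x $ n $ b * ?P s a b)) * weyl (vary h s) x p q m n) 
 0
      (\<Sum>m\<in>UNIV. \<Sum>n\<in>UNIV. \<Sum>a\<in>UNIV. \<Sum>b\<in>UNIV. 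
        (1/2 * (ginv (vary h 0) x $ m $ a * ginv (vary h 0) x $ n $ b * ?P 0 a b)) * weyl1 h x p q m n)"
      by (rule jet_eqI, (rule jet_sum jet_mult_isCont[OF jet_weyl[OF h sym x] c])+) simp_all
    have e: "(\<Sum>a\<in>UNIV. \<Sum>b\<in>UNIV. (1/2 * (ginv (vary h 0) x $ m $ a * ginv (vary h 0) x $ n $ b * ?P 0 a b)) * weyl1 h x p q m n)
       = (norm x) ^ 4 / 2 * (weyl1 h x p q m n * ?P 0 m n)" for m n
      using sum_delta_scaleR[of "weyl1 h x p q m n / 2" m "(norm x)\<^sup>2" n "?P 0"]
      by (simp add: vary_0 ginv_cyl_metric[OF x] mult_ac power4_eq_xxxx power2_eq_square)
    show ?thesis
      using A unfolding e by (simp add: weyl_op_def vary_0 asd_proj_cyl_metric[OF x] sum_distrib_left sum_divide_distrib mult_ac)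
  qed
  show ?thesis
    using jet_asd_proj[OF W, of i j] by (simp add: weyl_minus_def weyl_minus_op_def wedge_def lin_weyl_def)
qed

lemma lin_weyl_minus_entry: "lin_weyl_minus cyl_metric h x $ i $ j $ k $ l = lin_weyl i j k l"
proof -
  have "((\<lambda>s. weyl_minus (vary h s) x) has_vector_derivative (\<chi> i j k l. lin_weyl i j k l)) (at 0)"
    using jet_weyl_minus by (intro has_vector_derivative_vecI) (simp add: jet_def has_real_derivative_iff_has_vector_derivative)
  then have "lin_weyl_minus cyl_metric h x = (\<chi> i j k l. lin_weyl i j k l)"
    unfolding lin_weyl_minus_def vary_def[symmetric] by (rule vector_derivative_at)
  then show ?thesis by simp
qed

text \<open>Both projections are moved onto U, which they fix. Contraction with the basic 2-forms
  doubles U and divides it by |x|^4, which the factor |x|^4/2 of the Weyl operator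
  compensates.\<close>

lemma contr_lin_weyl:
  assumes U: "asd_weyl U"
  shows "contr U lin_weyl = contr U (weyl1 h x)"
proof -
  define r where "r = 1 / (norm x) ^ 4"
  have r: "(norm x) ^ 4 * r = 1" using x by (simp add: r_def cyl_iff)
  define B where "B k l = (\<lambda>p q. (norm x) ^ 4 / 2 * (\<Sum>m\<in>UNIV. \<Sum>n\<in>UNIV.
    weyl1 h x p q m n * asdp (\<lambda>a b. wedge cyl_metric x k l $ a $ b) m n))" for k l
  have sw: "(\<Sum>i\<in>UNIV. \<Sum>j\<in>UNIV. \<Sum>k\<in>UNIV. \<Sum>l\<in>UNIV. f i j k l) = (\<Sum>k\<in>UNIV. \<Sum>l\<in>UNIV. \<Sum>i\<in>UNIV. \<Sum>j\<in>UNIV. f i j k l)"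
    for f :: "4 \<Rightarrow> 4 \<Rightarrow> 4 \<Rightarrow> 4 \<Rightarrow> real"
  proof -
    have "(\<Sum>i\<in>UNIV. \<Sum>j\<in>UNIV. \<Sum>k\<in>UNIV. \<Sum>l\<in>UNIV. f i j k l) = (\<Sum>(i, j)\<in>UNIV. \<Sum>(k, l)\<in>UNIV. f i j k l)"
      by (simp add: UNIV_Times_UNIV[symmetric] sum.cartesian_product[symmetric] del: UNIV_Times_UNIV)
    also have "\<dots> = (\<Sum>(k, l)\<in>UNIV. \<Sum>(i, j)\<in>UNIV. f i j k l)"
      unfolding case_prod_unfold by (rule sum.swap)
    finally show ?thesis
      by (simp add: UNIV_Times_UNIV[symmetric] sum.cartesian_product[symmetric] del: UNIV_Times_UNIV)
  qed
  have P: "(\<Sum>k\<in>UNIV. \<Sum>l\<in>UNIV. U i j k l * asdp (\<lambda>a b. wedge cyl_metric x k l $ a $ b) m n) = 2 * r * U i j m n" for i j m n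
  proof -
    have e: "wedge cyl_metric x k l $ a $ b = r * (kr k a * kr l b - kr k b * kr l a)" for k l a b
      by (simp add: wedge_def cyl_metric_entry[OF x] kr_def r_def power4_eq_xxxx power2_eq_square)
    have "(\<Sum>k\<in>UNIV. \<Sum>l\<in>UNIV. U i j k l * asdp (\<lambda>a b. wedge cyl_metric x k l $ a $ b) m n)
      = asdp (\<lambda>a b. \<Sum>k\<in>UNIV. \<Sum>l\<in>UNIV. U i j k l * wedge cyl_metric x k l $ a $ b) m n"
      unfolding asdp_linear ..
    also have "(\<lambda>a b. \<Sum>k\<in>UNIV. \<Sum>l\<in>UNIV. U i j k l * wedge cyl_metric x k l $ a $ b) = (\<lambda>a b. 2 * r * U i j a b)"
    proof (intro ext)
      fix a b
      have "(\<Sum>k\<in>UNIV. \<Sum>l\<in>UNIV. U i j k l * wedge cyl_metric x k l $ a $ b)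
        = (\<Sum>k\<in>UNIV. kr k a * (\<Sum>l\<in>UNIV. kr l b * (r * U i j k l)) - kr k b * (\<Sum>l\<in>UNIV. kr l a * (r * U i j k l)))"
        by (simp add: e sum_distrib_left sum_subtractf algebra_simps)
      also have "\<dots> = r * U i j a b - r * U i j b a" by (simp only: sum_kr sum_subtractf)
      finally show "(\<Sum>k\<in>UNIV. \<Sum>l\<in>UNIV. U i j k l * wedge cyl_metric x k l $ a $ b) = 2 * r * U i j a b"
        using asd_weyl_antisym2[OF U, of i j b a] by simp
    qed
    also have "asdp (\<lambda>a b. 2 * r * U i j a b) m n = 2 * r * U i j m n"
      unfolding asdp_linear asdp_asd_weyl(1)[OF U] ..
    finally show ?thesis .
  qed
  have "contr U lin_weyl = (\<Sum>k\<in>UNIV. \<Sum>l\<in>UNIV. \<Sum>i\<in>UNIV. \<Sum>j\<in>UNIV. U i j k l * asdp (B k l) i j)"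
    unfolding contr_def lin_weyl_def B_def by (rule sw)
  also have "\<dots> = (\<Sum>k\<in>UNIV. \<Sum>l\<in>UNIV. \<Sum>i\<in>UNIV. \<Sum>j\<in>UNIV. U i j k l * B k l i j)"
    unfolding asdp_asd_weyl(2)[OF U] ..
  also have "\<dots> = (\<Sum>i\<in>UNIV. \<Sum>j\<in>UNIV. \<Sum>k\<in>UNIV. \<Sum>l\<in>UNIV. \<Sum>m\<in>UNIV. \<Sum>n\<in>UNIV. (norm x) ^ 4 / 2 *
      (weyl1 h x i j m n * (U i j k l * asdp (\<lambda>a b. wedge cyl_metric x k l $ a $ b) m n)))"
    unfolding B_def by (rule trans[OF sw[symmetric]]) (simp add: sum_distrib_left mult_ac)
  also have "\<dots> = (\<Sum>i\<in>UNIV. \<Sum>j\<in>UNIV. \<Sum>m\<in>UNIV. \<Sum>n\<in>UNIV. \<Sum>k\<in>UNIV. \<Sum>l\<in>UNIV. (norm x) ^ 4 / 2 *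
      (weyl1 h x i j m n * (U i j k l * asdp (\<lambda>a b. wedge cyl_metric x k l $ a $ b) m n)))"
    by (intro sum.cong refl sw)
  also have "\<dots> = (\<Sum>i\<in>UNIV. \<Sum>j\<in>UNIV. \<Sum>m\<in>UNIV. \<Sum>n\<in>UNIV. (norm x) ^ 4 / 2 * (weyl1 h x i j m n * (2 * r * U i j m n)))"
    unfolding sum_distrib_left[symmetric] P ..
  also have "\<dots> = contr U (weyl1 h x)"
  proof -
    have e: "(norm x) ^ 4 / 2 * (weyl1 h x i j m n * (2 * r * U i j m n)) = U i j m n * weyl1 h x i j m n" for i j m n
      using r by (simp add: algebra_simps)
    show ?thesis unfolding e contr_def ..
  qed
  finally show ?thesis .
qed

end

lemma asd_weyl_Re_Im:
  assumes "asd_weyl (\<lambda>i j k l. U i j k l :: complex)"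
  shows "asd_weyl (\<lambda>i j k l. Re (U i j k l))" "asd_weyl (\<lambda>i j k l. Im (U i j k l))"
proof -
  obtain a b c d e where U: "U = (\<lambda>i j k l. asd_form
     (asd_form a b c k l) (asd_form b d e k l) (asd_form c e (- a - d) k l) i j)"
    using assms by (auto simp: asd_weyl_def)
  have "Re (asd_form p q r i j) = asd_form (Re p) (Re q) (Re r) i j"
    "Im (asd_form p q r i j) = asd_form (Im p) (Im q) (Im r) i j" for p q r i j
    by (simp_all add: asd_form_def)
  note e = this
  show "asd_weyl (\<lambda>i j k l. Re (U i j k l))"
    unfolding U asd_weyl_def
    by (rule exI[of _ "Re a"], rule exI[of _ "Re b"], rule exI[of _ "Re c"], rule exI[of _ "Re d"], rule exI[of _ "Re e"])
      (simp add: e)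
  show "asd_weyl (\<lambda>i j k l. Im (U i j k l))"
    unfolding U asd_weyl_def
    by (rule exI[of _ "Im a"], rule exI[of _ "Im b"], rule exI[of _ "Im c"], rule exI[of _ "Im d"], rule exI[of _ "Im e"])
      (simp add: e)
qed

lemma inner4_cyl_metric:
  assumes x: "x \<in> cyl"
  shows "inner4 cyl_metric x A Z = ((norm x) ^ 8 / 4) *\<^sub>R
    (\<Sum>i\<in>UNIV. \<Sum>j\<in>UNIV. \<Sum>k\<in>UNIV. \<Sum>l\<in>UNIV. A $ i $ j $ k $ l *\<^sub>R Z $ i $ j $ k $ l)"
proof -
  let ?g = "\<lambda>i a. if i = a then (norm x)\<^sup>2 else 0"
  have "(\<Sum>a\<in>UNIV. \<Sum>b\<in>UNIV. \<Sum>c\<in>UNIV. \<Sum>d\<in>UNIV.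
      (?g i a * ?g j b * ?g k c * ?g l d * A $ i $ j $ k $ l) *\<^sub>R Z $ a $ b $ c $ d)
    = (norm x) ^ 8 *\<^sub>R A $ i $ j $ k $ l *\<^sub>R Z $ i $ j $ k $ l" for i j k l
  proof -
    have "(\<Sum>c\<in>UNIV. \<Sum>d\<in>UNIV. (?g i a * ?g j b * ?g k c * ?g l d * A $ i $ j $ k $ l) *\<^sub>R Z $ a $ b $ c $ d)
      = (((norm x)\<^sup>2 * (norm x)\<^sup>2 * A $ i $ j $ k $ l) * ?g i a * ?g j b) *\<^sub>R Z $ a $ b $ k $ l" for a b
      using sum_delta_scaleR[of "?g i a * ?g j b * A $ i $ j $ k $ l" k "(norm x)\<^sup>2" l "\<lambda>c d. Z $ a $ b $ c $ d"]
      by (simp only: mult_ac)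
    then show ?thesis
      using sum_delta_scaleR[of "(norm x)\<^sup>2 * (norm x)\<^sup>2 * A $ i $ j $ k $ l" i "(norm x)\<^sup>2" j "\<lambda>a b. Z $ a $ b $ k $ l"]
      by (simp add: mult_ac flip: power_add)
  qed
  then show ?thesis
    unfolding inner4_def ginv_cyl_metric[OF x] by (simp add: scaleR_sum_right)
qed

text \<open>The identities for real tensors are applied to the real and imaginary parts of Z, which
  are again anti-self-dual Weyl tensors.\<close>

lemma inner4_lin_weyl_minus:
  fixes Z :: "complex tens4"
  assumes h: "smooth_on cyl h" and sym: "\<And>z i j. h z $ i $ j = h z $ j $ i" and x: "x \<in> cyl"
    and Z: "asd_weyl (\<lambda>i j k l. Z $ i $ j $ k $ l)"
  shows "inner4 cyl_metric x (lin_weyl_minus cyl_metric h x) Z = (- ((norm x) ^ 6 / 2)) *\<^sub>R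
    (\<Sum>i\<in>UNIV. \<Sum>j\<in>UNIV. \<Sum>k\<in>UNIV. \<Sum>l\<in>UNIV. var2 h x i k j l *\<^sub>R Z $ i $ j $ k $ l)"
proof -
  have r: "(norm x) ^ 8 / 4 * (- 2 / (norm x)\<^sup>2) = - ((norm x) ^ 6 / 2)"
    using x by (simp add: cyl_iff field_simps flip: power_add)
  have "(norm x) ^ 8 / 4 * contr U (lin_weyl h x) = - ((norm x) ^ 6 / 2) * contr U (\<lambda>i j k l. var2 h x i k j l)"
    if "asd_weyl U" for U
    unfolding contr_lin_weyl[OF h sym x that] contr_weyl1[OF h sym x that] r[symmetric] by simp
  from this[OF asd_weyl_Re_Im(1)[OF Z]] this[OF asd_weyl_Re_Im(2)[OF Z]]
  show ?thesis
    unfolding inner4_cyl_metric[OF x] lin_weyl_minus_entry[OF h sym x]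
    by (intro complex_eqI) (simp_all add: contr_def mult_ac)
qed

section \<open>Integration by parts and the formal adjoint\<close>

definition csupp :: "sfun \<Rightarrow> bool" where
  "csupp f \<longleftrightarrow> (\<exists>K. compact K \<and> K \<subseteq> cyl \<and> (\<forall>x. x \<notin> K \<longrightarrow> ev f x = 0))"

lemma csupp_mult: "csupp f \<Longrightarrow> csupp (f * g)" "csupp f \<Longrightarrow> csupp (g * f)"
  unfolding csupp_def by (metis ev_simps(2) mult_zero_left, metis ev_simps(2) mult_zero_right)

lemma csupp_add: "csupp f \<Longrightarrow> csupp g \<Longrightarrow> csupp (f + g)"
proof -
  assume "csupp f" "csupp g"
  then obtain K L where "compact K" "K \<subseteq> cyl" "\<And>x. x \<notin> K \<Longrightarrow> ev f x = 0"
    "compact L" "L \<subseteq> cyl" "\<And>x. x \<notin> L \<Longrightarrow> ev g x = 0"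
    unfolding csupp_def by blast
  then show "csupp (f + g)"
    unfolding csupp_def by (intro exI[of _ "K \<union> L"]) auto
qed

lemma csupp_0 [simp]: "csupp 0"
  unfolding csupp_def by (intro exI[of _ "{}"]) simp

lemma csupp_sum: "(\<And>i. i \<in> I \<Longrightarrow> csupp (f i)) \<Longrightarrow> csupp (\<Sum>i\<in>I. f i)"
  by (induction I rule: infinite_finite_induct) (auto intro: csupp_add)

lemma csupp_vanishes_nearby:
  assumes "compact K" "K \<subseteq> cyl" "\<And>x. x \<notin> K \<Longrightarrow> ev f x = 0" "x \<notin> K"
  shows "(ev f has_derivative (\<lambda>v. 0)) (at x)"
  by (subst has_derivative_cong_open[of "- K" _ "\<lambda>x. 0"]) (use assms in \<open>auto simp: open_Compl compact_imp_closed\<close>)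

text \<open>The support is closed and avoids the origin, so the function vanishes near 0 and its
  derivatives exist on the whole space.\<close>

lemma csupp_differentiable: "csupp f \<Longrightarrow> ev f differentiable (at x)"
  and csupp_pd: "csupp f \<Longrightarrow> pd i (ev f) x = ev (D i f) x"
proof -
  assume "csupp f"
  then obtain K where K: "compact K" "K \<subseteq> cyl" "\<And>x. x \<notin> K \<Longrightarrow> ev f x = 0"
    unfolding csupp_def by blast
  have 0: "(ev f has_derivative (\<lambda>v. 0)) (at 0)"
    using K by (intro csupp_vanishes_nearby[OF K]) (auto simp: cyl_def)
  show "ev f differentiable (at x)"
    using 0 diff_ev[of x f] by (cases "x = 0") (auto simp: cyl_iff differentiable_def)
  show "pd i (ev f) x = ev (D i f) x"
    using pd_eqI[OF 0] by (cases "x = 0") (auto simp: ev_D cyl_iff)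
qed

lemma csupp_D: "csupp f \<Longrightarrow> csupp (D i f)"
proof -
  assume f: "csupp f"
  then obtain K where K: "compact K" "K \<subseteq> cyl" "\<And>x. x \<notin> K \<Longrightarrow> ev f x = 0"
    unfolding csupp_def by blast
  have "ev (D i f) x = 0" if "x \<notin> K" for x
    using pd_eqI[OF csupp_vanishes_nearby[OF K that]] csupp_pd[OF f] by metis
  with K show ?thesis unfolding csupp_def by blast
qed

lemma csupp_continuous: "csupp f \<Longrightarrow> continuous_on S (ev f)"
  by (meson csupp_differentiable differentiable_imp_continuous_within continuous_at_imp_continuous_on)

lemma has_integral_translate:
  fixes F :: "'a::euclidean_space \<Rightarrow> 'b::banach"
  assumes "(F has_integral J) (cbox a b)" "\<And>x. x \<notin> cbox a b \<Longrightarrow> F x = 0"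
  shows "((\<lambda>x. F (x + c)) has_integral J) UNIV"
proof (rule has_integral_on_superset)
  show "((\<lambda>x. F (x + c)) has_integral J) ((\<lambda>x. x - c) ` cbox a b)"
    using has_integral_affinity[OF assms(1), of 1 c] by simp
  fix x assume "x \<notin> (\<lambda>x. x - c) ` cbox a b"
  then have "x + c \<notin> cbox a b" by (metis add_diff_cancel_right' image_eqI)
  then show "F (x + c) = 0" by (rule assms(2))
qed simp

lemma csupp_has_integral:
  assumes "csupp f"
  shows "(ev f has_integral integral cyl (ev f)) UNIV" "(ev f has_integral integral cyl (ev f)) cyl"
proof -
  obtain K where K: "compact K" "K \<subseteq> cyl" "\<And>x. x \<notin> K \<Longrightarrow> ev f x = 0"
    using assms unfolding csupp_def by blast
  obtain a where a: "K \<subseteq> cbox (-a) a"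
    using bounded_subset_cbox_symmetric[OF compact_imp_bounded[OF K(1)]] .
  have 0: "(ev f has_integral integral (cbox (-a) a) (ev f)) (cbox (-a) a)"
    by (intro integrable_integral integrable_continuous csupp_continuous assms)
  have 1: "(ev f has_integral integral (cbox (-a) a) (ev f)) UNIV"
    by (rule has_integral_on_superset[OF 0 _ subset_UNIV]) (use a K(3) in blast)
  have e: "(\<lambda>x. if x \<in> cyl then ev f x else 0) = ev f" by (auto simp: cyl_iff)
  have 2: "(ev f has_integral integral (cbox (-a) a) (ev f)) cyl"
    using 1 by (subst has_integral_restrict_UNIV[symmetric]) (simp add: e)
  show "(ev f has_integral integral cyl (ev f)) UNIV" "(ev f has_integral integral cyl (ev f)) cyl"
    using 1 2 integral_unique[OF 2] by simp_all
qed

text \<open>Translation invariance: the integral of f(x + t e_i) does not depend on t, and by the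
  Leibniz rule its derivative at t = 0 is the integral of \<open>D i f\<close>. No iterated integral
  is involved.\<close>

lemma integral_D_zero:
  assumes f: "csupp f"
  shows "integral cyl (ev (D i f)) = 0"
proof -
  let ?e = "axis i 1 :: real ^ 4" and ?U = "{-1<..<1::real}"
  obtain K where K: "compact K" "K \<subseteq> cyl" "\<And>x. x \<notin> K \<Longrightarrow> ev f x = 0" "\<And>x. x \<notin> K \<Longrightarrow> ev (D i f) x = 0"
  proof -
    obtain K where K: "compact K" "K \<subseteq> cyl" "\<And>x. x \<notin> K \<Longrightarrow> ev f x = 0" using f unfolding csupp_def by blast
    obtain L where L: "compact L" "L \<subseteq> cyl" "\<And>x. x \<notin> L \<Longrightarrow> ev (D i f) x = 0" using csupp_D[OF f, of i] unfolding csupp_def by blast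
    show ?thesis by (rule that[of "K \<union> L"]) (use K L in auto)
  qed
  \<comment> \<open>One box has to contain the translates of the support for all t in [-1, 1], so
    that the domain of integration is fixed.\<close>
  have c: "compact ((\<lambda>p. snd p - fst p *\<^sub>R ?e) ` ({-1..1} \<times> K))"
    by (intro compact_continuous_image continuous_intros compact_Times K) simp
  obtain a where a: "(\<lambda>p. snd p - fst p *\<^sub>R ?e) ` ({-1..1} \<times> K) \<subseteq> cbox (-a) a"
    using bounded_subset_cbox_symmetric[OF compact_imp_bounded[OF c]] .
  have outside: "x + t *\<^sub>R ?e \<notin> K" if "t \<in> ?U" "x \<notin> cbox (-a) a" for t x
  proof
    assume "x + t *\<^sub>R ?e \<in> K"
    then have "x \<in> (\<lambda>p. snd p - fst p *\<^sub>R ?e) ` ({-1..1} \<times> K)"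
      using that(1) by (intro image_eqI[of _ _ "(t, x + t *\<^sub>R ?e)"]) auto
    with a that(2) show False by blast
  qed
  have sub: "K \<subseteq> cbox (-a) a"
    using outside[of 0] by auto
  have int0: "(ev g has_integral integral (cbox (-a) a) (ev g)) (cbox (-a) a)" if "csupp g" for g
    by (intro integrable_integral integrable_continuous csupp_continuous that)
  have const: "integral (cbox (-a) a) (\<lambda>x. ev f (x + t *\<^sub>R ?e)) = integral (cbox (-a) a) (ev f)" if t: "t \<in> ?U" for t
  proof -
    have 1: "((\<lambda>x. ev f (x + t *\<^sub>R ?e)) has_integral integral (cbox (-a) a) (ev f)) UNIV"
      by (rule has_integral_translate[OF int0[OF f]]) (use sub K(3) in blast)
    have "(\<lambda>x. if x \<in> cbox (-a) a then ev f (x + t *\<^sub>R ?e) else 0) = (\<lambda>x. ev f (x + t *\<^sub>R ?e))"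
      using outside[OF t] K(3) by auto
    then have "((\<lambda>x. ev f (x + t *\<^sub>R ?e)) has_integral integral (cbox (-a) a) (ev f)) (cbox (-a) a)"
      using 1 by (subst has_integral_restrict_UNIV[symmetric]) simp
    then show ?thesis by (rule integral_unique)
  qed
  have cont: "continuous_on UNIV (\<lambda>x. ev g (h x))" if "csupp g" "continuous_on UNIV h" for g and h :: "'x::topological_space \<Rightarrow> _"
    using continuous_on_compose2[OF csupp_continuous[OF that(1), of UNIV] that(2)] by simp
  have "((\<lambda>t. integral (cbox (-a) a) (\<lambda>x. ev f (x + t *\<^sub>R ?e))) has_vector_derivative
      integral (cbox (-a) a) (\<lambda>x. ev (D i f) (x + 0 *\<^sub>R ?e))) (at 0 within ?U)"
  proof (rule leibniz_rule_vector_derivative)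
    fix t :: real and x :: "real ^ 4"
    show "((\<lambda>t. ev f (x + t *\<^sub>R ?e)) has_vector_derivative ev (D i f) (x + t *\<^sub>R ?e)) (at t within ?U)"
      using has_vector_derivative_pd[OF csupp_differentiable[OF f]] csupp_pd[OF f]
      by (metis has_vector_derivative_at_within)
    show "(\<lambda>x. ev f (x + t *\<^sub>R ?e)) integrable_on cbox (-a) a"
      by (intro integrable_continuous continuous_on_subset[OF cont[OF f]]) (auto intro!: continuous_intros)
    show "continuous_on (?U \<times> cbox (-a) a) (\<lambda>(t, x). ev (D i f) (x + t *\<^sub>R ?e))"
      unfolding case_prod_unfold
      by (intro continuous_on_subset[OF cont[OF csupp_D[OF f]]]) (auto intro!: continuous_intros)
  qed auto
  then have "((\<lambda>t. integral (cbox (-a) a) (\<lambda>x. ev f (x + t *\<^sub>R ?e))) has_vector_derivative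
      integral (cbox (-a) a) (ev (D i f))) (at 0)"
    by (subst (asm) at_within_open) auto
  moreover have "((\<lambda>t. integral (cbox (-a) a) (\<lambda>x. ev f (x + t *\<^sub>R ?e))) has_vector_derivative 0) (at 0)"
    by (rule has_vector_derivative_transform_within_open[where S = ?U, OF has_vector_derivative_const])
      (auto simp: const)
  ultimately have "integral (cbox (-a) a) (ev (D i f)) = 0" by (rule vector_derivative_unique_at)
  then have z: "(ev (D i f) has_integral 0) (cbox (-a) a)" using int0[OF csupp_D[OF f], of i] by simp
  have "(ev (D i f) has_integral 0) UNIV"
    by (rule has_integral_on_superset[OF z _ subset_UNIV]) (use sub K(4) in blast)
  then show ?thesis by (rule has_integral_unique[OF csupp_has_integral(1)[OF csupp_D[OF f]]])
qed

lemma integral_csupp_add: "csupp f \<Longrightarrow> csupp g \<Longrightarrow> integral cyl (ev (f + g)) = integral cyl (ev f) + integral cyl (ev g)"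
  using has_integral_add[OF csupp_has_integral(2) csupp_has_integral(2), of f g]
  by (simp add: plus_sfun.rep_eq[abs_def] integral_unique)

lemma integral_csupp_sum: "(\<And>i. i \<in> I \<Longrightarrow> csupp (f i)) \<Longrightarrow> integral cyl (ev (\<Sum>i\<in>I. f i)) = (\<Sum>i\<in>I. integral cyl (ev (f i)))"
proof (induction I rule: infinite_finite_induct)
  case (insert i I)
  then have "integral cyl (ev (f i + sum f I)) = integral cyl (ev (f i)) + integral cyl (ev (sum f I))"
    by (intro integral_csupp_add csupp_sum) auto
  also have "integral cyl (ev (sum f I)) = (\<Sum>i\<in>I. integral cyl (ev (f i)))" by (rule insert) (simp add: insert)
  finally show ?case unfolding sum.insert[OF insert(1,2)] .
qed (simp_all add: zero_sfun.rep_eq)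

lemma integral_parts:
  assumes "csupp f"
  shows "integral cyl (ev (D i f * g)) = - integral cyl (ev (f * D i g))"
  using integral_D_zero[OF csupp_mult(1)[OF assms], of i g]
    integral_csupp_add[OF csupp_mult(1)[OF csupp_D[OF assms]] csupp_mult(1)[OF assms], of i g "D i g"]
  by (simp add: D_mult eq_neg_iff_add_eq_0)

lemma integral_parts_twice:
  assumes "csupp f"
  shows "integral cyl (ev (D i (D k f) * g)) = integral cyl (ev (f * D i (D k g)))"
  using integral_parts[OF csupp_D[OF assms], of i k g] integral_parts[OF assms, of k "D i g"]
  by (simp add: D_commute[of k i])

subsection \<open>Bump functions\<close>

text \<open>The functions p(1/s) e^{-1/s}, extended by zero, form a family closed under
  differentiation: with u = 1/s, the derivative replaces p by u^2 (p - p'). This is the family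
  needed for \<open>smooth_on_compose\<close>.\<close>

definition flat_exp :: "real poly \<Rightarrow> real \<Rightarrow> real" where
  "flat_exp p s = (if s > 0 then poly p (1 / s) * exp (- (1 / s)) else 0)"

lemma flat_exp_tendsto_0: "(flat_exp p \<longlongrightarrow> 0) (at 0)"
proof -
  have "((\<lambda>u. \<Sum>i\<le>degree p. coeff p i * (u ^ i / exp u)) \<longlongrightarrow> (\<Sum>i\<le>degree p. coeff p i * 0)) at_top"
    by (intro tendsto_sum tendsto_mult tendsto_const tendsto_power_div_exp_0)
  then have 1: "((\<lambda>u. poly p u * exp (- u)) \<longlongrightarrow> 0) at_top"
    by (simp add: poly_altdef sum_distrib_right exp_minus divide_inverse mult.assoc)
  have "((\<lambda>s. poly p (inverse s) * exp (- inverse s)) \<longlongrightarrow> 0) (at_right 0)"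
    by (rule filterlim_compose[OF 1 filterlim_inverse_at_top_right])
  moreover have "\<forall>\<^sub>F s in at_right 0. poly p (inverse s) * exp (- inverse s) = flat_exp p s"
    unfolding eventually_at_right_field by (auto simp: flat_exp_def inverse_eq_divide intro!: exI[of _ 1])
  ultimately have r: "(flat_exp p \<longlongrightarrow> 0) (at_right 0)" by (rule Lim_transform_eventually)
  have "\<forall>\<^sub>F s in at_left 0. 0 = flat_exp p s"
    unfolding eventually_at_left_field by (auto simp: flat_exp_def intro!: exI[of _ "-1"])
  then have "(flat_exp p \<longlongrightarrow> 0) (at_left 0)" by (rule Lim_transform_eventually[OF tendsto_const])
  with r show ?thesis by (simp add: filterlim_at_split)
qed

lemma flat_exp_has_derivative:
  "(flat_exp p has_real_derivative flat_exp ([:0, 0, 1:] * (p - pderiv p)) s) (at s)"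
proof (cases s "0::real" rule: linorder_cases)
  case less
  have "(flat_exp p has_real_derivative 0) (at s)"
    by (rule has_field_derivative_transform_within_open[of "\<lambda>s. 0" _ _ "{..<0}"]) (use less in \<open>auto simp: flat_exp_def\<close>)
  with less show ?thesis by (simp add: flat_exp_def)
next
  case equal
  \<comment> \<open>The difference quotient at 0 belongs to the family again, with the polynomial u
    p, and so tends to 0.\<close>
  have "((\<lambda>h. flat_exp p h / h) \<longlongrightarrow> 0) (at 0)"
    using flat_exp_tendsto_0[of "[:0, 1:] * p"]
    by (rule Lim_transform_eventually) (auto simp: flat_exp_def intro!: always_eventually)
  with equal show ?thesis by (simp add: has_field_derivative_iff) (simp add: flat_exp_def)
next
  case greater
  have d: "((\<lambda>s. poly p (1 / s) * exp (- (1 / s))) has_real_derivative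
      poly ([:0, 0, 1:] * (p - pderiv p)) (1 / s) * exp (- (1 / s))) (at s)"
    using greater
    by (auto intro!: derivative_eq_intros poly_DERIV[THEN DERIV_chain2] simp: field_simps power2_eq_square)
  have "(flat_exp p has_real_derivative poly ([:0, 0, 1:] * (p - pderiv p)) (1 / s) * exp (- (1 / s))) (at s)"
    by (rule has_field_derivative_transform_within_open[OF d, of "{0<..}"])
      (use greater in \<open>auto simp: flat_exp_def\<close>)
  with greater show ?thesis by (simp add: flat_exp_def)
qed

definition bump :: "real \<Rightarrow> real" where "bump = flat_exp 1"

lemma bump_nonneg: "bump s \<ge> 0" and bump_pos_iff: "bump s > 0 \<longleftrightarrow> s > 0"
  by (simp_all add: bump_def flat_exp_def)

lemma smooth_on_bump: "open U \<Longrightarrow> smooth_on U f \<Longrightarrow> smooth_on U (\<lambda>x. bump (f x))"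
  by (rule smooth_on_compose[where S = "range flat_exp"])
    (auto simp: bump_def has_real_derivative_iff_has_vector_derivative[symmetric] intro: flat_exp_has_derivative)

definition bumpf :: "(real ^ 4 \<Rightarrow> real) \<Rightarrow> sfun" where
  "bumpf f = sf (\<lambda>x. of_real (bump (f x)))"

lemma ev_bumpf: "smooth_on cyl f \<Longrightarrow> x \<in> cyl \<Longrightarrow> ev (bumpf f) x = of_real (bump (f x))"
  by (simp add: bumpf_def ev_sf smooth_on_of_real smooth_on_bump open_cyl cyl_iff)

lemma csupp_bumpf:
  assumes "smooth_on cyl f" "compact K" "K \<subseteq> cyl" "\<And>x. x \<in> cyl \<Longrightarrow> x \<notin> K \<Longrightarrow> f x \<le> 0"
  shows "csupp (bumpf f)"
  unfolding csupp_def
proof (intro exI[of _ K] conjI allI impI assms)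
  fix x assume "x \<notin> K"
  then show "ev (bumpf f) x = 0"
    using assms(4)[of x] bump_nonneg[of "f x"] bump_pos_iff[of "f x"] by (cases "x = 0") (auto simp: ev_bumpf assms(1) cyl_iff)
qed

text \<open>The real part of the integrand is \<open>2 \<psi> |Re \<tau>|\<^sup>2\<close>.\<close>

lemma definite_pairing:
  fixes \<tau> :: "4 \<Rightarrow> 4 \<Rightarrow> sfun"
  assumes c: "csupp \<psi>" and r: "\<And>x. ev \<psi> x = of_real (g x)" "\<And>x. g x \<ge> 0"
    and 0: "integral cyl (ev (\<Sum>j\<in>UNIV. \<Sum>l\<in>UNIV. \<psi> * (\<tau> j l + cj (\<tau> j l)) * \<tau> j l)) = 0"
    and x: "g x > 0"
  shows "Re (ev (\<tau> j l) x) = 0"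
proof -
  let ?f = "\<Sum>j\<in>UNIV. \<Sum>l\<in>UNIV. \<psi> * (\<tau> j l + cj (\<tau> j l)) * \<tau> j l"
  let ?q = "\<lambda>x. g x * (\<Sum>j\<in>UNIV. \<Sum>l\<in>UNIV. 2 * (Re (ev (\<tau> j l) x))\<^sup>2)"
  have cs: "csupp ?f" by (intro csupp_sum csupp_mult c)
  have q: "Re (ev ?f x) = ?q x" for x
  proof -
    have z: "of_real c * (z + cnj z) * z = of_real (c * 2 * Re z) * z" for c z
      by (simp add: complex_eq_iff)
    have "ev ?f x = (\<Sum>j\<in>UNIV. \<Sum>l\<in>UNIV. of_real (g x * 2 * Re (ev (\<tau> j l) x)) * ev (\<tau> j l) x)"
      unfolding ev_sum ev_simps r z ..
    then show ?thesis by (simp add: sum_distrib_left power2_eq_square mult_ac)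
  qed
  obtain a where a: "x \<in> box (-a) a"
    using bounded_subset_box_symmetric[of "{x}"] by auto
  have "((\<lambda>x. Re (ev ?f x)) has_integral Re 0) UNIV"
    using has_integral_linear[OF csupp_has_integral(1)[OF cs] bounded_linear_Re] unfolding 0 by (simp add: o_def)
  then have i: "(?q has_integral 0) UNIV" unfolding q by simp
  have nn: "?q x \<ge> 0" for x by (intro mult_nonneg_nonneg r sum_nonneg) auto
  have ct: "continuous_on (cbox (-a) a) ?q"
    unfolding q[symmetric] by (intro continuous_on_Re csupp_continuous cs)
  have "(?q has_integral integral (cbox (-a) a) ?q) (cbox (-a) a)"
    by (rule integrable_integral[OF integrable_continuous[OF ct]])
  moreover have "integral (cbox (-a) a) ?q = 0"
  proof (rule antisym)
    show "integral (cbox (-a) a) ?q \<le> 0"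
      by (rule has_integral_subset_le[OF subset_UNIV calculation i]) (use nn in auto)
    show "integral (cbox (-a) a) ?q \<ge> 0"
      by (rule has_integral_nonneg[OF calculation]) (use nn in auto)
  qed
  ultimately have "?q x = 0"
    using a box_subset_cbox[of "-a" a] by (intro has_integral_0_cbox_imp_0[OF ct nn]) auto
  then have "(\<Sum>j\<in>UNIV. \<Sum>l\<in>UNIV. (Re (ev (\<tau> j l) x))\<^sup>2) = 0"
    using x by (simp add: sum_distrib_left[symmetric])
  then show ?thesis
    by (simp add: sum_nonneg_eq_0_iff sum_nonneg)
qed

lemma integral_cst_mult: "integral cyl (ev (cst c * f)) = c * integral cyl (ev f)"
proof -
  have "integral cyl (ev (cst c * f)) = integral cyl (\<lambda>x. c * ev f x)"
    by (rule integral_cong) (simp add: ev_cst)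
  then show ?thesis by simp
qed

text \<open>Test tensors are real, so only real parts can be tested. Applying this to c \<tau> with
  c = 1 and c = \<i> yields the real and the imaginary part of \<tau>.\<close>

lemma definite_pairing_complex:
  fixes \<tau> :: "4 \<Rightarrow> 4 \<Rightarrow> sfun"
  assumes c: "csupp \<psi>" and r: "\<And>x. ev \<psi> x = of_real (g x)" "\<And>x. g x \<ge> 0"
    and 0: "\<And>c. integral cyl (ev (\<Sum>j\<in>UNIV. \<Sum>l\<in>UNIV. \<psi> * (cst c * \<tau> j l + cj (cst c * \<tau> j l)) * \<tau> j l)) = 0"
    and x: "g x > 0" "x \<in> cyl"
  shows "ev (\<tau> j l) x = 0"
proof -
  have "Re (ev (cst c * \<tau> j l) x) = 0" for c
  proof (rule definite_pairing[OF assms(1-3) _ x(1)])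
    have "(\<Sum>j\<in>UNIV. \<Sum>l\<in>UNIV. \<psi> * (cst c * \<tau> j l + cj (cst c * \<tau> j l)) * (cst c * \<tau> j l))
      = cst c * (\<Sum>j\<in>UNIV. \<Sum>l\<in>UNIV. \<psi> * (cst c * \<tau> j l + cj (cst c * \<tau> j l)) * \<tau> j l)"
      unfolding sum_distrib_left by (intro sum.cong refl) (simp only: mult_ac)
    then show "integral cyl (ev (\<Sum>j\<in>UNIV. \<Sum>l\<in>UNIV. \<psi> * (cst c * \<tau> j l + cj (cst c * \<tau> j l)) * (cst c * \<tau> j l))) = 0"
      by (simp only: integral_cst_mult 0 mult_zero_right)
  qed
  from this[of 1] this[of "\<i>"] x(2) show ?thesis by (simp add: ev_cst complex_eq_iff)
qed

subsection \<open>The adjoint of the linearized Weyl tensor\<close>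

lemma asd_weyl_canonical:
  assumes "asd_weyl W"
  shows "W i j k l = asd_form (asd_form (W 1 2 1 2) (W 1 2 1 3) (W 1 2 1 4) k l)
    (asd_form (W 1 2 1 3) (W 1 3 1 3) (W 1 3 1 4) k l) (asd_form (W 1 2 1 4) (W 1 3 1 4) (- W 1 2 1 2 - W 1 3 1 3) k l) i j"
  using assms by (auto simp: asd_weyl_def asd_form_values)

text \<open>At each point the five parameters merely exist. Reading them off as particular
  components of U makes them elements of the ring.\<close>

lemma asd_weyl_sfunI:
  assumes "\<And>x. x \<in> cyl \<Longrightarrow> asd_weyl (\<lambda>i j k l. ev (U i j k l) x)"
  shows "asd_weyl U"
  unfolding asd_weyl_def
proof (intro exI ext)
  fix i j k l
  have e: "ev (asd_form p q r i j) x = asd_form (ev p x) (ev q x) (ev r x) i j" for p q r i j x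
    by (simp add: asd_form_def)
  show "U i j k l = asd_form (asd_form (U 1 2 1 2) (U 1 2 1 3) (U 1 2 1 4) k l)
    (asd_form (U 1 2 1 3) (U 1 3 1 3) (U 1 3 1 4) k l) (asd_form (U 1 2 1 4) (U 1 3 1 4) (- U 1 2 1 2 - U 1 3 1 3) k l) i j"
    by (rule sfun_eqI) (simp only: e ev_simps asd_weyl_canonical[OF assms, of _ i j k l])
qed

lemma asd_weyl_mult:
  assumes "asd_weyl U" shows "asd_weyl (\<lambda>i j k l. c * U i j k l)"
proof -
  have "c * asd_form p q r i j = asd_form (c * p) (c * q) (c * r) i j" for p q r i j
    by (simp add: asd_form_def)
  moreover obtain a b d e f where "U = (\<lambda>i j k l. asd_form
     (asd_form a b d k l) (asd_form b e f k l) (asd_form d f (- a - e) k l) i j)"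
    using assms by (auto simp: asd_weyl_def)
  ultimately show ?thesis
    unfolding asd_weyl_def
    by (intro exI[of _ "c * a"] exI[of _ "c * b"] exI[of _ "c * d"] exI[of _ "c * e"] exI[of _ "c * f"])
      (simp add: right_diff_distrib)
qed

lemma integral_div_div:
  assumes H: "\<And>j l. csupp (H j l)"
  shows "integral cyl (ev (\<Sum>j\<in>UNIV. \<Sum>l\<in>UNIV. H j l * div_div U j l))
    = integral cyl (ev (contr U (\<lambda>i j k l. D i (D k (H j l)))))"
proof -
  have c: "csupp (U i j k l * D i (D k (H j l)))" "csupp (H j l * D i (D k (U i j k l)))" for i j k l
    by (intro csupp_mult csupp_D H)+
  have "integral cyl (ev (contr U (\<lambda>i j k l. D i (D k (H j l)))))
    = (\<Sum>i\<in>UNIV. \<Sum>j\<in>UNIV. \<Sum>k\<in>UNIV. \<Sum>l\<in>UNIV. integral cyl (ev (U i j k l * D i (D k (H j l)))))"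
    unfolding contr_def by (simp add: integral_csupp_sum csupp_sum c)
  also have "\<dots> = (\<Sum>i\<in>UNIV. \<Sum>j\<in>UNIV. \<Sum>k\<in>UNIV. \<Sum>l\<in>UNIV. integral cyl (ev (H j l * D i (D k (U i j k l)))))"
    by (intro sum.cong refl) (simp only: integral_parts_twice[OF H, symmetric] mult.commute)
  also have "\<dots> = (\<Sum>j\<in>UNIV. \<Sum>i\<in>UNIV. \<Sum>k\<in>UNIV. \<Sum>l\<in>UNIV. integral cyl (ev (H j l * D i (D k (U i j k l)))))"
    by (rule sum.swap)
  also have "\<dots> = (\<Sum>j\<in>UNIV. \<Sum>i\<in>UNIV. \<Sum>l\<in>UNIV. \<Sum>k\<in>UNIV. integral cyl (ev (H j l * D i (D k (U i j k l)))))"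
    by (intro sum.cong refl sum.swap)
  also have "\<dots> = (\<Sum>j\<in>UNIV. \<Sum>l\<in>UNIV. \<Sum>i\<in>UNIV. \<Sum>k\<in>UNIV. integral cyl (ev (H j l * D i (D k (U i j k l)))))"
    by (intro sum.cong refl sum.swap)
  also have "\<dots> = integral cyl (ev (\<Sum>j\<in>UNIV. \<Sum>l\<in>UNIV. H j l * div_div U j l))"
    by (simp add: integral_csupp_sum csupp_sum c div_div_def sum_distrib_left)
  finally show ?thesis ..
qed

definition sft :: "complex tens4 fld \<Rightarrow> 4 \<Rightarrow> 4 \<Rightarrow> 4 \<Rightarrow> 4 \<Rightarrow> sfun" where
  "sft Z i j k l = ex 2 * sf (\<lambda>x. Z x $ i $ j $ k $ l)"

lemma ev_sft: "smooth_on cyl Z \<Longrightarrow> x \<in> cyl \<Longrightarrow> ev (sft Z i j k l) x = of_real ((norm x)\<^sup>2) * Z x $ i $ j $ k $ l"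
  using ev_ex_nat[of x 2] by (simp add: sft_def ev_sf smooth_on_vec_nth open_cyl cyl_iff)

lemma asd_weyl_sft:
  assumes "smooth_on cyl Z" "\<And>x. x \<in> cyl \<Longrightarrow> sym_traceless_asd cyl_metric x (Z x)"
  shows "asd_weyl (sft Z)"
  by (rule asd_weyl_sfunI)
    (simp only: ev_sft assms(1) asd_weyl_mult[OF sym_traceless_asd_imp_asd_weyl[OF _ assms(2)]])

lemma inner2_cyl_metric:
  assumes "x \<in> cyl"
  shows "vol_density cyl_metric x *\<^sub>R inner2 cyl_metric x h \<sigma> = (\<Sum>j\<in>UNIV. \<Sum>l\<in>UNIV. h $ j $ l *\<^sub>R \<sigma> $ j $ l)"
proof -
  let ?r = "(norm x)\<^sup>2"
  have A: "(\<Sum>a\<in>UNIV. \<Sum>b\<in>UNIV. (ginv cyl_metric x $ i $ a * ginv cyl_metric x $ j $ b * h $ i $ j) *\<^sub>R \<sigma> $ a $ b)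
      = (h $ i $ j * ?r * ?r) *\<^sub>R \<sigma> $ i $ j" for i j
    using sum_delta_scaleR[of "h $ i $ j" i ?r j "\<lambda>a b. \<sigma> $ a $ b"]
    unfolding ginv_cyl_metric[OF assms] by (simp only: mult_ac)
  have B: "vol_density cyl_metric x * (c * ?r * ?r) = c" for c
    using assms by (simp add: vol_density_cyl_metric cyl_iff power2_eq_square power4_eq_xxxx)
  show ?thesis
    unfolding inner2_def A scaleR_sum_right scaleR_scaleR B ..
qed

lemma sym_traceless_cyl_metric:
  "x \<in> cyl \<Longrightarrow> sym_traceless cyl_metric x h \<longleftrightarrow> (\<forall>i j. h $ i $ j = h $ j $ i) \<and> (\<Sum>i\<in>UNIV. h $ i $ i) = 0"
proof -
  assume x: "x \<in> cyl"
  have "(\<Sum>j\<in>UNIV. ginv cyl_metric x $ i $ j *\<^sub>R h $ i $ j) = (norm x)\<^sup>2 *\<^sub>R h $ i $ i" for i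
  proof -
    have "(if i = j then (norm x)\<^sup>2 else 0) *\<^sub>R h $ i $ j = (if i = j then (norm x)\<^sup>2 *\<^sub>R h $ i $ j else 0)" for j
      by simp
    then show ?thesis by (simp add: ginv_cyl_metric[OF x])
  qed
  then show ?thesis
    using x by (simp add: sym_traceless_def cyl_iff scaleR_sum_right[symmetric])
qed

lemma flat_var_entry: "flat_var h x $ j $ l = (norm x)\<^sup>2 * h x $ j $ l"
  by (simp add: flat_var_def)

definition flat_sf :: "real tens2 fld \<Rightarrow> 4 \<Rightarrow> 4 \<Rightarrow> sfun" where
  "flat_sf h j l = sf (\<lambda>x. of_real (flat_var h x $ j $ l))"

context
  fixes h :: "real tens2 fld"
  assumes h: "test_tensor cyl_metric cyl h"
begin

lemma test_tensor_smooth: "smooth_on cyl h"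
  using h by (simp add: test_tensor_def)

lemma test_tensor_sym: "h x $ i $ j = h x $ j $ i"
proof (cases "x \<in> cyl")
  case True
  then show ?thesis using h unfolding test_tensor_def sym_traceless_def by blast
next
  case False
  then have "h x = 0" using h unfolding test_tensor_def by blast
  then show ?thesis by simp
qed

lemma ev_flat_sf: "x \<in> cyl \<Longrightarrow> ev (flat_sf h j l) x = of_real (flat_var h x $ j $ l)"
  by (simp add: flat_sf_def ev_sf smooth_on_of_real smooth_flat_var test_tensor_smooth open_cyl cyl_iff)

lemma csupp_flat_sf: "csupp (flat_sf h j l)"
proof -
  obtain K where K: "compact K" "K \<subseteq> cyl" "\<And>x. x \<notin> K \<Longrightarrow> h x = 0"
    using h unfolding test_tensor_def by blast
  show ?thesis
    unfolding csupp_def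
  proof (intro exI[of _ K] conjI allI impI K(1,2))
    show "ev (flat_sf h j l) x = 0" if "x \<notin> K" for x
      using K(3)[OF that] ev_flat_sf[of x j l] by (cases "x = 0") (auto simp: cyl_iff flat_var_def)
  qed
qed

lemma ev_D_D_flat_sf:
  assumes x: "x \<in> cyl"
  shows "ev (D i (D k (flat_sf h j l))) x = of_real (pd i (pd k (\<lambda>z. flat_var h z $ j $ l)) x)"
proof -
  have s: "smooth_on cyl (\<lambda>z. flat_var h z $ j $ l)" by (rule smooth_flat_var[OF test_tensor_smooth])
  have r: "pd i (\<lambda>z. complex_of_real (g z)) x = of_real (pd i g x)" if "smooth_on cyl g" "x \<in> cyl" for g i x
    by (rule pd_linear[OF bounded_linear_of_real diff_smooth[OF that]])
  have "ev (D k (flat_sf h j l)) z = of_real (pd k (\<lambda>z. flat_var h z $ j $ l) z)" if "z \<in> cyl" for z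
    using pd_cong[OF open_cyl ev_flat_sf that] r[OF s that] that by (simp add: ev_D)
  from pd_cong[OF open_cyl this x] r[OF smooth_on_pd[OF s] x] x
  show ?thesis by (simp add: ev_D)
qed

text \<open>The weights combine to |x|^-4 |x|^6 = |x|^2, which explains the factor in
  \<open>sft\<close>. The integration by parts is then entirely in flat coordinates.\<close>

lemma integral_lin_weyl_minus:
  assumes Z: "smooth_on cyl Z" "\<And>x. x \<in> cyl \<Longrightarrow> sym_traceless_asd cyl_metric x (Z x)"
  shows "integral cyl (\<lambda>x. vol_density cyl_metric x *\<^sub>R inner4 cyl_metric x (lin_weyl_minus cyl_metric h x) (Z x))
    = integral cyl (ev (cst (-1/2) * (\<Sum>j\<in>UNIV. \<Sum>l\<in>UNIV. flat_sf h j l * div_div (sft Z) j l)))"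
proof -
  have "integral cyl (\<lambda>x. vol_density cyl_metric x *\<^sub>R inner4 cyl_metric x (lin_weyl_minus cyl_metric h x) (Z x))
    = integral cyl (ev (cst (-1/2) * contr (sft Z) (\<lambda>i j k l. D i (D k (flat_sf h j l)))))"
  proof (rule integral_cong)
    fix x assume x: "x \<in> cyl"
    have r: "1 / (norm x) ^ 4 * - ((norm x) ^ 6 / 2) = - (1/2) * (norm x)\<^sup>2"
      using x by (simp add: cyl_iff field_simps flip: power_add)
    show "vol_density cyl_metric x *\<^sub>R inner4 cyl_metric x (lin_weyl_minus cyl_metric h x) (Z x)
        = ev (cst (-1/2) * contr (sft Z) (\<lambda>i j k l. D i (D k (flat_sf h j l)))) x"
      unfolding inner4_lin_weyl_minus[OF test_tensor_smooth test_tensor_sym x sym_traceless_asd_imp_asd_weyl[OF x Z(2)[OF x]]]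
        vol_density_cyl_metric[OF x] scaleR_scaleR r
      using x by (simp add: contr_def ev_sum ev_cst ev_sft[OF Z(1)] ev_D_D_flat_sf scaleR_conv_of_real sum_distrib_left mult_ac)
  qed
  then show ?thesis
    unfolding integral_cst_mult integral_div_div[of "flat_sf h", OF csupp_flat_sf] .
qed

end

lemma test_tensorI:
  assumes c: "\<And>j l. csupp (G j l)" and sym: "\<And>j l. G j l = G l j" and tr: "(\<Sum>j\<in>UNIV. G j j) = 0"
  shows "test_tensor cyl_metric cyl (\<lambda>x. \<chi> j l. Re (ev (G j l) x))"
  unfolding test_tensor_def
proof (intro conjI ballI)
  show "smooth_on cyl (\<lambda>x. \<chi> j l. Re (ev (G j l) x))"
    by (intro smooth_on_vec open_cyl smooth_on_linear[OF bounded_linear_Re] smooth_ev)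
  fix x assume x: "x \<in> cyl"
  have "(\<Sum>i\<in>UNIV. Re (ev (G i i) x)) = Re (ev (\<Sum>j\<in>UNIV. G j j) x)" by (simp add: ev_sum)
  then show "sym_traceless cyl_metric x (\<chi> j l. Re (ev (G j l) x))"
    unfolding sym_traceless_cyl_metric[OF x] tr using sym by auto
next
  obtain K where K: "\<And>j l. compact (K j l)" "\<And>j l. K j l \<subseteq> cyl" "\<And>j l x. x \<notin> K j l \<Longrightarrow> ev (G j l) x = 0"
    using c unfolding csupp_def by metis
  show "\<exists>K. compact K \<and> K \<subseteq> cyl \<and> (\<forall>x. x \<notin> K \<longrightarrow> (\<chi> j l. Re (ev (G j l) x)) = 0)"
    by (rule exI[of _ "\<Union>j. \<Union>l. K j l"]) (use K(1,3) subsetD[OF K(2)] in \<open>auto simp: vec_eq_iff intro!: compact_UN\<close>)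
qed

text \<open>The factor |x|^2 comes from \<open>flat_sf\<close>; the pairing of symmetric 2-tensors
  with the volume density is already the flat one, see \<open>inner2_cyl_metric\<close>.\<close>

definition adj_weyl :: "complex tens4 fld \<Rightarrow> 4 \<Rightarrow> 4 \<Rightarrow> sfun" where
  "adj_weyl Z j l = cst (-1/2) * ex 2 * div_div (sft Z) j l"

context
  fixes Z :: "complex tens4 fld"
  assumes Z: "smooth_on cyl Z" "\<And>x. x \<in> cyl \<Longrightarrow> sym_traceless_asd cyl_metric x (Z x)"
begin

lemma asd_weyl_sft': "asd_weyl (sft Z)"
  by (rule asd_weyl_sft[OF Z])

lemma div_div_sym: "div_div (sft Z) j l = div_div (sft Z) l j"
  unfolding div_div_def
  by (subst sum.swap, intro sum.cong refl, subst D_commute, subst asd_weyl_pair[OF asd_weyl_sft', symmetric]) (rule refl)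

lemma div_div_trace: "(\<Sum>j\<in>UNIV. div_div (sft Z) j j) = 0"
proof -
  have "(\<Sum>j\<in>UNIV. div_div (sft Z) j j) = (\<Sum>i\<in>UNIV. \<Sum>j\<in>UNIV. \<Sum>k\<in>UNIV. D i (D k (sft Z i j k j)))"
    unfolding div_div_def by (rule sum.swap)
  also have "\<dots> = (\<Sum>i\<in>UNIV. \<Sum>k\<in>UNIV. D i (D k (\<Sum>j\<in>UNIV. sft Z i j k j)))"
    unfolding D_sum by (intro sum.cong refl sum.swap)
  finally show ?thesis by (simp only: asd_weyl_trace_snd[OF asd_weyl_sft'] D_0 sum.neutral_const)
qed

lemma integral_adj_weyl:
  assumes h: "test_tensor cyl_metric cyl h"
  shows "integral cyl (\<lambda>x. vol_density cyl_metric x *\<^sub>R inner4 cyl_metric x (lin_weyl_minus cyl_metric h x) (Z x))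
    = integral cyl (\<lambda>x. vol_density cyl_metric x *\<^sub>R inner2 cyl_metric x (h x) (\<chi> j l. ev (adj_weyl Z j l) x))"
proof (rule trans[OF integral_lin_weyl_minus[OF h Z] integral_cong])
  fix x assume x: "x \<in> cyl"
  show "ev (cst (-1/2) * (\<Sum>j\<in>UNIV. \<Sum>l\<in>UNIV. flat_sf h j l * div_div (sft Z) j l)) x
      = vol_density cyl_metric x *\<^sub>R inner2 cyl_metric x (h x) (\<chi> j l. ev (adj_weyl Z j l) x)"
    unfolding inner2_cyl_metric[OF x]
    using x ev_ex_nat[OF x, of 2]
    by (simp add: adj_weyl_def ev_sum ev_cst ev_flat_sf[OF h] flat_var_entry scaleR_conv_of_real sum_distrib_left mult_ac)
qed

lemma formal_adjoint_value_adj_weyl: "formal_adjoint_value cyl_metric cyl Z (\<lambda>x. \<chi> j l. ev (adj_weyl Z j l) x)"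
  unfolding formal_adjoint_value_def
proof (intro conjI ballI allI impI integral_adj_weyl)
  show "smooth_on cyl (\<lambda>x. \<chi> j l. ev (adj_weyl Z j l) x)"
    by (intro smooth_on_vec open_cyl smooth_ev)
  fix x assume x: "x \<in> cyl"
  have "(\<Sum>i\<in>UNIV. ev (adj_weyl Z i i) x) = ev (cst (-1/2) * ex 2 * (\<Sum>j\<in>UNIV. div_div (sft Z) j j)) x"
    by (simp add: adj_weyl_def ev_sum sum_distrib_left)
  then show "sym_traceless cyl_metric x (\<chi> j l. ev (adj_weyl Z j l) x)"
    unfolding sym_traceless_cyl_metric[OF x] div_div_trace by (simp add: adj_weyl_def div_div_sym[of _ "_ :: 4"]) 
qed

text \<open>The difference of two candidates is symmetric, traceless and orthogonal to every test
  tensor. Testing with a localized copy of its own real part shows that it vanishes, so the choice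
  operator in the definition of the adjoint is determined on the cylinder.\<close>

lemma formal_adjoint_value_unique:
  assumes \<sigma>: "formal_adjoint_value cyl_metric cyl Z \<sigma>" and x: "x \<in> cyl"
  shows "\<sigma> x $ j $ l = ev (adj_weyl Z j l) x"
proof -
  define \<tau> where "\<tau> = (\<lambda>j l. sf (\<lambda>x. \<sigma> x $ j $ l) - adj_weyl Z j l)"
  have s: "smooth_on cyl \<sigma>" and st: "sym_traceless cyl_metric z (\<sigma> z)" if "z \<in> cyl" for z
    using \<sigma> that unfolding formal_adjoint_value_def by blast+
  have ev_s: "ev (sf (\<lambda>x. \<sigma> x $ j $ l)) z = \<sigma> z $ j $ l" if "z \<in> cyl" for z j l
    using that by (simp add: ev_sf smooth_on_vec_nth s open_cyl cyl_iff)
  have ssym: "sf (\<lambda>x. \<sigma> x $ j $ l) = sf (\<lambda>x. \<sigma> x $ l $ j)" for j l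
  proof (rule sfun_eqI)
    fix z assume z: "z \<in> cyl"
    have "\<sigma> z $ j $ l = \<sigma> z $ l $ j" using st[OF z] unfolding sym_traceless_def by blast
    then show "ev (sf (\<lambda>x. \<sigma> x $ j $ l)) z = ev (sf (\<lambda>x. \<sigma> x $ l $ j)) z" by (simp only: ev_s[OF z])
  qed
  have tsym: "\<tau> j l = \<tau> l j" for j l
    unfolding \<tau>_def ssym[of j l] adj_weyl_def div_div_sym[of j l] ..
  have str: "(\<Sum>j\<in>UNIV. sf (\<lambda>x. \<sigma> x $ j $ j)) = 0"
  proof (rule sfun_eqI)
    fix z assume z: "z \<in> cyl"
    then have "(\<Sum>j\<in>UNIV. \<sigma> z $ j $ j) = 0" using st[OF z] unfolding sym_traceless_cyl_metric[OF z] by blast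
    then show "ev (\<Sum>j\<in>UNIV. sf (\<lambda>x. \<sigma> x $ j $ j)) z = ev 0 z" by (simp add: ev_sum ev_s z)
  qed
  have ttr: "(\<Sum>j\<in>UNIV. \<tau> j j) = 0"
    by (simp add: \<tau>_def sum_subtractf str adj_weyl_def sum_distrib_left[symmetric] div_div_trace)
  \<comment> \<open>Half the distance to the origin keeps the support of the bump inside the
    cylinder.\<close>
  define \<delta> where "\<delta> = norm x / 2"
  define P where "P = (\<lambda>z::real^4. \<delta>\<^sup>2 - (\<Sum>i\<in>UNIV. (z $ i - x $ i) * (z $ i - x $ i)))"
  have P: "P z = \<delta>\<^sup>2 - (norm (z - x))\<^sup>2" for z
    by (simp add: P_def norm_vec_def L2_set_def power2_eq_square sum_nonneg)
  have sP: "smooth_on cyl P"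
    unfolding P_def
    by (intro smooth_on_diff smooth_on_const smooth_on_sum smooth_on_mult smooth_on_coord open_cyl)
  have \<delta>: "\<delta> > 0" using x by (simp add: \<delta>_def cyl_iff)
  have cs: "csupp (bumpf P)"
  proof (rule csupp_bumpf[OF sP compact_cball[of x \<delta>]])
    show "cball x \<delta> \<subseteq> cyl" using \<delta> by (auto simp: cyl_iff \<delta>_def)
    fix z assume "z \<notin> cball x \<delta>"
    then have "\<delta> \<le> norm (z - x)" by (simp add: dist_norm norm_minus_commute)
    then show "P z \<le> 0" using \<delta> by (simp add: P power_mono)
  qed
  define g where "g = (\<lambda>z. Re (ev (bumpf P) z))"
  have g: "ev (bumpf P) z = of_real (g z)" "g z \<ge> 0" for z
    using bump_nonneg[of "P z"] by (cases "z = 0"; simp add: g_def ev_bumpf sP cyl_iff)+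
  have gx: "g x > 0"
    using x \<delta> bump_pos_iff[of "P x"] by (simp add: g_def ev_bumpf sP P)
  have "ev (\<tau> j l) x = 0"
  proof (rule definite_pairing_complex[OF cs g _ gx x])
    fix c
    \<comment> \<open>Adding the complex conjugate makes the tensor real, and symmetry and vanishing
      trace are inherited from \<tau>, so \<open>G\<close> is an admissible test tensor.\<close>
    define G where "G = (\<lambda>j l. bumpf P * (cst c * \<tau> j l + cj (cst c * \<tau> j l)))"
    have csG: "csupp (G j l)" for j l unfolding G_def by (intro csupp_mult cs)
    have "(\<Sum>j\<in>UNIV. G j j) = bumpf P * (cst c * (\<Sum>j\<in>UNIV. \<tau> j j) + cj (cst c * (\<Sum>j\<in>UNIV. \<tau> j j)))"
      unfolding G_def cj_hom cj_sum sum_distrib_left sum.distrib[symmetric] distrib_left ..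
    then have Gtr: "(\<Sum>j\<in>UNIV. G j j) = 0" by (simp add: ttr)
    have test: "test_tensor cyl_metric cyl (\<lambda>x. \<chi> j l. Re (ev (G j l) x))"
      by (rule test_tensorI[where G = G, OF csG _ Gtr]) (simp only: G_def tsym[of _ "_ :: 4"])
    have Gr: "of_real (Re (ev (G j l) z)) = ev (G j l) z" for j l z
      unfolding G_def by (cases "z = 0") (simp_all add: g ev_cst cyl_iff complex_eq_iff)
    have "integral cyl (\<lambda>x. vol_density cyl_metric x *\<^sub>R inner2 cyl_metric x (\<chi> j l. Re (ev (G j l) x)) (\<sigma> x))
      = integral cyl (\<lambda>x. vol_density cyl_metric x *\<^sub>R inner2 cyl_metric x (\<chi> j l. Re (ev (G j l) x)) (\<chi> j l. ev (adj_weyl Z j l) x))"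
      using \<sigma>[unfolded formal_adjoint_value_def, THEN conjunct2, THEN conjunct2, rule_format, OF test]
        integral_adj_weyl[OF test] by (rule trans[OF sym])
    moreover have "integral cyl (\<lambda>x. vol_density cyl_metric x *\<^sub>R inner2 cyl_metric x (\<chi> j l. Re (ev (G j l) x)) (\<sigma> x))
      = integral cyl (ev (\<Sum>j\<in>UNIV. \<Sum>l\<in>UNIV. G j l * sf (\<lambda>x. \<sigma> x $ j $ l)))"
      by (rule integral_cong, subst inner2_cyl_metric) (simp_all add: scaleR_conv_of_real Gr ev_sum ev_s)
    moreover have "integral cyl (\<lambda>x. vol_density cyl_metric x *\<^sub>R inner2 cyl_metric x (\<chi> j l. Re (ev (G j l) x)) (\<chi> j l. ev (adj_weyl Z j l) x))
      = integral cyl (ev (\<Sum>j\<in>UNIV. \<Sum>l\<in>UNIV. G j l * adj_weyl Z j l))"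
      by (rule integral_cong, subst inner2_cyl_metric) (simp_all add: scaleR_conv_of_real Gr ev_sum)
    moreover have "integral cyl (ev ((\<Sum>j\<in>UNIV. \<Sum>l\<in>UNIV. G j l * \<tau> j l) + (\<Sum>j\<in>UNIV. \<Sum>l\<in>UNIV. G j l * adj_weyl Z j l)))
      = integral cyl (ev (\<Sum>j\<in>UNIV. \<Sum>l\<in>UNIV. G j l * \<tau> j l)) + integral cyl (ev (\<Sum>j\<in>UNIV. \<Sum>l\<in>UNIV. G j l * adj_weyl Z j l))"
      by (intro integral_csupp_add csupp_sum csupp_mult csG)
    moreover have "(\<Sum>j\<in>UNIV. \<Sum>l\<in>UNIV. G j l * \<tau> j l) + (\<Sum>j\<in>UNIV. \<Sum>l\<in>UNIV. G j l * adj_weyl Z j l)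
      = (\<Sum>j\<in>UNIV. \<Sum>l\<in>UNIV. G j l * sf (\<lambda>x. \<sigma> x $ j $ l))"
      by (simp add: \<tau>_def sum.distrib[symmetric] right_diff_distrib)
    ultimately have "integral cyl (ev (\<Sum>j\<in>UNIV. \<Sum>l\<in>UNIV. G j l * \<tau> j l)) = 0" by simp
    then show "integral cyl (ev (\<Sum>j\<in>UNIV. \<Sum>l\<in>UNIV. bumpf P * (cst c * \<tau> j l + cj (cst c * \<tau> j l)) * \<tau> j l)) = 0"
      by (simp only: G_def)
  qed
  then show ?thesis using ev_s[OF x] by (simp add: \<tau>_def)
qed

lemma lin_weyl_minus_adj_eq: "x \<in> cyl \<Longrightarrow> lin_weyl_minus_adj cyl_metric cyl Z x $ j $ l = ev (adj_weyl Z j l) x"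
  unfolding lin_weyl_minus_adj_def
  by (rule formal_adjoint_value_unique[OF someI[where P = "formal_adjoint_value cyl_metric cyl Z", OF formal_adjoint_value_adj_weyl]])

end

section \<open>The indicial equation\<close>

subsection \<open>The operators of the cylinder in flat coordinates\<close>

lemma christoffel_cyl_metric: "x \<in> cyl \<Longrightarrow> christoffel cyl_metric x k i j = Gam0 (dlog1 x) k i j"
proof -
  assume x: "x \<in> cyl"
  have v: "vary (\<lambda>_. 0) 0 = cyl_metric" by (simp add: vary_def)
  have "christoffel (vary (\<lambda>_. 0) 0) x k i j = chris (\<lambda>_. 0) 0 x k i j"
    by (rule christoffel_vary) (simp_all add: x flat_metric_def)
  then show ?thesis
    using jet_chris[of "\<lambda>_. 0" x k i j] unfolding v jet_def by simp
qed

definition sfv :: "complex tens1 fld \<Rightarrow> 4 \<Rightarrow> sfun" where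
  "sfv \<omega> i = sf (\<lambda>x. \<omega> x $ i)"

definition flat_vec :: "complex tens1 fld \<Rightarrow> 4 \<Rightarrow> sfun" where
  "flat_vec \<omega> i = ex 2 * sfv \<omega> i"

lemma ev_sfv: "smooth_on cyl \<omega> \<Longrightarrow> x \<in> cyl \<Longrightarrow> ev (sfv \<omega> i) x = \<omega> x $ i"
  by (simp add: sfv_def ev_sf smooth_on_vec_nth open_cyl cyl_iff)

lemma ev_ex_minus_2: "x \<in> cyl \<Longrightarrow> ev (ex (-2)) x = of_real (1 / (norm x)\<^sup>2)"
proof -
  assume x: "x \<in> cyl"
  have "ev (ex (-2) * ex 2) x = 1" unfolding ex_mult using x by (simp add: ev_1)
  then show ?thesis using ev_ex_nat[OF x, of 2] x by (simp add: cyl_iff field_simps)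
qed

lemma ev_numeral: "x \<in> cyl \<Longrightarrow> ev (numeral n) x = numeral n"
  using ev_cst[of x "numeral n"] by simp

lemma cov_deriv_cyl_metric:
  assumes \<omega>: "smooth_on cyl \<omega>" and x: "x \<in> cyl"
  shows "cov_deriv cyl_metric \<omega> x i j = ev (D i (sfv \<omega> j) + ex (-2) * (X i * sfv \<omega> j + X j * sfv \<omega> i
    - (if i = j then \<Sum>k\<in>UNIV. X k * sfv \<omega> k else 0))) x"
proof -
  define q where "q = complex_of_real (1 / (norm x)\<^sup>2)"
  have d: "complex_of_real (dlog k x) = - q * of_real (x $ k)" for k
    by (simp add: dlog_def q_def)
  have "pd i (\<lambda>z. \<omega> z $ j) x = ev (D i (sfv \<omega> j)) x"
    using x by (simp add: ev_D pd_cong[OF open_cyl ev_sfv[OF \<omega>] x])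
  moreover have "(\<Sum>k\<in>UNIV. Gam0 (dlog1 x) k i j *\<^sub>R \<omega> x $ k)
      = - q * of_real (x $ i) * \<omega> x $ j - q * of_real (x $ j) * \<omega> x $ i
        + (if i = j then q * (\<Sum>k\<in>UNIV. of_real (x $ k) * \<omega> x $ k) else 0)"
  proof -
    have "Gam0 (dlog1 x) k i j *\<^sub>R \<omega> x $ k = (if j = k then - q * of_real (x $ i) * \<omega> x $ k else 0)
        + (if i = k then - q * of_real (x $ j) * \<omega> x $ k else 0) + (if i = j then q * (of_real (x $ k) * \<omega> x $ k) else 0)" for k
      by (simp add: Gam0_def kr_def scaleR_conv_of_real d algebra_simps)
    then show ?thesis by (simp add: sum.distrib sum_distrib_left)
  qed
  moreover have "ev (ex (-2)) x = q" using ev_ex_minus_2[OF x] by (simp add: q_def)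
  ultimately show ?thesis
    using x by (simp add: cov_deriv_def christoffel_cyl_metric[OF x] ev_sum ev_sfv[OF \<omega> x] algebra_simps)
qed

lemma delta1_cyl_metric:
  assumes \<omega>: "smooth_on cyl \<omega>" and x: "x \<in> cyl"
  shows "delta1 cyl_metric \<omega> x = ev (ex 2 * (\<Sum>i\<in>UNIV. D i (sfv \<omega> i)) - 2 * (\<Sum>i\<in>UNIV. X i * sfv \<omega> i)) x"
proof -
  let ?C = "\<lambda>i j. D i (sfv \<omega> j) + ex (-2) * (X i * sfv \<omega> j + X j * sfv \<omega> i
    - (if i = j then \<Sum>k\<in>UNIV. X k * sfv \<omega> k else 0))"
  have "ginv cyl_metric x $ i $ j *\<^sub>R cov_deriv cyl_metric \<omega> x i j
      = (if i = j then ev (ex 2 * ?C i j) x else 0)" for i j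
    using x ev_ex_nat[OF x, of 2]
    unfolding ginv_cyl_metric[OF x] cov_deriv_cyl_metric[OF \<omega> x] by (simp add: scaleR_conv_of_real ev_numeral[OF x])
  then have "delta1 cyl_metric \<omega> x = (\<Sum>i\<in>UNIV. ev (ex 2 * ?C i i) x)"
    by (simp only: delta1_def sum.delta' sum.delta finite UNIV_I if_True)
  also have "\<dots> = ev (\<Sum>i\<in>UNIV. ex 2 * ?C i i) x" by (simp only: ev_sum)
  also have "(\<Sum>i\<in>UNIV. ex 2 * ?C i i) = ex 2 * (\<Sum>i\<in>UNIV. D i (sfv \<omega> i)) - 2 * (\<Sum>i\<in>UNIV. X i * sfv \<omega> i)"
    by (simp add: distrib_left right_diff_distrib ex_mult' sum.distrib sum_subtractf sum_distrib_left[symmetric])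
  finally show ?thesis .
qed

text \<open>Conformal covariance: the vector field dual to \<omega> has components V = |x|^2
  \<omega>, and for the metric |x|^-2 \<delta> the conformal Killing operator is |x|^-2 times the
  flat one applied to V. The Christoffel terms are absorbed by differentiating |x|^2.\<close>

lemma conf_killing_op_cyl_metric:
  assumes \<omega>: "smooth_on cyl \<omega>" and x: "x \<in> cyl"
  shows "conf_killing_op cyl_metric \<omega> x $ i $ j = ev (ex (-2) * conf_killing (flat_vec \<omega>) i j) x"
proof -
  let ?W = "sfv \<omega>"
  let ?C = "\<lambda>i j. D i (?W j) + ex (-2) * (X i * ?W j + X j * ?W i
    - (if i = j then \<Sum>k\<in>UNIV. X k * ?W k else 0))"
  have g: "(cyl_metric x $ i $ j / 2) *\<^sub>R ev f x = ev (if i = j then cst (1/2) * (ex (-2) * f) else 0) x" for f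
    using x by (simp add: cyl_metric_entry ev_cst ev_ex_minus_2 scaleR_conv_of_real)
  have "conf_killing_op cyl_metric \<omega> x $ i $ j = ev (?C i j + ?C j i
      - (if i = j then cst (1/2) * (ex (-2) * (ex 2 * (\<Sum>i\<in>UNIV. D i (?W i)) - 2 * (\<Sum>i\<in>UNIV. X i * ?W i))) else 0)) x"
    unfolding conf_killing_op_def vec_lambda_beta cov_deriv_cyl_metric[OF assms] delta1_cyl_metric[OF assms] g
    by (simp only: ev_simps)
  also have "?C i j + ?C j i
      - (if i = j then cst (1/2) * (ex (-2) * (ex 2 * (\<Sum>i\<in>UNIV. D i (?W i)) - 2 * (\<Sum>i\<in>UNIV. X i * ?W i))) else 0)
      = ex (-2) * conf_killing (flat_vec \<omega>) i j"
  proof -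
    have hh: "cst (1/2) * (a + 2 * b) = cst (1/2) * a + b" "cst (1/2) * (a - 2 * b) = cst (1/2) * a - b" for a b
      using half_half[of b] by (simp_all only: distrib_left right_diff_distrib mult_2)
    have D: "ex (-2) * D i (flat_vec \<omega> j) = D i (?W j) + 2 * (ex (-2) * (X i * ?W j))" for i j
      by (simp add: flat_vec_def D_mult D_ex distrib_left ex_mult' mult.assoc)
    have "ex (-2) * (cst (1/2) * (\<Sum>i\<in>UNIV. D i (flat_vec \<omega> i)))
      = cst (1/2) * (\<Sum>i\<in>UNIV. ex (-2) * D i (flat_vec \<omega> i))"
      by (simp add: sum_distrib_left mult_ac)
    also have "\<dots> = cst (1/2) * (\<Sum>i\<in>UNIV. D i (?W i)) + ex (-2) * (\<Sum>i\<in>UNIV. X i * ?W i)"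
      unfolding D sum.distrib sum_distrib_left[symmetric] hh(1) ..
    finally have t: "ex (-2) * (cst (1/2) * (\<Sum>i\<in>UNIV. D i (flat_vec \<omega> i)))
      = cst (1/2) * (\<Sum>i\<in>UNIV. D i (?W i)) + ex (-2) * (\<Sum>i\<in>UNIV. X i * ?W i)" .
    have u: "cst (1/2) * (ex (-2) * (ex 2 * f - 2 * h)) = cst (1/2) * f - ex (-2) * h" for f h
      unfolding right_diff_distrib[of "ex (-2)"] mult.left_commute[of "ex (-2)" 2] hh(2) by (simp add: ex_mult')
    show ?thesis
      unfolding u
      unfolding conf_killing_def right_diff_distrib[of "ex (-2)"] distrib_left[of "ex (-2)"] D
      by (simp add: t)
  qed
  finally show ?thesis .
qed

lemma F_star_zero_iff:
  assumes Z: "smooth_on cyl Z" "\<And>x. x \<in> cyl \<Longrightarrow> sym_traceless_asd cyl_metric x (Z x)" and \<omega>: "smooth_on cyl \<omega>"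
  shows "(\<forall>x\<in>cyl. F_star cyl_metric cyl Z \<omega> x = 0) \<longleftrightarrow>
    (\<forall>j l. div_div (sft Z) j l = cst (-2) * (ex (-4) * conf_killing (flat_vec \<omega>) j l))"
proof -
  have "(\<forall>x\<in>cyl. F_star cyl_metric cyl Z \<omega> x = 0) \<longleftrightarrow> (\<forall>j l. adj_weyl Z j l = ex (-2) * conf_killing (flat_vec \<omega>) j l)"
  proof -
    have L: "lin_weyl_minus_adj cyl_metric cyl Z x $ j $ l = ev (adj_weyl Z j l) x" if "x \<in> cyl" for x j l
      by (rule lin_weyl_minus_adj_eq[OF Z that])
    have F: "F_star cyl_metric cyl Z \<omega> x $ j $ l = ev (adj_weyl Z j l) x - ev (ex (-2) * conf_killing (flat_vec \<omega>) j l) x"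
      if "x \<in> cyl" for x j l
      unfolding F_star_def vector_minus_component L[OF that] conf_killing_op_cyl_metric[OF \<omega> that] ..
    have "(\<forall>x\<in>cyl. F_star cyl_metric cyl Z \<omega> x = 0)
      \<longleftrightarrow> (\<forall>j l. \<forall>x\<in>cyl. ev (adj_weyl Z j l) x = ev (ex (-2) * conf_killing (flat_vec \<omega>) j l) x)"
      unfolding vec_eq_iff zero_index using F by (auto simp del: ev_simps)
    then show ?thesis using sfun_eqI by metis
  qed
  also have "\<dots> \<longleftrightarrow> (\<forall>j l. div_div (sft Z) j l = cst (-2) * (ex (-4) * conf_killing (flat_vec \<omega>) j l))"
  proof (intro iff_allI)
    fix j l
    define f where "f = conf_killing (flat_vec \<omega>) j l"
    have "cst (-2) * (ex (-2) * adj_weyl Z j l) = div_div (sft Z) j l"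
    proof -
      have "cst (-2) * (ex (-2) * adj_weyl Z j l) = (cst (-2) * cst (-1/2)) * (ex (-2) * (ex 2 * div_div (sft Z) j l))"
        by (simp only: adj_weyl_def mult_ac)
      also have "cst (-2) * cst (-1/2) = 1" by (simp only: cst_hom(2)[symmetric]) simp
      finally show ?thesis by (simp add: ex_mult')
    qed
    moreover have "cst (-1/2) * (ex 2 * (cst (-2) * (ex (-4) * f))) = ex (-2) * f"
    proof -
      have "cst (-1/2) * (ex 2 * (cst (-2) * (ex (-4) * f))) = (cst (-1/2) * cst (-2)) * (ex 2 * (ex (-4) * f))"
        by (simp only: mult_ac)
      also have "cst (-1/2) * cst (-2) = 1" by (simp only: cst_hom(2)[symmetric]) simp
      finally show ?thesis by (simp add: ex_mult')
    qed
    moreover have "cst (-2) * (ex (-2) * (ex (-2) * f)) = cst (-2) * (ex (-4) * f)" by (simp add: ex_mult')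
    moreover have "adj_weyl Z j l = cst (-1/2) * (ex 2 * div_div (sft Z) j l)" by (simp add: adj_weyl_def mult.assoc)
    ultimately have "adj_weyl Z j l = ex (-2) * f \<longleftrightarrow> div_div (sft Z) j l = cst (-2) * (ex (-4) * f)"
      by metis
    then show "adj_weyl Z j l = ex (-2) * conf_killing (flat_vec \<omega>) j l
      \<longleftrightarrow> div_div (sft Z) j l = cst (-2) * (ex (-4) * conf_killing (flat_vec \<omega>) j l)" by (simp only: f_def)
  qed
  finally show ?thesis .
qed

subsection \<open>Vanishing of the conformal Killing operator\<close>

lemma radialI:
  assumes "\<And>x i. x \<in> cyl \<Longrightarrow> ev (D i A) x = of_real (x $ i) * k x"
  shows "radial A"
  unfolding radial_def
proof (intro allI sfun_eqI)
  fix i x assume x: "x \<in> cyl"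
  have "(\<Sum>j\<in>UNIV. complex_of_real (x $ j) * of_real (x $ j)) = of_real ((norm x)\<^sup>2)"
    by (simp add: norm_vec_def L2_set_def power2_eq_square sum_nonneg flip: of_real_mult of_real_sum)
  then have "ev (eul A) x = of_real ((norm x)\<^sup>2) * k x"
    by (simp add: eul_def ev_sum assms[OF x] mult.assoc[symmetric] sum_distrib_right[symmetric])
  then show "ev (D i A) x = ev (ex (-2) * X i * eul A) x"
    using x by (simp add: assms[OF x] ev_ex_minus_2 cyl_iff)
qed

text \<open>A cut-off that depends on |x| alone, as multiplication by it has to preserve the class
  \<open>low_tensor\<close>.\<close>

lemma radial_bump:
  assumes x: "x \<in> cyl"
  obtains \<psi> g where "csupp \<psi>" "radial \<psi>" "\<And>z. ev \<psi> z = of_real (g z)" "\<And>z. g z \<ge> 0" "g x > 0"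
proof -
  define n where "n = (norm x)\<^sup>2"
  have n: "n > 0" using x by (simp add: n_def cyl_iff)
  \<comment> \<open>Positive exactly for s between n/2 and 2n, so that the bump is supported in a
    spherical shell around |x|^2 = n.\<close>
  define q where "q s = (s - n / 2) * (2 * n - s)" for s :: real
  define P where "P z = q ((norm z)\<^sup>2)" for z :: "real ^ 4"
  have sP: "smooth_on cyl P"
    unfolding P_def q_def by (intro smooth_on_mult smooth_on_diff smooth_on_norm2 smooth_on_const open_cyl)
  have q: "q s \<le> 0" if "s \<le> n / 2 \<or> 2 * n \<le> s" for s
    using that n unfolding q_def by (auto intro: mult_nonpos_nonneg mult_nonneg_nonpos)
  define K where "K = {z :: real ^ 4. n / 2 \<le> (norm z)\<^sup>2 \<and> (norm z)\<^sup>2 \<le> 2 * n}"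
  have "closed K"
    unfolding K_def by (intro closed_Collect_conj closed_Collect_le continuous_intros)
  moreover have "K \<subseteq> cball 0 (sqrt (2 * n))"
    by (auto simp: K_def real_le_rsqrt)
  ultimately have K: "compact K"
    using bounded_subset[OF bounded_cball] by (auto simp: compact_eq_bounded_closed)
  have 1: "csupp (bumpf P)"
    by (rule csupp_bumpf[OF sP K]) (use n q in \<open>auto simp: K_def cyl_iff P_def not_le less_imp_le\<close>)
  have 2: "radial (bumpf P)"
  proof (rule radialI)
    fix z i assume z: "z \<in> cyl"
    let ?k = "flat_exp ([:0, 0, 1:] * (1 - pderiv 1)) (P z) * (2 * (2 * n + n / 2 - 2 * (norm z)\<^sup>2))"
    have b: "(bump has_real_derivative flat_exp ([:0, 0, 1:] * (1 - pderiv 1)) s) (at s)" for s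
      unfolding bump_def by (rule flat_exp_has_derivative)
    have "((\<lambda>z. q (z \<bullet> z)) has_derivative (\<lambda>v. (2 * n + n / 2 - 2 * (z \<bullet> z)) * (2 * (v \<bullet> z)))) (at z)"
      unfolding q_def by (auto intro!: derivative_eq_intros simp: inner_commute algebra_simps)
    from has_derivative_compose[OF this b[unfolded has_field_derivative_def]]
    have "((\<lambda>z. bump (P z)) has_derivative (\<lambda>v. flat_exp ([:0, 0, 1:] * (1 - pderiv 1)) (P z) * ((2 * n + n / 2 - 2 * (z \<bullet> z)) * (2 * (v \<bullet> z))))) (at z)"
      by (simp add: P_def dot_square_norm)
    then have d: "((\<lambda>z. complex_of_real (bump (P z))) has_derivative (\<lambda>v. of_real (flat_exp ([:0, 0, 1:] * (1 - pderiv 1)) (P z) * ((2 * n + n / 2 - 2 * (z \<bullet> z)) * (2 * (v \<bullet> z)))))) (at z)"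
      by (rule has_derivative_of_real)
    have "ev (D i (bumpf P)) z = pd i (\<lambda>z. complex_of_real (bump (P z))) z"
      using z pd_cong[OF open_cyl ev_bumpf[OF sP] z] by (simp add: ev_D)
    also have "\<dots> = of_real (z $ i) * of_real ?k"
      unfolding pd_eqI[OF d] by (simp add: inner_axis' dot_square_norm algebra_simps)
    finally show "ev (D i (bumpf P)) z = of_real (z $ i) * of_real ?k" .
  qed
  define g where "g = (\<lambda>z. Re (ev (bumpf P) z))"
  have g: "ev (bumpf P) z = of_real (g z)" "g z \<ge> 0" for z
    using bump_nonneg[of "P z"] by (cases "z = 0"; simp add: g_def ev_bumpf sP cyl_iff)+
  have "P x > 0" using n by (simp add: P_def q_def n_def[symmetric])
  then have "g x > 0"
    using x bump_pos_iff[of "P x"] by (simp add: g_def ev_bumpf sP)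
  with that[OF 1 2 g] show thesis by blast
qed

text \<open>The coefficients found in \<open>conf_killing_radial_coefficients\<close> are rewritten
  from y to x = |x| y; the powers of |x| are absorbed into the radial coefficients of
  \<open>W\<close>, and the rest is the multiple of the identity.\<close>

lemma low_tensor_conf_killing:
  assumes V: "\<And>l. V l = ex 1 * (F0 * y l + rlin F1 * y l + G l + rlin (H l))"
    and r: "radial F0" "\<And>i. radial (F1 i)" "\<And>i. radial (G i)" "\<And>i j. radial (H i j)" "\<And>i j. H i j = - H j i"
  shows "low_tensor (conf_killing V)"
proof -
  define W where "W l = ex (-2) * eul F0 * X l + (\<Sum>m\<in>UNIV. ex (-3) * (eul (F1 m) - F1 m) * X m) * X l
      + ex (-1) * (G l + eul (G l) + F1 l) + (\<Sum>m\<in>UNIV. ex (-2) * eul (H l m) * X m)" for l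
  have W: "low_vector W"
    unfolding low_vector_def
  proof (intro exI conjI allI)
    show "W l = ex (-2) * eul F0 * X l + (\<Sum>m\<in>UNIV. ex (-3) * (eul (F1 m) - F1 m) * X m) * X l
      + ex (-1) * (G l + eul (G l) + F1 l) + (\<Sum>m\<in>UNIV. ex (-2) * eul (H l m) * X m)" for l
      by (rule W_def)
    show "ex (-2) * eul (H i j) = - (ex (-2) * eul (H j i))" for i j by (subst r(5)) simp
  qed (intro radial_mult radial_ex radial_eul radial_diff radial_add r)+
  have e: "X j * W l = (eul F0 + rlin (\<lambda>i. eul (F1 i) - F1 i)) * (y j * y l)
      + y j * (G l + eul (G l) + F1 l + rlin (\<lambda>i. eul (H l i)))" for j l
  proof -
    have x: "ex (-2) = ex (-1) * ex (-1)" "ex (-3) = ex (-1) * (ex (-1) * ex (-1))" by (simp_all add: ex_mult)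
    have "W l = ex (-1) * ((eul F0 + rlin (\<lambda>i. eul (F1 i) - F1 i)) * y l
      + (G l + eul (G l) + F1 l + rlin (\<lambda>i. eul (H l i))))"
      unfolding W_def rlin_def y_def x distrib_left distrib_right sum_distrib_left sum_distrib_right
      by (simp only: mult_ac add_ac)
    then have "X j * W l = (ex 1 * ex (-1)) * (y j * ((eul F0 + rlin (\<lambda>i. eul (F1 i) - F1 i)) * y l
      + (G l + eul (G l) + F1 l + rlin (\<lambda>i. eul (H l i)))))"
      unfolding ex_1_y[symmetric] by (simp only: mult_ac)
    then show ?thesis by (simp add: ex_mult distrib_left mult_ac)
  qed
  show ?thesis
    unfolding low_tensor_def
  proof (intro exI conjI allI)
    show "conf_killing V j l = X j * W l + X l * W j
      + (if j = l then - (cst (1/2) * (\<Sum>i\<in>UNIV. D i (V i)) - 2 * (F0 + rlin F1)) else 0)" for j l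
      unfolding conf_killing_radial_coefficients[OF V r] e by (simp add: algebra_simps)
  qed (rule W)
qed

text \<open>The equation is paired with radial cut-offs of the real and imaginary parts of \<open>conf_killing V\<close>. These
  are orthogonal to the left-hand side, so that the norm of \<open>conf_killing V\<close> vanishes.\<close>

lemma conf_killing_eq_0:
  assumes low: "low_tensor (conf_killing V)" and U: "asd_weyl U"
    and eq: "\<And>j l. div_div U j l = cst (-2) * (ex (-4) * conf_killing V j l)"
  shows "conf_killing V j l = 0"
proof (rule sfun_eqI)
  fix x assume x: "x \<in> cyl"
  obtain \<psi> g where \<psi>: "csupp \<psi>" "radial \<psi>" "\<And>z. ev \<psi> z = of_real (g z)" "\<And>z. g z \<ge> 0" "g x > 0"
    by (rule radial_bump[OF x]) (rule that)
  have "ev (conf_killing V j l) x = 0"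
  proof (rule definite_pairing_complex[where \<tau> = "conf_killing V", OF \<psi>(1,3,4) _ \<psi>(5) x])
    fix c
    \<comment> \<open>The power |x|^4 cancels the factor |x|^-4 on the right-hand side of the
      equation.\<close>
    define H where "H j l = (ex 4 * \<psi>) * (cst c * conf_killing V j l + cj (cst c * conf_killing V j l))" for j l
    have "low_tensor H"
      unfolding H_def[abs_def]
      by (intro low_tensor_mult low_tensor_add low_tensor_cj low radial_mult radial_ex radial_cst \<psi>)
    then have "contr U (\<lambda>i j k l. D i (D k (H j l))) = 0" by (rule contr_D_D_low_tensor[OF U])
    moreover have "csupp (H j l)" for j l unfolding H_def by (intro csupp_mult \<psi>)
    ultimately have "integral cyl (ev (\<Sum>j\<in>UNIV. \<Sum>l\<in>UNIV. H j l * div_div U j l)) = 0"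
      using integral_div_div[of H U] by (simp add: zero_sfun.rep_eq[abs_def])
    moreover have "H j l * div_div U j l
        = cst (-2) * (\<psi> * (cst c * conf_killing V j l + cj (cst c * conf_killing V j l)) * conf_killing V j l)" for j l
    proof -
      have "ex 4 * a * b * (cst (-2) * (ex (-4) * d)) = cst (-2) * ((ex 4 * ex (-4)) * (a * b * d))" for a b d
        by (simp only: mult_ac)
      then show ?thesis unfolding H_def eq by (simp add: ex_mult)
    qed
    ultimately show "integral cyl (ev (\<Sum>j\<in>UNIV. \<Sum>l\<in>UNIV. \<psi> * (cst c * conf_killing V j l + cj (cst c * conf_killing V j l)) * conf_killing V j l)) = 0"
      by (simp only: sum_distrib_left[symmetric] integral_cst_mult) simp
  qed
  then show "ev (conf_killing V j l) x = ev 0 x" by simp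
qed

subsection \<open>Solutions of exponential type\<close>

lemma norm_cyl_y: "x \<in> cyl \<Longrightarrow> norm (cyl_y x) = 1" and cyl_y_in_cyl: "x \<in> cyl \<Longrightarrow> cyl_y x \<in> cyl"
  and cyl_y_S3: "norm x = 1 \<Longrightarrow> cyl_y x = x" and cyl_y_scaleR: "s > 0 \<Longrightarrow> cyl_y (s *\<^sub>R x) = cyl_y x"
  by (simp_all add: cyl_y_def cyl_iff)

lemma ev_sf_cyl_y: "smooth_on_S3 p \<Longrightarrow> x \<in> cyl \<Longrightarrow> ev (sf (p \<circ> cyl_y)) x = p (cyl_y x)"
  by (simp add: smooth_on_S3_def ev_sf cyl_iff)

lemma eul_sf_cyl_y:
  assumes "smooth_on_S3 p"
  shows "eul (sf (p \<circ> cyl_y)) = 0"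
proof (rule sfun_eqI)
  fix x assume x: "x \<in> cyl"
  let ?f = "ev (sf (p \<circ> cyl_y))"
  have 1: "((\<lambda>s. s *\<^sub>R x) has_derivative (\<lambda>h. h *\<^sub>R x)) (at (1::real))"
    by (auto intro!: derivative_eq_intros)
  have x1: "1 *\<^sub>R x \<in> cyl" using x by simp
  have d1: "((\<lambda>s. ?f (s *\<^sub>R x)) has_derivative (\<lambda>h. \<Sum>i\<in>UNIV. (h *\<^sub>R x) $ i *\<^sub>R pd i ?f (1 *\<^sub>R x))) (at 1)"
    by (rule has_derivative_compose[OF 1 has_derivative_pd[OF diff_ev[OF x1]]])
  have d2: "((\<lambda>s. ?f (s *\<^sub>R x)) has_derivative (\<lambda>h. 0)) (at (1::real))"
  proof (rule has_derivative_transform_within_open[where s = "{0<..}", OF has_derivative_const])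
    fix s :: real assume "s \<in> {0<..}"
    then have s: "s > 0" by simp
    then have "s *\<^sub>R x \<in> cyl" using x by (simp add: cyl_iff)
    then show "p (cyl_y x) = ?f (s *\<^sub>R x)" by (simp add: ev_sf_cyl_y[OF assms] cyl_y_scaleR[OF s])
  qed auto
  have "(\<Sum>i\<in>UNIV. (1 *\<^sub>R x) $ i *\<^sub>R pd i ?f (1 *\<^sub>R x)) = 0"
    using fun_cong[OF has_derivative_unique[OF d1 d2], of 1] .
  then show "ev (eul (sf (p \<circ> cyl_y))) x = ev 0 x"
    using x by (simp add: eul_def ev_sum ev_D scaleR_conv_of_real)
qed

lemma nil_T_power: "eul p = 0 \<Longrightarrow> nil 0 (Suc n) (T ^ n * p)"
proof (induction n)
  case 0
  then show ?case by (simp add: nil_def shift_eul_def)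
next
  case (Suc n)
  have "shift_eul 0 (T ^ Suc n * p) = cst (of_nat (Suc n)) * (T ^ n * p)"
    by (simp only: shift_eul_def eul_mult eul_power eul_T Suc.prems cst_of_nat cst_0) (simp add: mult.assoc)
  then show ?case
    unfolding nil_Suc[of 0 "Suc n"] using nil_cst_mult[OF Suc.IH[OF Suc.prems]] by simp
qed

lemma exp_poly_imp_nil:
  assumes "exp_poly \<beta> f"
  shows "\<exists>n. nil \<beta> n (sf f)"
proof -
  obtain N p where p: "\<And>n. n \<le> N \<Longrightarrow> smooth_on_S3 (p n)"
    and f: "\<And>x. x \<in> cyl \<Longrightarrow> f x = exp (\<beta> * of_real (cyl_t x)) * (\<Sum>n\<le>N. of_real (cyl_t x) ^ n * p n (cyl_y x))"
    using assms unfolding exp_poly_def by blast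
  define P where "P n = sf (p n \<circ> cyl_y)" for n
  have e: "ev (ex \<beta> * (\<Sum>n\<le>N. T ^ n * P n)) x = f x" if "x \<in> cyl" for x
    using that by (simp add: f ev_ex ev_sum ev_power ev_T P_def ev_sf_cyl_y p)
  have "smooth_on cyl f"
    using smooth_ev[of "ex \<beta> * (\<Sum>n\<le>N. T ^ n * P n)"]
    by (rule iffD1[OF smooth_on_cong[OF open_cyl], rotated]) (rule e)
  then have "sf f = ex \<beta> * (\<Sum>n\<le>N. T ^ n * P n)"
    by (intro sfun_eqI) (subst e, auto simp: ev_sf cyl_iff)
  moreover have "nil 0 (Suc N) (\<Sum>n\<le>N. T ^ n * P n)"
    by (intro nil_sum nil_mono[OF nil_T_power[of "P _"]]) (auto simp: P_def eul_sf_cyl_y p)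
  ultimately show ?thesis using nil_ex_mult[of 0 _ _ \<beta>] by auto
qed

lemma uniform_nil:
  fixes f :: "'i::finite \<Rightarrow> sfun"
  assumes "\<And>i. \<exists>n. nil d n (f i)"
  obtains n where "\<And>i. nil d n (f i)"
proof -
  obtain n where n: "\<And>i. nil d (n i) (f i)" using assms by metis
  have "nil d (\<Sum>j\<in>UNIV. n j) (f i)" for i
    by (rule nil_mono[OF n[of i]]) (rule member_le_sum; simp)
  then show thesis by (rule that)
qed

text \<open>The frame components |x|^4 Z and |x| \<omega> have exponent \<beta>, so U = |x|^2 Z has
  degree \<beta> - 2 and V = |x|^2 \<omega> has degree \<beta> + 1, up to logarithms. The hypothesis
  on \<beta> puts the degree of U between -4 and 0.\<close>

lemma solution_cases:
  assumes s: "solution \<Gamma> \<beta> Z \<omega>" and \<beta>: "\<bar>Re \<beta>\<bar> < 2"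
  obtains (zero) "\<And>x. x \<in> cyl \<Longrightarrow> Z x = 0" "\<And>j l. conf_killing (flat_vec \<omega>) j l = 0" "\<And>l. flat_vec \<omega> l = 0"
  | (rotation) f h where "\<And>x. x \<in> cyl \<Longrightarrow> Z x = 0" "\<And>j l. conf_killing (flat_vec \<omega>) j l = 0" "\<beta> = 0" "\<And>i j. h i j = - h j i" "\<And>l. flat_vec \<omega> l = cst f * X l + (\<Sum>i\<in>UNIV. cst (h l i) * X i)"
  | (special) p where "\<And>x. x \<in> cyl \<Longrightarrow> Z x = 0" "\<And>j l. conf_killing (flat_vec \<omega>) j l = 0" "\<beta> = 1" "\<And>l. flat_vec \<omega> l = (\<Sum>i\<in>UNIV. cst (p i) * X i) * (2 * X l) - cst (p l) * ex 2"
  | (translation) c where "\<And>x. x \<in> cyl \<Longrightarrow> Z x = 0" "\<And>j l. conf_killing (flat_vec \<omega>) j l = 0" "\<beta> = -1" "\<And>l. flat_vec \<omega> l = cst (c l)"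
proof -
  have Z: "smooth_on cyl Z" "\<And>x. x \<in> cyl \<Longrightarrow> sym_traceless_asd cyl_metric x (Z x)" and \<omega>: "smooth_on cyl \<omega>"
    and eZ: "\<And>i j k l. exp_poly \<beta> (\<lambda>x. norm x ^ 4 *\<^sub>R Z x $ i $ j $ k $ l)"
    and e\<omega>: "\<And>i. exp_poly \<beta> (\<lambda>x. norm x *\<^sub>R \<omega> x $ i)" and F: "\<forall>x\<in>cyl. F_star cyl_metric cyl Z \<omega> x = 0"
    using s unfolding solution_def by blast+
  define V where "V = flat_vec \<omega>"
  have eq: "div_div (sft Z) j l = cst (-2) * (ex (-4) * conf_killing V j l)" for j l
    unfolding V_def by (rule iffD1[OF F_star_zero_iff[OF Z \<omega>] F, rule_format])
  have U: "asd_weyl (sft Z)" by (rule asd_weyl_sft[OF Z])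
  have norms: "smooth_on cyl (\<lambda>x. norm x ^ 4 *\<^sub>R Z x $ i $ j $ k $ l)" "smooth_on cyl (\<lambda>x. norm x *\<^sub>R \<omega> x $ i)" for i j k l
  proof -
    have n: "norm x ^ 4 = (norm x)\<^sup>2 * (norm x)\<^sup>2" for x :: "real^4" by simp
    show "smooth_on cyl (\<lambda>x. norm x ^ 4 *\<^sub>R Z x $ i $ j $ k $ l)"
      unfolding n by (intro smooth_on_scaleR smooth_on_mult smooth_on_norm2 smooth_on_vec_nth Z open_cyl)
    have e: "ev (ex 1 * sfv \<omega> i) x = norm x *\<^sub>R \<omega> x $ i" if "x \<in> cyl" for x
      using that by (simp add: ev_ex_1 ev_sfv[OF \<omega>] scaleR_conv_of_real)
    show "smooth_on cyl (\<lambda>x. norm x *\<^sub>R \<omega> x $ i)"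
      using smooth_ev[of "ex 1 * sfv \<omega> i"] by (rule iffD1[OF smooth_on_cong[OF open_cyl], rotated]) (rule e)
  qed
  have Ue: "sft Z i j k l = ex (-2) * sf (\<lambda>x. norm x ^ 4 *\<^sub>R Z x $ i $ j $ k $ l)" for i j k l
  proof (rule sfun_eqI)
    fix x assume x: "x \<in> cyl"
    have "ev (sf (\<lambda>x. norm x ^ 4 *\<^sub>R Z x $ i $ j $ k $ l)) x = norm x ^ 4 *\<^sub>R Z x $ i $ j $ k $ l"
      using x by (simp only: ev_sf[OF norms(1)] cyl_iff if_False)
    then show "ev (sft Z i j k l) x = ev (ex (-2) * sf (\<lambda>x. norm x ^ 4 *\<^sub>R Z x $ i $ j $ k $ l)) x"
      using x by (simp add: ev_sft[OF Z(1)] ev_ex_minus_2 cyl_iff scaleR_conv_of_real power2_eq_square power4_eq_xxxx)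
  qed
  have Ve: "V l = ex 1 * sf (\<lambda>x. norm x *\<^sub>R \<omega> x $ l)" for l
  proof (rule sfun_eqI)
    fix x assume x: "x \<in> cyl"
    have "ev (sf (\<lambda>x. norm x *\<^sub>R \<omega> x $ l)) x = norm x *\<^sub>R \<omega> x $ l"
      using x by (simp only: ev_sf[OF norms(2)] cyl_iff if_False)
    then show "ev (V l) x = ev (ex 1 * sf (\<lambda>x. norm x *\<^sub>R \<omega> x $ l)) x"
      using x ev_ex_nat[OF x, of 2] by (simp add: V_def flat_vec_def ev_sfv[OF \<omega>] ev_ex_1 scaleR_conv_of_real power2_eq_square)
  qed
  obtain N where "\<And>q. nil \<beta> N (case q of (i, j, k, l) \<Rightarrow> sf (\<lambda>x. norm x ^ 4 *\<^sub>R Z x $ i $ j $ k $ l))"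
    using uniform_nil[of \<beta> "\<lambda>q. case q of (i, j, k, l) \<Rightarrow> sf (\<lambda>x. norm x ^ 4 *\<^sub>R Z x $ i $ j $ k $ l)"]
      exp_poly_imp_nil[OF eZ] by (auto split: prod.split)
  from this[of "(_, _, _, _)"] have "nil \<beta> N (sf (\<lambda>x. norm x ^ 4 *\<^sub>R Z x $ i $ j $ k $ l))" for i j k l by simp
  from nil_ex_mult[OF this, of "-2"] have nilU: "nil (\<beta> - 2) N (sft Z i j k l)" for i j k l
    by (simp add: Ue)
  obtain n where "\<And>l. nil \<beta> n (sf (\<lambda>x. norm x *\<^sub>R \<omega> x $ l))"
    using uniform_nil[of \<beta> "\<lambda>l. sf (\<lambda>x. norm x *\<^sub>R \<omega> x $ l)"] exp_poly_imp_nil[OF e\<omega>] by blast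
  from nil_ex_mult[OF this, of 1] have nilV: "nil (\<beta> + 1) n (V l)" for l by (simp add: Ve)
  have "(\<Sum>j\<in>UNIV. D j (ex (-4) * conf_killing V j l)) = 0" for l
  proof -
    have "cst (-2) * (\<Sum>j\<in>UNIV. D j (ex (-4) * conf_killing V j l)) = (\<Sum>j\<in>UNIV. D j (div_div (sft Z) j l))"
      unfolding eq D_mult[of _ "cst (-2)"] by (simp only: D_cst sum_distrib_left mult_zero_left add_0_left)
    also have "\<dots> = 0" by (rule div_div_div[OF U])
    finally show ?thesis by (rule cst_mult_cancel[THEN iffD1, rotated]) simp
  qed
  then obtain F0 F1 G H where r: "radial F0" "\<And>i. radial (F1 i)" "\<And>i. radial (G i)" "\<And>i j. radial (H i j)" "\<And>i j. H i j = - H j i"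
    and V: "\<And>l. V l = ex 1 * (F0 * y l + rlin F1 * y l + G l + rlin (H l))"
    by (rule div_conf_killing_solution[OF _ nilV \<beta>]) (rule that)
  have K: "conf_killing V j l = 0" for j l
    by (rule conf_killing_eq_0[OF low_tensor_conf_killing[OF V r] U eq])
  have "sft Z i j k l = 0" for i j k l
    by (rule div_div_zero_imp_zero[OF U nilU]) (use \<beta> in \<open>simp_all add: eq K\<close>)
  then have Z0: "Z x = 0" if "x \<in> cyl" for x
    using ev_sft[OF Z(1) that] cyl_iff[THEN iffD1, OF that] by (simp add: vec_eq_iff[of "Z _"] vec_eq_iff[of "Z _ $ _"]
      vec_eq_iff[of "Z _ $ _ $ _"] vec_eq_iff[of "Z _ $ _ $ _ $ _"])
  from K have K': "conf_killing (flat_vec \<omega>) j l = 0" for j l by (simp add: V_def)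
  show thesis
  proof (rule conf_killing_cases[OF V r K nilV])
    assume a: "\<And>l. V l = 0"
    show thesis by (rule zero) (fact Z0 K' a[unfolded V_def])+
  next
    fix f h
    assume a: "\<beta> = 0" "\<And>i j. h i j = - h j i" "\<And>l. V l = cst f * X l + (\<Sum>i\<in>UNIV. cst (h l i) * X i)"
    show thesis by (rule rotation) (fact Z0 K' a[unfolded V_def])+
  next
    fix p
    assume a: "\<beta> = 1" "\<And>l. V l = (\<Sum>i\<in>UNIV. cst (p i) * X i) * (2 * X l) - cst (p l) * ex 2"
    show thesis by (rule special) (fact Z0 K' a[unfolded V_def])+
  next
    fix c
    assume a: "\<beta> = -1" "\<And>l. V l = cst (c l)"
    show thesis by (rule translation) (fact Z0 K' a[unfolded V_def])+
  qed
qed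

subsection \<open>Construction of solutions\<close>

lemma smooth_on_congI: "open U \<Longrightarrow> smooth_on U g \<Longrightarrow> (\<And>x. x \<in> U \<Longrightarrow> f x = g x) \<Longrightarrow> smooth_on U f"
  using smooth_on_cong[of U f g] by simp

lemma orthogonal_matrix_cyl: "orthogonal_matrix A \<Longrightarrow> x \<in> cyl \<Longrightarrow> A *v x \<in> cyl"
  and orthogonal_matrix_norm: "orthogonal_matrix A \<Longrightarrow> norm (A *v x) = norm x"
  for A :: "real ^ 4 ^ 4"
proof -
  assume A: "orthogonal_matrix A"
  then have "orthogonal_transformation ((*v) A)"
    by (simp add: orthogonal_transformation_matrix)
  then show n: "norm (A *v x) = norm x" for x
    by (simp add: orthogonal_transformation)
  show "x \<in> cyl \<Longrightarrow> A *v x \<in> cyl"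
    using n[of x] by (metis cyl_iff norm_eq_zero)
qed

lemma orthogonal_matrix_sum:
  fixes A :: "real ^ 4 ^ 4" and v :: "4 \<Rightarrow> 'a::real_vector"
  assumes "orthogonal_matrix A"
  shows "(\<Sum>a\<in>UNIV. A $ a $ i *\<^sub>R (\<Sum>b\<in>UNIV. A $ a $ b *\<^sub>R v b)) = v i"
proof -
  have e: "transpose A ** A = mat 1" using assms by (simp add: orthogonal_matrix)
  have AA: "(\<Sum>a\<in>UNIV. A $ a $ i * A $ a $ b) = (if i = b then 1 else 0)" for b
    using arg_cong[OF e, of "\<lambda>M. M $ i $ b"] by (simp add: matrix_matrix_mult_def transpose_def mat_def)
  have "(\<Sum>a\<in>UNIV. A $ a $ i *\<^sub>R (\<Sum>b\<in>UNIV. A $ a $ b *\<^sub>R v b)) = (\<Sum>a\<in>UNIV. \<Sum>b\<in>UNIV. (A $ a $ i * A $ a $ b) *\<^sub>R v b)"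
    by (simp add: scaleR_sum_right)
  also have "\<dots> = (\<Sum>b\<in>UNIV. \<Sum>a\<in>UNIV. (A $ a $ i * A $ a $ b) *\<^sub>R v b)"
    by (rule sum.swap)
  also have "\<dots> = (\<Sum>b\<in>UNIV. if i = b then v b else 0)"
    unfolding scaleR_sum_left[symmetric] AA by (intro sum.cong refl) simp
  finally show ?thesis by simp
qed

lemma matrix_vector_mult_entry: "(A *v x) $ a = (\<Sum>b\<in>UNIV. A $ a $ b * x $ b)"
  by (simp add: matrix_vector_mult_def)

lemma exp_poly_homogeneous:
  assumes "eul f = cst \<beta> * f" "\<And>x. x \<in> cyl \<Longrightarrow> g x = ev f x"
  shows "exp_poly \<beta> g"
proof -
  define p where "p = ex (- \<beta>) * f"
  have f: "f = ex \<beta> * p" and p: "eul p = 0"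
    unfolding p_def using homogeneous_eq_ex_mult[OF assms(1)] by auto
  have pc: "ev p (cyl_y x) = ev p x" if "x \<in> cyl" for x
    unfolding cyl_y_def using eul_zero_imp_radially_constant[OF p that, of "inverse (norm x)"] that by (simp add: cyl_iff)
  have "smooth_on_S3 (ev p)"
    unfolding smooth_on_S3_def by (rule smooth_on_congI[OF open_cyl smooth_ev[of p]]) (simp add: pc)
  then show ?thesis
    unfolding exp_poly_def
    by (intro exI[of _ 0] exI[of _ "\<lambda>n. ev p"]) (auto simp: assms(2) pc f ev_ex)
qed

lemma smooth_from_sfun:
  assumes "\<And>x i. x \<in> cyl \<Longrightarrow> \<omega> x $ i = ev (W i) x"
  shows "smooth_on cyl \<omega>" and "sfv \<omega> i = W i"
proof -
  have "smooth_on cyl (\<lambda>x. \<chi> i. ev (W i) x)" by (intro smooth_on_vec open_cyl smooth_ev)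
  then show s: "smooth_on cyl \<omega>"
    by (rule smooth_on_congI[OF open_cyl]) (simp add: vec_eq_iff assms)
  show "sfv \<omega> i = W i" by (rule sfun_eqI) (simp add: ev_sfv[OF s] assms)
qed

lemma zero_sym_traceless_asd: "sym_traceless_asd g x 0"
proof -
  have "(\<chi> i j. 0 $ i $ j $ k $ l) = (0 :: 'a::real_vector tens2)" for k l by (simp add: vec_eq_iff)
  moreover have "hodge g x 0 = (0 :: 'a::real_vector tens2)" by (simp add: hodge_def vec_eq_iff)
  ultimately show ?thesis by (simp add: sym_traceless_asd_def)
qed

text \<open>With Z = 0 the equation reduces to K V = 0. Homogeneity of V of degree \<beta> + 1 makes
  |x| \<omega> homogeneous of degree \<beta>, so that the polynomial in t is constant.\<close>

lemma solution_from_sfun: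
  assumes \<Gamma>: "\<And>A. A \<in> \<Gamma> \<Longrightarrow> orthogonal_matrix A" and Z: "\<And>x. x \<in> cyl \<Longrightarrow> Z x = 0"
    and \<omega>: "\<And>x i. x \<in> cyl \<Longrightarrow> \<omega> x $ i = ev (ex (-2) * V i) x" and inv: "invariant1 \<Gamma> \<omega>"
    and V: "\<And>i. eul (V i) = cst (\<beta> + 1) * V i" "\<And>j l. conf_killing V j l = 0"
  shows "solution \<Gamma> \<beta> Z \<omega>"
  unfolding solution_def
proof (intro conjI allI ballI inv)
  show sZ: "smooth_on cyl Z" by (rule smooth_on_congI[OF open_cyl smooth_on_const[of cyl 0]]) (rule Z)
  show s\<omega>: "smooth_on cyl \<omega>" by (rule smooth_from_sfun(1)[OF \<omega>])
  show tZ: "sym_traceless_asd cyl_metric x (Z x)" if "x \<in> cyl" for x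
    unfolding Z[OF that] by (rule zero_sym_traceless_asd)
  show "invariant4 \<Gamma> Z" by (simp add: invariant4_def Z orthogonal_matrix_cyl \<Gamma>)
  show "exp_poly \<beta> (\<lambda>x. norm x ^ 4 *\<^sub>R Z x $ i $ j $ k $ l)" for i j k l
    by (rule exp_poly_homogeneous[of 0]) (simp_all add: Z)
  show "exp_poly \<beta> (\<lambda>x. norm x *\<^sub>R \<omega> x $ i)" for i
  proof (rule exp_poly_homogeneous)
    show "eul (ex (-1) * V i) = cst \<beta> * (ex (-1) * V i)"
      by (simp add: eul_mult eul_ex V cst_hom algebra_simps)
    fix x assume x: "x \<in> cyl"
    have "ex 1 * (ex (-2) * V i) = ex (-1) * V i" by (simp add: ex_mult')
    then show "norm x *\<^sub>R \<omega> x $ i = ev (ex (-1) * V i) x"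
      using x by (metis \<omega> ev_ex_1 ev_simps(2) scaleR_conv_of_real)
  qed
  have V': "flat_vec \<omega> = V"
    by (rule ext) (simp add: flat_vec_def smooth_from_sfun(2)[OF \<omega>] ex_mult')
  have "sft Z = (\<lambda>i j k l. 0)"
    by (intro ext sfun_eqI) (simp add: ev_sft[OF sZ] Z)
  then have "\<forall>j l. div_div (sft Z) j l = cst (-2) * (ex (-4) * conf_killing (flat_vec \<omega>) j l)"
    by (simp add: V' V div_div_def)
  then show "F_star cyl_metric cyl Z \<omega> x = 0" if "x \<in> cyl" for x
    using F_star_zero_iff[OF sZ tZ s\<omega>] that by blast
qed

lemma conf_killing_add: "conf_killing (\<lambda>l. V l + W l) j l = conf_killing V j l + conf_killing W j l"
  and conf_killing_cst_mult: "conf_killing (\<lambda>l. cst c * V l) j l = cst c * conf_killing V j l"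
  by (simp_all add: conf_killing_def D_mult sum.distrib sum_distrib_left[symmetric] distrib_left right_diff_distrib mult_ac)

lemma conf_killing_sum: "conf_killing (\<lambda>l. \<Sum>k\<in>I. V k l) j l = (\<Sum>k\<in>I. conf_killing (V k) j l)"
proof (induction I rule: infinite_finite_induct)
  case (insert k I)
  then show ?case using conf_killing_add[of "V k" "\<lambda>l. \<Sum>k\<in>I. V k l" j l] by simp
qed (simp_all add: conf_killing_def)

lemma conf_killing_X: "conf_killing X j l = 0"
  using half_half[of "4"] cst_hom(2)[of "1/2" 4] by (simp add: conf_killing_def D_X)

lemma conf_killing_translation: "conf_killing (\<lambda>l. cst (c l)) j l = 0"
  by (simp add: conf_killing_def)

lemma conf_killing_special:
  "conf_killing (\<lambda>l. (\<Sum>i\<in>UNIV. cst (p i) * X i) * (2 * X l) - cst (p l) * ex 2) j l = 0"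
proof -
  have D: "D j ((\<Sum>i\<in>UNIV. cst (p i) * X i) * (2 * X l) - cst (p l) * ex 2)
      = cst (p j) * (2 * X l) + (if j = l then 2 * (\<Sum>i\<in>UNIV. cst (p i) * X i) else 0) - cst (p l) * (2 * X j)" for j l
    by (simp add: D_mult D_X D_ex mult_delta_right mult_ac)
  have "cst (1/2) * (8 * (\<Sum>i\<in>UNIV. cst (p i) * X i)) = 4 * (\<Sum>i\<in>UNIV. cst (p i) * X i)"
    using cst_hom(2)[of "1/2" 8] by (simp add: mult.assoc[symmetric])
  then show ?thesis
    unfolding conf_killing_def D by (simp add: sum.distrib sum_subtractf algebra_simps)
qed

subsection \<open>Eigenfunctions of the sphere\<close>

lemma laplacian_S3_eq:
  assumes \<phi>: "smooth_on_S3 \<phi>" and x: "x \<in> cyl"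
  shows "laplacian_S3 \<phi> x = ev (lapS (sf (\<phi> \<circ> cyl_y))) x"
proof -
  let ?f = "sf (\<phi> \<circ> cyl_y)" and ?\<omega> = "\<lambda>x. \<chi> i. pd i (\<phi> \<circ> cyl_y) x"
  have "?\<omega> z $ i = ev (D i ?f) z" if z: "z \<in> cyl" for z i
    using z pd_cong[OF open_cyl, of "\<phi> \<circ> cyl_y" "ev ?f" z i] by (simp add: ev_D ev_sf_cyl_y[OF \<phi>])
  from smooth_from_sfun[of ?\<omega>, OF this]
  have "smooth_on cyl ?\<omega>" "sfv ?\<omega> i = D i ?f" for i by auto
  from delta1_cyl_metric[OF this(1) x] this(2)
  show ?thesis
    by (simp add: laplacian_S3_def laplacian_def lapS_def lap_def eul_def[of ?f, symmetric] eul_sf_cyl_y[OF \<phi>])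
qed

text \<open>The radially constant extension and its image under \<Delta>_S are both constant along
  rays, so an equation on the sphere is an equation in the ring.\<close>

lemma eigenfunction_S3_iff:
  assumes \<phi>: "smooth_on_S3 \<phi>"
  shows "eigenfunction_S3 \<mu> \<phi> \<longleftrightarrow> sf (\<phi> \<circ> cyl_y) \<noteq> 0
    \<and> lapS (sf (\<phi> \<circ> cyl_y)) + cst (of_real \<mu>) * sf (\<phi> \<circ> cyl_y) = 0"
proof -
  let ?f = "sf (\<phi> \<circ> cyl_y)"
  have S3: "z \<in> cyl" "cyl_y z = z" if "z \<in> S3" for z using that by (auto simp: cyl_iff cyl_y_S3)
  have "(\<exists>z\<in>S3. \<phi> z \<noteq> 0) \<longleftrightarrow> ?f \<noteq> 0"
  proof
    assume "\<exists>z\<in>S3. \<phi> z \<noteq> 0"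
    then obtain z where z: "z \<in> S3" "\<phi> z \<noteq> 0" by blast
    then have "ev ?f z \<noteq> 0" by (simp only: ev_sf_cyl_y[OF \<phi> S3(1)] S3(2)) simp
    then show "?f \<noteq> 0" by auto
  next
    assume "?f \<noteq> 0"
    then obtain x where x: "x \<in> cyl" "ev ?f x \<noteq> 0" using sfun_eqI[of ?f 0] by auto
    then have "\<phi> (cyl_y x) \<noteq> 0" "cyl_y x \<in> S3" by (simp_all add: ev_sf_cyl_y[OF \<phi>] norm_cyl_y)
    then show "\<exists>z\<in>S3. \<phi> z \<noteq> 0" by blast
  qed
  moreover have "(\<forall>z\<in>S3. - laplacian_S3 \<phi> z = \<mu> *\<^sub>R \<phi> z) \<longleftrightarrow> lapS ?f + cst (of_real \<mu>) * ?f = 0"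
  proof -
    let ?g = "lapS ?f + cst (of_real \<mu>) * ?f"
    have g: "- laplacian_S3 \<phi> z = \<mu> *\<^sub>R \<phi> z \<longleftrightarrow> ev ?g z = 0" if "z \<in> S3" for z
      using laplacian_S3_eq[OF \<phi> S3(1)[OF that]] S3[OF that] ev_sf_cyl_y[OF \<phi> S3(1)[OF that]]
      by (simp add: ev_cst scaleR_conv_of_real neg_eq_iff_add_eq_0)
    have e: "eul ?g = 0" by (simp add: eul_lapS eul_mult eul_sf_cyl_y[OF \<phi>])
    have "ev ?g x = ev ?g (cyl_y x)" if "x \<in> cyl" for x
    proof -
      have "inverse (norm x) > 0" using that by (simp add: cyl_iff)
      from eul_zero_imp_radially_constant[OF e that this] show ?thesis by (simp only: cyl_y_def)
    qed
    then have "(\<forall>z\<in>S3. ev ?g z = 0) \<longleftrightarrow> ?g = 0"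
      using norm_cyl_y by (intro iffI sfun_eqI) (simp_all del: ev_simps(1,2))
    then show ?thesis using g by simp
  qed
  ultimately show ?thesis using \<phi> by (simp add: eigenfunction_S3_def)
qed

lemma eigenvalue_ge_3:
  assumes "eigenfunction_S3 \<mu> \<phi>" "\<mu> > 0"
  shows "\<mu> \<ge> 3"
proof (rule ccontr)
  assume less: "\<not> \<mu> \<ge> 3"
  have \<phi>: "smooth_on_S3 \<phi>" using assms(1) by (simp add: eigenfunction_S3_def)
  have "complex_of_real \<mu> \<noteq> of_nat k * (of_nat k + 2)" for k :: nat
  proof
    assume "complex_of_real \<mu> = of_nat k * (of_nat k + 2)"
    then have "complex_of_real \<mu> = of_real (real k * (real k + 2))" by simp
    then have \<mu>: "\<mu> = real k * (real k + 2)" by (simp only: of_real_eq_iff)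
    then have "k \<noteq> 0" using assms(2) by (cases k) auto
    then have "real k \<ge> 1" by simp
    then have "real k * (real k + 2) \<ge> 1 * (1 + 2)" by (intro mult_mono) auto
    with \<mu> less show False by simp
  qed
  with lapS_eigenvalue[OF eul_sf_cyl_y[OF \<phi>]] assms(1)[unfolded eigenfunction_S3_iff[OF \<phi>]]
  show False by blast
qed

definition linf :: "(4 \<Rightarrow> complex) \<Rightarrow> complex fld" where
  "linf d x = (\<Sum>i\<in>UNIV. d i * of_real (x $ i))"

lemma ev_y: "x \<in> cyl \<Longrightarrow> ev (y i) x = of_real (cyl_y x $ i)"
  by (simp add: y_def ev_ex_minus_1 cyl_y_def)

lemma ev_ylin: "x \<in> cyl \<Longrightarrow> ev (ylin d) x = linf d (cyl_y x)"
  by (simp add: ylin_def linf_def ev_sum ev_cst ev_y)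

lemma smooth_on_S3_linf: "smooth_on_S3 (linf d)" and sf_linf: "sf (linf d \<circ> cyl_y) = ylin d"
proof -
  show s: "smooth_on_S3 (linf d)"
    unfolding smooth_on_S3_def by (rule smooth_on_congI[OF open_cyl smooth_ev[of "ylin d"]]) (simp add: ev_ylin)
  show "sf (linf d \<circ> cyl_y) = ylin d"
    by (rule sfun_eqI) (simp add: ev_sf_cyl_y[OF s] ev_ylin)
qed

lemma eigenfunction_3_iff:
  "eigenfunction_S3 3 \<phi> \<longleftrightarrow> (\<exists>d. (\<exists>i. d i \<noteq> 0) \<and> smooth_on_S3 \<phi> \<and> sf (\<phi> \<circ> cyl_y) = ylin d)"
proof
  assume e: "eigenfunction_S3 3 \<phi>"
  then have \<phi>: "smooth_on_S3 \<phi>" by (simp add: eigenfunction_S3_def)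
  have f: "sf (\<phi> \<circ> cyl_y) \<noteq> 0" "lapS (sf (\<phi> \<circ> cyl_y)) + 3 * sf (\<phi> \<circ> cyl_y) = ylin (\<lambda>_. 0)"
    using e[unfolded eigenfunction_S3_iff[OF \<phi>]] by (simp_all add: ylin_def)
  obtain d where d: "sf (\<phi> \<circ> cyl_y) = ylin d"
    by (rule lapS_plus_3_linear_imp_linear[OF eul_sf_cyl_y[OF \<phi>] f(2)])
  have "\<exists>i. d i \<noteq> 0"
  proof (rule ccontr)
    assume "\<not> (\<exists>i. d i \<noteq> 0)"
    then have "ylin d = 0" by (simp add: ylin_def)
    with d f(1) show False by simp
  qed
  with \<phi> d show "\<exists>d. (\<exists>i. d i \<noteq> 0) \<and> smooth_on_S3 \<phi> \<and> sf (\<phi> \<circ> cyl_y) = ylin d" by blast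
next
  assume "\<exists>d. (\<exists>i. d i \<noteq> 0) \<and> smooth_on_S3 \<phi> \<and> sf (\<phi> \<circ> cyl_y) = ylin d"
  then obtain d i where d: "d i \<noteq> 0" "smooth_on_S3 \<phi>" "sf (\<phi> \<circ> cyl_y) = ylin d" by blast
  have "ylin d \<noteq> 0"
  proof
    assume "ylin d = 0"
    then have "cst (d i) = 0" using D_ex_1_ylin[of i d] by simp
    with d(1) show False by simp
  qed
  then show "eigenfunction_S3 3 \<phi>"
    unfolding eigenfunction_S3_iff[OF d(2)] d(3) by (simp add: lapS_ylin)
qed

lemma lowest_nontrivial_eigenfunction_iff: "lowest_nontrivial_eigenfunction \<phi> \<longleftrightarrow> eigenfunction_S3 3 \<phi>"
proof -
  have "eigenfunction_S3 3 (linf (\<lambda>_. 1))"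
    unfolding eigenfunction_3_iff using smooth_on_S3_linf sf_linf by (intro exI[of _ "\<lambda>_. 1"]) simp
  then have e: "\<exists>\<psi>. eigenfunction_S3 3 \<psi>" by blast
  have "\<mu> = 3" if "\<mu> > 0" "eigenfunction_S3 \<mu> \<phi>" "\<forall>\<nu>>0. (\<exists>\<psi>. eigenfunction_S3 \<nu> \<psi>) \<longrightarrow> \<mu> \<le> \<nu>" for \<mu>
    using eigenvalue_ge_3[OF that(2,1)] that(3)[rule_format, OF _ e] by simp
  then show ?thesis
    unfolding lowest_nontrivial_eigenfunction_def using eigenvalue_ge_3
    by (metis zero_less_numeral)
qed

text \<open>For \<phi> = d \<cdot> y, the form e^t (\<phi> dt - d\<phi>) is dual to the special
  conformal field 2 (d \<cdot> x) x - |x|^2 d, and e^{-t} (\<phi> dt + d\<phi>) to the constant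
  field d.\<close>

lemma eigen_form_eq:
  assumes \<epsilon>: "\<epsilon> = 1 \<or> \<epsilon> = -1" and \<phi>: "smooth_on_S3 \<phi>" "sf (\<phi> \<circ> cyl_y) = ylin d" and x: "x \<in> cyl"
  shows "eigen_form \<epsilon> \<phi> x $ l = ev (ex (-2) * (if \<epsilon> = 1
    then (\<Sum>i\<in>UNIV. cst (d i) * X i) * (2 * X l) - cst (d l) * ex 2 else cst (d l))) x"
proof -
  have "pd l (\<phi> \<circ> cyl_y) x = ev (D l (ylin d)) x"
    using x pd_cong[OF open_cyl, of "\<phi> \<circ> cyl_y" "ev (ylin d)" x l] ev_sf_cyl_y[OF \<phi>(1)] by (simp add: ev_D \<phi>(2))
  moreover have "\<phi> (cyl_y x) = ev (ylin d) x" using ev_sf_cyl_y[OF \<phi>(1) x] by (simp add: \<phi>(2))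
  moreover have "of_real (pd l cyl_t x) = ev (ex (-2) * X l) x"
    using x by (simp add: pd_cyl_t cyl_iff ev_ex_minus_2)
  moreover have "of_real (exp (\<epsilon> * cyl_t x)) = ev (ex (of_real \<epsilon>)) x"
    using x by (simp add: ev_ex flip: exp_of_real of_real_mult)
  ultimately have E: "eigen_form \<epsilon> \<phi> x $ l = ev (ex (of_real \<epsilon>) * (ylin d * (ex (-2) * X l) - cst (of_real \<epsilon>) * D l (ylin d))) x"
    using x by (simp add: eigen_form_def ev_cst)
  have D: "D l (ylin d) = ex (-1) * cst (d l) - ex (-2) * X l * ylin d"
  proof -
    have "ylin d = ex (-1) * (ex 1 * ylin d)" by (simp add: ex_mult')
    then have "D l (ylin d) = D l (ex (-1)) * (ex 1 * ylin d) + ex (-1) * D l (ex 1 * ylin d)"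
      by (metis D_mult)
    also have "D l (ex (-1)) * (ex 1 * ylin d) = - (ex (-3) * ex 1) * X l * ylin d"
      by (simp add: D_ex mult_ac)
    finally show ?thesis by (simp add: D_ex_1_ylin ex_mult)
  qed
  have "ex 1 * (ylin d * (ex (-2) * X l) - (ex (-1) * cst (d l) - ex (-2) * X l * ylin d))
    = 2 * ((ex 1 * ex (-2)) * (X l * ylin d)) - (ex 1 * ex (-1)) * cst (d l)"
    "ex (-2) * (ex 1 * ylin d * (2 * X l) - cst (d l) * ex 2) = 2 * ((ex 1 * ex (-2)) * (X l * ylin d)) - (ex 2 * ex (-2)) * cst (d l)"
    "ex (-1) * (ylin d * (ex (-2) * X l) + (ex (-1) * cst (d l) - ex (-2) * X l * ylin d)) = (ex (-1) * ex (-1)) * cst (d l)"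
    by (simp_all add: algebra_simps)
  then show ?thesis
    using \<epsilon> E unfolding D ex_1_ylin[symmetric] by (auto simp: ex_mult simp del: ev_simps)
qed

subsection \<open>Killing fields\<close>

lemma cyl_y_orthogonal: "orthogonal_matrix A \<Longrightarrow> cyl_y (A *v x) = A *v cyl_y x" for A :: "real ^ 4 ^ 4"
  by (simp add: cyl_y_def orthogonal_matrix_norm matrix_vector_mult_scaleR)

lemma S3_dual_tangent:
  assumes Q: "\<And>z. z \<in> S3 \<Longrightarrow> Q z \<bullet> z = 0" and x: "x \<in> cyl"
  shows "S3_dual Q x $ l = of_real (Q (cyl_y x) $ l / norm x)"
proof -
  have "Q (cyl_y x) \<bullet> cyl_y x = 0" using Q norm_cyl_y[OF x] by simp
  then have "Q (cyl_y x) \<bullet> x = 0" using x by (simp add: cyl_y_def cyl_iff)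
  then show ?thesis
    using x by (simp add: S3_dual_def pd_cyl_y cyl_iff inner_diff_right inner_axis divide_inverse mult.commute)
qed

text \<open>The field V = |x| Q(x/|x|) is the extension of degree one. The Killing equation on the
  sphere concerns tangential directions only; the components with a radial direction follow from
  tangency of Q and from homogeneity.\<close>

lemma S3_dual_killing_field:
  assumes k: "killing_field \<Gamma> Q"
  obtains V where "\<And>l. eul (V l) = V l" "\<And>j l. conf_killing V j l = 0"
    "\<And>x l. x \<in> cyl \<Longrightarrow> S3_dual Q x $ l = ev (ex (-2) * V l) x"
proof -
  let ?F = "Q \<circ> cyl_y"
  have sF: "smooth_on cyl ?F" and tan: "\<And>z. z \<in> S3 \<Longrightarrow> Q z \<bullet> z = 0"
    and kill: "\<And>z u v. z \<in> S3 \<Longrightarrow> u \<bullet> z = 0 \<Longrightarrow> v \<bullet> z = 0 \<Longrightarrow>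
      frechet_derivative ?F (at z) u \<bullet> v + u \<bullet> frechet_derivative ?F (at z) v = 0"
    using k unfolding killing_field_def smooth_on_S3_def by blast+
  define p where "p l z = complex_of_real (Q z $ l)" for l z
  have sp: "smooth_on_S3 (p l)" for l
    using smooth_on_of_real[OF open_cyl smooth_on_vec_nth[OF open_cyl sF], of l]
    by (simp add: smooth_on_S3_def p_def o_def)
  define f where "f l = sf (p l \<circ> cyl_y)" for l
  have ef: "eul (f l) = 0" for l unfolding f_def by (rule eul_sf_cyl_y[OF sp])
  have ev_f: "ev (f l) x = of_real (?F x $ l)" if "x \<in> cyl" for x l
    using that by (simp add: f_def ev_sf_cyl_y[OF sp] p_def)
  have lin: "bounded_linear (\<lambda>v :: real ^ 4. complex_of_real (v $ l))" for l
    by (rule bounded_linear_compose[OF bounded_linear_of_real bounded_linear_vec_nth])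
  have ev_Df: "ev (D j (f l)) x = of_real (pd j ?F x $ l)" if x: "x \<in> cyl" for x j l
    using x pd_cong[OF open_cyl ev_f x] pd_linear[OF lin smooth_on_imp_differentiable[OF sF open_cyl x], of j l]
    by (simp add: ev_D)
  define V where "V l = ex 1 * f l" for l
  have eV: "eul (V l) = V l" for l by (simp add: V_def eul_mult ef eul_ex)
  have S: "D j (V l) + D l (V j) = 0" for j l
  proof (rule sfun_eqI)
    fix x assume x: "x \<in> cyl"
    let ?g = "D j (V l) + D l (V j)"
    define z where "z = cyl_y x"
    have z: "z \<in> S3" "z \<in> cyl" "norm z = 1" using norm_cyl_y[OF x] cyl_y_in_cyl[OF x] by (simp_all add: z_def)
    have zz: "z \<bullet> z = 1" using z(3) by (simp add: dot_square_norm)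
    have Fz: "?F z = Q z" using cyl_y_S3[OF z(3)] by simp
    define B where "B = frechet_derivative ?F (at z)"
    have B: "(?F has_derivative B) (at z)"
      unfolding B_def using smooth_on_imp_differentiable[OF sF open_cyl z(2)] frechet_derivative_works by blast
    have pB: "pd i ?F z = B (axis i 1)" for i unfolding pd_def B_def ..
    have linB: "linear B" using B by (rule has_derivative_linear)
    \<comment> \<open>The extension is constant along rays, so its derivative in the radial
      direction is 0.\<close>
    have Bz: "B z = 0"
    proof -
      have e: "ev (eul (f l)) z = of_real ((\<Sum>i\<in>UNIV. z $ i *\<^sub>R B (axis i 1)) $ l)" for l
        using z(2) by (simp add: eul_def ev_sum ev_Df pB)
      have "(\<Sum>i\<in>UNIV. z $ i *\<^sub>R B (axis i 1)) $ l = 0" for l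
        using e[of l] unfolding ef ev_simps(5) by (rule of_real_eq_0_iff[THEN iffD1, OF sym])
      then have "(\<Sum>i\<in>UNIV. z $ i *\<^sub>R B (axis i 1)) = 0" by (simp only: vec_eq_iff zero_index simp_thms)
      moreover have "B z = (\<Sum>i\<in>UNIV. z $ i *\<^sub>R B (axis i 1))"
        using basis_expansion[of z] linear_sum[OF linB, of "\<lambda>i. z $ i *s axis i 1" UNIV]
        by (simp add: scalar_mult_eq_scaleR linear_scale[OF linB])
      ultimately show ?thesis by simp
    qed
    \<comment> \<open>The normal component of the derivative comes from differentiating the tangency
      condition, which holds on the whole cylinder.\<close>
    have Bt: "B u \<bullet> z = - (Q z \<bullet> u)" for u
    proof -
      have "((\<lambda>x. ?F x \<bullet> x) has_derivative (\<lambda>v. ?F z \<bullet> v + B v \<bullet> z)) (at z)"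
        by (rule has_derivative_inner[OF B has_derivative_ident])
      moreover have "((\<lambda>x. ?F x \<bullet> x) has_derivative (\<lambda>v. 0)) (at z)"
      proof (subst has_derivative_cong_open[OF open_cyl _ z(2), of _ "\<lambda>x. 0"])
        fix w assume w: "w \<in> cyl"
        then have "?F w \<bullet> cyl_y w = 0" using tan[of "cyl_y w"] norm_cyl_y by simp
        then show "?F w \<bullet> w = 0" using w by (simp add: cyl_y_def cyl_iff)
      qed simp
      ultimately have "(\<lambda>v. ?F z \<bullet> v + B v \<bullet> z) = (\<lambda>v. 0)" by (rule has_derivative_unique)
      from fun_cong[OF this, of u] show ?thesis by (simp only: Fz)
    qed
    \<comment> \<open>The tangential parts of the basis vectors; by \<open>Bz\<close> the derivative
      does not see the difference.\<close>
    define u where "u i = axis i 1 - (z $ i) *\<^sub>R z" for i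
    have ut: "u i \<bullet> z = 0" for i by (simp add: u_def inner_diff_left inner_axis' zz)
    have Bu: "B (u i) = B (axis i 1)" for i
      using linear_diff[OF linB] linear_scale[OF linB] by (simp add: u_def Bz)
    have "B (u j) \<bullet> u l + u j \<bullet> B (u l) = 0"
      unfolding B_def by (rule kill[OF z(1) ut ut])
    then have "B (axis j 1) $ l + z $ l * Q z $ j + (B (axis l 1) $ j + z $ j * Q z $ l) = 0"
      unfolding Bu unfolding u_def
      using tan[OF z(1)]
      by (simp add: inner_diff_right inner_diff_left inner_axis inner_axis' inner_commute[of z] Bt)
    then have "complex_of_real (B (axis j 1) $ l + z $ l * Q z $ j + (B (axis l 1) $ j + z $ j * Q z $ l)) = 0"
      by simp
    moreover have "ev (D j (V l)) z = of_real (B (axis j 1) $ l + z $ j * Q z $ l)" for j l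
      using z ev_ex_1[OF z(2)] ev_ex_minus_1[OF z(2)]
      by (simp add: V_def D_mult D_ex ev_Df pB ev_f cyl_y_S3)
    ultimately have "ev ?g z = 0" by (simp add: algebra_simps)
    moreover have "eul ?g = 0"
      using D_eul[of j "V l"] D_eul[of l "V j"] by (simp add: eV)
    then have "ev ?g z = ev ?g x"
    proof -
      assume e: "eul ?g = 0"
      have "inverse (norm x) > 0" using x by (simp add: cyl_iff)
      from eul_zero_imp_radially_constant[OF e x this] show ?thesis by (simp only: cyl_y_def z_def)
    qed
    ultimately show "ev ?g x = ev 0 x" by simp
  qed
  have "D i (V i) = 0" for i
  proof -
    have "2 * D i (V i) = 0" using S[of i i] by (simp only: mult_2)
    then show ?thesis unfolding numeral_mult_cancel .
  qed
  then have K: "conf_killing V j l = 0" for j l using S[of j l] by (simp add: conf_killing_def)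
  have dual: "S3_dual Q x $ l = ev (ex (-2) * V l) x" if x: "x \<in> cyl" for x l
  proof -
    have "ex (-2) * V l = ex (-1) * f l" by (simp add: V_def ex_mult')
    then have "ev (ex (-2) * V l) x = ev (ex (-1) * f l) x" by (simp only:)
    also have "\<dots> = of_real (Q (cyl_y x) $ l / norm x)"
      using x by (simp add: ev_ex_minus_1 ev_f divide_inverse mult.commute)
    finally show ?thesis using S3_dual_tangent[OF tan x, of l] by simp
  qed
  show thesis by (rule that[OF eV K dual])
qed

lemma invariant1_S3_dual:
  assumes \<Gamma>: "\<And>A. A \<in> \<Gamma> \<Longrightarrow> orthogonal_matrix A" and k: "killing_field \<Gamma> Q"
  shows "invariant1 \<Gamma> (S3_dual Q)"
  unfolding invariant1_def
proof (intro ballI allI)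
  fix A x i assume A: "A \<in> \<Gamma>" and x: "x \<in> cyl"
  have tan: "Q z \<bullet> z = 0" if "z \<in> S3" for z using k that unfolding killing_field_def by blast
  have eq: "Q (A *v z) = A *v Q z" if "z \<in> S3" for z using k A that unfolding killing_field_def by blast
  have S: "S3_dual Q w $ a = of_real (Q (cyl_y w) $ a / norm w)" if "w \<in> cyl" for w a
    by (rule S3_dual_tangent[OF tan that])
  have QA: "Q (cyl_y (A *v x)) = A *v Q (cyl_y x)"
    unfolding cyl_y_orthogonal[OF \<Gamma>[OF A]] by (rule eq) (simp add: norm_cyl_y[OF x])
  have "S3_dual Q (A *v x) $ a = (\<Sum>b\<in>UNIV. A $ a $ b *\<^sub>R S3_dual Q x $ b)" for a
    unfolding S[OF x] S[OF orthogonal_matrix_cyl[OF \<Gamma>[OF A] x]] QA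
      matrix_vector_mult_entry orthogonal_matrix_norm[OF \<Gamma>[OF A]]
    by (simp add: sum_divide_distrib scaleR_conv_of_real)
  then show "S3_dual Q x $ i = (\<Sum>a\<in>UNIV. A $ a $ i *\<^sub>R S3_dual Q (A *v x) $ a)"
    by (simp only: orthogonal_matrix_sum[OF \<Gamma>[OF A]])
qed

lemma antisymmetric_inner:
  fixes M :: "real ^ 4 ^ 4"
  assumes "\<And>i j. M $ i $ j = - M $ j $ i"
  shows "(M *v u) \<bullet> v = - (u \<bullet> (M *v v))"
proof -
  have t: "transpose M = - M" by (simp add: transpose_def vec_eq_iff) (use assms in blast)
  have "(M *v u) \<bullet> v = u \<bullet> (transpose M *v v)"
    by (metis dot_lmul_matrix inner_commute transpose_matrix_vector)
  moreover have "(- M) *v v = - (M *v v)" by (simp add: matrix_vector_mult_def vec_eq_iff sum_negf)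
  ultimately show ?thesis by (simp add: t)
qed

lemma killing_field_matrix:
  fixes M :: "real ^ 4 ^ 4"
  assumes M: "\<And>i j. M $ i $ j = - M $ j $ i" and eq: "\<And>A z. A \<in> \<Gamma> \<Longrightarrow> M *v (A *v z) = A *v (M *v z)"
  shows "killing_field \<Gamma> ((*v) M)"
  unfolding killing_field_def
proof (intro conjI ballI allI impI)
  have e: "(M *v cyl_y x) $ l = Re (ev (ylin (\<lambda>b. of_real (M $ l $ b))) x)" if "x \<in> cyl" for x l
    using that by (simp add: ylin_def ev_sum ev_cst ev_y matrix_vector_mult_entry)
  have s: "smooth_on cyl (\<lambda>x. \<chi> l. Re (ev (ylin (\<lambda>b. of_real (M $ l $ b))) x))"
    by (intro smooth_on_vec open_cyl smooth_on_linear[OF bounded_linear_Re] smooth_ev)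
  show "smooth_on_S3 ((*v) M)"
    unfolding smooth_on_S3_def by (rule smooth_on_congI[OF open_cyl s]) (simp add: vec_eq_iff e)
  show "(M *v z) \<bullet> z = 0" for z
    using antisymmetric_inner[OF M, of z z] by (simp add: inner_commute)
  show "M *v (A *v z) = A *v (M *v z)" if "A \<in> \<Gamma>" for A z by (rule eq[OF that])
  fix z u v assume z: "z \<in> S3" and uv: "u \<bullet> z = 0 \<and> v \<bullet> z = 0"
  have z0: "z \<noteq> 0" using z by auto
  have "((\<lambda>x. inverse (norm x) *\<^sub>R x) has_derivative
      (\<lambda>v. inverse (norm z) *\<^sub>R v + (- (inverse (norm z) * (v \<bullet> sgn z) * inverse (norm z))) *\<^sub>R z)) (at z)"
    using z0 by (auto intro!: derivative_eq_intros has_derivative_norm)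
  from bounded_linear.has_derivative[OF matrix_vector_mul_bounded_linear this, of M]
  have d: "((*v) M \<circ> cyl_y has_derivative (\<lambda>v. M *v (inverse (norm z) *\<^sub>R v + (- (inverse (norm z) * (v \<bullet> sgn z) * inverse (norm z))) *\<^sub>R z))) (at z)"
    by (simp add: o_def cyl_y_def)
  have "frechet_derivative ((*v) M \<circ> cyl_y) (at z) w = M *v w" if "w \<bullet> z = 0" for w
    unfolding frechet_derivative_at[OF d, symmetric] using z that by (simp add: sgn_div_norm)
  then show "frechet_derivative ((*v) M \<circ> cyl_y) (at z) u \<bullet> v + u \<bullet> frechet_derivative ((*v) M \<circ> cyl_y) (at z) v = 0"
    using uv antisymmetric_inner[OF M, of u v] by simp
qed

subsection \<open>The solutions for the roots \<open>0\<close> and \<open>\<plusminus>1\<close>\<close>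

lemma solution_entry:
  assumes "solution \<Gamma> \<beta> Z \<omega>" and x: "x \<in> cyl"
  shows "\<omega> x $ l = ev (ex (-2) * flat_vec \<omega> l) x"
proof -
  have "smooth_on cyl \<omega>" using assms(1) unfolding solution_def by blast
  moreover have "ex (-2) * flat_vec \<omega> l = sfv \<omega> l" by (simp add: flat_vec_def ex_mult')
  ultimately show ?thesis using x by (simp only: ev_sfv)
qed

lemma ev_ex_minus_2_mult: "x \<in> cyl \<Longrightarrow> ev (ex (-2) * f) x = ev f x / of_real ((norm x)\<^sup>2)"
  by (simp add: ev_ex_minus_2 divide_inverse mult.commute)

lemma dt_form_entry: "x \<in> cyl \<Longrightarrow> dt_form x $ l = ev (ex (-2) * X l) x"
  by (subst ev_ex_minus_2_mult) (simp_all add: dt_form_def pd_cyl_t cyl_iff)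

lemma dt_form_value: "x \<in> cyl \<Longrightarrow> dt_form x $ l = of_real (x $ l) / of_real ((norm x)\<^sup>2)"
  by (simp add: dt_form_def pd_cyl_t cyl_iff)

lemma orthogonal_matrix_sum_real:
  fixes A :: "real ^ 4 ^ 4"
  assumes "orthogonal_matrix A"
  shows "(\<Sum>a\<in>UNIV. A $ a $ i *\<^sub>R complex_of_real ((A *v x) $ a)) = of_real (x $ i)"
  using orthogonal_matrix_sum[OF assms, of i "\<lambda>b. complex_of_real (x $ b)"]
  by (simp add: matrix_vector_mult_entry scaleR_conv_of_real)

lemma invariant1_dt_form:
  assumes "\<And>A. A \<in> \<Gamma> \<Longrightarrow> orthogonal_matrix A"
  shows "invariant1 \<Gamma> dt_form"
  unfolding invariant1_def
proof (intro ballI allI)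
  fix A x i assume A: "A \<in> \<Gamma>" and x: "x \<in> cyl"
  show "dt_form x $ i = (\<Sum>a\<in>UNIV. A $ a $ i *\<^sub>R dt_form (A *v x) $ a)"
    unfolding dt_form_value[OF x] dt_form_value[OF orthogonal_matrix_cyl[OF assms[OF A] x]] orthogonal_matrix_norm[OF assms[OF A]]
    using orthogonal_matrix_sum_real[OF assms[OF A], of i x]
    by (simp add: scaleR_conv_of_real sum_divide_distrib[symmetric])
qed

text \<open>The dilation part is invariant under every orthogonal matrix, so invariance of \<omega>
  reduces to that of the linear part h, which therefore commutes with A.\<close>

lemma rotation_commutes:
  fixes A :: "real ^ 4 ^ 4" and h :: "4 \<Rightarrow> 4 \<Rightarrow> complex"
  assumes A: "orthogonal_matrix A"
    and inv: "\<And>x i. x \<in> cyl \<Longrightarrow> \<omega> x $ i = (\<Sum>a\<in>UNIV. A $ a $ i *\<^sub>R \<omega> (A *v x) $ a)"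
    and \<omega>: "\<And>x i. x \<in> cyl \<Longrightarrow> \<omega> x $ i = (f * of_real (x $ i) + (\<Sum>j\<in>UNIV. h i j * of_real (x $ j))) / of_real ((norm x)\<^sup>2)"
  shows "(\<Sum>j\<in>UNIV. h b j * of_real ((A *v x) $ j)) = (\<Sum>i\<in>UNIV. A $ b $ i *\<^sub>R (\<Sum>j\<in>UNIV. h i j * of_real (x $ j)))"
proof (cases "x \<in> cyl")
  case True
  let ?k = "\<lambda>x i. \<Sum>j\<in>UNIV. h i j * of_real (x $ j)"
  have n: "of_real ((norm x)\<^sup>2) \<noteq> (0::complex)" using True by (simp add: cyl_iff)
  have k: "?k x i = (\<Sum>a\<in>UNIV. A $ a $ i *\<^sub>R ?k (A *v x) a)" for i
  proof -
    have "(\<Sum>a\<in>UNIV. A $ a $ i *\<^sub>R (f * of_real ((A *v x) $ a))) = f * of_real (x $ i)"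
      unfolding orthogonal_matrix_sum_real[OF A, of i x, symmetric] sum_distrib_left
      by (simp add: scaleR_conv_of_real mult_ac)
    moreover have "\<omega> x $ i = (\<Sum>a\<in>UNIV. A $ a $ i *\<^sub>R (f * of_real ((A *v x) $ a) + ?k (A *v x) a)) / of_real ((norm x)\<^sup>2)"
      unfolding inv[OF True] \<omega>[OF orthogonal_matrix_cyl[OF A True]] orthogonal_matrix_norm[OF A] sum_divide_distrib
      by (simp add: scaleR_conv_of_real)
    ultimately show ?thesis
      using n unfolding \<omega>[OF True] by (simp add: scaleR_add_right sum.distrib)
  qed
  have "orthogonal_matrix (transpose A)" using A by simp
  from orthogonal_matrix_sum[OF this, of b "?k (A *v x)"] show ?thesis
    unfolding k by (simp only: transpose_def vec_lambda_beta)
next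
  case False
  then show ?thesis by (simp add: cyl_iff)
qed

lemma solution_0_imp:
  assumes \<Gamma>: "\<And>A. A \<in> \<Gamma> \<Longrightarrow> orthogonal_matrix A" and s: "solution \<Gamma> 0 Z \<omega>"
  shows "\<exists>(a::complex) (n::nat) (c :: nat \<Rightarrow> complex) Q. (\<forall>k<n. killing_field \<Gamma> (Q k)) \<and>
    (\<forall>x\<in>cyl. \<omega> x = a *s dt_form x + (\<Sum>k<n. c k *s S3_dual (Q k) x))"
proof -
  have inv: "\<omega> x $ i = (\<Sum>a\<in>UNIV. A $ a $ i *\<^sub>R \<omega> (A *v x) $ a)" if "A \<in> \<Gamma>" "x \<in> cyl" for A x i
    using s that unfolding solution_def invariant1_def by blast
  obtain f h where h: "\<And>i j. h i j = - h j i" and V: "\<And>l. flat_vec \<omega> l = cst f * X l + (\<Sum>i\<in>UNIV. cst (h l i) * X i)"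
  proof (rule solution_cases[OF s])
    assume "\<And>l. flat_vec \<omega> l = 0"
    then show thesis using that[of "\<lambda>_ _. 0" 0] by simp
  next
    fix f h assume "\<And>i j. h i j = - h j i" "\<And>l. flat_vec \<omega> l = cst f * X l + (\<Sum>i\<in>UNIV. cst (h l i) * X i)"
    then show thesis by (rule that)
  next
    assume "(0::complex) = 1"
    then show thesis by simp
  next
    assume "(0::complex) = -1"
    then show thesis by simp
  next
    show "\<bar>Re 0\<bar> < 2" by simp
  qed
  have \<omega>: "\<omega> x $ i = (f * of_real (x $ i) + (\<Sum>j\<in>UNIV. h i j * of_real (x $ j))) / of_real ((norm x)\<^sup>2)" if "x \<in> cyl" for x i
    unfolding solution_entry[OF s that] V ev_ex_minus_2_mult[OF that] using that by (simp add: ev_sum ev_cst)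
  \<comment> \<open>The complex matrix h splits into two real antisymmetric matrices, each commuting
    with \<Gamma>. They give two Killing fields, combined with the coefficients 1 and \<i>.\<close>
  define M where "M k = (\<chi> i j. if k = 0 then Re (h i j) else Im (h i j))" for k :: nat
  have MRe: "(M 0 *v x) $ i = Re (\<Sum>j\<in>UNIV. h i j * of_real (x $ j))"
    and MIm: "(M 1 *v x) $ i = Im (\<Sum>j\<in>UNIV. h i j * of_real (x $ j))" for x i
    by (simp_all add: M_def matrix_vector_mult_entry)
  have antisym: "M k $ i $ j = - M k $ j $ i" for k i j
    using arg_cong[OF h[of i j], of Re] arg_cong[OF h[of i j], of Im] by (simp add: M_def)
  have comm: "M k *v (A *v x) = A *v (M k *v x)" if "A \<in> \<Gamma>" "k < 2" for A x k
  proof -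
    note c = rotation_commutes[OF \<Gamma>[OF that(1)] inv[OF that(1)] \<omega>]
    have "M 0 *v (A *v x) = A *v (M 0 *v x)" "M 1 *v (A *v x) = A *v (M 1 *v x)"
      by (simp_all only: vec_eq_iff MRe MIm c matrix_vector_mult_entry[of A "M _ *v _"]) simp_all
    moreover have "k = 0 \<or> k = 1" using that(2) by auto
    ultimately show ?thesis by blast
  qed
  have K: "killing_field \<Gamma> ((*v) (M k))" if "k < 2" for k
    by (rule killing_field_matrix[OF antisym comm[OF _ that]])
  have S: "S3_dual ((*v) (M k)) x $ l = of_real ((M k *v x) $ l) / of_real ((norm x)\<^sup>2)" if "x \<in> cyl" for k x l
  proof -
    have tan: "(M k *v z) \<bullet> z = 0" for z
      using antisymmetric_inner[OF antisym, of k z z] by (simp add: inner_commute)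
    show ?thesis
      unfolding S3_dual_tangent[of "(*v) (M k)", OF tan that]
      by (simp add: cyl_y_def matrix_vector_mult_scaleR power2_eq_square divide_inverse mult_ac)
  qed
  show ?thesis
  proof (intro exI conjI allI impI ballI)
    show "killing_field \<Gamma> ((\<lambda>k. (*v) (M k)) k)" if "k < 2" for k using K[OF that] .
    fix x assume x: "x \<in> cyl"
    show "\<omega> x = f *s dt_form x + (\<Sum>k<2. (if k = 0 then 1 else \<i>) *s S3_dual ((\<lambda>k. (*v) (M k)) k) x)"
    proof (simp only: vec_eq_iff, intro allI)
      fix i
      have c: "(\<Sum>j\<in>UNIV. h i j * of_real (x $ j)) = of_real ((M 0 *v x) $ i) + \<i> * of_real ((M 1 *v x) $ i)"
        unfolding MRe MIm by (simp only: complex_eq[symmetric])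
      have "(f *s dt_form x + (\<Sum>k<2. (if k = 0 then 1 else \<i>) *s S3_dual ((\<lambda>k. (*v) (M k)) k) x)) $ i
        = f * dt_form x $ i + (S3_dual ((*v) (M 0)) x $ i + \<i> * S3_dual ((*v) (M 1)) x $ i)"
        by (simp add: numeral_2_eq_2)
      then show "\<omega> x $ i = (f *s dt_form x + (\<Sum>k<2. (if k = 0 then 1 else \<i>) *s S3_dual ((\<lambda>k. (*v) (M k)) k) x)) $ i"
        unfolding S[OF x] dt_form_value[OF x] \<omega>[OF x] c
        by (simp add: add_divide_distrib)
    qed
  qed
qed

lemma solution_0I:
  fixes n :: nat
  assumes \<Gamma>: "\<And>A. A \<in> \<Gamma> \<Longrightarrow> orthogonal_matrix A" and Z: "\<And>x. x \<in> cyl \<Longrightarrow> Z x = 0"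
    and Q: "\<And>k. k < n \<Longrightarrow> killing_field \<Gamma> (Q k)"
    and \<omega>: "\<And>x. x \<in> cyl \<Longrightarrow> \<omega> x = a *s dt_form x + (\<Sum>k<n. c k *s S3_dual (Q k) x)"
  shows "solution \<Gamma> 0 Z \<omega>"
proof -
  have "\<forall>k. \<exists>V. k < n \<longrightarrow> (\<forall>l. eul (V l) = V l) \<and> (\<forall>j l. conf_killing V j l = 0) \<and>
    (\<forall>x\<in>cyl. \<forall>l. S3_dual (Q k) x $ l = ev (ex (-2) * V l) x)"
  proof (intro allI)
    fix k
    show "\<exists>V. k < n \<longrightarrow> (\<forall>l. eul (V l) = V l) \<and> (\<forall>j l. conf_killing V j l = 0) \<and>
      (\<forall>x\<in>cyl. \<forall>l. S3_dual (Q k) x $ l = ev (ex (-2) * V l) x)"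
    proof (cases "k < n")
      case True
      obtain V where "\<And>l. eul (V l) = V l" "\<And>j l. conf_killing V j l = 0"
        "\<And>x l. x \<in> cyl \<Longrightarrow> S3_dual (Q k) x $ l = ev (ex (-2) * V l) x"
        by (rule S3_dual_killing_field[OF Q[OF True]]) (rule that)
      then show ?thesis by blast
    qed simp
  qed
  then obtain V where V: "\<And>k l. k < n \<Longrightarrow> eul (V k l) = V k l" "\<And>k j l. k < n \<Longrightarrow> conf_killing (V k) j l = 0"
    "\<And>k x l. k < n \<Longrightarrow> x \<in> cyl \<Longrightarrow> S3_dual (Q k) x $ l = ev (ex (-2) * V k l) x"
    by metis
  define W where "W l = cst a * X l + (\<Sum>k<n. cst (c k) * V k l)" for l
  show ?thesis
  proof (rule solution_from_sfun[OF \<Gamma> Z])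
    show "\<omega> x $ i = ev (ex (-2) * W i) x" if "x \<in> cyl" for x i
      using that
      by (simp add: \<omega> W_def dt_form_entry V(3) ev_sum ev_cst sum_distrib_left distrib_left mult_ac)
    show "eul (W i) = cst (0 + 1) * W i" for i
      by (simp add: W_def eul_mult V(1))
    have "conf_killing W j l = cst a * conf_killing X j l + (\<Sum>k<n. cst (c k) * conf_killing (V k) j l)" for j l
      unfolding W_def[abs_def] conf_killing_add conf_killing_sum conf_killing_cst_mult ..
    then show "conf_killing W j l = 0" for j l
      by (simp add: conf_killing_X V(2))
    show "invariant1 \<Gamma> \<omega>"
      unfolding invariant1_def
    proof (intro ballI allI)
      fix A x i assume A: "A \<in> \<Gamma>" and x: "x \<in> cyl"
      have d: "dt_form x $ i = (\<Sum>b\<in>UNIV. A $ b $ i *\<^sub>R dt_form (A *v x) $ b)"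
        using invariant1_dt_form[OF \<Gamma>] A x unfolding invariant1_def by blast
      have e: "S3_dual (Q k) x $ i = (\<Sum>b\<in>UNIV. A $ b $ i *\<^sub>R S3_dual (Q k) (A *v x) $ b)" if "k < n" for k
        using invariant1_S3_dual[OF \<Gamma> Q[OF that]] A x unfolding invariant1_def by blast
      have "(\<Sum>b\<in>UNIV. A $ b $ i *\<^sub>R \<omega> (A *v x) $ b) = (\<Sum>b\<in>UNIV. a * (A $ b $ i *\<^sub>R dt_form (A *v x) $ b)
          + (\<Sum>k<n. c k * (A $ b $ i *\<^sub>R S3_dual (Q k) (A *v x) $ b)))"
        unfolding \<omega>[OF orthogonal_matrix_cyl[OF \<Gamma>[OF A] x]]
        by (simp add: scaleR_conv_of_real distrib_left sum_distrib_left mult_ac)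
      also have "\<dots> = a * dt_form x $ i + (\<Sum>k<n. c k * S3_dual (Q k) x $ i)"
        unfolding sum.distrib sum_distrib_left[symmetric] d[symmetric]
        by (subst sum.swap) (simp add: e sum_distrib_left)
      finally show "\<omega> x $ i = (\<Sum>b\<in>UNIV. A $ b $ i *\<^sub>R \<omega> (A *v x) $ b)" by (simp add: \<omega>[OF x])
    qed
  qed
qed

text \<open>The conformal Killing field with parameter p that belongs to the root \<epsilon>: a
  special conformal field for \<epsilon> = 1, and a translation for \<epsilon> = -1.\<close>

definition root_form :: "real \<Rightarrow> (4 \<Rightarrow> complex) \<Rightarrow> 4 \<Rightarrow> sfun" where
  "root_form \<epsilon> p l = (if \<epsilon> = 1 then (\<Sum>i\<in>UNIV. cst (p i) * X i) * (2 * X l) - cst (p l) * ex 2 else cst (p l))"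

lemma conf_killing_root_form: "conf_killing (root_form \<epsilon> p) j l = 0"
  by (cases "\<epsilon> = 1") (simp_all only: root_form_def[abs_def] if_True if_False simp_thms conf_killing_special conf_killing_translation)

lemma eul_root_form: "\<epsilon> = 1 \<or> \<epsilon> = -1 \<Longrightarrow> eul (root_form \<epsilon> p l) = cst (of_real \<epsilon> + 1) * root_form \<epsilon> p l"
  by (auto simp: root_form_def eul_mult eul_ex algebra_simps)

lemma ev_root_form_axis:
  "ev (ex (-2) * root_form \<epsilon> p i) (axis i 1) = p i"
proof -
  have "axis i 1 \<in> cyl" by (simp add: cyl_iff)
  moreover have "(\<Sum>j\<in>UNIV. p j * complex_of_real (axis i 1 $ j)) = p i"
    by (simp add: axis_def if_distrib cong: if_cong)
  ultimately show ?thesis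
    using ev_ex_nat[of "axis i 1" 2]
    by (subst ev_ex_minus_2_mult) (simp_all add: root_form_def ev_sum ev_cst ev_numeral)
qed

text \<open>Invariance is evaluated at x = e_i. At a unit vector z the special field is 2 (p \<cdot>
  z) z - p, so for z = A e_i its contraction with column i of A is 2q - q = q, where q is component
  i of the transpose of A applied to p. For a translation the contraction is q directly.\<close>

lemma root_form_fixed:
  fixes A :: "real ^ 4 ^ 4"
  assumes A: "orthogonal_matrix A"
    and \<omega>: "\<And>x i. x \<in> cyl \<Longrightarrow> \<omega> x $ i = ev (ex (-2) * root_form \<epsilon> p i) x"
    and inv: "\<And>x i. x \<in> cyl \<Longrightarrow> \<omega> x $ i = (\<Sum>a\<in>UNIV. A $ a $ i *\<^sub>R \<omega> (A *v x) $ a)"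
  shows "(\<Sum>a\<in>UNIV. A $ a $ i *\<^sub>R p a) = p i"
proof -
  define x where "x = (axis i 1 :: real ^ 4)"
  define q where "q = (\<Sum>a\<in>UNIV. A $ a $ i *\<^sub>R p a)"
  have x: "x \<in> cyl" "norm x = 1" by (simp_all add: x_def cyl_iff)
  have Ax: "A *v x \<in> cyl" "norm (A *v x) = 1" using x orthogonal_matrix_cyl[OF A] orthogonal_matrix_norm[OF A] by auto
  have Axa: "(A *v x) $ a = A $ a $ i" for a
    by (simp add: x_def matrix_vector_mult_entry axis_def if_distrib cong: if_cong)
  have s: "(\<Sum>a\<in>UNIV. A $ a $ i *\<^sub>R complex_of_real (A $ a $ i)) = 1"
    using orthogonal_matrix_sum_real[OF A, of i x] by (simp add: Axa) (simp add: x_def)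
  have \<omega>A: "\<omega> (A *v x) $ a = (if \<epsilon> = 1 then 2 * q * of_real (A $ a $ i) - p a else p a)" for a
    unfolding \<omega>[OF Ax(1)] ev_ex_minus_2_mult[OF Ax(1)] Ax(2)
    using Ax ev_ex_nat[OF Ax(1), of 2]
    by (simp add: root_form_def ev_sum ev_cst ev_numeral Axa q_def scaleR_conv_of_real sum_distrib_right mult_ac)
  have "p i = \<omega> x $ i" unfolding \<omega>[OF x(1)] unfolding x_def by (simp only: ev_root_form_axis)
  also have "\<dots> = (\<Sum>a\<in>UNIV. A $ a $ i *\<^sub>R (if \<epsilon> = 1 then 2 * q * of_real (A $ a $ i) - p a else p a))"
    unfolding inv[OF x(1)] \<omega>A ..
  also have "\<dots> = q"
  proof (cases "\<epsilon> = 1")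
    case True
    have "(\<Sum>a\<in>UNIV. A $ a $ i *\<^sub>R (2 * q * of_real (A $ a $ i) - p a))
      = 2 * q * (\<Sum>a\<in>UNIV. A $ a $ i *\<^sub>R complex_of_real (A $ a $ i)) - q"
      unfolding q_def[symmetric] sum_distrib_left scaleR_diff_right sum_subtractf
      by (simp add: q_def scaleR_conv_of_real mult_ac)
    then show ?thesis using True by (simp add: s)
  qed (simp add: q_def)
  finally show ?thesis by (simp add: q_def)
qed

text \<open>The real or the imaginary part of p is a nonzero real vector fixed by the transpose of
  A. As A is orthogonal, A fixes it as well, and normalization gives a fixed point on the
  sphere.\<close>

lemma fixed_vector_imp_trivial:
  assumes free: "acts_freely_on_S3 \<Gamma>" and A: "A \<in> \<Gamma>" "orthogonal_matrix A"
    and p: "\<And>i. (\<Sum>a\<in>UNIV. A $ a $ i *\<^sub>R p a) = (p i :: complex)" "p i \<noteq> 0"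
  shows "A = mat 1"
proof -
  have fix1: "A = mat 1" if u: "\<And>i. (\<Sum>a\<in>UNIV. A $ a $ i * u a) = u i" "u i \<noteq> 0" for u :: "4 \<Rightarrow> real" and i
  proof -
    define w where "w = (\<chi> i. u i)"
    have w0: "w \<noteq> 0" using u(2) by (auto simp: w_def vec_eq_iff)
    have "transpose A *v w = w"
      by (simp add: vec_eq_iff matrix_vector_mult_entry transpose_def w_def u(1))
    then have "A *v w = (A ** transpose A) *v w" by (metis matrix_vector_mul_assoc)
    also have "A ** transpose A = mat 1" using A(2) by (simp add: orthogonal_matrix_def)
    finally have "A *v w = w" by simp
    then have "A *v (inverse (norm w) *\<^sub>R w) = inverse (norm w) *\<^sub>R w"
      by (simp add: matrix_vector_mult_scaleR)
    moreover have "inverse (norm w) *\<^sub>R w \<in> S3" using w0 by simp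
    ultimately show ?thesis using free A(1) unfolding acts_freely_on_S3_def by blast
  qed
  have "Re (p i) \<noteq> 0 \<or> Im (p i) \<noteq> 0" using p(2) by (simp add: complex_eq_iff)
  then show ?thesis
  proof
    assume "Re (p i) \<noteq> 0"
    then show ?thesis using arg_cong[OF p(1), of Re] by (intro fix1[of "\<lambda>a. Re (p a)"]) (simp_all add: Re_sum)
  next
    assume "Im (p i) \<noteq> 0"
    then show ?thesis using arg_cong[OF p(1), of Im] by (intro fix1[of "\<lambda>a. Im (p a)"]) (simp_all add: Im_sum)
  qed
qed

lemma solution_root_form:
  assumes s: "solution \<Gamma> (complex_of_real \<epsilon>) Z \<omega>" and \<epsilon>: "\<epsilon> = 1 \<or> \<epsilon> = -1"
  obtains p where "\<And>x. x \<in> cyl \<Longrightarrow> Z x = 0" "\<And>x i. x \<in> cyl \<Longrightarrow> \<omega> x $ i = ev (ex (-2) * root_form \<epsilon> p i) x"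
proof -
  have r: "\<bar>Re (complex_of_real \<epsilon>)\<bar> < 2" using \<epsilon> by auto
  show thesis
  proof (rule solution_cases[OF s r])
    assume Z: "\<And>x. x \<in> cyl \<Longrightarrow> Z x = 0" and "\<And>l. flat_vec \<omega> l = 0"
    then have "\<And>x i. x \<in> cyl \<Longrightarrow> \<omega> x $ i = ev (ex (-2) * root_form \<epsilon> (\<lambda>_. 0) i) x"
      using solution_entry[OF s] by (simp add: root_form_def)
    with Z show thesis by (rule that)
  next
    assume "complex_of_real \<epsilon> = 0"
    then show thesis using \<epsilon> by auto
  next
    fix p
    assume Z: "\<And>x. x \<in> cyl \<Longrightarrow> Z x = 0" and e: "complex_of_real \<epsilon> = 1"
      and V: "\<And>l. flat_vec \<omega> l = (\<Sum>i\<in>UNIV. cst (p i) * X i) * (2 * X l) - cst (p l) * ex 2"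
    have "\<epsilon> = 1" using e by simp
    then have "\<And>x i. x \<in> cyl \<Longrightarrow> \<omega> x $ i = ev (ex (-2) * root_form \<epsilon> p i) x"
      using solution_entry[OF s] V by (simp only: root_form_def if_True simp_thms)
    with Z show thesis by (rule that)
  next
    fix c
    assume Z: "\<And>x. x \<in> cyl \<Longrightarrow> Z x = 0" and e: "complex_of_real \<epsilon> = -1"
      and V: "\<And>l. flat_vec \<omega> l = cst (c l)"
    have "complex_of_real \<epsilon> = complex_of_real (-1)" using e by simp
    then have "\<epsilon> = -1" by (simp only: of_real_eq_iff)
    then have "root_form \<epsilon> c i = flat_vec \<omega> i" for i by (simp add: root_form_def V)
    then have "\<And>x i. x \<in> cyl \<Longrightarrow> \<omega> x $ i = ev (ex (-2) * root_form \<epsilon> c i) x"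
      using solution_entry[OF s] by (simp only:)
    with Z show thesis by (rule that)
  qed
qed

lemma solution_root_formI:
  assumes Z: "\<And>x. x \<in> cyl \<Longrightarrow> Z x = 0" and \<epsilon>: "\<epsilon> = 1 \<or> \<epsilon> = -1"
    and \<omega>: "\<And>x i. x \<in> cyl \<Longrightarrow> \<omega> x $ i = ev (ex (-2) * root_form \<epsilon> p i) x"
  shows "solution {mat 1} (complex_of_real \<epsilon>) Z \<omega>"
proof (rule solution_from_sfun[OF _ Z \<omega>])
  have "(mat 1 :: real ^ 4 ^ 4) $ a $ i *\<^sub>R c = (if a = i then c else 0)" for a i and c :: complex
    by (simp add: mat_def)
  then show "invariant1 {mat 1} \<omega>" by (simp add: invariant1_def)
qed (simp_all add: orthogonal_matrix_id eul_root_form[OF \<epsilon>] conf_killing_root_form)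

text \<open>An eigenfunction is nonzero by definition while the solutions form a vector space; this
  is the reason for the alternative \<omega> = 0 in the last case. Finite combinations of real
  Killing fields with complex coefficients describe the complex solutions for the root 0.\<close>

theorem theorem1p4:
  fixes \<Gamma> :: "(real ^ 4 ^ 4) set"
  assumes "subgroup \<Gamma> SO4" and "finite \<Gamma>" and "acts_freely_on_S3 \<Gamma>"
  shows
    "(\<forall>\<beta>\<in>indicial_roots \<Gamma>. \<bar>Re \<beta>\<bar> < 2 \<longrightarrow>
        (\<beta> = 0 \<or> \<beta> = 1 \<or> \<beta> = -1) \<and>
        (\<forall>Z \<omega>. solution \<Gamma> \<beta> Z \<omega> \<longrightarrow>
           (\<forall>x\<in>cyl. Z x = 0) \<and> (\<forall>x\<in>cyl. conf_killing_op cyl_metric \<omega> x = 0)))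
     \<and>
     (0 \<in> indicial_roots \<Gamma> \<and>
      (\<forall>Z \<omega>. solution \<Gamma> 0 Z \<omega> \<longleftrightarrow>
         (\<forall>x\<in>cyl. Z x = 0) \<and>
         (\<exists>(a::complex) (n::nat) (c :: nat \<Rightarrow> complex) X.
            (\<forall>k<n. killing_field \<Gamma> (X k)) \<and>
            (\<forall>x\<in>cyl. \<omega> x = a *s dt_form x + (\<Sum>k<n. c k *s S3_dual (X k) x)))))
     \<and>
     ((\<forall>\<epsilon>\<in>{1, -1::real}. complex_of_real \<epsilon> \<in> indicial_roots \<Gamma> \<longleftrightarrow> \<Gamma> = {mat 1}) \<and>
      (\<Gamma> = {mat 1} \<longrightarrow>
         (\<forall>\<phi>. lowest_nontrivial_eigenfunction \<phi> \<longleftrightarrow> eigenfunction_S3 3 \<phi>) \<and>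
         (\<forall>\<epsilon>\<in>{1, -1::real}. \<forall>Z \<omega>. solution \<Gamma> (complex_of_real \<epsilon>) Z \<omega> \<longleftrightarrow>
            (\<forall>x\<in>cyl. Z x = 0) \<and>
            ((\<forall>x\<in>cyl. \<omega> x = 0) \<or>
             (\<exists>\<phi>. lowest_nontrivial_eigenfunction \<phi> \<and> (\<forall>x\<in>cyl. \<omega> x = eigen_form \<epsilon> \<phi> x))))))"
proof -
  have orth: "orthogonal_matrix A" if "A \<in> \<Gamma>" for A
    using subgroup.subset[OF assms(1)] that by (auto simp: SO4_def)
  have one: "mat 1 \<in> \<Gamma>"
    using subgroup.one_closed[OF assms(1)] by (simp add: SO4_def)
  have ax: "axis 1 1 \<in> cyl" by (simp add: cyl_iff)
  have part1: "(\<beta> = 0 \<or> \<beta> = 1 \<or> \<beta> = -1) \<and>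
      (\<forall>Z \<omega>. solution \<Gamma> \<beta> Z \<omega> \<longrightarrow> (\<forall>x\<in>cyl. Z x = 0) \<and> (\<forall>x\<in>cyl. conf_killing_op cyl_metric \<omega> x = 0))"
    if \<beta>: "\<beta> \<in> indicial_roots \<Gamma>" "\<bar>Re \<beta>\<bar> < 2" for \<beta>
  proof (intro conjI allI impI)
    obtain Z \<omega> where s: "solution \<Gamma> \<beta> Z \<omega>" and n: "\<exists>x\<in>cyl. Z x \<noteq> 0 \<or> \<omega> x \<noteq> 0"
      using \<beta>(1) unfolding indicial_roots_def by blast
    show "\<beta> = 0 \<or> \<beta> = 1 \<or> \<beta> = -1"
    proof (rule solution_cases[OF s \<beta>(2)])
      assume Z: "\<And>x. x \<in> cyl \<Longrightarrow> Z x = 0" and V: "\<And>l. flat_vec \<omega> l = 0"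
      have "\<omega> x = 0" if "x \<in> cyl" for x
        using solution_entry[OF s that] by (simp add: vec_eq_iff V)
      with n Z show ?thesis by blast
    qed blast+
  next
    fix Z \<omega> assume s: "solution \<Gamma> \<beta> Z \<omega>"
    have \<omega>: "smooth_on cyl \<omega>" using s unfolding solution_def by blast
    have *: "(\<forall>x\<in>cyl. Z x = 0) \<and> (\<forall>j l. conf_killing (flat_vec \<omega>) j l = 0)"
      by (rule solution_cases[OF s \<beta>(2)]) blast+
    then show "\<forall>x\<in>cyl. Z x = 0" by blast
    show "\<forall>x\<in>cyl. conf_killing_op cyl_metric \<omega> x = 0"
      using * by (simp add: vec_eq_iff conf_killing_op_cyl_metric[OF \<omega>])
  qed
  have case0: "solution \<Gamma> 0 Z \<omega> \<longleftrightarrow> (\<forall>x\<in>cyl. Z x = 0) \<and>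
      (\<exists>(a::complex) (n::nat) (c :: nat \<Rightarrow> complex) Q. (\<forall>k<n. killing_field \<Gamma> (Q k)) \<and>
        (\<forall>x\<in>cyl. \<omega> x = a *s dt_form x + (\<Sum>k<n. c k *s S3_dual (Q k) x)))" for Z \<omega>
  proof
    assume s: "solution \<Gamma> 0 Z \<omega>"
    have "\<forall>x\<in>cyl. Z x = 0" by (rule solution_cases[OF s]) (simp, blast+)
    with solution_0_imp[OF orth s] show "(\<forall>x\<in>cyl. Z x = 0) \<and>
      (\<exists>(a::complex) (n::nat) (c :: nat \<Rightarrow> complex) Q. (\<forall>k<n. killing_field \<Gamma> (Q k)) \<and>
        (\<forall>x\<in>cyl. \<omega> x = a *s dt_form x + (\<Sum>k<n. c k *s S3_dual (Q k) x)))" by blast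
  qed (use solution_0I[OF orth] in blast)
  have root0: "0 \<in> indicial_roots \<Gamma>"
  proof -
    have "solution \<Gamma> 0 (\<lambda>_. 0) dt_form"
      by (rule solution_0I[OF orth, where n = 0 and a = 1 and Q = "\<lambda>_ _. 0" and c = "\<lambda>_. 0"]) simp_all
    moreover have "dt_form (axis 1 1) $ 1 \<noteq> 0" by (simp add: dt_form_value[OF ax])
    then have "dt_form (axis 1 1) \<noteq> 0" by auto
    ultimately show ?thesis unfolding indicial_roots_def using ax by blast
  qed
  have root1: "complex_of_real \<epsilon> \<in> indicial_roots \<Gamma> \<longleftrightarrow> \<Gamma> = {mat 1}" if \<epsilon>: "\<epsilon> = 1 \<or> \<epsilon> = -1" for \<epsilon>
  proof
    assume "complex_of_real \<epsilon> \<in> indicial_roots \<Gamma>"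
    then obtain Z \<omega> where s: "solution \<Gamma> (complex_of_real \<epsilon>) Z \<omega>" and n: "\<exists>x\<in>cyl. Z x \<noteq> 0 \<or> \<omega> x \<noteq> 0"
      unfolding indicial_roots_def by blast
    obtain p where Z: "\<And>x. x \<in> cyl \<Longrightarrow> Z x = 0" and \<omega>: "\<And>x i. x \<in> cyl \<Longrightarrow> \<omega> x $ i = ev (ex (-2) * root_form \<epsilon> p i) x"
      by (rule solution_root_form[OF s \<epsilon>]) (rule that)
    have "\<exists>i. p i \<noteq> 0"
    proof (rule ccontr)
      assume "\<not> (\<exists>i. p i \<noteq> 0)"
      then have "\<omega> x = 0" if "x \<in> cyl" for x using \<omega>[OF that] by (simp add: vec_eq_iff root_form_def)
      with n Z show False by blast
    qed
    then obtain i where i: "p i \<noteq> 0" by blast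
    have "A = mat 1" if A: "A \<in> \<Gamma>" for A
    proof (rule fixed_vector_imp_trivial[where p = p, OF assms(3) A orth[OF A] _ i])
      have inv: "\<omega> x $ i = (\<Sum>a\<in>UNIV. A $ a $ i *\<^sub>R \<omega> (A *v x) $ a)" if "x \<in> cyl" for x i
        using s A that unfolding solution_def invariant1_def by blast
      show "(\<Sum>a\<in>UNIV. A $ a $ i *\<^sub>R p a) = p i" for i
        by (rule root_form_fixed[OF orth[OF A], of \<omega> \<epsilon>]) (fact \<omega> inv)+
    qed
    with one show "\<Gamma> = {mat 1}" by blast
  next
    assume \<Gamma>: "\<Gamma> = {mat 1}"
    \<comment> \<open>Any nonzero parameter p gives a nonzero form: its component i at the basis
      vector e_i is p_i.\<close>
    let ?\<omega> = "\<lambda>x. \<chi> i. ev (ex (-2) * root_form \<epsilon> (\<lambda>_. 1) i) x"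
    have "solution \<Gamma> (complex_of_real \<epsilon>) (\<lambda>_. 0) ?\<omega>"
      unfolding \<Gamma> by (rule solution_root_formI[where p = "\<lambda>_. 1", OF _ \<epsilon>]) simp_all
    moreover have "?\<omega> (axis 1 1) $ 1 \<noteq> 0" by (simp only: vec_lambda_beta ev_root_form_axis) simp
    then have "?\<omega> (axis 1 1) \<noteq> 0" by (metis zero_index)
    ultimately show "complex_of_real \<epsilon> \<in> indicial_roots \<Gamma>"
      unfolding indicial_roots_def using ax by blast
  qed
  have case1: "solution \<Gamma> (complex_of_real \<epsilon>) Z \<omega> \<longleftrightarrow> (\<forall>x\<in>cyl. Z x = 0) \<and>
      ((\<forall>x\<in>cyl. \<omega> x = 0) \<or> (\<exists>\<phi>. lowest_nontrivial_eigenfunction \<phi> \<and> (\<forall>x\<in>cyl. \<omega> x = eigen_form \<epsilon> \<phi> x)))"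
    if \<Gamma>: "\<Gamma> = {mat 1}" and \<epsilon>: "\<epsilon> = 1 \<or> \<epsilon> = -1" for \<epsilon> Z \<omega>
  proof
    assume s: "solution \<Gamma> (complex_of_real \<epsilon>) Z \<omega>"
    obtain p where Z: "\<And>x. x \<in> cyl \<Longrightarrow> Z x = 0" and \<omega>: "\<And>x i. x \<in> cyl \<Longrightarrow> \<omega> x $ i = ev (ex (-2) * root_form \<epsilon> p i) x"
      by (rule solution_root_form[OF s \<epsilon>]) (rule that)
    have "(\<forall>x\<in>cyl. \<omega> x = 0) \<or> (\<exists>\<phi>. lowest_nontrivial_eigenfunction \<phi> \<and> (\<forall>x\<in>cyl. \<omega> x = eigen_form \<epsilon> \<phi> x))"
    proof (cases "\<exists>i. p i \<noteq> 0")
      case True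
      have "lowest_nontrivial_eigenfunction (linf p)"
        unfolding lowest_nontrivial_eigenfunction_iff eigenfunction_3_iff
        using True smooth_on_S3_linf sf_linf by blast
      moreover have "\<omega> x = eigen_form \<epsilon> (linf p) x" if "x \<in> cyl" for x
        unfolding vec_eq_iff \<omega>[OF that] eigen_form_eq[OF \<epsilon> smooth_on_S3_linf sf_linf that] root_form_def by blast
      ultimately show ?thesis by blast
    next
      case False
      then have "\<omega> x = 0" if "x \<in> cyl" for x using \<omega>[OF that] by (simp add: vec_eq_iff root_form_def)
      then show ?thesis by blast
    qed
    with Z show "(\<forall>x\<in>cyl. Z x = 0) \<and>
      ((\<forall>x\<in>cyl. \<omega> x = 0) \<or> (\<exists>\<phi>. lowest_nontrivial_eigenfunction \<phi> \<and> (\<forall>x\<in>cyl. \<omega> x = eigen_form \<epsilon> \<phi> x)))" by blast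
  next
    assume a: "(\<forall>x\<in>cyl. Z x = 0) \<and>
      ((\<forall>x\<in>cyl. \<omega> x = 0) \<or> (\<exists>\<phi>. lowest_nontrivial_eigenfunction \<phi> \<and> (\<forall>x\<in>cyl. \<omega> x = eigen_form \<epsilon> \<phi> x)))"
    have "\<exists>p. \<forall>x\<in>cyl. \<forall>i. \<omega> x $ i = ev (ex (-2) * root_form \<epsilon> p i) x"
    proof (cases "\<forall>x\<in>cyl. \<omega> x = 0")
      case True
      then show ?thesis by (intro exI[of _ "\<lambda>_. 0"]) (simp add: root_form_def)
    next
      case False
      then obtain \<phi> where "eigenfunction_S3 3 \<phi>" and \<omega>: "\<And>x. x \<in> cyl \<Longrightarrow> \<omega> x = eigen_form \<epsilon> \<phi> x"
        using a unfolding lowest_nontrivial_eigenfunction_iff by blast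
      then obtain d where d: "smooth_on_S3 \<phi>" "sf (\<phi> \<circ> cyl_y) = ylin d"
        unfolding eigenfunction_3_iff by blast
      show ?thesis
      proof (intro exI[of _ d] ballI allI)
        fix x i assume x: "x \<in> cyl"
        show "\<omega> x $ i = ev (ex (-2) * root_form \<epsilon> d i) x"
          unfolding \<omega>[OF x] root_form_def by (rule eigen_form_eq[OF \<epsilon> d x])
      qed
    qed
    then obtain p where "\<And>x i. x \<in> cyl \<Longrightarrow> \<omega> x $ i = ev (ex (-2) * root_form \<epsilon> p i) x" by blast
    then show "solution \<Gamma> (complex_of_real \<epsilon>) Z \<omega>"
      unfolding \<Gamma> using a by (intro solution_root_formI[OF _ \<epsilon>]) blast+
  qed
  show ?thesis
  proof (intro conjI)
    show "\<forall>\<beta>\<in>indicial_roots \<Gamma>. \<bar>Re \<beta>\<bar> < 2 \<longrightarrow>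
        (\<beta> = 0 \<or> \<beta> = 1 \<or> \<beta> = -1) \<and>
        (\<forall>Z \<omega>. solution \<Gamma> \<beta> Z \<omega> \<longrightarrow>
           (\<forall>x\<in>cyl. Z x = 0) \<and> (\<forall>x\<in>cyl. conf_killing_op cyl_metric \<omega> x = 0))"
      by (intro ballI impI) (rule part1)
    show "0 \<in> indicial_roots \<Gamma>" by (rule root0)
    show "\<forall>Z \<omega>. solution \<Gamma> 0 Z \<omega> \<longleftrightarrow> (\<forall>x\<in>cyl. Z x = 0) \<and>
      (\<exists>(a::complex) (n::nat) (c :: nat \<Rightarrow> complex) Q. (\<forall>k<n. killing_field \<Gamma> (Q k)) \<and>
        (\<forall>x\<in>cyl. \<omega> x = a *s dt_form x + (\<Sum>k<n. c k *s S3_dual (Q k) x)))"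
      by (intro allI) (rule case0)
    show "\<forall>\<epsilon>\<in>{1, -1::real}. complex_of_real \<epsilon> \<in> indicial_roots \<Gamma> \<longleftrightarrow> \<Gamma> = {mat 1}"
      by (intro ballI root1) blast
    show "\<Gamma> = {mat 1} \<longrightarrow>
         (\<forall>\<phi>. lowest_nontrivial_eigenfunction \<phi> \<longleftrightarrow> eigenfunction_S3 3 \<phi>) \<and>
         (\<forall>\<epsilon>\<in>{1, -1::real}. \<forall>Z \<omega>. solution \<Gamma> (complex_of_real \<epsilon>) Z \<omega> \<longleftrightarrow>
            (\<forall>x\<in>cyl. Z x = 0) \<and>
            ((\<forall>x\<in>cyl. \<omega> x = 0) \<or>
             (\<exists>\<phi>. lowest_nontrivial_eigenfunction \<phi> \<and> (\<forall>x\<in>cyl. \<omega> x = eigen_form \<epsilon> \<phi> x))))"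
      by (intro impI conjI allI ballI lowest_nontrivial_eigenfunction_iff case1) (assumption, blast)
  qed
qed

end
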